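(* In the setting of the context, let $F$ be an extended neutral to the right process on $(0,\infty)\times\mathcal{X}$ determined by the random hazard measure $\Lambda\sim\mathcal{P}(d\Lambda|\rho_\Lambda,\eta)$, and consider the (right-censored) likelihood $$\Big[\prod_{l=1}^mS(C_l-)\Big]\Big[\prod_{i=1}^nS(T_i-)\Lambda(dT_i,dX_i)\Big],\qquad n\ge1,\ m\ge0,$$ with observations $(T_i,X_i)\in(0,\infty)\times\mathcal{X}$ and censoring times $C_1,\dots,C_m>0$. Then: (i) The posterior distribution of $\Lambda$ is $\mathcal{P}(d\Lambda|e^{-f_{n,m}}\rho_\Lambda,\eta,\mathbf{T},\mathbf{X})$; that is, given the data $\Lambda$ is equal in distribution to $$\Lambda(\cdot|Y_{n,m})+\sum_{j=1}^{n(\mathbf{p})}J_{j,n}\,\delta_{(T_j^*,X_j^* )}(\cdot),$$ where $\Lambda(\cdot|Y_{n,m})$ is a completely random measure with intensity $(1-u)^{Y_{n,m}(s)}\rho_\Lambda(du|s)\eta(ds,dx)$, and, independently of it, the $J_{j,n}$ are mutually independent with $$\Pr(J_{j,n}\in du|e^{-f_{n,m}}\rho_\Lambda,T_j^* )=\frac{u^{e_{j,n}}(1-u)^{Y_{n,m}(T_j^* )}\rho_\Lambda(du|T_j^* )}{\kappa_{e_{j,n}}(e^{-f_{n,m}}\rho_\Lambda|T_j^* )}.$$ (ii) The posterior distribution of $F$ is again that of an extended neutral to the right process, determined by replacing $\Lambda$ by the random measure displayed in (i) in $F(ds,dx)=S(s-)\Lambda(ds,dx)$. (iii) The posterior distribution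 of $Z$ is the law of the random measure $$Z(\cdot|Y_{n,m})+\sum_{j=1}^{n(\mathbf{p})}\big(-\log(1-J_{j,n})\big)\delta_{(T_j^*,X_j^* )}(\cdot),$$ where the Lévy measure of $Z(\cdot|Y_{n,m})$ is the image of $(1-u)^{Y_{n,m}(s)}\rho_\Lambda(du|s)\eta(ds,dx)$ under the map $(u,s)\mapsto(-\log(1-u),s)$ (leaving $x$ fixed). When $m=0$ the results correspond to the complete data model.
   Context: $\mathcal{X}$ is a Polish space. $\Lambda$ is a completely random measure on $(0,\infty)\times\mathcal{X}$, $\Lambda(ds,dx)=\int_0^1uN(du,ds,dx)$, where $N$ is a Poisson random measure on $(0,1]\times(0,\infty)\times\mathcal{X}$ with intensity $\rho_\Lambda(du|s)\eta(ds,dx)$; its law is $\mathcal{P}(d\Lambda|\rho_\Lambda,\eta)$. The marginal $\eta(ds,\mathcal{X})$ is non-atomic, and $A_0(ds,dx)=[\int_0^1u\rho_\Lambda(du|s)]\eta(ds,dx)$ is assumed to be a hazard measure. $\Lambda(ds)=\Lambda(ds,\mathcal{X})$, and $S(s-)=\prod_{v<s}(1-\Lambda(dv))$ (product integral; since $\Lambda$ is purely atomic, the product of $1-\Lambda(\{v\})$ over atoms $v<s$). The extended neutral to the right process is $F(ds,dx)=S(s-)\Lambda(ds,dx)$; a posterior process for $F$ is still called extended NTR if for $t_1<\dots<t_k$ and measurable $B$, $(F(t_1,B),F(t_2,B)-F(t_1,B),\dots)$ has the law of $(V_{1,B},V_{2,B}(1-V_1),\dots,V_{k,B}\prod_{i<k}(1-V_i))$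 with $V_j=V_{j,B}+V_{j,B^c}$ and $V_{i,B}$ independent of $V_{j,C}$ for $i\neq j$. $Z$ is the associated Lévy process/measure, whose atoms are $-\log(1-u)$ at $(s,x)$ for each atom $u$ of $\Lambda$ at $(s,x)$. $Y_{n,m}(s)=\sum_{i=1}^nI\{T_i>s\}+\sum_{l=1}^mI\{C_l>s\}$ and $f_{n,m}(u,s)=-Y_{n,m}(s)\log(1-u)$. $\kappa_k(e^{-f_{n,m}}\rho_\Lambda|t)=\int_0^1u^k(1-u)^{Y_{n,m}(t)}\rho_\Lambda(du|t)$. $(T_1^*,X_1^* ),\dots$ are the distinct values among the $(T_i,X_i)$, $\mathbf{p}=\{C_1,\dots,C_{n(\mathbf{p})}\}$ is the induced partition of $\{1,\dots,n\}$ and $e_{j,n}$ the size of its $j$-th cell. The posterior law is the conditional law of $\Lambda$ given the data obtained from disintegrating the joint measure (likelihood)$\times\mathcal{P}(d\Lambda|\rho_\Lambda,\eta)$, for almost every data point. *)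

theory Defs
  imports "HOL-Probability.Probability"
begin

section \<open>Random measures\<close>

text \<open>The space of all measures on \<open>K\<close>, with the sigma-algebra generated by the evaluation
  maps; this is \<open>subprob_algebra\<close> without the bound on the total mass.\<close>

definition measure_algebra :: "'a measure \<Rightarrow> 'a measure measure" where
  "measure_algebra K =
     (SUP A \<in> sets K. vimage_algebra {\<mu>. sets \<mu> = sets K} (\<lambda>\<mu>. emeasure \<mu> A) borel)"

definition base :: "(real \<times> 'x::polish_space) measure" where
  "base = restrict_space borel ({0<..} \<times> UNIV)"

definition unit_jumps :: "real measure" where
  "unit_jumps = restrict_space borel {0<..1}"

text \<open>The value \<open>\<infinity>\<close> is included because a jump \<open>u = 1\<close> of \<open>\<Lambda>\<close> is a jump
  \<open>- log (1 - u) = \<infinity>\<close> of \<open>Z\<close>.\<close>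

definition levy_jumps :: "ennreal measure" where
  "levy_jumps = restrict_space borel {0<..}"

text \<open>\<open>N\<close> is a Poisson random measure on \<open>E\<close> with mean measure \<open>\<nu>\<close>. The mass function is
  written out because \<open>poisson_pmf\<close> excludes the rate \<open>0\<close>.\<close>

definition poisson_random_measure ::
  "'w measure \<Rightarrow> 'e measure \<Rightarrow> 'e measure \<Rightarrow> ('w \<Rightarrow> 'e measure) \<Rightarrow> bool" where
  "poisson_random_measure M E \<nu> N \<longleftrightarrow>
     N \<in> M \<rightarrow>\<^sub>M measure_algebra E \<and>
     (\<forall>A\<in>sets E. emeasure \<nu> A < \<infinity> \<longrightarrow>
        (\<forall>k::nat. measure M {\<omega> \<in> space M. emeasure (N \<omega>) A = of_nat k}
            = measure \<nu> A ^ k / fact k * exp (- measure \<nu> A))) \<and>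
     (\<forall>A\<in>sets E. emeasure \<nu> A = \<infinity> \<longrightarrow> (AE \<omega> in M. emeasure (N \<omega>) A = \<infinity>)) \<and>
     (\<forall>(A :: nat \<Rightarrow> 'e set) k. A ` {..<k} \<subseteq> sets E \<longrightarrow> disjoint_family_on A {..<k} \<longrightarrow>
        prob_space.indep_vars M (\<lambda>_. borel) (\<lambda>i \<omega>. emeasure (N \<omega>) (A i)) {..<k})"

text \<open>The measure \<open>\<rho>(du|s) \<eta>(ds,dx)\<close>.\<close>

definition intensity ::
  "(real \<Rightarrow> real measure) \<Rightarrow> (real \<times> 'x::polish_space) measure \<Rightarrow> (real \<times> real \<times> 'x) measure" where
  "intensity \<rho> \<eta> =
     measure_of (space (unit_jumps \<Otimes>\<^sub>M base)) (sets (unit_jumps \<Otimes>\<^sub>M base))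
       (\<lambda>B. \<integral>\<^sup>+ p. emeasure (\<rho> (fst p)) {u \<in> {0<..1}. (u, p) \<in> B} \<partial>\<eta>)"

text \<open>The random measure \<open>\<integral> \<phi>(z) N(dz,ds,dx)\<close>.\<close>

definition jump_integral ::
  "('j \<Rightarrow> ennreal) \<Rightarrow> ('j \<times> real \<times> 'x::polish_space) measure \<Rightarrow> (real \<times> 'x) measure" where
  "jump_integral \<phi> N = distr (density N (\<lambda>(z, p). \<phi> z)) base snd"

text \<open>The completely random measure \<open>\<integral> u N(du,ds,dx)\<close>.\<close>

definition crm :: "(real \<times> real \<times> 'x::polish_space) measure \<Rightarrow> (real \<times> 'x) measure" where
  "crm N = jump_integral ennreal N"

definition add_atoms ::
  "(real \<times> 'x::polish_space) measure \<Rightarrow> (real \<times> 'x) set \<Rightarrow> (real \<times> 'x \<Rightarrow> ennreal)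
    \<Rightarrow> (real \<times> 'x) measure" where
  "add_atoms \<mu> P w = measure_of (space base) (sets base)
     (\<lambda>B. emeasure \<mu> B + (\<Sum>p\<in>P. w p * indicator B p))"

section \<open>Hazard measures and neutral to the right processes\<close>

text \<open>\<open>A\<close> is the hazard measure \<open>F(ds,dx) / P(T \<ge> s)\<close> of a lifetime distribution \<open>F\<close>. Mass at
  \<open>T = \<infinity>\<close> is allowed, so \<open>F\<close> is a subprobability and \<open>P(T \<ge> s) = 1 - F((0,s) \<times> X)\<close>.\<close>

definition hazard_measure :: "(real \<times> 'x::polish_space) measure \<Rightarrow> bool" where
  "hazard_measure A \<longleftrightarrow>
     (\<exists>F. sets F = sets base \<and> subprob_space F \<and>
        A = density F (\<lambda>(s, x). 1 / (1 - emeasure F ({0<..<s} \<times> UNIV))))"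

definition mean_hazard ::
  "(real \<Rightarrow> real measure) \<Rightarrow> (real \<times> 'x::polish_space) measure \<Rightarrow> (real \<times> 'x) measure" where
  "mean_hazard \<rho> \<eta> = density \<eta> (\<lambda>(s, x). \<integral>\<^sup>+ u. ennreal u \<partial>\<rho> s)"

text \<open>\<open>S(s-)\<close> for a purely atomic \<open>\<Lambda>\<close>. All factors lie in \<open>[0,1]\<close> (subtraction on \<open>ennreal\<close>
  is truncated at \<open>0\<close>), so the product over all times \<open>v < s\<close> is the infimum of the finite
  products.\<close>

definition survival_left :: "(real \<times> 'x::polish_space) measure \<Rightarrow> real \<Rightarrow> ennreal" where
  "survival_left \<Lambda> s =
     (INF V \<in> {V. finite V \<and> V \<subseteq> {0<..<s}}. \<Prod>v\<in>V. 1 - emeasure \<Lambda> ({v} \<times> UNIV))"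

definition ntr :: "(real \<times> 'x::polish_space) measure \<Rightarrow> (real \<times> 'x) measure" where
  "ntr \<Lambda> = density \<Lambda> (\<lambda>(s, x). survival_left \<Lambda> s)"

definition neg_log_compl :: "ennreal \<Rightarrow> ennreal" where
  "neg_log_compl u = (if u < 1 then ennreal (- ln (1 - enn2real u)) else \<infinity>)"

text \<open>\<open>Z\<close>: an atom \<open>- log (1 - u)\<close> at \<open>(s,x)\<close> for each atom \<open>u\<close> of \<open>\<Lambda>\<close> at \<open>(s,x)\<close>.\<close>

definition levy_measure_of :: "(real \<times> 'x::polish_space) measure \<Rightarrow> (real \<times> 'x) measure" where
  "levy_measure_of \<Lambda> =
     distr (density (count_space (space base)) (\<lambda>p. neg_log_compl (emeasure \<Lambda> {p}))) base (\<lambda>p. p)"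

text \<open>The extended neutral to the right property of the law \<open>L\<close> of a random measure on
  \<open>(0,\<infinity>) \<times> X\<close>. The variable \<open>V j B\<close> stands for \<open>V\<^sub>j\<^sub>,\<^sub>B\<close>, and \<open>V\<^sub>j = V j UNIV\<close>;
  the processes \<open>B \<mapsto> V j B\<close> are independent over \<open>j\<close>. The sample space carries
  the canonical version of the process \<open>V\<close>, so fixing its type loses no generality.\<close>

definition extended_ntr_law :: "(real \<times> 'x::polish_space) measure measure \<Rightarrow> bool" where
  "extended_ntr_law L \<longleftrightarrow>
     (\<forall>(k::nat) (t :: nat \<Rightarrow> real). t 0 = 0 \<longrightarrow> strict_mono_on {0..k} t \<longrightarrow>
       (\<exists>(M :: (nat \<Rightarrow> 'x set \<Rightarrow> real) measure) V.
          prob_space M \<and>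
          (\<forall>j\<in>{1..k}. \<forall>B\<in>sets borel. V j B \<in> borel_measurable M \<and>
             (AE \<omega> in M. V j B \<omega> \<in> {0..1} \<and> V j UNIV \<omega> = V j B \<omega> + V j (- B) \<omega>)) \<and>
          prob_space.indep_vars M (\<lambda>_. \<Pi>\<^sub>M B\<in>sets (borel :: 'x measure). (borel :: real measure))
            (\<lambda>j \<omega>. \<lambda>B\<in>sets borel. V j B \<omega>) {1..k} \<and>
          (\<forall>B\<in>sets borel.
             distr L (\<Pi>\<^sub>M j\<in>{1..k}. borel)
               (\<lambda>\<Phi>. \<lambda>j\<in>{1..k}. measure \<Phi> ({0<..t j} \<times> B) - measure \<Phi> ({0<..t (j - 1)} \<times> B))
             = distr M (\<Pi>\<^sub>M j\<in>{1..k}. borel)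
               (\<lambda>\<omega>. \<lambda>j\<in>{1..k}. V j B \<omega> * (\<Prod>i\<in>{1..<j}. 1 - V i UNIV \<omega>)))))"

section \<open>Data, likelihood and posterior\<close>

text \<open>The data \<open>d i = (T\<^sub>i, X\<^sub>i)\<close> and the censoring times \<open>C l\<close> are indexed from \<open>0\<close>.\<close>

definition data_space :: "nat \<Rightarrow> (nat \<Rightarrow> real \<times> 'x::polish_space) measure" where
  "data_space n = (\<Pi>\<^sub>M i\<in>{..<n}. base)"

text \<open>The likelihood \<open>[\<Prod>\<^sub>l S(C\<^sub>l-)] [\<Prod>\<^sub>i S(T\<^sub>i-) \<Lambda>(dT\<^sub>i,dX\<^sub>i)]\<close>
  as a measure in the data.\<close>

definition likelihood ::
  "nat \<Rightarrow> nat \<Rightarrow> (nat \<Rightarrow> real) \<Rightarrow> (real \<times> 'x::polish_space) measure \<Rightarrow> (nat \<Rightarrow> real \<times> 'x) measure" where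
  "likelihood n m C \<Lambda> =
     scale_measure (\<Prod>l<m. survival_left \<Lambda> (C l)) (\<Pi>\<^sub>M i\<in>{..<n}. ntr \<Lambda>)"

text \<open>Below, \<open>L \<omega>\<close> is the likelihood at the sample point \<open>\<omega>\<close> and \<open>W\<close> is a random element
  of \<open>V\<close>. The joint measure of \<open>W\<close> and the data has the value
  \<open>\<integral> 1\<^sub>A(W \<omega>) L \<omega> B \<partial>M\<close> on \<open>A \<times> B\<close>; \<open>data_marginal\<close> is its marginal, and the posterior
  of \<open>W\<close> is the kernel in its disintegration.\<close>

definition data_marginal :: "'w measure \<Rightarrow> 'd measure \<Rightarrow> ('w \<Rightarrow> 'd measure) \<Rightarrow> 'd measure" where
  "data_marginal M D L = measure_of (space D) (sets D) (\<lambda>B. \<integral>\<^sup>+ \<omega>. emeasure (L \<omega>) B \<partial>M)"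

definition posterior_kernel ::
  "'w measure \<Rightarrow> 'd measure \<Rightarrow> ('w \<Rightarrow> 'd measure) \<Rightarrow> 'v measure \<Rightarrow> ('w \<Rightarrow> 'v)
    \<Rightarrow> ('d \<Rightarrow> 'v measure) \<Rightarrow> bool" where
  "posterior_kernel M D L V W K \<longleftrightarrow>
     K \<in> D \<rightarrow>\<^sub>M prob_algebra V \<and>
     (\<forall>A\<in>sets V. \<forall>B\<in>sets D.
        (\<integral>\<^sup>+ \<omega>. indicator A (W \<omega>) * emeasure (L \<omega>) B \<partial>M)
        = (\<integral>\<^sup>+ d \<in> B. emeasure (K d) A \<partial>data_marginal M D L))"

text \<open>\<open>at_risk\<close> is \<open>Y\<^sub>n\<^sub>,\<^sub>m(s)\<close>.\<close>

definition at_risk ::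
  "nat \<Rightarrow> nat \<Rightarrow> (nat \<Rightarrow> real) \<Rightarrow> (nat \<Rightarrow> real \<times> 'x) \<Rightarrow> real \<Rightarrow> nat" where
  "at_risk n m C d s = card {i. i < n \<and> fst (d i) > s} + card {l. l < m \<and> C l > s}"

text \<open>\<open>e\<^sup>-\<^sup>f \<rho>\<close> for \<open>f(u,s) = - Y(s) log (1 - u)\<close>; at \<open>u = 1\<close> and \<open>Y(s) = 0\<close> the factor
  is \<open>0 ^ 0 = 1\<close>.\<close>

definition tilted :: "(real \<Rightarrow> nat) \<Rightarrow> (real \<Rightarrow> real measure) \<Rightarrow> real \<Rightarrow> real measure" where
  "tilted Y \<rho> s = density (\<rho> s) (\<lambda>u. ennreal ((1 - u) ^ Y s))"

text \<open>\<open>kappa k (tilted Y \<rho>) t\<close> is \<open>\<kappa>\<^sub>k(e\<^sup>-\<^sup>f \<rho>|t)\<close>.\<close>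

definition kappa :: "nat \<Rightarrow> (real \<Rightarrow> real measure) \<Rightarrow> real \<Rightarrow> ennreal" where
  "kappa k \<rho> t = (\<integral>\<^sup>+ u. ennreal (u ^ k) \<partial>\<rho> t)"

text \<open>The cells of the partition \<open>p\<close> correspond to the distinct values \<open>p \<in> d ` {..<n}\<close>; the jumps
  and the cell sizes are therefore indexed by these values.\<close>

definition cell_size :: "nat \<Rightarrow> (nat \<Rightarrow> real \<times> 'x) \<Rightarrow> real \<times> 'x \<Rightarrow> nat" where
  "cell_size n d p = card {i. i < n \<and> d i = p}"

definition jump_law ::
  "nat \<Rightarrow> (nat \<Rightarrow> real \<times> 'x) \<Rightarrow> (real \<Rightarrow> real measure) \<Rightarrow> real \<times> 'x \<Rightarrow> real measure" where
  "jump_law n d \<rho> p =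
     density (\<rho> (fst p))
       (\<lambda>u. ennreal (u ^ cell_size n d p) / kappa (cell_size n d p) \<rho> (fst p))"

text \<open>A Poisson random measure \<open>N\<close> with mean \<open>\<nu>\<close> and, independently of it, independent jumps
  \<open>J p\<close> with the laws \<open>jump_law n d \<rho> p\<close>.\<close>

definition poisson_and_jumps ::
  "'w measure \<Rightarrow> 'e measure \<Rightarrow> 'e measure \<Rightarrow> nat \<Rightarrow> (nat \<Rightarrow> real \<times> 'x) \<Rightarrow> (real \<Rightarrow> real measure)
    \<Rightarrow> ('w \<Rightarrow> 'e measure) \<Rightarrow> (real \<times> 'x \<Rightarrow> 'w \<Rightarrow> real) \<Rightarrow> bool" where
  "poisson_and_jumps M E \<nu> n d \<rho> N J \<longleftrightarrow>
     prob_space M \<and>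
     poisson_random_measure M E \<nu> N \<and>
     (\<forall>p\<in>d ` {..<n}. J p \<in> M \<rightarrow>\<^sub>M unit_jumps \<and> distr M unit_jumps (J p) = jump_law n d \<rho> p) \<and>
     prob_space.indep_vars M (\<lambda>_. unit_jumps) J (d ` {..<n}) \<and>
     prob_space.indep_set M
       (sets (vimage_algebra (space M) N (measure_algebra E)))
       (sets (vimage_algebra (space M) (\<lambda>\<omega>. \<lambda>p\<in>d ` {..<n}. J p \<omega>)
          (\<Pi>\<^sub>M p\<in>d ` {..<n}. unit_jumps)))"

definition posterior_hazard ::
  "nat \<Rightarrow> (nat \<Rightarrow> real \<times> 'x::polish_space) \<Rightarrow> ('w \<Rightarrow> (real \<times> real \<times> 'x) measure)
    \<Rightarrow> (real \<times> 'x \<Rightarrow> 'w \<Rightarrow> real) \<Rightarrow> 'w \<Rightarrow> (real \<times> 'x) measure" where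
  "posterior_hazard n d N J \<omega> = add_atoms (crm (N \<omega>)) (d ` {..<n}) (\<lambda>p. ennreal (J p \<omega>))"

definition posterior_levy ::
  "nat \<Rightarrow> (nat \<Rightarrow> real \<times> 'x::polish_space) \<Rightarrow> ('w \<Rightarrow> (ennreal \<times> real \<times> 'x) measure)
    \<Rightarrow> (real \<times> 'x \<Rightarrow> 'w \<Rightarrow> real) \<Rightarrow> 'w \<Rightarrow> (real \<times> 'x) measure" where
  "posterior_levy n d N J \<omega> =
     add_atoms (jump_integral (\<lambda>z. z) (N \<omega>)) (d ` {..<n})
       (\<lambda>p. neg_log_compl (ennreal (J p \<omega>)))"

text \<open>The image of \<open>\<rho>(du|s) \<eta>(ds,dx)\<close> under \<open>(u,s,x) \<mapsto> (- log (1 - u), s, x)\<close>.\<close>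

definition levy_intensity ::
  "(real \<Rightarrow> real measure) \<Rightarrow> (real \<times> 'x::polish_space) measure \<Rightarrow> (ennreal \<times> real \<times> 'x) measure" where
  "levy_intensity \<rho> \<eta> =
     distr (intensity \<rho> \<eta>) (levy_jumps \<Otimes>\<^sub>M base) (\<lambda>(u, p). (neg_log_compl (ennreal u), p))"

end

theory Submission
  imports Defs
begin

text \<open>The Poisson random measure \<open>N\<close> behind \<open>\<Lambda>\<close> is characterised by the Mecke equation. Iterating
  that equation disintegrates \<open>\<Lambda>(dd\<^sub>1)\<cdots>\<Lambda>(dd\<^sub>n) P(dN)\<close> with respect to the data: new values are
  drawn from the mean hazard \<open>A\<close>, and at each distinct value \<open>p = (t,x)\<close> a point \<open>(u,p)\<close> is added to \<open>N\<close>,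
  with \<open>u\<close> drawn from \<open>u \<rho>(du|t) / \<kappa>\<^sub>1(t)\<close> and weighted by \<open>u\<^sup>e\<^sup>-\<^sup>1\<close>. The survival factors of the likelihood are
  multiplicative over the points of \<open>N\<close>, a point \<open>(u,s,x)\<close> contributing \<open>(1 - u)\<close> to the power \<open>Y(s)\<close>. Weighting by
  them turns the Mecke equation with intensity \<open>\<nu>\<close> into the one with the tilted intensity, and it tilts
  the laws of the added jumps without making them dependent. The three posterior laws are images of
  this one law of point configurations. In the posterior, the increment of \<open>F\<close> over a time strip is the
  survival probability up to the strip times a functional of the points in the strip, and the
  restrictions of the configuration to disjoint strips are independent.\<close>

text \<open>Survival probabilities are infinite products. Each is written as the exponential of
  minus an integral of \<open>- log (1 - u)\<close> over the points, infinity being allowed at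
  \<open>u = 1\<close>: this form is measurable in \<open>N\<close>, and adding points adds
  integrals. The product in \<open>survival_left\<close> is recovered only on simple configurations,
  that is, countably many unit atoms at distinct times. Almost every \<open>N\<close> is one,
  because the time marginal of \<open>\<eta>\<close> has no atoms. Measurable functionals that agree
  there with \<open>ntr\<close> and with the likelihood are used instead of these, and this is why
  the law of \<open>F\<close> lives on a completed space. The assumption on the mean hazard is used
  twice. It makes \<open>A\<close> sigma-finite, which provides the level sets for the Mecke
  equation and permits Fubini. It also bounds the mean hazard up to almost every observation and
  almost every point of \<open>N\<close>; without such a bound mass may be lost in the identity that
  failure in a strip and survival of the strip have total probability one. That identity is what
  makes the factor \<open>1 - V\<close> of the extended property the survival probability over a
  strip.\<close>

type_synonym 'x mark = "real \<times> real \<times> 'x"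

abbreviation bm :: "'a measure \<Rightarrow> ('a \<Rightarrow> 'b::topological_space) set" where "bm \<equiv> borel_measurable"

abbreviation MA :: "'a measure \<Rightarrow> 'a measure measure" where "MA \<equiv> measure_algebra"

abbreviation ind1 :: "'a set \<Rightarrow> 'a \<Rightarrow> 'b::zero_neq_one" where "ind1 \<equiv> indicator"

notation measurable (infixr "->M" 60)

syntax "_nn_integral" :: "pttrn \<Rightarrow> ennreal \<Rightarrow> 'a measure \<Rightarrow> ennreal" ("(NN _./ _/ \<partial>_)" [60, 61] 110)

lemmas m_comp = measurable_compose
  and bm_times = borel_measurable_times_ennreal
  and m_cong_sets = measurable_cong_sets
  and space_eq = sets_eq_imp_space_eq
  and bm_ind = borel_measurable_indicator
  and m_proj = measurable_component_singleton
  and bm_prod = borel_measurable_prod_ennreal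
  and bm_div = borel_measurable_divide_ennreal
  and nn_cong = nn_integral_cong
  and m_id = measurable_ident_sets[OF refl]

section \<open>The space of measures\<close>

lemma space_measure_algebra: "space (MA K) = {\<mu>. sets \<mu> = sets K}"
 by (auto simp add: measure_algebra_def space_Sup_eq_UN)

lemma measurable_emeasure_measure_algebra [measurable]:
 "A \<in> sets K ==> (%\<mu>. emeasure \<mu> A) \<in> bm (MA K)"
 by (auto intro!: measurable_Sup1 measurable_vimage_algebra1 simp: measure_algebra_def)

lemma measurable_measure_algebraI:
 "(!!x. x \<in> space M ==> sets (f x) = sets K) ==>
 (!!A. A \<in> sets K ==> (%x. emeasure (f x) A) \<in> bm M) ==>
 f \<in> M ->M MA K"
 by (auto intro!: measurable_Sup2 measurable_vimage_algebra2 simp: measure_algebra_def)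

lemma nn_integral_measurable_measure_algebra:
 assumes f: "f \<in> bm K"
 shows "(%\<mu>. NN x. f x \<partial>\<mu>) \<in> bm (MA K)"
 using f
proof induct
 case (cong f g)
 have "(%\<mu>. NN x. f x \<partial>\<mu>) \<in> bm (MA K) \<longleftrightarrow>
   (%\<mu>. NN x. g x \<partial>\<mu>) \<in> bm (MA K)"
  by (intro measurable_cong nn_cong cong)
   (auto simp: space_measure_algebra dest!: space_eq)
 with cong show ?case by simp
next
 case (set B)
 then have "(%\<mu>. NN x. ind1 B x \<partial>\<mu>) \<in> bm (MA K) \<longleftrightarrow>
   (%\<mu>. emeasure \<mu> B) \<in> bm (MA K)"
  by (intro measurable_cong nn_integral_indicator) (simp add: space_measure_algebra)
 with set show ?case by simp
next
 case (mult f c)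
 then have "(%\<mu>. NN x. c * f x \<partial>\<mu>) \<in> bm (MA K) \<longleftrightarrow>
   (%\<mu>. c * NN x. f x \<partial>\<mu>) \<in> bm (MA K)"
  by (intro measurable_cong nn_integral_cmult) (auto simp add: space_measure_algebra cong: m_cong_sets)
 with mult show ?case by simp
next
 case (add f g)
 then have "(%\<mu>. NN x. f x + g x \<partial>\<mu>) \<in> bm (MA K) \<longleftrightarrow>
   (%\<mu>. (NN x. f x \<partial>\<mu>) + (NN x. g x \<partial>\<mu>)) \<in> bm (MA K)"
  by (intro measurable_cong nn_integral_add) (auto simp add: space_measure_algebra cong: m_cong_sets)
 with add show ?case by (simp add: ac_simps)
next
 case (seq F)
 then have "(%\<mu>. NN x. (SUP i. F i) x \<partial>\<mu>) \<in> bm (MA K) \<longleftrightarrow>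
   (%\<mu>. SUP i. (NN x. F i x \<partial>\<mu>)) \<in> bm (MA K)"
  unfolding SUP_apply
  by (intro measurable_cong nn_integral_monotone_convergence_SUP) (auto simp add: space_measure_algebra cong: m_cong_sets)
 with seq show ?case by (simp add: ac_simps)
qed

text \<open>Replacing a finite family by the atoms of the algebra it generates reduces equality on
 finite-dimensional events to disjoint families.\<close>

lemma finite_atoms:
 assumes "finite \<A>" "\<A> \<subseteq> sets K"
 obtains \<D> where "finite \<D>" "\<D> \<subseteq> sets K" "disjoint \<D>"
  "!!A. A \<in> \<A> ==> \<Union>{D \<in> \<D>. D \<subseteq> A} = A" "!!A D. A \<in> \<A> ==> D \<in> \<D> ==> D \<subseteq> A \<or> D \<inter> A = {}"
proof -
 define atm where "atm S = {x \<in> space K. \<forall>A\<in>\<A>. x \<in> A \<longleftrightarrow> A \<in> S}" for S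
 let ?D = "atm ` Pow \<A>"
 have 1: "finite ?D" using assms by simp
 have 2: "?D \<subseteq> sets K"
 proof safe
  fix S assume "S \<subseteq> \<A>"
  have "atm S = space K \<inter> (\<Inter>A\<in>\<A>. {x \<in> space K. x \<in> A \<longleftrightarrow> A \<in> S})"
   by (auto simp: atm_def)
  also have "\<dots> \<in> sets K"
  proof (cases "\<A> = {}")
   case False
   with assms show ?thesis
    by (intro sets.Int sets.finite_INT sets.top) auto
  qed auto
  finally show "atm S \<in> sets K" .
 qed
 have atm_disj: "S = T" if "S \<subseteq> \<A>" "T \<subseteq> \<A>" "x \<in> atm S" "x \<in> atm T" for S T x
 proof (rule set_eqI)
  fix A
  have "A \<in> S \<longleftrightarrow> x \<in> A" if "A \<in> \<A>" using that \<open>x \<in> atm S\<close> by (simp add: atm_def)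
  moreover have "A \<in> T \<longleftrightarrow> x \<in> A" if "A \<in> \<A>" using that \<open>x \<in> atm T\<close> by (simp add: atm_def)
  ultimately show "A \<in> S \<longleftrightarrow> A \<in> T" using that(1,2) by (cases "A \<in> \<A>") auto
 qed
 have 3: "disjoint ?D"
 proof (rule disjointI)
  fix D D' assume "D \<in> ?D" "D' \<in> ?D" "D \<noteq> D'"
  then obtain S T where ST: "D = atm S" "D' = atm T" "S \<subseteq> \<A>" "T \<subseteq> \<A>" by blast
  show "D \<inter> D' = {}"
  proof (rule ccontr)
   assume "D \<inter> D' \<noteq> {}"
   then obtain x where "x \<in> atm S" "x \<in> atm T" using ST by auto
   then have "S = T" using atm_disj ST by metis
   then show False using ST \<open>D \<noteq> D'\<close> by simp
  qed
 qed
 have 4: "D \<subseteq> A \<or> D \<inter> A = {}" if "A \<in> \<A>" "D \<in> ?D" for A D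
 proof -
  from that obtain S where S: "D = atm S" by blast
  have "x \<in> A \<longleftrightarrow> A \<in> S" if "x \<in> D" for x using that S \<open>A \<in> \<A>\<close> by (simp add: atm_def)
  then show ?thesis by blast
 qed
 have 5: "\<Union>{D \<in> ?D. D \<subseteq> A} = A" if A: "A \<in> \<A>" for A
 proof -
  have "x \<in> \<Union>{D \<in> ?D. D \<subseteq> A}" if "x \<in> A" for x
  proof -
   have "x \<in> space K" using A assms(2) that sets.sets_into_space by blast
   then have x: "x \<in> atm {B\<in>\<A>. x \<in> B}" by (auto simp: atm_def)
   moreover have "atm {B\<in>\<A>. x \<in> B} \<subseteq> A" using A that by (auto simp: atm_def)
   ultimately show ?thesis by (intro UnionI[of "atm {B\<in>\<A>. x \<in> B}"]) auto
  qed
  then show ?thesis by (intro equalityI subsetI) auto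
 qed
 show thesis by (rule that[of ?D]) (fact 1 2 3 4 5)+
qed

lemma emeasure_Union_disjoint:
 assumes "finite \<D>" "\<D> \<subseteq> sets \<mu>" "disjoint \<D>"
 shows "emeasure \<mu> (\<Union>\<D>) = (\<Sum>D\<in>\<D>. emeasure \<mu> D)"
 using sum_emeasure[of "%D. D" \<D> \<mu>] assms
 by (auto simp: disjoint_family_on_def disjoint_def)

text \<open>Events in finitely many masses form a pi-system that generates the sigma-algebra, and
  \<open>finite_atoms\<close> refines each of them to a disjoint family. The set \<open>B\<close> is
  put into every family so that it is a union of members: the Mecke equation weights configurations
  by the mass of \<open>B\<close>, which must then split into the masses at hand.\<close>

lemma measure_algebra_eqI:
 fixes K :: "'a measure"
 assumes m1: "finite_measure m1" "sets m1 = sets (MA K)"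
  and m2: "finite_measure m2" "sets m2 = sets (MA K)" and B: "B \<in> sets K"
  and eq: "!!\<D> I. finite \<D> ==> \<D> \<subseteq> sets K ==> disjoint \<D> ==> \<Union>{A\<in>\<D>. A \<subseteq> B} = B ==>
   (!!A. A \<in> \<D> ==> A \<subseteq> B \<or> A \<inter> B = {}) ==> (!!A. I A \<in> sets (borel :: ennreal measure)) ==>
   emeasure m1 {\<mu> \<in> space (MA K). \<forall>A\<in>\<D>. emeasure \<mu> A \<in> I A} =
   emeasure m2 {\<mu> \<in> space (MA K). \<forall>A\<in>\<D>. emeasure \<mu> A \<in> I A}"
 shows "m1 = m2"
proof -
 interpret m1: finite_measure m1 by fact
 interpret m2: finite_measure m2 by fact
 let ?Sp = "space (MA K)"
 let ?C = "%\<A> I. {\<mu> \<in> ?Sp. \<forall>A\<in>\<A>. emeasure \<mu> A \<in> I A}"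
 define G where "G = {?C \<A> I | \<A> I. finite \<A> \<and> \<A> \<subseteq> sets K \<and> B \<in> \<A> \<and> (\<forall>A. I A \<in> sets (borel :: ennreal measure))}"
 have C_sets: "?C \<A> I \<in> sets (MA K)"
  if "finite \<A>" "\<A> \<subseteq> sets K" "!!A. I A \<in> sets borel" for \<A> I
 proof -
  have "?C \<A> I = space (MA K) \<inter> (\<Inter>A\<in>\<A>. (%\<mu>. emeasure \<mu> A) -` I A \<inter> ?Sp)" by auto
  also have "\<dots> \<in> sets (MA K)"
  proof (cases "\<A> = {}")
   case False
   with that show ?thesis
    by (intro sets.Int sets.finite_INT sets.top measurable_sets[OF measurable_emeasure_measure_algebra]) auto
  qed auto
  finally show ?thesis .
 qed
 have eqG: "emeasure m1 X = emeasure m2 X" if "X \<in> G" for X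
 proof -
  from that obtain \<A> I where X: "X = ?C \<A> I" and \<A>: "finite \<A>" "\<A> \<subseteq> sets K" "B \<in> \<A>"
   and I: "!!A. I A \<in> sets borel" by (auto simp: G_def)
  obtain \<D> where \<D>: "finite \<D>" "\<D> \<subseteq> sets K" "disjoint \<D>"
   "!!A. A \<in> \<A> ==> \<Union>{D \<in> \<D>. D \<subseteq> A} = A" "!!A D. A \<in> \<A> ==> D \<in> \<D> ==> D \<subseteq> A \<or> D \<inter> A = {}"
   using finite_atoms[OF \<A>(1,2)] by metis
  let ?P = "\<Pi>\<^sub>M D\<in>\<D>. (borel :: ennreal measure)"
  define v where "v = (%\<mu>::'a measure. \<lambda>D\<in>\<D>. emeasure \<mu> D)"
  have v[measurable]: "v \<in> MA K ->M ?P"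
   unfolding v_def using \<D> by (intro measurable_restrict) auto
  have v1[measurable]: "v \<in> m1 ->M ?P" and v2[measurable]: "v \<in> m2 ->M ?P"
   using v m1(2) m2(2) by (simp_all cong: m_cong_sets)
  have sp: "space m1 = ?Sp" "space m2 = ?Sp"
   using m1(2) m2(2) space_eq by blast+
  \<comment> \<open>Joint laws of the masses of the atoms. Boxes in these masses are exactly the
    events of the hypothesis \<open>eq\<close>.\<close>
  have "distr m1 ?P v = distr m2 ?P v"
  proof (rule measure_eqI_PiM_finite[where A="%_. space ?P"])
   show "finite \<D>" by fact
   fix J assume J: "!!i. i \<in> \<D> ==> J i \<in> sets (borel::ennreal measure)"
   have *: "v -` Pi\<^sub>E \<D> J \<inter> ?Sp = ?C \<D> (%D. if D \<in> \<D> then J D else UNIV)"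
    by (auto simp: v_def PiE_iff)
   have "Pi\<^sub>E \<D> J \<in> sets ?P" using J \<D> by (intro sets_PiM_I_finite) auto
   then show "emeasure (distr m1 ?P v) (Pi\<^sub>E \<D> J) = emeasure (distr m2 ?P v) (Pi\<^sub>E \<D> J)"
    using eq[of \<D> "%D. if D \<in> \<D> then J D else UNIV"] \<D> B \<A>(3) J by (simp add: emeasure_distr sp *)
  next
   show "range (%_::nat. space ?P) \<subseteq> prod_algebra \<D> (%_. borel)"
    using \<D>(1) by (auto simp: space_PiM intro!: prod_algebraI_finite)
   show "(\<Union>i::nat. space ?P) = space ?P" by simp
   show "!!i::nat. emeasure (distr m1 ?P v) (space ?P) \<noteq> \<infinity>"
    by (subst emeasure_distr) auto
  qed simp_all
  \<comment> \<open>The masses of the original sets are sums of masses of atoms, so the event is the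
    preimage under \<open>v\<close> of a measurable set of vectors.\<close>
  moreover define Y where "Y = {x \<in> space ?P. \<forall>A\<in>\<A>. (\<Sum>D\<in>{D\<in>\<D>. D \<subseteq> A}. x D) \<in> I A}"
  have v_eq: "emeasure \<mu> A = (\<Sum>D\<in>{D\<in>\<D>. D \<subseteq> A}. v \<mu> D)" if "A \<in> \<A>" "\<mu> \<in> ?Sp" for \<mu> A
  proof -
   have "emeasure \<mu> (\<Union>{D\<in>\<D>. D \<subseteq> A}) = (\<Sum>D\<in>{D\<in>\<D>. D \<subseteq> A}. emeasure \<mu> D)"
    using \<D> that by (intro emeasure_Union_disjoint) (auto simp: space_measure_algebra disjoint_def)
   then show ?thesis using \<D>(4)[OF that(1)] by (simp add: v_def)
  qed
  have X': "X = v -` Y \<inter> ?Sp"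
  proof (intro set_eqI)
   fix \<mu>
   have "v \<mu> \<in> space ?P" by (simp add: v_def space_PiM)
   then show "\<mu> \<in> X \<longleftrightarrow> \<mu> \<in> v -` Y \<inter> ?Sp" using v_eq unfolding X Y_def by auto
  qed
  moreover have Y: "Y \<in> sets ?P"
  proof -
   have "Y = space ?P \<inter> (\<Inter>A\<in>\<A>. (%x. \<Sum>D\<in>{D\<in>\<D>. D \<subseteq> A}. x D) -` I A \<inter> space ?P)"
    by (auto simp: Y_def)
   also have "\<dots> \<in> sets ?P"
    using \<A> I \<D>(1)
    by (intro sets.Int sets.finite_INT sets.top measurable_sets[of _ _ borel] borel_measurable_sum
      m_proj) auto
   finally show ?thesis .
  qed
  have "emeasure m1 X = emeasure (distr m1 ?P v) Y" "emeasure m2 X = emeasure (distr m2 ?P v) Y"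
   using Y X' by (simp_all add: emeasure_distr sp)
  ultimately show ?thesis by simp
 qed
 have G_sub: "G \<subseteq> Pow ?Sp" by (auto simp: G_def)
 have Sp_G: "?Sp \<in> G"
  unfolding G_def using B by (intro CollectI exI[of _ "{B}"] exI[of _ "%_. UNIV"]) auto
 have sig: "sets (MA K) = sigma_sets ?Sp G"
 proof
  show "sigma_sets ?Sp G \<subseteq> sets (MA K)"
   using C_sets by (intro sets.sigma_sets_subset) (auto simp: G_def)
  have "(%\<mu>. \<mu>) \<in> sigma ?Sp G ->M MA K"
  proof (rule measurable_measure_algebraI)
   fix A assume A: "A \<in> sets K"
   show "(%\<mu>. emeasure \<mu> A) \<in> bm (sigma ?Sp G)"
   proof (rule measurableI)
    fix Y :: "ennreal set" assume "Y \<in> sets borel"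
    \<comment> \<open>Members of \<open>G\<close> must contain \<open>B\<close>; it enters with the
      void condition \<open>UNIV\<close> when it differs from \<open>A\<close>.\<close>
    then have "?C {A, B} (%D. if D = A then Y else UNIV) \<in> G"
     using A B unfolding G_def
     by (intro CollectI exI[of _ "{A, B}"] exI[of _ "%D. if D = A then Y else UNIV"]) auto
    also have "?C {A, B} (%D. if D = A then Y else UNIV) = (%\<mu>. emeasure \<mu> A) -` Y \<inter> ?Sp" by auto
    finally show "(%\<mu>. emeasure \<mu> A) -` Y \<inter> space (sigma ?Sp G) \<in> sets (sigma ?Sp G)"
     using G_sub by (simp add: space_measure_of sets_measure_of)
   qed auto
  qed (use G_sub in \<open>simp add: space_measure_of space_measure_algebra\<close>)
  then show "sets (MA K) \<subseteq> sigma_sets ?Sp G"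
   using measurable_sets[of "%\<mu>. \<mu>" "sigma ?Sp G" "MA K"] G_sub
    sets.sets_into_space[of _ "MA K"]
   by (auto simp: space_measure_of sets_measure_of Int_absorb2)
 qed
 have Int_G: "Int_stable G"
 proof (rule Int_stableI)
  fix a b assume "a \<in> G" "b \<in> G"
  then obtain \<A> I \<A>' I' where 1: "a = ?C \<A> I" "finite \<A>" "\<A> \<subseteq> sets K" "B \<in> \<A>" "\<forall>A. I A \<in> sets borel"
   and 2: "b = ?C \<A>' I'" "finite \<A>'" "\<A>' \<subseteq> sets K" "B \<in> \<A>'" "\<forall>A. I' A \<in> sets borel"
   unfolding G_def by auto
  let ?I = "%A. (if A \<in> \<A> then I A else UNIV) \<inter> (if A \<in> \<A>' then I' A else UNIV)"
  have "a \<inter> b = ?C (\<A> \<union> \<A>') ?I" unfolding 1(1) 2(1) by auto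
  then show "a \<inter> b \<in> G" unfolding G_def using 1 2
   by (intro CollectI exI[of _ "\<A> \<union> \<A>'"] exI[of _ ?I]) auto
 qed
 show ?thesis
 proof (rule measure_eqI_generator_eq[OF Int_G G_sub eqG])
  show "sets m1 = sigma_sets ?Sp G" "sets m2 = sigma_sets ?Sp G"
   using sig m1 m2 by simp_all
  show "range (%_::nat. ?Sp) \<subseteq> G" "(\<Union>i::nat. ?Sp) = ?Sp" using Sp_G by auto
 qed simp_all
qed

section \<open>Mixtures of measures over a kernel\<close>

lemma sets_data_marginal [simp, measurable_cong]: "sets (data_marginal M D L) = sets D"
 and space_data_marginal [simp]: "space (data_marginal M D L) = space D"
 by (auto simp: data_marginal_def)

context
 fixes M :: "'w measure" and D :: "'d measure" and L L' :: "'w => 'd measure"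
 assumes L': "L' \<in> M ->M MA D" and ae: "AE w in M. L w = L' w"
begin

lemma sets_mixture_kernel: "w \<in> space M ==> sets (L' w) = sets D"
 using measurable_space[OF L'] by (simp add: space_measure_algebra)

lemma measurable_mixture_kernel: "B \<in> sets D ==> (%w. emeasure (L' w) B) \<in> bm M"
 using m_comp[OF L' measurable_emeasure_measure_algebra] .

text \<open>\<open>L\<close> itself need not be measurable. The set function behind
  \<open>data_marginal\<close> sees it only through integrals, so \<open>L\<close> may be replaced
  by its almost sure version \<open>L'\<close>; for a kernel countable additivity is monotone
  convergence.\<close>

lemma emeasure_data_marginal:
 assumes "B \<in> sets D"
 shows "emeasure (data_marginal M D L) B = (NN w. emeasure (L' w) B \<partial>M)"
proof -
 have *: "(NN w. emeasure (L w) B \<partial>M) = (NN w. emeasure (L' w) B \<partial>M)" for B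
  by (rule nn_integral_cong_AE) (use ae in auto)
 have "data_marginal M D L = measure_of (space D) (sets D) (%B. NN w. emeasure (L' w) B \<partial>M)"
  unfolding data_marginal_def * ..
 then show ?thesis
 proof (rule emeasure_measure_of)
  show "countably_additive (sets (data_marginal M D L)) (%B. NN w. emeasure (L' w) B \<partial>M)"
   unfolding countably_additive_def
  proof safe
   fix F :: "nat => 'd set" assume F: "range F \<subseteq> sets (data_marginal M D L)" "disjoint_family F"
   then have "(\<Sum>i. NN w. emeasure (L' w) (F i) \<partial>M) = (NN w. (\<Sum>i. emeasure (L' w) (F i)) \<partial>M)"
    by (intro nn_integral_suminf[symmetric] measurable_mixture_kernel) auto
   also have "\<dots> = (NN w. emeasure (L' w) (\<Union>i. F i) \<partial>M)"
    using F by (intro nn_cong suminf_emeasure) (auto simp: sets_mixture_kernel)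
   finally show "(\<Sum>i. NN w. emeasure (L' w) (F i) \<partial>M) = \<dots>" .
  qed
 qed (use assms sets.sets_into_space[of _ D] in \<open>auto simp: positive_def\<close>)
qed

lemma nn_integral_data_marginal:
 assumes "h \<in> bm D"
 shows "(NN d. h d \<partial>data_marginal M D L) = (NN w. NN d. h d \<partial>L' w \<partial>M)"
 using assms
proof induct
 case (cong f g)
 then have "(NN d. f d \<partial>L' w) = (NN d. g d \<partial>L' w)" if "w \<in> space M" for w
  using space_eq[OF sets_mixture_kernel[OF that]] by (intro nn_cong) simp
 moreover have "(NN d. f d \<partial>data_marginal M D L) = (NN d. g d \<partial>data_marginal M D L)"
  using cong by (intro nn_cong) simp
 ultimately show ?case using cong by (simp cong: nn_cong)
next
 case (set A)
 then show ?case
  by (simp add: emeasure_data_marginal sets_mixture_kernel cong: nn_cong)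
next
 case (mult f c)
 moreover have "(%w. NN d. f d \<partial>L' w) \<in> bm M"
  using m_comp[OF L' nn_integral_measurable_measure_algebra] mult by simp
 ultimately show ?case
  by (simp add: nn_integral_cmult sets_mixture_kernel cong: nn_cong m_cong_sets)
next
 case (add f g)
 moreover have "(%w. NN d. f d \<partial>L' w) \<in> bm M" "(%w. NN d. g d \<partial>L' w) \<in> bm M"
  using m_comp[OF L' nn_integral_measurable_measure_algebra] add by simp_all
 ultimately show ?case
  by (simp add: nn_integral_add sets_mixture_kernel cong: nn_cong m_cong_sets)
next
 case (seq F)
 have "(%w. NN d. F i d \<partial>L' w) \<in> bm M" for i
  using m_comp[OF L' nn_integral_measurable_measure_algebra] seq by simp
 moreover have "incseq (%i w. NN d. F i d \<partial>L' w)"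
  using seq by (auto simp: incseq_def le_fun_def intro!: nn_integral_mono)
 moreover have "(NN d. (SUP i. F i d) \<partial>L' w) = (SUP i. NN d. F i d \<partial>L' w)" if "w \<in> space M" for w
  using seq that
  by (intro nn_integral_monotone_convergence_SUP) (auto simp: sets_mixture_kernel cong: m_cong_sets)
 ultimately show ?case using seq
  by (simp add: nn_integral_monotone_convergence_SUP image_comp cong: nn_cong m_cong_sets)
qed

end

section \<open>Adding finitely many points to a measure\<close>

definition add_pts :: "'e measure => 'i set => ('i => 'e) => 'e measure" where
 "add_pts N I z = measure_of (space N) (sets N) (%B. emeasure N B + (\<Sum>i\<in>I. ind1 B (z i)))"

lemma sets_add_pts [simp, measurable_cong]: "sets (add_pts N I z) = sets N"
 and space_add_pts [simp]: "space (add_pts N I z) = space N"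
 by (auto simp: add_pts_def)

lemma emeasure_add_pts:
 assumes "B \<in> sets N"
 shows "emeasure (add_pts N I z) B = emeasure N B + (\<Sum>i\<in>I. ind1 B (z i))"
 using add_pts_def
proof (rule emeasure_measure_of)
 show "countably_additive (sets (add_pts N I z)) (%B. emeasure N B + (\<Sum>i\<in>I. ind1 B (z i)))"
  unfolding countably_additive_def
 proof safe
  fix F :: "nat => 'a set" assume F: "range F \<subseteq> sets (add_pts N I z)" "disjoint_family F"
  have "(\<Sum>n. emeasure N (F n) + (\<Sum>i\<in>I. ind1 (F n) (z i)))
    = emeasure N (\<Union>n. F n) + (\<Sum>n. \<Sum>i\<in>I. ind1 (F n) (z i))"
   using F by (subst suminf_add[symmetric]) (auto simp: suminf_emeasure)
  also have "(\<Sum>n. \<Sum>i\<in>I. ind1 (F n) (z i) :: ennreal) = (\<Sum>i\<in>I. ind1 (\<Union>n. F n) (z i))"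
   using F by (subst suminf_sum) (auto simp: suminf_indicator)
  finally show "(\<Sum>n. emeasure N (F n) + (\<Sum>i\<in>I. ind1 (F n) (z i)))
    = emeasure N (\<Union>n. F n) + (\<Sum>i\<in>I. ind1 (\<Union>n. F n) (z i))" .
 qed
qed (use assms sets.sets_into_space[of _ N] in \<open>auto simp: positive_def\<close>)

lemma nn_integral_add_pts:
 assumes "f \<in> bm N" and z: "!!i. i \<in> I ==> z i \<in> space N"
 shows "(NN x. f x \<partial>add_pts N I z) = (NN x. f x \<partial>N) + (\<Sum>i\<in>I. f (z i))"
 using assms(1)
proof induct
 case (cong f g)
 have 1: "(NN d. f d \<partial>N) = (NN d. g d \<partial>N)"
   "(NN d. f d \<partial>add_pts N I z) = (NN d. g d \<partial>add_pts N I z)"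
   "(\<Sum>i\<in>I. f (z i)) = (\<Sum>i\<in>I. g (z i))"
  by (intro nn_cong sum.cong; use cong z in simp)+
 show ?case unfolding 1 by (rule cong(4))
next
 case (set A) then show ?case by (simp add: emeasure_add_pts)
next
 case (mult f c)
 then show ?case by (simp add: nn_integral_cmult sum_distrib_left distrib_left)
next
 case (add f g) then show ?case by (simp add: nn_integral_add sum.distrib ac_simps)
next
 case (seq F)
 have inc: "incseq (%i. F i x)" for x using seq by (auto simp: incseq_def le_fun_def)
 have 1: "(NN x. (SUP i. F i x) \<partial>M) = (SUP i. NN x. F i x \<partial>M)" if "sets M = sets N" for M
  using seq that by (intro nn_integral_monotone_convergence_SUP) (auto cong: m_cong_sets)
 have 2: "(\<Sum>i\<in>I. SUP n. F n (z i)) = (SUP n. \<Sum>i\<in>I. F n (z i))"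
  using inc by (intro ennreal_SUP_sum[symmetric])
 have "(SUP n. NN x. F n x \<partial>N) + (SUP n. \<Sum>i\<in>I. F n (z i)) =
  (SUP n. (NN x. F n x \<partial>N) + (\<Sum>i\<in>I. F n (z i)))"
  using inc by (intro ennreal_SUP_add[symmetric])
   (auto simp: incseq_def intro!: nn_integral_mono sum_mono)
 then show ?case using seq 1 2 by (simp add: image_comp)
qed

section \<open>Measures that are finite on each set of a countable partition\<close>

locale exhaustion =
 fixes E :: "'e measure" and D :: "nat => 'e set"
 assumes D_sets [measurable]: "!!k. D k \<in> sets E"
  and D_disj: "disjoint_family D" and D_UN: "(\<Union>k. D k) = space E"
begin

text \<open>Finiteness on one fixed partition makes all these measures sigma-finite along the same
  sets, so that integrals of jointly measurable functions, and integrals against powers of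
  \<open>N\<close>, depend measurably on \<open>N\<close>.\<close>

definition lf :: "'e measure measure" where
 "lf = restrict_space (MA E) {N. \<forall>k. emeasure N (D k) < \<infinity>}"

lemma space_lf: "space lf = {N. sets N = sets E \<and> (\<forall>k. emeasure N (D k) < \<infinity>)}"
 by (auto simp: lf_def space_restrict_space space_measure_algebra)

lemma sets_lfD: "N \<in> space lf ==> sets N = sets E"
 by (simp add: space_lf)

lemma space_lfD: "N \<in> space lf ==> space N = space E"
 by (rule space_eq) (rule sets_lfD)

lemma measurable_lfI:
 "f \<in> M ->M MA E ==> (!!x k. x \<in> space M ==> emeasure (f x) (D k) < \<infinity>) ==> f \<in> M ->M lf"
 unfolding lf_def by (rule measurable_restrict_space2) auto

lemma measurable_lfD: "f \<in> M ->M lf ==> f \<in> M ->M MA E"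
 unfolding lf_def by (simp add: measurable_restrict_space2_iff)

lemma lf_in_sets: "space lf \<in> sets (MA E)"
proof -
 have "space lf = (\<Inter>k. (%N. emeasure N (D k)) -` {..<\<infinity>} \<inter> space (MA E))"
  by (auto simp: space_lf space_measure_algebra)
 also have "\<dots> \<in> sets (MA E)"
  by (intro sets.countable_INT' measurable_sets[OF measurable_emeasure_measure_algebra[OF D_sets]]) auto
 finally show ?thesis .
qed

lemma sets_lf_iff: "C \<in> sets lf \<longleftrightarrow> C \<in> sets (MA E) \<and> C \<subseteq> space lf"
proof -
 let ?F = "{N. \<forall>k. emeasure N (D k) < \<infinity>}"
 have *: "?F \<inter> space (MA E) = space lf"
  by (auto simp: space_lf space_measure_algebra)
 show ?thesis
 proof
  assume C: "C \<in> sets lf"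
  then obtain C' where C': "C' \<in> sets (MA E)" "C = ?F \<inter> C'"
   by (auto simp: lf_def sets_restrict_space)
  then have "C = C' \<inter> space lf" using sets.sets_into_space[OF C'(1)] * by auto
  then show "C \<in> sets (MA E) \<and> C \<subseteq> space lf"
   using C' lf_in_sets by auto
 next
  assume C: "C \<in> sets (MA E) \<and> C \<subseteq> space lf"
  then have "C = ?F \<inter> C" using * by auto
  then show "C \<in> sets lf" using C unfolding lf_def sets_restrict_space by blast
 qed
qed

lemma measurable_emeasure_lf [measurable]:
 "A \<in> sets E ==> (%N. emeasure N A) \<in> bm lf"
 unfolding lf_def by (rule measurable_restrict_space1) simp

lemma lf_finite: "N \<in> space lf ==> emeasure N (D k) < \<infinity>"
 by (auto simp: space_lf)

lemma sigma_finite_lf: "N \<in> space lf ==> sigma_finite_measure N"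
 by (rule sigma_finite_measure.intro, rule exI[of _ "range D"])
  (auto simp: D_UN sets_lfD space_lfD less_top[symmetric] dest: lf_finite intro: lf_finite[simplified less_top[symmetric]])

lemma nn_integral_exhaustion:
 assumes "sets N = sets E" "h \<in> bm E"
 shows "(NN z. h z \<partial>N) = (\<Sum>k. NN z. ind1 (D k) z * h z \<partial>N)"
proof -
 have "(\<Sum>k. NN z. ind1 (D k) z * h z \<partial>N) = (NN z. (\<Sum>k. ind1 (D k) z * h z) \<partial>N)"
  using assms by (intro nn_integral_suminf[symmetric]) (auto cong: m_cong_sets)
 also have "\<dots> = (NN z. h z \<partial>N)"
 proof (rule nn_cong)
  fix z assume "z \<in> space N"
  then have "z \<in> (\<Union>k. D k)" using D_UN space_eq[OF assms(1)] by simp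
  then show "(\<Sum>k. ind1 (D k) z * h z) = h z"
   using D_disj by (simp add: ennreal_suminf_multc suminf_indicator)
 qed
 finally show ?thesis ..
qed

text \<open>The piece of \<open>\<kappa> x\<close> on \<open>D k\<close> is divided by
  \<open>c k x\<close> to become a subprobability, for which joint measurability is known; the
  pieces are then summed with the factors restored. Since \<open>c k x\<close> is one plus the mass
  of \<open>D k\<close>, it is never zero.\<close>

lemma measurable_nn_integral_lf:
 assumes \<kappa>[measurable]: "\<kappa> \<in> M ->M lf" and h[measurable]: "h \<in> bm (M \<Otimes>\<^sub>M E)"
 shows "(%x. NN z. h (x, z) \<partial>\<kappa> x) \<in> bm M"
\<comment> \<open>A subprobability space has to be non-empty, so an empty \<open>E\<close> is
  treated apart.\<close>
proof (cases "space E = {}")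
 case True
 then have "(NN z. h (x, z) \<partial>\<kappa> x) = 0" if "x \<in> space M" for x
  using measurable_space[OF \<kappa> that] by (intro nn_integral_empty) (simp add: space_lfD)
 then show ?thesis by (simp cong: measurable_cong)
next
 case False
 define c where "c k x = 1 + emeasure (\<kappa> x) (D k)" for k x
 define sub where "sub k x = density (\<kappa> x) (%z. ind1 (D k) z / c k x)" for k x
 have \<kappa>_sets: "sets (\<kappa> x) = sets E" "space (\<kappa> x) = space E" if "x \<in> space M" for x
  using measurable_space[OF \<kappa> that] by (simp_all add: sets_lfD space_lfD)
 have c: "c k x \<noteq> 0" "c k x < \<infinity>" if "x \<in> space M" for k x
  using lf_finite[OF measurable_space[OF \<kappa> that], of k] by (auto simp: c_def)
 have \<kappa>_em[measurable]: "(%x. emeasure (\<kappa> x) A) \<in> bm M" if "A \<in> sets E" for A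
  using m_comp[OF \<kappa> measurable_emeasure_lf[OF that]] .
 have c_meas[measurable]: "c k \<in> bm M" for k
  unfolding c_def by measurable
 have em: "emeasure (sub k x) A = emeasure (\<kappa> x) (A \<inter> D k) / c k x" if "x \<in> space M" "A \<in> sets E" for k x A
 proof -
  have "emeasure (sub k x) A = (NN z. ind1 (A \<inter> D k) z / c k x \<partial>\<kappa> x)"
   unfolding sub_def using that \<kappa>_sets
   by (subst emeasure_density) (auto cong: m_cong_sets intro!: nn_cong split: split_indicator)
  also have "\<dots> = emeasure (\<kappa> x) (A \<inter> D k) / c k x"
   using that \<kappa>_sets by (subst nn_integral_divide) (auto cong: m_cong_sets)
  finally show ?thesis .
 qed
 have sub[measurable]: "sub k \<in> M ->M subprob_algebra E" for k
 proof (rule measurable_subprob_algebra)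
  fix x assume x: "x \<in> space M"
  have "emeasure (sub k x) (space E) \<le> 1"
   using em[OF x, of "space E" k] c[OF x, of k] sets.sets_into_space[OF D_sets, of k]
   by (simp add: Int_absorb1 c_def divide_le_posI_ennreal add_pos_nonneg)
  then show "subprob_space (sub k x)"
   using False \<kappa>_sets[OF x] by (intro subprob_spaceI) (auto simp: sub_def)
  show "sets (sub k x) = sets E" using \<kappa>_sets[OF x] by (simp add: sub_def)
 next
  fix A assume A: "A \<in> sets E"
  then show "(%x. emeasure (sub k x) A) \<in> bm M"
   by (subst measurable_cong[OF em]) auto
 qed
 have "(NN z. h (x, z) \<partial>\<kappa> x) = (\<Sum>k. c k x * NN z. h (x, z) \<partial>sub k x)" if x: "x \<in> space M" for x
 proof -
  have hx: "(%z. h (x, z)) \<in> bm E" using x by measurable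
  have "c k x * (NN z. h (x, z) \<partial>sub k x) = (NN z. ind1 (D k) z * h (x, z) \<partial>\<kappa> x)" for k
  proof -
   have "(NN z. h (x, z) \<partial>sub k x) = (NN z. ind1 (D k) z / c k x * h (x, z) \<partial>\<kappa> x)"
    unfolding sub_def using hx \<kappa>_sets[OF x]
    by (intro nn_integral_density) (auto cong: m_cong_sets)
   also have "c k x * \<dots> = (NN z. c k x * (ind1 (D k) z / c k x * h (x, z)) \<partial>\<kappa> x)"
    using hx \<kappa>_sets[OF x] by (intro nn_integral_cmult[symmetric]) (auto cong: m_cong_sets)
   also have "\<dots> = (NN z. ind1 (D k) z * h (x, z) \<partial>\<kappa> x)"
    using c[OF x, of k]
    by (intro nn_cong) (auto simp: mult.assoc[symmetric] ennreal_times_divide ennreal_mult_divide_eq mult.commute[of "c k x"] split: split_indicator)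
   finally show ?thesis .
  qed
  then show ?thesis
   using nn_integral_exhaustion[OF \<kappa>_sets(1)[OF x] hx] by simp
 qed
 then have *: "(%x. NN z. h (x, z) \<partial>\<kappa> x) \<in> bm M \<longleftrightarrow>
   (%x. \<Sum>k. c k x * NN z. h (x, z) \<partial>sub k x) \<in> bm M"
  by (rule measurable_cong)
 have "(%x. NN z. h (x, z) \<partial>sub k x) \<in> bm M" for k
  using nn_integral_measurable_subprob_algebra2[of "%x z. h (x, z)" M E "sub k"] by simp
 note [measurable] = this
 show ?thesis
  unfolding * by measurable
qed

lemma measurable_nn_integral_lf' [measurable (raw)]:
 assumes "\<kappa> \<in> M ->M lf" "(%(x, z). h x z) \<in> bm (M \<Otimes>\<^sub>M E)"
 shows "(%x. NN z. h x z \<partial>\<kappa> x) \<in> bm M"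
 using measurable_nn_integral_lf[OF assms] by simp

text \<open>The set of added indices may depend on \<open>x\<close> (it will be the set of first
  occurrences in the data). Embedding it in a fixed finite \<open>J\<close> turns the sum over
  \<open>I x\<close> into a sum over \<open>J\<close> of measurable terms.\<close>

lemma measurable_add_pts:
 assumes \<kappa>: "\<kappa> \<in> M ->M lf" and J: "finite J" "!!x. x \<in> space M ==> I x \<subseteq> J"
  and I: "!!i. i \<in> J ==> Measurable.pred M (%x. i \<in> I x)" and z: "!!i. i \<in> J ==> z i \<in> M ->M E"
 shows "(%x. add_pts (\<kappa> x) (I x) (%i. z i x)) \<in> M ->M lf"
proof (rule measurable_lfI)
 have em: "emeasure (add_pts (\<kappa> x) (I x) (%i. z i x)) A =
   emeasure (\<kappa> x) A + (\<Sum>i\<in>J. if i \<in> I x then ind1 A (z i x) else 0)"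
  if "x \<in> space M" "A \<in> sets E" for x A
 proof -
  have "J \<inter> I x = I x" using J that by blast
  then show ?thesis
   using that J measurable_space[OF \<kappa> that(1)]
   by (subst emeasure_add_pts) (auto simp: sum.inter_restrict[symmetric] sets_lfD)
 qed
 show "(%x. add_pts (\<kappa> x) (I x) (%i. z i x)) \<in> M ->M MA E"
 proof (rule measurable_measure_algebraI)
  fix x assume "x \<in> space M"
  then show "sets (add_pts (\<kappa> x) (I x) (%i. z i x)) = sets E"
   using measurable_space[OF \<kappa>] by (simp add: sets_lfD)
 next
  fix A assume A[measurable]: "A \<in> sets E"
  have [measurable]: "(%x. emeasure (\<kappa> x) A) \<in> bm M"
   using m_comp[OF \<kappa> measurable_emeasure_lf[OF A]] .
  have "(%x. ind1 A (z i x) :: ennreal) \<in> bm M" if "i \<in> J" for i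
   using m_comp[OF z[OF that] bm_ind[OF A]] .
  then show "(%x. emeasure (add_pts (\<kappa> x) (I x) (%i. z i x)) A) \<in> bm M"
   using I A by (subst measurable_cong[OF em]) (auto intro!: borel_measurable_add borel_measurable_sum measurable_If)
 qed
 fix x k assume x: "x \<in> space M"
 have "(\<Sum>i\<in>J. if i \<in> I x then ind1 (D k) (z i x) else 0 :: ennreal) < \<infinity>"
  using J(1) by (simp split: split_indicator)
 then show "emeasure (add_pts (\<kappa> x) (I x) (%i. z i x)) (D k) < \<infinity>"
  using em[OF x D_sets] lf_finite[OF measurable_space[OF \<kappa> x]] by (simp add: less_top)
qed

text \<open>Integrating out the last coordinate is a measurable operation by
  \<open>measurable_nn_integral_lf'\<close>, and this gives the induction. The empty product is the
  one-point space whose element is the function \<open>undefined\<close>.\<close>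

lemma measurable_nn_integral_PiM_lf:
 assumes "\<kappa> \<in> M ->M lf" "h \<in> bm (M \<Otimes>\<^sub>M (\<Pi>\<^sub>M i\<in>{..<n::nat}. E))"
 shows "(%x. NN y. h (x, y) \<partial>(\<Pi>\<^sub>M i\<in>{..<n}. \<kappa> x)) \<in> bm M"
 using assms(2)
proof (induction n arbitrary: h)
 case 0
 have "(NN y. h (x, y) \<partial>(\<Pi>\<^sub>M i\<in>{..<0::nat}. \<kappa> x)) = h (x, %_. undefined)" for x
  by (simp add: PiM_empty nn_integral_count_space_finite)
 moreover have "(%_. undefined) \<in> space (\<Pi>\<^sub>M i\<in>{..<0::nat}. E)" by (simp add: space_PiM)
 then have "(%x. h (x, %_. undefined)) \<in> bm M"
  using 0 by measurable
 ultimately show ?case by simp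
next
 case (Suc n)
 note [measurable] = assms(1) Suc.prems
 have 1: "(NN y. h (x, y) \<partial>(\<Pi>\<^sub>M i\<in>{..<Suc n}. \<kappa> x)) =
   (NN y. (NN z. h (x, y(n := z)) \<partial>\<kappa> x) \<partial>(\<Pi>\<^sub>M i\<in>{..<n}. \<kappa> x))" if x: "x \<in> space M" for x
 proof -
  interpret product_sigma_finite "%_. \<kappa> x"
   using sigma_finite_lf[OF measurable_space[OF assms(1) x]] by (intro product_sigma_finite.intro)
  have "sets (\<Pi>\<^sub>M i\<in>insert n {..<n}. \<kappa> x) = sets (\<Pi>\<^sub>M i\<in>{..<Suc n}. E)"
   using measurable_space[OF assms(1) x] by (intro sets_PiM_cong) (auto simp: sets_lfD)
  then have "(%y. h (x, y)) \<in> bm (\<Pi>\<^sub>M i\<in>insert n {..<n}. \<kappa> x)"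
   using x by (simp cong: m_cong_sets)
  from product_nn_integral_insert[OF _ _ this] show ?thesis
   by (simp add: lessThan_Suc)
 qed
 let ?h = "%(x, y). NN z. h (x, y(n := z)) \<partial>\<kappa> x"
 have "?h \<in> bm (M \<Otimes>\<^sub>M (\<Pi>\<^sub>M i\<in>{..<n}. E))"
  unfolding case_prod_beta
 proof (rule measurable_nn_integral_lf')
  show "(%(x, z). h (fst x, (snd x)(n := z))) \<in> bm ((M \<Otimes>\<^sub>M (\<Pi>\<^sub>M i\<in>{..<n}. E)) \<Otimes>\<^sub>M E)"
   unfolding case_prod_beta
   by (rule m_comp[OF measurable_Pair Suc.prems], measurable,
     rule measurable_fun_upd[where J="{..<n}"]) (auto simp: lessThan_Suc)
 qed measurable
 from Suc.IH[OF this] show ?case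
  by (subst measurable_cong[OF 1]) auto
qed

end

text \<open>Only probabilities of finite integers are prescribed. They add up to one, and this
  excludes infinity and all other values of \<open>X\<close>.\<close>

lemma poisson_AE_nat:
 assumes "prob_space M" and X[measurable]: "X \<in> bm M" and l: "l \<ge> 0"
  and p: "!!k. measure M {w\<in>space M. X w = (of_nat k :: ennreal)} = l ^ k / fact k * exp (- l)"
 shows "AE w in M. \<exists>k. X w = of_nat k"
proof -
 interpret prob_space M by fact
 have "(%k. (l ^ k /\<^sub>R fact k) * exp (- l)) sums (exp l * exp (- l))"
  by (intro sums_mult2 exp_converges)
 then have 1: "(%k. measure M {w\<in>space M. X w = of_nat k}) sums 1"
  by (simp add: p exp_minus field_simps)
 have "(%k. measure M {w\<in>space M. X w = of_nat k}) sums measure M (\<Union>k. {w\<in>space M. X w = of_nat k})"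
  by (intro finite_measure_UNION) (auto simp: disjoint_family_on_def)
 with 1 have "measure M (\<Union>k. {w\<in>space M. X w = of_nat k}) = 1"
  using sums_unique2 by blast
 then have "AE w in M. w \<in> (\<Union>k. {w\<in>space M. X w = of_nat k})"
  by (subst (asm) prob_eq_1) auto
 then show ?thesis by eventually_elim auto
qed

lemma poisson_nn_integral:
 assumes "prob_space M" and X[measurable]: "X \<in> bm M" and l: "l \<ge> 0"
  and p: "!!k. measure M {w\<in>space M. X w = (of_nat k :: ennreal)} = l ^ k / fact k * exp (- l)"
 shows "(NN w. f (X w) \<partial>M) = (\<Sum>k. f (of_nat k) * ennreal (l ^ k / fact k * exp (- l)))"
proof -
 interpret prob_space M by fact
 let ?S = "%k. {w\<in>space M. X w = of_nat k}"
 have "(NN w. f (X w) \<partial>M) = (NN w. (\<Sum>k. f (of_nat k) * ind1 (?S k) w) \<partial>M)"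
 proof (rule nn_integral_cong_AE)
  show "AE w in M. f (X w) = (\<Sum>k. f (of_nat k) * ind1 (?S k) w)"
   using poisson_AE_nat[OF assms] AE_space
  proof eventually_elim
   fix w assume "\<exists>k. X w = of_nat k" "w \<in> space M"
   then obtain k where k: "X w = of_nat k" by auto
   have "(\<Sum>j. f (of_nat j) * ind1 (?S j) w) = (\<Sum>j\<in>{k}. f (of_nat j) * ind1 (?S j) w)"
    using k \<open>w \<in> space M\<close> by (intro suminf_finite) (auto split: split_indicator)
   then show "f (X w) = (\<Sum>k. f (of_nat k) * ind1 (?S k) w)"
    using k \<open>w \<in> space M\<close> by simp
  qed
 qed
 also have "\<dots> = (\<Sum>k. NN w. f (of_nat k) * ind1 (?S k) w \<partial>M)"
  by (rule nn_integral_suminf) measurable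
 also have "\<dots> = (\<Sum>k. f (of_nat k) * ennreal (l ^ k / fact k * exp (- l)))"
  by (subst nn_integral_cmult_indicator) (auto simp: emeasure_eq_measure p)
 finally show ?thesis .
qed

text \<open>Comes from the recursion \<open>(k + 1) p(k + 1) = l p(k)\<close> of the Poisson
  weights. It is the Mecke equation seen through the mass of a single set.\<close>

lemma poisson_shift:
 assumes "prob_space M" and X[measurable]: "X \<in> bm M" and l: "l \<ge> 0"
  and p: "!!k. measure M {w\<in>space M. X w = (of_nat k :: ennreal)} = l ^ k / fact k * exp (- l)"
 shows "(NN w. X w * f (X w) \<partial>M) = ennreal l * (NN w. f (X w + 1) \<partial>M)"
proof -
 let ?p = "%k::nat. ennreal (l ^ k / fact k * exp (- l))"
 have *: "of_nat (Suc k) * ?p (Suc k) = ennreal l * ?p k" for k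
 proof -
  have "of_nat (Suc k) * ?p (Suc k) = ennreal (real (Suc k) * (l ^ Suc k / fact (Suc k) * exp (- l)))"
   using l by (subst ennreal_mult) (auto simp: ennreal_of_nat_eq_real_of_nat)
  also have "real (Suc k) * (l ^ Suc k / fact (Suc k) * exp (- l)) = l * (l ^ k / fact k * exp (- l))"
   by (simp add: field_simps del: of_nat_Suc)
  also have "ennreal \<dots> = ennreal l * ?p k" using l by (intro ennreal_mult) auto
  finally show ?thesis .
 qed
 have "(NN w. X w * f (X w) \<partial>M) = (\<Sum>k. of_nat k * f (of_nat k) * ?p k)"
  using poisson_nn_integral[OF assms, of "%x. x * f x"] by simp
 also have "\<dots> = (\<Sum>k. of_nat (Suc k) * f (of_nat (Suc k)) * ?p (Suc k))"
  by (subst suminf_offset[of _ 1]) auto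
 also have "\<dots> = (\<Sum>k. ennreal l * (f (of_nat k + 1) * ?p k))"
 proof (intro suminf_cong)
  fix k
  have "of_nat (Suc k) * f (of_nat (Suc k)) * ?p (Suc k) = (of_nat (Suc k) * ?p (Suc k)) * f (of_nat (Suc k))"
   by (simp only: ac_simps)
  also have "\<dots> = ennreal l * (f (of_nat k + 1) * ?p k)"
   unfolding * by (simp add: ac_simps)
  finally show "of_nat (Suc k) * f (of_nat (Suc k)) * ?p (Suc k) = \<dots>" .
 qed
 also have "\<dots> = ennreal l * (\<Sum>k. f (of_nat k + 1) * ?p k)"
  by (rule ennreal_suminf_cmult)
 also have "(\<Sum>k. f (of_nat k + 1) * ?p k) = (NN w. f (X w + 1) \<partial>M)"
  using poisson_nn_integral[OF assms, of "%x. f (x + 1)"] by simp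
 finally show ?thesis .
qed

section \<open>The Mecke equation\<close>

abbreviation add1 :: "'e measure => 'e => 'e measure" where
 "add1 N z \<equiv> add_pts N {()} (%_. z)"

context exhaustion
begin

text \<open>The Mecke equation characterises Poisson random measures; it makes the multivariate Palm
 formula, the effect of exponential tilting and the simplicity of the atoms one-line computations.\<close>

definition mecke :: "'e measure => 'e measure measure => bool" where
 "mecke \<nu> P \<longleftrightarrow> (\<forall>g\<in>bm (lf \<Otimes>\<^sub>M E).
  (NN N. NN z. g (N, z) \<partial>N \<partial>P) = (NN z. NN N. g (add1 N z, z) \<partial>P \<partial>\<nu>))"

lemma measurable_add1 [measurable (raw)]:
 "\<kappa> \<in> M ->M lf ==> z \<in> M ->M E ==> (%x. add1 (\<kappa> x) (z x)) \<in> M ->M lf"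
 using measurable_add_pts[of \<kappa> M "{()}" "%_. {()}" "%_. z"] by simp

lemma measurable_add1_left: "z \<in> space E ==> (%N. add1 N z) \<in> lf ->M lf"
 by (rule measurable_add1[where \<kappa>="%N. N" and z="%_. z", OF m_id measurable_const])

text \<open>Both sides of the Mecke equation are integrals against measures on
  \<open>lf \<times> E\<close>: \<open>m1\<close> is the Campbell measure of \<open>P\<close>, and
  \<open>m2\<close> is the law of a configuration with an independent point of \<open>\<nu>\<close>
  added, together with that point. They agree on rectangles over subsets of one level, where they
  are finite, and these determine them.\<close>

lemma meckeI:
 assumes P: "prob_space P" and P_sets[measurable_cong]: "sets P = sets lf"
  and \<nu>[measurable_cong]: "sets \<nu> = sets E" and fin: "!!k. emeasure \<nu> (D k) < \<infinity>"
  and rect: "!!B k C. B \<in> sets E ==> B \<subseteq> D k ==> C \<in> sets lf ==>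
   (NN N. emeasure N B * ind1 C N \<partial>P) =
   (NN z. ind1 B z * emeasure P {N \<in> space lf. add1 N z \<in> C} \<partial>\<nu>)"
 shows "mecke \<nu> P"
proof -
 interpret P: prob_space P by fact
 let ?T = "lf \<Otimes>\<^sub>M E"
 have spP: "space P = space lf" using P_sets by (rule space_eq)
 define L where "L N = distr N ?T (%z. (N, z))" for N
 define m1 where "m1 = data_marginal P ?T L"
 define m2 where "m2 = distr (\<nu> \<Otimes>\<^sub>M P) ?T (%(z, N). (add1 N z, z))"
 have pair_meas: "(%z. (N, z)) \<in> N ->M ?T" if "N \<in> space lf" for N
  using that by (simp cong: m_cong_sets add: sets_lfD)
 have emL: "emeasure (L N) A = (NN z. ind1 A (N, z) \<partial>N)" if "N \<in> space lf" "A \<in> sets ?T" for N A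
 proof -
  have "emeasure (L N) A = emeasure N ((%z. (N, z)) -` A \<inter> space N)"
   unfolding L_def using that pair_meas by (simp add: emeasure_distr)
  also have "\<dots> = (NN z. ind1 ((%z. (N, z)) -` A \<inter> space N) z \<partial>N)"
   using measurable_sets[OF pair_meas[OF that(1)] that(2)] by simp
  also have "\<dots> = (NN z. ind1 A (N, z) \<partial>N)"
   by (intro nn_cong) (auto split: split_indicator)
  finally show ?thesis .
 qed
 have L: "L \<in> P ->M MA ?T"
 proof (rule measurable_measure_algebraI)
  fix A assume A[measurable]: "A \<in> sets ?T"
  have "(%N. NN z. ind1 A (N, z) \<partial>N :: ennreal) \<in> bm lf"
   by measurable
  then have "(%N. emeasure (L N) A) \<in> bm lf"
   by (subst measurable_cong[OF emL]) (use A in auto)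
  then show "(%N. emeasure (L N) A) \<in> bm P" by (simp cong: m_cong_sets add: P_sets)
 qed (simp add: L_def)
 have m1_int: "(NN x. g x \<partial>m1) = (NN N. NN z. g (N, z) \<partial>N \<partial>P)" if "g \<in> bm ?T" for g
  unfolding m1_def
  by (subst nn_integral_data_marginal[OF L _ that])
   (auto intro!: nn_cong simp: L_def spP nn_integral_distr pair_meas that)
 have m2_meas[measurable]: "(%(z, N). (add1 N z, z)) \<in> \<nu> \<Otimes>\<^sub>M P ->M ?T" 
  unfolding case_prod_beta
  by (intro measurable_Pair measurable_add1) (simp_all cong: m_cong_sets add: P_sets \<nu>)
 have m2_int: "(NN x. g x \<partial>m2) = (NN z. NN N. g (add1 N z, z) \<partial>P \<partial>\<nu>)"
  if [measurable]: "g \<in> bm ?T" for g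
 proof -
  have "(NN x. g x \<partial>m2) = (NN x. g (case x of (z, N) => (add1 N z, z)) \<partial>(\<nu> \<Otimes>\<^sub>M P))"
   unfolding m2_def by (rule nn_integral_distr) (use m2_meas that in auto)
  also have "\<dots> = (NN z. NN N. g (add1 N z, z) \<partial>P \<partial>\<nu>)"
   using P.nn_integral_fst[of "%x. g (case x of (z, N) => (add1 N z, z))" \<nu>]
    m_comp[OF m2_meas that] by simp
  finally show ?thesis .
 qed
 have m_sets: "sets m1 = sets ?T" "sets m2 = sets ?T" by (auto simp: m1_def m2_def)
 have eq: "emeasure m1 (C \<times> B) = emeasure m2 (C \<times> B)"
  if C[measurable]: "C \<in> sets lf" and B[measurable]: "B \<in> sets E" and k: "B \<subseteq> D k" for C B k
 proof -
  have [measurable]: "C \<times> B \<in> sets ?T" by auto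
  have "emeasure m1 (C \<times> B) = (NN x. ind1 (C \<times> B) x \<partial>m1)"
   using m_sets by simp
  also have "\<dots> = (NN N. NN z. ind1 (C \<times> B) (N, z) \<partial>N \<partial>P)"
   by (rule m1_int) simp
  also have "\<dots> = (NN N. NN z. ind1 C N * ind1 B z \<partial>N \<partial>P)"
   by (intro nn_cong) (auto split: split_indicator)
  also have "\<dots> = (NN N. emeasure N B * ind1 C N \<partial>P)"
   using B by (intro nn_cong) (subst nn_integral_cmult_indicator, auto simp: spP sets_lfD mult.commute)
  also have "\<dots> = (NN z. ind1 B z * emeasure P {N \<in> space lf. add1 N z \<in> C} \<partial>\<nu>)"
   by (rule rect) fact+
  also have "\<dots> = (NN z. NN N. ind1 (C \<times> B) (add1 N z, z) \<partial>P \<partial>\<nu>)"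
  proof (rule nn_cong)
   fix z assume "z \<in> space \<nu>"
   then have z: "z \<in> space E" using space_eq[OF \<nu>] by simp
   define K where "K = {N \<in> space lf. add1 N z \<in> C}"
   have "K = (%N. add1 N z) -` C \<inter> space lf" by (auto simp: K_def)
   also have "\<dots> \<in> sets lf"
    by (rule measurable_sets[OF measurable_add1_left[OF z] C])
   finally have K: "K \<in> sets P" unfolding P_sets .
   then have "ind1 B z * emeasure P K = (NN N. ind1 B z * ind1 K N \<partial>P)"
    by (subst nn_integral_cmult) auto
   also have "\<dots> = (NN N. ind1 (C \<times> B) (add1 N z, z) \<partial>P)"
    by (intro nn_cong) (auto simp: spP K_def split: split_indicator)
   finally show "ind1 B z * emeasure P {N \<in> space lf. add1 N z \<in> C} = \<dots>"
    unfolding K_def .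
  qed
  also have "\<dots> = emeasure m2 (C \<times> B)"
   using m2_int[of "ind1 (C \<times> B)"] m_sets by simp
  finally show ?thesis .
 qed
 have "m1 = m2"
 proof (rule measure_eqI_generator_eq[OF Int_stable_pair_measure_generator[of lf E]])
  show "{a \<times> b |a b. a \<in> sets lf \<and> b \<in> sets E} \<subseteq> Pow (space lf \<times> space E)"
   by (rule pair_measure_closed)
  show "sets m1 = sigma_sets (space lf \<times> space E) {a \<times> b |a b. a \<in> sets lf \<and> b \<in> sets E}"
   "sets m2 = sigma_sets (space lf \<times> space E) {a \<times> b |a b. a \<in> sets lf \<and> b \<in> sets E}"
   using m_sets by (simp_all add: sets_pair_measure)
  show "range (%k. space lf \<times> D k) \<subseteq> {a \<times> b |a b. a \<in> sets lf \<and> b \<in> sets E}"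
  proof safe
   fix k show "\<exists>a b. space lf \<times> D k = a \<times> b \<and> a \<in> sets lf \<and> b \<in> sets E"
    by (rule exI[of _ "space lf"], rule exI[of _ "D k"]) auto
  qed
  show "(\<Union>k. space lf \<times> D k) = space lf \<times> space E" using D_UN by auto
  \<comment> \<open>Finiteness of the Campbell measure is read off from \<open>m2\<close>: the mass
    over \<open>D k\<close> is at most that of \<open>D k\<close> under
    \<open>\<nu>\<close>.\<close>
  show "emeasure m1 (space lf \<times> D k) \<noteq> \<infinity>" for k
  proof -
   have "emeasure m1 (space lf \<times> D k) = (NN z. NN N. ind1 (space lf \<times> D k) (add1 N z, z) \<partial>P \<partial>\<nu>)"
    using m2_int[of "ind1 (space lf \<times> D k)"] m_sets eq[of "space lf" "D k" k] by simp
   also have "\<dots> \<le> (NN z. ind1 (D k) z \<partial>\<nu>)"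
    by (intro nn_integral_mono P.nn_integral_le_const) (auto split: split_indicator)
   also have "\<dots> < \<infinity>" using fin[of k] \<nu> by simp
   finally show ?thesis by simp
  qed
  fix X assume "X \<in> {a \<times> b |a b. a \<in> sets lf \<and> b \<in> sets E}"
  then obtain C B where X: "X = C \<times> B" and C: "C \<in> sets lf" and B: "B \<in> sets E" by auto
  have X': "X = (\<Union>k. C \<times> (B \<inter> D k))"
   using D_UN sets.sets_into_space[OF B] unfolding X by auto
  have "emeasure m X = (\<Sum>k. emeasure m (C \<times> (B \<inter> D k)))" if "sets m = sets ?T" for m
   unfolding X' using C B D_disj that
   by (intro suminf_emeasure[symmetric]) (auto simp: disjoint_family_on_def)
  moreover have "emeasure m1 (C \<times> (B \<inter> D k)) = emeasure m2 (C \<times> (B \<inter> D k))" for k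
   using eq[OF C, of "B \<inter> D k" k] B by simp
  ultimately show "emeasure m1 X = emeasure m2 X"
   using m_sets by simp
 qed
 show ?thesis
  unfolding mecke_def
 proof
  fix g :: "'e measure \<times> 'e => ennreal" assume g: "g \<in> bm ?T"
  show "(NN N. NN z. g (N, z) \<partial>N \<partial>P) = (NN z. NN N. g (add1 N z, z) \<partial>P \<partial>\<nu>)"
   unfolding m1_int[OF g, symmetric] m2_int[OF g, symmetric] \<open>m1 = m2\<close> ..
 qed
qed

end

context exhaustion
begin

lemma null_measure_lf: "null_measure E \<in> space lf"
 by (auto simp: space_lf)

text \<open>For an event on a disjoint family that splits \<open>B\<close>, the mass of
  \<open>B\<close> is the sum of the masses of the members inside \<open>B\<close>. Independence
  factors the integral of each summand, and the one-dimensional shift raises by one the mass of the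
  member that receives the added point. \<open>N0\<close> replaces exceptional configurations by the
  null measure, so that its law lives on \<open>lf\<close>.\<close>

theorem poisson_mecke:
 assumes M: "prob_space M" and prm: "poisson_random_measure M E \<nu> N"
  and \<nu>[measurable_cong]: "sets \<nu> = sets E" and fin: "!!k. emeasure \<nu> (D k) < \<infinity>"
 defines "N0 \<equiv> %w. if N w \<in> space lf then N w else null_measure E"
 shows "N0 \<in> M ->M lf" "AE w in M. N0 w = N w" "mecke \<nu> (distr M lf N0)"
proof -
 interpret prob_space M by fact
 have N[measurable]: "N \<in> M ->M MA E"
  and pois: "!!A k. A \<in> sets E ==> emeasure \<nu> A < \<infinity> ==>
   measure M {w \<in> space M. emeasure (N w) A = of_nat k} = measure \<nu> A ^ k / fact k * exp (- measure \<nu> A)"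
  and ind: "!!(A :: nat => 'e set) k. A ` {..<k} \<subseteq> sets E ==> disjoint_family_on A {..<k} ==>
    indep_vars (%_. borel) (%i w. emeasure (N w) (A i)) {..<k}"
  using prm by (auto simp: poisson_random_measure_def)
 have Nem[measurable]: "(%w. emeasure (N w) A) \<in> bm M" if "A \<in> sets E" for A
  using m_comp[OF N measurable_emeasure_measure_algebra[OF that]] .
 have "Measurable.pred M (%w. N w \<in> space lf)"
  using measurable_sets[OF N lf_in_sets] by (simp add: pred_def vimage_def Int_def conj_commute)
 then have "N0 \<in> M ->M MA E"
  unfolding N0_def by (intro measurable_If N) (simp_all add: space_measure_algebra pred_def)
 then show N0[measurable]: "N0 \<in> M ->M lf"
  by (rule measurable_lfI) (use null_measure_lf in \<open>auto simp: N0_def dest: lf_finite\<close>)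
 have "AE w in M. emeasure (N w) (D k) < \<infinity>" for k
  using poisson_AE_nat[OF M Nem[OF D_sets] _ pois[OF D_sets fin], of k, simplified]
  by eventually_elim (auto simp: ennreal_of_nat_eq_real_of_nat)
 then have "AE w in M. \<forall>k. emeasure (N w) (D k) < \<infinity>"
  by (simp add: AE_all_countable)
 then show ae: "AE w in M. N0 w = N w"
  using AE_space
 proof eventually_elim
  fix w assume "\<forall>k. emeasure (N w) (D k) < \<infinity>" "w \<in> space M"
  then have "N w \<in> space lf"
   using measurable_space[OF N] by (auto simp: space_lf space_measure_algebra)
  then show "N0 w = N w" by (simp add: N0_def)
 qed
 have N0s: "sets (N0 w) = sets E" if "w \<in> space M" for w
  using measurable_space[OF N0 that] by (rule sets_lfD)
 show "mecke \<nu> (distr M lf N0)"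
 proof (rule meckeI)
  show "prob_space (distr M lf N0)" by (rule prob_space_distr) fact
  fix B k C assume B[measurable]: "B \<in> sets E" and Bk: "B \<subseteq> D k" and C: "C \<in> sets lf"
  have \<nu>B: "emeasure \<nu> B < \<infinity>"
   using emeasure_mono[OF Bk, of \<nu>] fin[of k] by (simp add: \<nu> order_le_less_trans)
  have N0B[measurable]: "(%w. emeasure (N0 w) B) \<in> bm M"
   by measurable
  \<comment> \<open>For fixed \<open>B\<close> the two sides of the rectangle identity are regarded
    as finite measures in the event \<open>C\<close>.\<close>
  define m1 where "m1 = distr (density M (%w. emeasure (N0 w) B)) (MA E) N0"
  define m2 where "m2 = distr (density \<nu> (ind1 B) \<Otimes>\<^sub>M M) (MA E) (%(z, w). add1 (N0 w) z)"
  have add_meas': "(%(z, w). add1 (N0 w) z) \<in> density \<nu> (ind1 B) \<Otimes>\<^sub>M M ->M lf"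
   unfolding case_prod_beta by measurable
  note add_meas = measurable_lfD[OF add_meas']
  have N0': "N0 \<in> density M (%w. emeasure (N0 w) B) ->M MA E"
   using measurable_lfD[OF N0] by simp
  have em1: "emeasure m1 A = (NN w. emeasure (N w) B * ind1 A (N w) \<partial>M)"
   if A: "A \<in> sets (MA E)" for A
  proof -
   have "emeasure m1 A = emeasure (density M (%w. emeasure (N0 w) B)) (N0 -` A \<inter> space M)"
    unfolding m1_def using A N0' by (subst emeasure_distr) auto
   also have "\<dots> = (NN w. emeasure (N0 w) B * ind1 (N0 -` A \<inter> space M) w \<partial>M)"
    using measurable_sets[OF N0' A] by (intro emeasure_density) auto
   also have "\<dots> = (NN w. emeasure (N w) B * ind1 A (N w) \<partial>M)"
    by (rule nn_integral_cong_AE) (use ae AE_space in \<open>eventually_elim, auto split: split_indicator\<close>)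
   finally show ?thesis .
  qed
  have em2: "emeasure m2 A = (NN z. ind1 B z * (NN w. ind1 A (add1 (N0 w) z) \<partial>M) \<partial>\<nu>)"
   if A: "A \<in> sets (MA E)" for A
  proof -
   have [measurable]: "(%x. ind1 A (case x of (z, w) => add1 (N0 w) z) :: ennreal) \<in> bm (density \<nu> (ind1 B) \<Otimes>\<^sub>M M)"
    using m_comp[OF add_meas bm_ind[OF A]] .
   then have [measurable]: "(%x. ind1 A (case x of (z, w) => add1 (N0 w) z) :: ennreal) \<in> bm (\<nu> \<Otimes>\<^sub>M M)"
    by (simp cong: m_cong_sets)
   have "emeasure m2 A = (NN x. ind1 A (case x of (z, w) => add1 (N0 w) z) \<partial>(density \<nu> (ind1 B) \<Otimes>\<^sub>M M))"
   proof -
    have "emeasure m2 A = (NN x. ind1 A x \<partial>m2)" using A by (simp add: m2_def)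
    also have "\<dots> = (NN x. ind1 A (case x of (z, w) => add1 (N0 w) z) \<partial>(density \<nu> (ind1 B) \<Otimes>\<^sub>M M))"
     unfolding m2_def by (rule nn_integral_distr[OF add_meas]) (use A in simp)
    finally show ?thesis .
   qed
   also have "\<dots> = (NN z. NN w. ind1 A (add1 (N0 w) z) \<partial>M \<partial>density \<nu> (ind1 B))"
    by (subst nn_integral_fst[symmetric]) auto
   also have "\<dots> = (NN z. ind1 B z * (NN w. ind1 A (add1 (N0 w) z) \<partial>M) \<partial>\<nu>)"
    using borel_measurable_nn_integral_fst[of "%x. ind1 A (case x of (z, w) => add1 (N0 w) z)" \<nu>]
    by (intro nn_integral_density) auto
   finally show ?thesis .
  qed
  have "m1 = m2"
  proof (rule measure_algebra_eqI[OF _ _ _ _ B])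
   have "emeasure m1 (space m1) = (NN w. emeasure (N w) B \<partial>M)"
    using em1[of "space (MA E)"] measurable_space[OF N]
    by (simp add: m1_def cong: nn_cong)
   also have "\<dots> = ennreal (measure \<nu> B) * (NN w. 1 \<partial>M)"
    using poisson_shift[OF M Nem[OF B] _ pois[OF B \<nu>B], of "%_. 1"] by simp
   finally show "finite_measure m1" by (intro finite_measureI) (simp add: ennreal_mult_eq_top_iff)
   have "emeasure m2 (space m2) = (NN z. ind1 B z * (NN w. ind1 (space (MA E)) (add1 (N0 w) z) \<partial>M) \<partial>\<nu>)"
    using em2[of "space (MA E)"] by (simp add: m2_def)
   also have "\<dots> \<le> (NN z. ind1 B z * 1 \<partial>\<nu>)"
    by (intro nn_integral_mono mult_left_mono nn_integral_le_const) (auto split: split_indicator)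
   also have "\<dots> < \<infinity>" using \<nu>B by simp
   finally show "finite_measure m2" by (intro finite_measureI) simp
   show "sets m1 = sets (MA E)" "sets m2 = sets (MA E)"
    by (simp_all add: m1_def m2_def)
   fix \<D> :: "'e set set" and I :: "'e set => ennreal set"
   assume \<D>: "finite \<D>" "\<D> \<subseteq> sets E" "disjoint \<D>" "\<Union>{A\<in>\<D>. A \<subseteq> B} = B"
    "!!A. A \<in> \<D> ==> A \<subseteq> B \<or> A \<inter> B = {}" and I[measurable]: "!!A. I A \<in> sets (borel :: ennreal measure)"
   let ?ev = "{\<mu> \<in> space (MA E). \<forall>A\<in>\<D>. emeasure \<mu> A \<in> I A}"
   obtain f where f: "bij_betw f {..<card \<D>} \<D>"
    using ex_bij_betw_nat_finite[OF \<D>(1)] by (auto simp: atLeast0LessThan)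
   define n where "n = card \<D>"
   have fD: "f ` {..<n} = \<D>" and finj: "inj_on f {..<n}" using f by (auto simp: bij_betw_def n_def)
   have fs[measurable]: "f i \<in> sets E" if "i < n" for i using fD \<D>(2) that by auto
   have disj: "f i \<inter> f j = {}" if "i < n" "j < n" "i \<noteq> j" for i j
    using \<D>(3) finj fD that by (metis disjointD imageI inj_on_def lessThan_iff)
   define X where "X i w = emeasure (N w) (f i)" for i w
   have X[measurable]: "X i \<in> bm M" if "i < n" for i
    unfolding X_def using fs[OF that] by measurable
   have indX: "indep_vars (%_. borel) X {..<n}"
    unfolding X_def by (rule ind) (use fD \<D>(2) disj in \<open>auto simp: disjoint_family_on_def\<close>)
   define S where "S = {i\<in>{..<n}. f i \<subseteq> B}"
   have S: "finite S" "!!i. i \<in> S ==> i < n" by (auto simp: S_def)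
   have BS: "\<Union>(f ` S) = B" using \<D>(4) unfolding fD[symmetric] S_def by auto
   have Bsum: "emeasure \<mu> B = (\<Sum>i\<in>S. emeasure \<mu> (f i))" if "sets \<mu> = sets E" for \<mu>
    unfolding BS[symmetric] using S disj that fs
    by (intro sum_emeasure[symmetric]) (auto simp: disjoint_family_on_def)
   have indB: "ind1 B z = (\<Sum>i\<in>S. ind1 (f i) z :: ennreal)" for z
    unfolding BS[symmetric] using S disj
    by (intro indicator_UN_disjoint) (auto simp: disjoint_family_on_def)
   have indev: "ind1 ?ev \<mu> = (\<Prod>j<n. ind1 (I (f j)) (emeasure \<mu> (f j)) :: ennreal)" if "sets \<mu> = sets E" for \<mu>
    using that unfolding fD[symmetric]
    by (auto simp: space_measure_algebra indicator_def prod_zero_iff split: if_splits)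
   have ev: "?ev \<in> sets (MA E)"
   proof -
    have "?ev = space (MA E) \<inter> (\<Inter>A\<in>\<D>. (%\<mu>. emeasure \<mu> A) -` I A \<inter> space (MA E))"
     by auto
    also have "\<dots> \<in> sets (MA E)"
    proof (cases "\<D> = {}")
     case False
     with \<D> I show ?thesis
      by (intro sets.Int sets.finite_INT sets.top measurable_sets[OF measurable_emeasure_measure_algebra]) auto
    qed auto
    finally show ?thesis .
   qed
   \<comment> \<open>The factor \<open>X i\<close> is absorbed into the i-th of the independent
     factors, which is then shifted by \<open>poisson_shift\<close>; the other factors stay as they
     are.\<close>
   have key: "(NN w. X i w * (\<Prod>j<n. ind1 (I (f j)) (X j w)) \<partial>M) =
     emeasure \<nu> (f i) * (NN w. (\<Prod>j<n. ind1 (I (f j)) (X j w + (if j = i then 1 else 0))) \<partial>M)"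
    if i: "i \<in> S" for i
   proof -
    have i': "i \<in> {..<n}" using S(2)[OF i] by simp
    have \<nu>i: "emeasure \<nu> (f i) < \<infinity>"
     using i B emeasure_mono[of "f i" B \<nu>] \<nu>B \<nu> unfolding S_def by (auto simp: order_le_less_trans)
    have "(NN w. X i w * (\<Prod>j<n. ind1 (I (f j)) (X j w)) \<partial>M) =
      (NN w. (\<Prod>j<n. (if j = i then X j w else 1) * ind1 (I (f j)) (X j w)) \<partial>M)"
     using i' by (intro nn_cong) (simp add: prod.distrib prod.delta)
    also have "\<dots> = (\<Prod>j<n. NN w. (if j = i then X j w else 1) * ind1 (I (f j)) (X j w) \<partial>M)"
     by (intro indep_vars_nn_integral indep_vars_compose2[OF indX, where Y="%j x. (if j = i then x else 1) * ind1 (I (f j)) x"]) auto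
    also have "\<dots> = (NN w. X i w * ind1 (I (f i)) (X i w) \<partial>M) *
      (\<Prod>j\<in>{..<n} - {i}. NN w. ind1 (I (f j)) (X j w) \<partial>M)"
     by (subst prod.remove[OF _ i']) (auto intro!: arg_cong2[where f="(*)"] prod.cong)
    also have "(NN w. X i w * ind1 (I (f i)) (X i w) \<partial>M) =
      emeasure \<nu> (f i) * (NN w. ind1 (I (f i)) (X i w + 1) \<partial>M)"
     using poisson_shift[OF M X, of i "measure \<nu> (f i)" "ind1 (I (f i))"] i' pois[OF fs \<nu>i] \<nu>i
     by (simp add: X_def emeasure_eq_ennreal_measure)
    also have "\<dots> * (\<Prod>j\<in>{..<n} - {i}. NN w. ind1 (I (f j)) (X j w) \<partial>M) =
      emeasure \<nu> (f i) * (\<Prod>j<n. NN w. ind1 (I (f j)) (X j w + (if j = i then 1 else 0)) \<partial>M)"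
     by (subst prod.remove[OF _ i']) (auto simp: mult.assoc intro!: arg_cong2[where f="(*)"] prod.cong)
    also have "(\<Prod>j<n. NN w. ind1 (I (f j)) (X j w + (if j = i then 1 else 0)) \<partial>M) =
     (NN w. (\<Prod>j<n. ind1 (I (f j)) (X j w + (if j = i then 1 else 0))) \<partial>M)"
     by (intro indep_vars_nn_integral[symmetric] indep_vars_compose2[OF indX, where Y="%j x. ind1 (I (f j)) (x + (if j = i then 1 else 0))"]) auto
    finally show ?thesis .
   qed
   have "emeasure m1 ?ev = (NN w. (\<Sum>i\<in>S. X i w * (\<Prod>j<n. ind1 (I (f j)) (X j w))) \<partial>M)"
    unfolding em1[OF ev]
   proof (rule nn_cong)
    fix w assume "w \<in> space M"
    then have "sets (N w) = sets E" using measurable_space[OF N] by (simp add: space_measure_algebra)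
    then show "emeasure (N w) B * ind1 ?ev (N w) = (\<Sum>i\<in>S. X i w * (\<Prod>j<n. ind1 (I (f j)) (X j w)))"
     by (simp add: Bsum indev X_def sum_distrib_right)
   qed
   also have "\<dots> = (\<Sum>i\<in>S. NN w. X i w * (\<Prod>j<n. ind1 (I (f j)) (X j w)) \<partial>M)"
    using S by (intro nn_integral_sum borel_measurable_times borel_measurable_prod) auto
   also have "\<dots> = (\<Sum>i\<in>S. NN z. ind1 (f i) z * (NN w. (\<Prod>j<n. ind1 (I (f j)) (X j w + (if j = i then 1 else 0))) \<partial>M) \<partial>\<nu>)"
    using S(2) fs by (intro sum.cong refl) (simp add: key nn_integral_multc \<nu>)
   also have "\<dots> = (NN z. (\<Sum>i\<in>S. ind1 (f i) z * (NN w. (\<Prod>j<n. ind1 (I (f j)) (X j w + (if j = i then 1 else 0))) \<partial>M)) \<partial>\<nu>)"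
    using S(2) fs by (intro nn_integral_sum[symmetric]) (auto simp: \<nu>)
   also have "\<dots> = emeasure m2 ?ev"
    unfolding em2[OF ev]
   proof (rule nn_cong)
    fix z assume "z \<in> space \<nu>"
    have "(\<Sum>i\<in>S. ind1 (f i) z * (NN w. (\<Prod>j<n. ind1 (I (f j)) (X j w + (if j = i then 1 else 0))) \<partial>M)) =
      (\<Sum>i\<in>S. ind1 (f i) z * (NN w. ind1 ?ev (add1 (N0 w) z) \<partial>M))"
    proof (intro sum.cong refl)
     fix i assume i: "i \<in> S"
     show "ind1 (f i) z * (NN w. (\<Prod>j<n. ind1 (I (f j)) (X j w + (if j = i then 1 else 0))) \<partial>M) =
      ind1 (f i) z * (NN w. ind1 ?ev (add1 (N0 w) z) \<partial>M)"
     proof (cases "z \<in> f i")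
      case True
      have i1: "ind1 (f j) z = (if j = i then 1 else 0 :: ennreal)" if "j < n" for j
       using True disj[of i j] S(2)[OF i] that by (auto simp: indicator_def disjoint_iff)
      have *: "ind1 ?ev (add1 (N w) z) = (\<Prod>j<n. ind1 (I (f j)) (X j w + (if j = i then 1 else 0)) :: ennreal)"
       if "w \<in> space M" for w
      proof -
       have Ns: "sets (N w) = sets E" using measurable_space[OF N that] by (simp add: space_measure_algebra)
       then have "ind1 ?ev (add1 (N w) z) = (\<Prod>j<n. ind1 (I (f j)) (emeasure (add1 (N w) z) (f j)) :: ennreal)"
        by (intro indev) simp
       also have "\<dots> = (\<Prod>j<n. ind1 (I (f j)) (X j w + (if j = i then 1 else 0)))"
        using fs by (intro prod.cong refl) (simp add: emeasure_add_pts X_def Ns i1)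
       finally show ?thesis .
      qed
      have "(NN w. (\<Prod>j<n. ind1 (I (f j)) (X j w + (if j = i then 1 else 0))) \<partial>M) = (NN w. ind1 ?ev (add1 (N0 w) z) \<partial>M)"
       by (intro nn_integral_cong_AE) (use ae AE_space in \<open>eventually_elim, simp add: *\<close>)
      then show ?thesis by simp
     qed simp
    qed
    then show "(\<Sum>i\<in>S. ind1 (f i) z * (NN w. (\<Prod>j<n. ind1 (I (f j)) (X j w + (if j = i then 1 else 0))) \<partial>M)) =
      ind1 B z * (NN w. ind1 ?ev (add1 (N0 w) z) \<partial>M)"
     by (simp add: indB sum_distrib_right)
   qed
   finally show "emeasure m1 ?ev = emeasure m2 ?ev" .
  qed
  have C': "C \<in> sets (MA E)" "C \<subseteq> space lf" using C by (auto simp: sets_lf_iff)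
  have "(NN N. emeasure N B * ind1 C N \<partial>distr M lf N0) = (NN w. emeasure (N0 w) B * ind1 C (N0 w) \<partial>M)"
   using C by (subst nn_integral_distr) auto
  also have "\<dots> = emeasure m1 C"
   unfolding em1[OF C'(1)] by (rule nn_integral_cong_AE) (use ae in \<open>eventually_elim, auto\<close>)
  also have "\<dots> = (NN z. ind1 B z * (NN w. ind1 C (add1 (N0 w) z) \<partial>M) \<partial>\<nu>)"
   unfolding \<open>m1 = m2\<close> em2[OF C'(1)] ..
  also have "\<dots> = (NN z. ind1 B z * emeasure (distr M lf N0) {N \<in> space lf. add1 N z \<in> C} \<partial>\<nu>)"
  proof (intro nn_cong arg_cong2[where f="(*)"] refl)
   fix z assume "z \<in> space \<nu>"
   then have z: "z \<in> space E" using space_eq[OF \<nu>] by simp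
   define K where "K = {N \<in> space lf. add1 N z \<in> C}"
   have "K = (%N. add1 N z) -` C \<inter> space lf" by (auto simp: K_def)
   also have "\<dots> \<in> sets lf"
    by (rule measurable_sets[OF measurable_add1_left[OF z] C])
   finally have K: "K \<in> sets lf" .
   have "(NN w. ind1 C (add1 (N0 w) z) \<partial>M) = (NN w. ind1 K (N0 w) \<partial>M)"
    using measurable_space[OF N0] by (intro nn_cong) (auto simp: K_def split: split_indicator)
   also have "\<dots> = (NN N. ind1 K N \<partial>distr M lf N0)"
    using K by (subst nn_integral_distr) auto
   finally show "(NN w. ind1 C (add1 (N0 w) z) \<partial>M) = emeasure (distr M lf N0) {N \<in> space lf. add1 N z \<in> C}"
    unfolding K_def[symmetric] using K by simp
  qed
  finally show "(NN N. emeasure N B * ind1 C N \<partial>distr M lf N0) = \<dots>" .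
 qed (use \<nu> fin in auto)
qed

end

section \<open>Tilting, simplicity of atoms and Poisson counts from the Mecke equation\<close>

context exhaustion
begin

lemma meckeD:
 "mecke \<nu> P ==> g \<in> bm (lf \<Otimes>\<^sub>M E) ==>
  (NN N. NN z. g (N, z) \<partial>N \<partial>P) = (NN z. NN N. g (add1 N z, z) \<partial>P \<partial>\<nu>)"
 by (auto simp: mecke_def)

lemma mecke_mean:
 assumes "mecke \<nu> P" "prob_space P" "f \<in> bm E"
 shows "(NN N. NN z. f z \<partial>N \<partial>P) = (NN z. f z \<partial>\<nu>)"
proof -
 interpret prob_space P by fact
 have [measurable]: "f \<in> bm E" by fact
 show ?thesis using meckeD[OF assms(1), of "%x. f (snd x)"] by (simp add: emeasure_space_1)
qed

lemma mecke_mean_emeasure: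
 assumes "mecke \<nu> P" "prob_space P" "sets P = sets lf" "sets \<nu> = sets E" "A \<in> sets E"
 shows "(NN N. emeasure N A \<partial>P) = emeasure \<nu> A"
proof -
 have "(NN N. emeasure N A \<partial>P) = (NN N. NN z. ind1 A z \<partial>N \<partial>P)"
  using assms space_eq[OF assms(3)] by (intro nn_cong) (simp add: sets_lfD)
 also have "\<dots> = emeasure \<nu> A" using mecke_mean[OF assms(1,2), of "ind1 A"] assms by simp
 finally show ?thesis .
qed

text \<open>Since \<open>w\<close> is multiplicative under adding a point, weighting
  \<open>P\<close> by \<open>w\<close> only multiplies the intensity of the added point by
  \<open>\<phi>\<close>, and the normaliser \<open>c\<close> is the same on both sides. This is the
  exponential change of measure for Poisson processes.\<close>

lemma mecke_density:
 assumes P: "prob_space P" and P_sets[measurable_cong]: "sets P = sets lf"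
  and \<nu>[measurable_cong]: "sets \<nu> = sets E" and mecke: "mecke \<nu> P"
  and w[measurable]: "w \<in> bm lf" and \<phi>[measurable]: "\<phi> \<in> bm E"
  and c: "c = (NN N. w N \<partial>P)" "0 < c" "c < \<infinity>"
  and mult: "!!N z. N \<in> space lf ==> z \<in> space E ==> w (add1 N z) = w N * \<phi> z"
 shows "prob_space (density P (%N. w N / c))" "mecke (density \<nu> \<phi>) (density P (%N. w N / c))"
proof -
 interpret P: prob_space P by fact
 have spP: "space P = space lf" using P_sets by (rule space_eq)
 have "emeasure (density P (%N. w N / c)) (space P) = (NN N. w N / c \<partial>P)"
  by (subst emeasure_density) (auto intro!: nn_cong)
 also have "\<dots> = c / c" unfolding c(1) by (rule nn_integral_divide) measurable
 also have "\<dots> = 1" using c by (intro ennreal_divide_self) auto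
 finally show "prob_space (density P (%N. w N / c))" by (intro prob_spaceI) simp
 show "mecke (density \<nu> \<phi>) (density P (%N. w N / c))"
  unfolding mecke_def
 proof
  fix g :: "'e measure \<times> 'e => ennreal" assume g[measurable]: "g \<in> bm (lf \<Otimes>\<^sub>M E)"
  have [measurable]: "(%N. NN z. g (N, z) \<partial>N) \<in> bm lf" by measurable
  have "(NN N. NN z. g (N, z) \<partial>N \<partial>density P (%N. w N / c)) =
    (NN N. w N / c * (NN z. g (N, z) \<partial>N) \<partial>P)"
   by (rule nn_integral_density) measurable
  also have "\<dots> = (NN N. NN z. w N / c * g (N, z) \<partial>N \<partial>P)"
  proof (intro nn_cong nn_integral_cmult[symmetric])
   fix N assume "N \<in> space P"
   then have N: "N \<in> space lf" by (simp add: spP)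
   have "(%z. g (N, z)) \<in> bm E" by (rule m_comp[OF measurable_Pair1'[OF N] g])
   then show "(%z. g (N, z)) \<in> bm N"
    by (simp cong: m_cong_sets add: sets_lfD[OF N])
  qed
  also have "\<dots> = (NN z. NN N. w (add1 N z) / c * g (add1 N z, z) \<partial>P \<partial>\<nu>)"
   using meckeD[OF mecke, of "%x. w (fst x) / c * g x"] by simp
  also have "\<dots> = (NN z. \<phi> z * (NN N. g (add1 N z, z) \<partial>density P (%N. w N / c)) \<partial>\<nu>)"
  proof (rule nn_cong)
   fix z assume "z \<in> space \<nu>"
   then have z: "z \<in> space E" using space_eq[OF \<nu>] by simp
   have [measurable]: "(%N. g (add1 N z, z)) \<in> bm P"
    unfolding m_cong_sets[OF P_sets refl]
    by (rule m_comp[OF measurable_Pair[OF measurable_add1_left[OF z] measurable_const[OF z]] g])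
   have "(NN N. w (add1 N z) / c * g (add1 N z, z) \<partial>P) = (NN N. \<phi> z * (w N / c * g (add1 N z, z)) \<partial>P)"
    using z by (intro nn_cong) (simp add: spP mult divide_ennreal_def ac_simps)
   also have "\<dots> = \<phi> z * (NN N. w N / c * g (add1 N z, z) \<partial>P)"
    by (rule nn_integral_cmult) measurable
   also have "(NN N. w N / c * g (add1 N z, z) \<partial>P) = (NN N. g (add1 N z, z) \<partial>density P (%N. w N / c))"
    by (rule nn_integral_density[symmetric]) measurable
   finally show "(NN N. w (add1 N z) / c * g (add1 N z, z) \<partial>P) =
    \<phi> z * (NN N. g (add1 N z, z) \<partial>density P (%N. w N / c))" .
  qed
  also have "\<dots> = (NN z. NN N. g (add1 N z, z) \<partial>density P (%N. w N / c) \<partial>density \<nu> \<phi>)"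
  proof (rule nn_integral_density[symmetric])
   have "(%x. w (snd x) / c * g (add1 (snd x) (fst x), fst x)) \<in> bm (\<nu> \<Otimes>\<^sub>M P)"
    by measurable
   then have "(%z. NN N. w N / c * g (add1 N z, z) \<partial>P) \<in> bm \<nu>"
    by (rule P.borel_measurable_nn_integral_fst[of "%x. w (snd x) / c * g (add1 (snd x) (fst x), fst x)", simplified])
   moreover have "(NN N. g (add1 N z, z) \<partial>density P (%N. w N / c)) = (NN N. w N / c * g (add1 N z, z) \<partial>P)" if "z \<in> space \<nu>" for z
   proof (rule nn_integral_density)
    have z: "z \<in> space E" using that space_eq[OF \<nu>] by simp
    show "(%N. g (add1 N z, z)) \<in> bm P"
     unfolding m_cong_sets[OF P_sets refl]
     by (rule m_comp[OF measurable_Pair[OF measurable_add1_left[OF z] measurable_const[OF z]] g])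
   qed measurable
   ultimately show "(%z. NN N. g (add1 N z, z) \<partial>density P (%N. w N / c)) \<in> bm \<nu>"
    by (simp cong: measurable_cong)
  qed measurable
  finally show "(NN N. NN z. g (N, z) \<partial>N \<partial>density P (%N. w N / c)) = \<dots>" .
 qed
qed

context
 fixes P :: "'e measure measure" and \<nu> :: "'e measure"
 assumes P: "prob_space P" and P_sets[measurable_cong]: "sets P = sets lf"
  and \<nu>[measurable_cong]: "sets \<nu> = sets E" and mecke: "mecke \<nu> P"
begin

interpretation P: prob_space P by (rule P)

lemma mecke_space: "space P = space lf"
 using P_sets by (rule space_eq)

text \<open>An independent point of \<open>\<nu>\<close> almost surely finds no point of
  \<open>N\<close> at its own time, because that time fibre is a null set for \<open>\<nu>\<close>.
  By the Mecke equation a typical point of \<open>N\<close> therefore shares its time with no other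
  point, and has exactly the mass one that its addition contributes.\<close>

lemma mecke_AE_simple:
 assumes tm[measurable]: "tm \<in> E ->M (borel :: real measure)"
  and diag[measurable]: "Measurable.pred (E \<Otimes>\<^sub>M E) (%x. fst x = snd x)"
  and diffuse: "!!z. z \<in> space E ==> emeasure \<nu> {z' \<in> space E. tm z' = tm z} = 0"
 shows "AE N in P. AE z in N. emeasure N {z} = 1 \<and> emeasure N {z' \<in> space E. tm z' = tm z} = 1"
proof -
 have sing[measurable]: "{z} \<in> sets E" if "z \<in> space E" for z
 proof -
  have "Measurable.pred E (%y. y = z)"
   using m_comp[OF measurable_Pair2'[OF that] diag] by simp
  then show ?thesis using that by (simp add: pred_def Collect_conv_if conj_commute cong: conj_cong)
 qed
 \<comment> \<open>The masses of \<open>{z}\<close> and of its time fibre are written as integrals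
   of indicators, which are jointly measurable in \<open>(N, z)\<close>.\<close>
 define bad where "bad = (%(N, z). if (NN y. (if y = z then 1 else 0) \<partial>N) = (1::ennreal) \<and>
   (NN y. (if tm y = tm z then 1 else 0) \<partial>N) = 1 then 0 else (1::ennreal))"
 have "(%x. (snd x, snd (fst x))) \<in> (lf \<Otimes>\<^sub>M E) \<Otimes>\<^sub>M E ->M E \<Otimes>\<^sub>M E" by measurable
 from m_comp[OF this diag]
 have [measurable]: "Measurable.pred ((lf \<Otimes>\<^sub>M E) \<Otimes>\<^sub>M E) (%x. snd x = snd (fst x))" by simp
 have "(%p. if snd p = snd (fst p) then 1 else 0 :: ennreal) \<in> bm ((lf \<Otimes>\<^sub>M E) \<Otimes>\<^sub>M E)"
  by measurable
 from measurable_nn_integral_lf[OF measurable_fst this]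
 have 1: "(%x. NN y. (if y = snd x then 1 else 0) \<partial>fst x :: ennreal) \<in> bm (lf \<Otimes>\<^sub>M E)"
  by simp
 have "(%p. if tm (snd p) = tm (snd (fst p)) then 1 else 0 :: ennreal) \<in> bm ((lf \<Otimes>\<^sub>M E) \<Otimes>\<^sub>M E)"
  by measurable
 from measurable_nn_integral_lf[OF measurable_fst this]
 have 2: "(%x. NN y. (if tm y = tm (snd x) then 1 else 0) \<partial>fst x :: ennreal) \<in> bm (lf \<Otimes>\<^sub>M E)"
  by simp
 have bad_meas: "bad \<in> bm (lf \<Otimes>\<^sub>M E)"
  unfolding bad_def case_prod_beta using 1 2 by measurable
 have int_eq: "(NN y. (if y = z then 1 else 0) \<partial>N) = emeasure N {z}"
  "(NN y. (if tm y = tm z then 1 else 0) \<partial>N) = emeasure N {z' \<in> space E. tm z' = tm z}"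
  if N: "N \<in> space lf" and z: "z \<in> space E" for N z
 proof -
  have "(NN y. (if y = z then 1 else 0) \<partial>N) = (NN y. ind1 {z} y \<partial>N)"
   by (intro nn_cong) (auto split: split_indicator)
  also have "\<dots> = emeasure N {z}" using sing[OF z] by (simp add: sets_lfD[OF N])
  finally show "(NN y. (if y = z then 1 else 0) \<partial>N) = emeasure N {z}" .
  have "(NN y. (if tm y = tm z then 1 else 0) \<partial>N) = (NN y. ind1 {z' \<in> space E. tm z' = tm z} y \<partial>N)"
   by (intro nn_cong) (auto simp: space_lfD[OF N] split: split_indicator)
  also have "\<dots> = emeasure N {z' \<in> space E. tm z' = tm z}"
   by (rule nn_integral_indicator) (simp add: sets_lfD[OF N])
  finally show "(NN y. (if tm y = tm z then 1 else 0) \<partial>N) = emeasure N {z' \<in> space E. tm z' = tm z}" .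
 qed
 have "(NN N. NN z. bad (N, z) \<partial>N \<partial>P) = (NN z. NN N. bad (add1 N z, z) \<partial>P \<partial>\<nu>)"
  by (rule meckeD[OF mecke bad_meas])
 also have "\<dots> = (NN z. 0 \<partial>\<nu>)"
 proof (rule nn_cong)
  fix z assume "z \<in> space \<nu>"
  then have z: "z \<in> space E" using space_eq[OF \<nu>] by simp
  let ?F = "{z' \<in> space E. tm z' = tm z}"
  have "(NN N. emeasure N ?F \<partial>P) = 0"
   using mecke_mean_emeasure[OF mecke P P_sets \<nu>, of ?F] diffuse[OF z] by simp
  then have "AE N in P. emeasure N ?F = 0"
   by (subst (asm) nn_integral_0_iff_AE) measurable
  then have "AE N in P. bad (add1 N z, z) = 0"
   using AE_space
  proof eventually_elim
   fix N assume F: "emeasure N ?F = 0" and N: "N \<in> space P"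
   have N': "N \<in> space lf" "add1 N z \<in> space lf"
    using N measurable_space[OF measurable_add1_left[OF z], of N] by (simp_all add: mecke_space)
   have "emeasure N {z} \<le> emeasure N ?F" using z by (intro emeasure_mono) (auto simp: sets_lfD[OF N'(1)])
   then have "emeasure N {z} = 0" using F by simp
   then show "bad (add1 N z, z) = 0"
    using F z N' by (simp add: bad_def int_eq emeasure_add_pts sets_lfD)
  qed
  then have "(NN N. bad (add1 N z, z) \<partial>P) = (NN N. 0 \<partial>P)" by (rule nn_integral_cong_AE)
  then show "(NN N. bad (add1 N z, z) \<partial>P) = 0" by simp
 qed
 finally have "(NN N. NN z. bad (N, z) \<partial>N \<partial>P) = 0" by simp
 moreover have "(%N. NN z. bad (N, z) \<partial>N) \<in> bm P"
  unfolding m_cong_sets[OF P_sets refl]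
  by (rule measurable_nn_integral_lf) (use bad_meas in auto)
 ultimately have "AE N in P. (NN z. bad (N, z) \<partial>N) = 0"
  by (subst (asm) nn_integral_0_iff_AE) auto
 with AE_space show ?thesis
 proof eventually_elim
  fix N assume "N \<in> space P" and 0: "(NN z. bad (N, z) \<partial>N) = 0"
  then have N: "N \<in> space lf" by (simp add: mecke_space)
  have "(%z. bad (N, z)) \<in> bm N"
   using m_comp[OF measurable_Pair1'[OF N] bad_meas] by (simp cong: m_cong_sets add: sets_lfD[OF N])
  then have "AE z in N. bad (N, z) = 0" using 0 by (subst (asm) nn_integral_0_iff_AE) auto
  with AE_space show "AE z in N. emeasure N {z} = 1 \<and> emeasure N {z' \<in> space E. tm z' = tm z} = 1"
   by eventually_elim (auto simp: bad_def space_lfD[OF N] int_eq[OF N] split: if_splits)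
 qed
qed

text \<open>Testing the Mecke equation with a point in \<open>A\<close> and the event that
  \<open>A\<close> has mass \<open>k + 1\<close> gives the Poisson recursion for the probabilities
  of mass \<open>k\<close> within \<open>C\<close>; invariance of \<open>C\<close> is what makes the
  same event come back. The factor \<open>measure P C\<close> already contains the independence of
  the mass of \<open>A\<close> from \<open>C\<close>.\<close>

lemma mecke_emeasure_invariant:
 assumes A[measurable]: "A \<in> sets E" and fin: "emeasure \<nu> A < \<infinity>"
  and nat: "AE N in P. emeasure N A = \<infinity> \<or> (\<exists>k. emeasure N A = of_nat k)"
  and C[measurable]: "C \<in> sets lf"
  and inv: "!!N z. N \<in> space lf ==> z \<in> A ==> add1 N z \<in> C \<longleftrightarrow> N \<in> C"
 shows "measure P ({N \<in> space lf. emeasure N A = of_nat k} \<inter> C) =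
  measure \<nu> A ^ k / fact k * exp (- measure \<nu> A) * measure P C"
proof -
 define l where "l = measure \<nu> A"
 have l: "emeasure \<nu> A = ennreal l" "0 \<le> l" using fin by (simp_all add: l_def emeasure_eq_ennreal_measure)
 define S where "S k = {N \<in> space lf. emeasure N A = of_nat k} \<inter> C" for k :: nat
 have S[measurable]: "S k \<in> sets lf" for k unfolding S_def by measurable
 define r where "r k = measure P (S k)" for k
 have rec: "real (Suc k) * r (Suc k) = l * r k" for k
 proof -
  let ?g = "%x. ind1 A (snd x) * ind1 (S (Suc k)) (fst x) :: ennreal"
  have "(NN N. NN z. ?g (N, z) \<partial>N \<partial>P) = (NN N. of_nat (Suc k) * ind1 (S (Suc k)) N \<partial>P)"
  proof (rule nn_cong)
   fix N assume "N \<in> space P"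
   then have N: "N \<in> space lf" by (simp add: mecke_space)
   have "(NN z. ?g (N, z) \<partial>N) = emeasure N A * ind1 (S (Suc k)) N"
    unfolding fst_conv snd_conv using bm_ind[of A N] A
    by (subst nn_integral_multc) (simp_all add: sets_lfD[OF N])
   then show "(NN z. ?g (N, z) \<partial>N) = of_nat (Suc k) * ind1 (S (Suc k)) N"
    by (auto simp: S_def split: split_indicator)
  qed
  also have "\<dots> = of_nat (Suc k) * emeasure P (S (Suc k))"
   by (subst nn_integral_cmult) (auto simp: P_sets)
  finally have 1: "(NN N. NN z. ?g (N, z) \<partial>N \<partial>P) = ennreal (real (Suc k) * r (Suc k))"
   by (simp add: r_def P.emeasure_eq_measure ennreal_of_nat_eq_real_of_nat ennreal_mult del: of_nat_Suc)
  have "(NN z. NN N. ?g (add1 N z, z) \<partial>P \<partial>\<nu>) = (NN z. ind1 A z * emeasure P (S k) \<partial>\<nu>)"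
  proof (rule nn_cong)
   fix z assume "z \<in> space \<nu>"
   then have z: "z \<in> space E" using space_eq[OF \<nu>] by simp
   have "(NN N. ?g (add1 N z, z) \<partial>P) = (NN N. ind1 A z * ind1 (S k) N \<partial>P)"
   proof (rule nn_cong)
    fix N assume "N \<in> space P"
    then have N: "N \<in> space lf" by (simp add: mecke_space)
    have N': "add1 N z \<in> space lf" using measurable_space[OF measurable_add1_left[OF z] N] .
    have "emeasure N A + 1 = 1 + of_nat k \<longleftrightarrow> emeasure N A = of_nat k"
     by (metis add.commute ennreal_add_left_cancel ennreal_one_neq_top infinity_ennreal_def)
    then show "?g (add1 N z, z) = ind1 A z * ind1 (S k) N"
     using A N N' inv[OF N, of z]
     by (auto simp: S_def emeasure_add_pts sets_lfD[OF N] indicator_def add.commute)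
   qed
   also have "\<dots> = ind1 A z * emeasure P (S k)"
    by (subst nn_integral_cmult) (auto simp: P_sets)
   finally show "(NN N. ?g (add1 N z, z) \<partial>P) = \<dots>" .
  qed
  also have "\<dots> = ennreal (l * r k)"
   using A l by (simp add: nn_integral_multc \<nu> r_def P.emeasure_eq_measure ennreal_mult)
  finally have "ennreal (real (Suc k) * r (Suc k)) = ennreal (l * r k)"
   using 1 meckeD[OF mecke, of ?g] by simp
  then show ?thesis using l by (simp add: r_def del: of_nat_Suc)
 qed
 have r: "r k = l ^ k / fact k * r 0" for k
 proof (induction k)
  case (Suc k)
  have "r (Suc k) = l * r k / real (Suc k)" using rec[of k] by (simp add: field_simps)
  then show ?case by (simp add: Suc field_simps)
 qed simp
 \<comment> \<open>The recursion leaves \<open>r 0\<close> open. It is found by summation, since the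
   events \<open>S k\<close> exhaust \<open>C\<close> almost surely: the mass of \<open>A\<close>
   has finite mean.\<close>
 have "(%k. (l ^ k /\<^sub>R fact k) * r 0) sums (exp l * r 0)"
  by (intro sums_mult2 exp_converges)
 then have 1: "r sums (exp l * r 0)"
  by (subst r[abs_def]) (simp add: field_simps)
 have "(%k. measure P (S k)) sums measure P (\<Union>k. S k)"
  by (intro P.finite_measure_UNION) (auto simp: disjoint_family_on_def S_def P_sets)
 with 1 have 2: "measure P (\<Union>k. S k) = exp l * r 0"
  unfolding r_def by (rule sums_unique2[symmetric])
 have "(NN N. emeasure N A \<partial>P) < \<infinity>"
  using mecke_mean_emeasure[OF mecke P P_sets \<nu> A] fin by simp
 then have "AE N in P. emeasure N A \<noteq> \<infinity>"
  by (intro nn_integral_PInf_AE) auto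
 then have "AE N in P. N \<in> (\<Union>k. S k) \<longleftrightarrow> N \<in> C"
  using nat AE_space by eventually_elim (auto simp: S_def mecke_space)
 then have "measure P (\<Union>k. S k) = measure P C"
  by (rule P.finite_measure_eq_AE) (auto simp: P_sets)
 then have "r 0 = exp (- l) * measure P C" using 2 by (simp add: exp_minus field_simps)
 then show ?thesis using r[of k] unfolding r_def S_def l_def[symmetric] by simp
qed

end

end

lemma emeasure_fun_measurable:
 "N \<in> M ->M MA E ==> A \<in> sets E ==> (%w. emeasure (N w) A) \<in> bm M"
 by (rule m_comp[OF _ measurable_emeasure_measure_algebra])

lemma pred_Ball_finite:
 assumes "finite I" "!!i. i \<in> I ==> Measurable.pred M (P i)"
 shows "Measurable.pred M (%x. \<forall>i\<in>I. P i x)"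
 using assms
proof (induction I)
 case (insert i I)
 then have "Measurable.pred M (%x. P i x \<and> (\<forall>i\<in>I. P i x))" by (intro pred_intros_logic(3)) auto
 then show ?case by simp
qed simp

lemma (in prob_space) indep_vars_empty: "indep_vars M' X {}"
 by (auto simp: indep_vars_def indep_sets_def)

text \<open>The variables agree only on the sample space, so independence is compared through joint
  and marginal laws.\<close>

lemma indep_vars_cong_space:
 assumes M: "prob_space M" and X: "!!i. i \<in> I ==> X i \<in> M ->M M' i"
  and eq: "!!i w. i \<in> I ==> w \<in> space M ==> X i w = Y i w"
  and indep: "prob_space.indep_vars M M' X I"
 shows "prob_space.indep_vars M M' Y I"
proof (cases "I = {}")
 case True
 then show ?thesis using prob_space.indep_vars_empty[OF M] by blast
next
 case False
 have Y: "Y i \<in> M ->M M' i" if "i \<in> I" for i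
  using X[OF that] eq[OF that] measurable_cong[of M "X i" "Y i" "M' i"] by blast
 have "distr M (\<Pi>\<^sub>M i\<in>I. M' i) (%x. \<lambda>i\<in>I. X i x) = distr M (\<Pi>\<^sub>M i\<in>I. M' i) (%x. \<lambda>i\<in>I. Y i x)"
  by (intro distr_cong refl) (auto simp: eq)
 moreover have "(\<Pi>\<^sub>M i\<in>I. distr M (M' i) (X i)) = (\<Pi>\<^sub>M i\<in>I. distr M (M' i) (Y i))"
  by (intro PiM_cong distr_cong refl) (simp add: eq)
 ultimately show ?thesis
  using prob_space.indep_vars_iff_distr_eq_PiM'[OF M False, where M'=M' and X=X] X
   prob_space.indep_vars_iff_distr_eq_PiM'[OF M False, where M'=M' and X=Y] Y indep
  by simp
qed

section \<open>Independence over disjoint sets\<close>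

text \<open>The restriction stays a measure on all of \<open>E\<close>, so that restrictions to
  different sets take values in one and the same space.\<close>

definition restr :: "'e set => 'e measure => 'e measure" where
 "restr S N = density N (ind1 S)"

lemma sets_restr [simp]: "sets (restr S N) = sets N" and space_restr [simp]: "space (restr S N) = space N"
 by (simp_all add: restr_def)

lemma emeasure_restr: "S \<in> sets N ==> X \<in> sets N ==> emeasure (restr S N) X = emeasure N (S \<inter> X)"
 unfolding restr_def by (rule emeasure_restricted)

context exhaustion
begin

lemma restr_measurable:
 assumes S: "S \<in> sets E" shows "restr S \<in> lf ->M lf"
proof (rule measurable_lfI)
 show "restr S \<in> lf ->M MA E"
 proof (rule measurable_measure_algebraI)
  fix X assume X: "X \<in> sets E"
  have "emeasure (restr S N) X = emeasure N (S \<inter> X)" if "N \<in> space lf" for N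
   using S X by (intro emeasure_restr) (simp_all add: sets_lfD[OF that])
  moreover have "(%N. emeasure N (S \<inter> X)) \<in> bm lf"
   by (rule emeasure_fun_measurable[OF measurable_lfD[OF m_id]]) (use S X in auto)
  ultimately show "(%N. emeasure (restr S N) X) \<in> bm lf" by (subst measurable_cong)
 qed (simp add: sets_lfD)
 fix N k assume N: "N \<in> space lf"
 have "emeasure (restr S N) (D k) = emeasure N (S \<inter> D k)"
  using S by (intro emeasure_restr) (simp_all add: sets_lfD[OF N])
 also have "\<dots> \<le> emeasure N (D k)" using S by (intro emeasure_mono) (simp_all add: sets_lfD[OF N])
 also have "\<dots> < \<infinity>" by (rule lf_finite[OF N])
 finally show "emeasure (restr S N) (D k) < \<infinity>" .
qed

lemma restr_add1:
 assumes S: "S \<in> sets E" and N: "N \<in> space lf" and z: "z \<notin> S"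
 shows "restr S (add1 N z) = restr S N"
proof (rule measure_eqI)
 fix X assume "X \<in> sets (restr S (add1 N z))"
 then have "X \<in> sets N" "S \<in> sets N" using S by (simp_all add: sets_lfD[OF N])
 then show "emeasure (restr S (add1 N z)) X = emeasure (restr S N) X"
  using z by (simp add: emeasure_restr emeasure_add_pts)
qed simp

text \<open>For every \<open>k\<close> the Mecke equation bounds the product of the infinite mean
  and the probability of mass \<open>k\<close> by the number \<open>k + 1\<close>, so no finite
  value has positive probability.\<close>

lemma mecke_emeasure_infinite:
 assumes P: "prob_space P" and P_sets[measurable_cong]: "sets P = sets lf"
  and \<nu>[measurable_cong]: "sets \<nu> = sets E" and mecke: "mecke \<nu> P"
  and A[measurable]: "A \<in> sets E" and inf: "emeasure \<nu> A = \<infinity>"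
  and nat: "AE N in P. emeasure N A = \<infinity> \<or> (\<exists>k. emeasure N A = of_nat k)"
 shows "AE N in P. emeasure N A = \<infinity>"
proof -
 interpret P: prob_space P by (rule P)
 have spP: "space P = space lf" using P_sets by (rule space_eq)
 define S where "S k = {N \<in> space lf. emeasure N A = of_nat k}" for k :: nat
 have S[measurable]: "S k \<in> sets lf" for k unfolding S_def by measurable
 have "emeasure P (S k) = 0" for k
 proof -
  let ?g = "%x. ind1 A (snd x) * ind1 (S (Suc k)) (fst x) :: ennreal"
  have "(NN N. NN z. ?g (N, z) \<partial>N \<partial>P) \<le> (NN N. of_nat (Suc k) \<partial>P)"
  proof (rule nn_integral_mono)
   fix N assume "N \<in> space P"
   then have N: "N \<in> space lf" by (simp add: spP)
   have "(NN z. ?g (N, z) \<partial>N) = emeasure N A * ind1 (S (Suc k)) N"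
    unfolding fst_conv snd_conv using bm_ind[of A N] A
    by (subst nn_integral_multc) (simp_all add: sets_lfD[OF N])
   then show "(NN z. ?g (N, z) \<partial>N) \<le> of_nat (Suc k)"
    by (auto simp: S_def split: split_indicator)
  qed
  also have "\<dots> < \<infinity>" by (simp add: P.emeasure_space_1 ennreal_of_nat_eq_real_of_nat)
  finally have 1: "(NN N. NN z. ?g (N, z) \<partial>N \<partial>P) < \<infinity>" .
  have "emeasure \<nu> A * emeasure P (S k) = (NN z. ind1 A z * emeasure P (S k) \<partial>\<nu>)"
   using A by (simp add: nn_integral_multc \<nu>)
  also have "\<dots> = (NN z. NN N. ?g (add1 N z, z) \<partial>P \<partial>\<nu>)"
  proof (rule nn_cong)
   fix z assume "z \<in> space \<nu>"
   then have z: "z \<in> space E" using space_eq[OF \<nu>] by simp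
   have "ind1 A z * emeasure P (S k) = (NN N. ind1 A z * ind1 (S k) N \<partial>P)"
    by (subst nn_integral_cmult) (auto simp: P_sets)
   also have "\<dots> = (NN N. ?g (add1 N z, z) \<partial>P)"
   proof (rule nn_cong)
    fix N assume "N \<in> space P"
    then have N: "N \<in> space lf" by (simp add: spP)
    have N': "add1 N z \<in> space lf" using measurable_space[OF measurable_add1_left[OF z] N] .
    have "emeasure N A + 1 = 1 + of_nat k \<longleftrightarrow> emeasure N A = of_nat k"
     by (metis add.commute ennreal_add_left_cancel ennreal_one_neq_top infinity_ennreal_def)
    then show "ind1 A z * ind1 (S k) N = ?g (add1 N z, z)"
     using A N N' by (auto simp: S_def emeasure_add_pts sets_lfD[OF N] indicator_def add.commute)
   qed
   finally show "ind1 A z * emeasure P (S k) = (NN N. ?g (add1 N z, z) \<partial>P)" .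
  qed
  also have "\<dots> < \<infinity>" using 1 meckeD[OF mecke, of ?g] by simp
  finally show ?thesis using inf by (auto simp: ennreal_top_mult split: if_splits)
 qed
 then have "AE N in P. N \<notin> S k" for k
  by (intro AE_not_in) (auto simp: null_sets_def P_sets)
 then have "AE N in P. \<forall>k. N \<notin> S k" by (simp add: AE_all_countable)
 then show ?thesis using nat AE_space
  by eventually_elim (auto simp: S_def spP)
qed

context
 fixes P :: "'e measure measure" and \<nu> :: "'e measure"
 assumes P: "prob_space P" and P_sets[measurable_cong]: "sets P = sets lf"
  and \<nu>[measurable_cong]: "sets \<nu> = sets E" and mecke: "mecke \<nu> P"
  and nat: "AE N in P. \<forall>A\<in>sets E. emeasure N A = \<infinity> \<or> (\<exists>k. emeasure N A = of_nat k)"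
begin

interpretation P: prob_space P by (rule P)

text \<open>With finite mean, \<open>mecke_emeasure_invariant\<close> is summed over the integers in
  \<open>J\<close>. With infinite mean the mass of \<open>A\<close> is almost surely constant and
  hence independent of everything.\<close>

lemma mecke_indep_invariant:
 assumes A[measurable]: "A \<in> sets E" and C[measurable]: "C \<in> sets lf" and J[measurable]: "J \<in> sets borel"
  and inv: "!!N z. N \<in> space lf ==> z \<in> A ==> add1 N z \<in> C \<longleftrightarrow> N \<in> C"
 shows "measure P ({N \<in> space lf. emeasure N A \<in> J} \<inter> C) =
  measure P {N \<in> space lf. emeasure N A \<in> J} * measure P C"
proof -
 have spP: "space P = space lf" using P_sets by (rule space_eq)
 have natA: "AE N in P. emeasure N A = \<infinity> \<or> (\<exists>k. emeasure N A = of_nat k)"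
  using nat by eventually_elim (use A in auto)
 show ?thesis
 proof (cases "emeasure \<nu> A < \<infinity>")
  case False
  then have "emeasure \<nu> A = \<infinity>" by (metis infinity_ennreal_def less_top)
  from mecke_emeasure_infinite[OF P P_sets \<nu> mecke A this natA]
  have ae: "AE N in P. emeasure N A = \<infinity>" .
  have "measure P ({N \<in> space lf. emeasure N A \<in> J} \<inter> C) = measure P (if \<infinity> \<in> J then C else {})"
   using ae AE_space by (intro P.finite_measure_eq_AE) (auto elim!: AE_mp simp: P_sets spP)
  moreover have "measure P {N \<in> space lf. emeasure N A \<in> J} = measure P (if \<infinity> \<in> J then space P else {})"
   using ae AE_space by (intro P.finite_measure_eq_AE) (auto elim!: AE_mp simp: P_sets spP)
  ultimately show ?thesis by (simp add: P.prob_space)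
 next
  case True
  let ?p = "%k. measure \<nu> A ^ k / fact k * exp (- measure \<nu> A)"
  have *: "measure P ({N \<in> space lf. emeasure N A \<in> J} \<inter> C') =
    (\<Sum>k. of_bool (of_nat k \<in> J) * ?p k) * measure P C'" and
   "summable (%k. of_bool (of_nat k \<in> J) * ?p k)"
   if C'[measurable]: "C' \<in> sets lf"
    and inv': "!!N z. N \<in> space lf ==> z \<in> A ==> add1 N z \<in> C' \<longleftrightarrow> N \<in> C'" for C'
  proof -
   have "(%k. (measure \<nu> A ^ k /\<^sub>R fact k) * exp (- measure \<nu> A)) sums (exp (measure \<nu> A) * exp (- measure \<nu> A))"
    by (intro sums_mult2 exp_converges)
   then have "summable ?p" by (auto simp: sums_iff field_simps)
   then show summ: "summable (%k. of_bool (of_nat k \<in> J) * ?p k)"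
    by (rule summable_comparison_test'[where N=0]) auto
   define S where "S k = (if of_nat k \<in> J then {N \<in> space lf. emeasure N A = of_nat k} \<inter> C' else {})" for k :: nat
   have mS: "measure P (S k) = of_bool (of_nat k \<in> J) * ?p k * measure P C'" for k
    using mecke_emeasure_invariant[OF P P_sets \<nu> mecke A True natA C' inv', of k]
    by (simp add: S_def)
   have "(%k. measure P (S k)) sums measure P (\<Union>k. S k)"
    by (intro P.finite_measure_UNION) (auto simp: disjoint_family_on_def S_def P_sets)
   moreover have "(%k. measure P (S k)) sums ((\<Sum>k. of_bool (of_nat k \<in> J) * ?p k) * measure P C')"
    unfolding mS by (intro sums_mult2 summable_sums summ)
   ultimately have "measure P (\<Union>k. S k) = (\<Sum>k. of_bool (of_nat k \<in> J) * ?p k) * measure P C'"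
    by (rule sums_unique2)
   moreover have "AE N in P. emeasure N A \<noteq> \<infinity>"
    using mecke_mean_emeasure[OF mecke P P_sets \<nu> A] True by (intro nn_integral_PInf_AE) auto
   then have "AE N in P. N \<in> (\<Union>k. S k) \<longleftrightarrow> N \<in> {N \<in> space lf. emeasure N A \<in> J} \<inter> C'"
    using natA AE_space by eventually_elim (auto simp: S_def spP split: if_splits)
   then have "measure P (\<Union>k. S k) = measure P ({N \<in> space lf. emeasure N A \<in> J} \<inter> C')"
    by (rule P.finite_measure_eq_AE) (auto simp: P_sets S_def)
   ultimately show "measure P ({N \<in> space lf. emeasure N A \<in> J} \<inter> C') =
    (\<Sum>k. of_bool (of_nat k \<in> J) * ?p k) * measure P C'" by simp
  qed
  have "measure P ({N \<in> space lf. emeasure N A \<in> J} \<inter> space lf) = (\<Sum>k. of_bool (of_nat k \<in> J) * ?p k) * measure P (space lf)"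
   using measurable_space[OF measurable_add1_left] sets.sets_into_space[OF A]
   by (intro *) auto
  moreover have "measure P (space lf) = 1" using P.prob_space by (simp add: spP)
  moreover have "{N \<in> space lf. emeasure N A \<in> J} \<inter> space lf = {N \<in> space lf. emeasure N A \<in> J}" by auto
  ultimately have "measure P {N \<in> space lf. emeasure N A \<in> J} = (\<Sum>k. of_bool (of_nat k \<in> J) * ?p k)" by simp
  then show ?thesis using *[OF C inv] by simp
 qed
qed

text \<open>Induction over the family. A point added in \<open>S \<inter> A\<close> does not change
  the masses of the other members, which are disjoint from \<open>A\<close>; the event for these
  members, intersected with \<open>C\<close>, is therefore again invariant.\<close>

lemma mecke_indep_traces:
 assumes S: "S \<in> sets E" and \<D>: "finite \<D>" "\<D> \<subseteq> sets E" "disjoint \<D>" and I: "!!A. I A \<in> sets (borel :: ennreal measure)"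
  and C: "C \<in> sets lf" and inv: "!!N z. N \<in> space lf ==> z \<in> S ==> add1 N z \<in> C \<longleftrightarrow> N \<in> C"
 shows "measure P ({N \<in> space lf. \<forall>A\<in>\<D>. emeasure N (S \<inter> A) \<in> I A} \<inter> C) =
  measure P {N \<in> space lf. \<forall>A\<in>\<D>. emeasure N (S \<inter> A) \<in> I A} * measure P C"
 using \<D> C inv
proof (induction \<D> arbitrary: C)
 case empty
 have "space P = space lf" using P_sets by (rule space_eq)
 moreover have "space lf \<inter> C = C" using sets.sets_into_space[OF empty(3)] by auto
 ultimately show ?case using P.prob_space by simp
next
 case (insert A \<D>)
 let ?H = "{N \<in> space lf. \<forall>A\<in>\<D>. emeasure N (S \<inter> A) \<in> I A}"
 let ?A = "{N \<in> space lf. emeasure N (S \<inter> A) \<in> I A}"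
 have SA: "S \<inter> A \<in> sets E" using S insert.prems(1) by auto
 have disj: "disjoint \<D>" using insert.prems(2) by (auto simp: disjoint_def pairwise_def)
 have H: "?H \<in> sets lf"
 proof -
  have "Measurable.pred lf (%N. \<forall>A\<in>\<D>. emeasure N (S \<inter> A) \<in> I A)"
  proof (rule pred_Ball_finite[OF insert.hyps(1)])
   fix A assume "A \<in> \<D>"
   then have "(%N. emeasure N (S \<inter> A)) \<in> bm lf"
    using S insert.prems(1) by (intro emeasure_fun_measurable[OF measurable_lfD[OF m_id]]) auto
   then show "Measurable.pred lf (%N. emeasure N (S \<inter> A) \<in> I A)" using I[of A] by measurable
  qed
  then show ?thesis by (simp add: pred_def)
 qed
 \<comment> \<open>A general invariant \<open>C'\<close> is needed: it is used for \<open>C\<close>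
   and also for the whole space, which supplies the unconditional probability on the right-hand
   side.\<close>
 have step: "measure P (?A \<inter> (?H \<inter> C')) = measure P ?A * (measure P ?H * measure P C')"
  if C': "C' \<in> sets lf" and inv': "!!N z. N \<in> space lf ==> z \<in> S ==> add1 N z \<in> C' \<longleftrightarrow> N \<in> C'" for C'
 proof -
  have "measure P (?A \<inter> (?H \<inter> C')) = measure P ?A * measure P (?H \<inter> C')"
  proof (rule mecke_indep_invariant[OF SA _ I])
   show "?H \<inter> C' \<in> sets lf" using H C' by auto
   fix N z assume N: "N \<in> space lf" and z: "z \<in> S \<inter> A"
   have zE: "z \<in> space E" using z sets.sets_into_space[OF S] by auto
   have N': "add1 N z \<in> space lf" using measurable_space[OF measurable_add1_left[OF zE] N] .
   have "emeasure (add1 N z) (S \<inter> A') = emeasure N (S \<inter> A')" if A': "A' \<in> \<D>" for A'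
   proof -
    have "A \<noteq> A'" using insert.hyps(2) A' by blast
    then have "A \<inter> A' = {}" using insert.prems(2) A' by (simp add: pairwise_insert disjnt_def)
    then have "z \<notin> S \<inter> A'" using z by blast
    then show ?thesis using insert.prems(1) S A' by (subst emeasure_add_pts) (auto simp: sets_lfD[OF N])
   qed
   then show "add1 N z \<in> ?H \<inter> C' \<longleftrightarrow> N \<in> ?H \<inter> C'" using N N' inv'[OF N, of z] z by auto
  qed
  also have "measure P (?H \<inter> C') = measure P ?H * measure P C'"
   by (rule insert.IH[OF _ disj C' inv']) (use insert.prems in auto)
  finally show ?thesis .
 qed
 have sp: "measure P (space lf) = 1" using P.prob_space space_eq[OF P_sets] by simp
 have inv_sp: "add1 N z \<in> space lf \<longleftrightarrow> N \<in> space lf" if "N \<in> space lf" "z \<in> S" for N z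
  using measurable_space[OF measurable_add1_left, of z N] sets.sets_into_space[OF S] that by auto
 have all: "{N \<in> space lf. \<forall>A\<in>insert A \<D>. emeasure N (S \<inter> A) \<in> I A} = ?A \<inter> (?H \<inter> space lf)" by auto
 have "{N \<in> space lf. \<forall>A\<in>insert A \<D>. emeasure N (S \<inter> A) \<in> I A} \<inter> C = ?A \<inter> (?H \<inter> C)" by auto
 then show ?case
  using step[OF insert.prems(3,4)] step[OF sets.top inv_sp] unfolding all by (simp add: sp)
qed

text \<open>Both sides are finite measures in \<open>G\<close>, determined by events in the masses
  of disjoint sets, for which the claim is \<open>mecke_indep_traces\<close>. No set is
  distinguished here, hence \<open>B = {}\<close>.\<close>

lemma mecke_indep_restr:
 assumes S: "S \<in> sets E" and G: "G \<in> sets lf"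
  and C: "C \<in> sets lf" and inv: "!!N z. N \<in> space lf ==> z \<in> S ==> add1 N z \<in> C \<longleftrightarrow> N \<in> C"
 shows "measure P ({N \<in> space lf. restr S N \<in> G} \<inter> C) = measure P {N \<in> space lf. restr S N \<in> G} * measure P C"
proof -
 have spP: "space P = space lf" using P_sets by (rule space_eq)
 have CP: "C \<in> sets P" using C P_sets by simp
 have r: "restr S \<in> P ->M MA E"
  using measurable_lfD[OF restr_measurable[OF S]] by (simp cong: m_cong_sets add: P_sets)
 define m1 where "m1 = distr (density P (ind1 C)) (MA E) (restr S)"
 define m2 where "m2 = scale_measure (emeasure P C) (distr P (MA E) (restr S))"
 have e1: "emeasure m1 X = emeasure P ({N \<in> space lf. restr S N \<in> X} \<inter> C)" if X: "X \<in> sets (MA E)" for X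
 proof -
  have "restr S -` X \<inter> space P \<in> sets P" by (rule measurable_sets[OF r X])
  then have "emeasure m1 X = emeasure P (C \<inter> (restr S -` X \<inter> space P))"
   unfolding m1_def using r X CP by (simp add: emeasure_distr emeasure_restricted)
  also have "C \<inter> (restr S -` X \<inter> space P) = {N \<in> space lf. restr S N \<in> X} \<inter> C" by (auto simp: spP)
  finally show ?thesis .
 qed
 have e2: "emeasure m2 X = emeasure P {N \<in> space lf. restr S N \<in> X} * emeasure P C" if X: "X \<in> sets (MA E)" for X
 proof -
  have "restr S -` X \<inter> space P = {N \<in> space lf. restr S N \<in> X}" by (auto simp: spP)
  then show ?thesis unfolding m2_def using r X by (simp add: emeasure_distr mult.commute)
 qed
 have "m1 = m2"
 proof (rule measure_algebra_eqI[where B="{}"])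
  have le1: "emeasure P X \<le> 1" for X by (rule P.emeasure_le_1)
  have ms: "space (MA E) \<in> sets (MA E)" by (rule sets.top)
  have "emeasure m1 (space m1) < \<infinity>"
   using e1[OF ms] le1 le_less_trans[OF le1 ennreal_one_less_top] by (simp add: m1_def)
  then show "finite_measure m1" by (intro finite_measureI) auto
  have "space m2 = space (MA E)" by (simp add: m2_def space_scale_measure)
  then have "emeasure m2 (space m2) \<le> 1 * 1"
   using e2[OF ms] mult_mono[OF le1 le1] by simp
  then have "emeasure m2 (space m2) < \<infinity>" using ennreal_one_less_top by (simp add: le_less_trans)
  then show "finite_measure m2" by (intro finite_measureI) auto
  fix \<D> and I :: "'e set => ennreal set"
  assume \<D>: "finite \<D>" "\<D> \<subseteq> sets E" "disjoint \<D>" and I: "!!A. I A \<in> sets (borel :: ennreal measure)"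
  let ?X = "{\<mu> \<in> space (MA E). \<forall>A\<in>\<D>. emeasure \<mu> A \<in> I A}"
  have X: "?X \<in> sets (MA E)"
  proof -
   have "Measurable.pred (MA E) (%\<mu>. \<forall>A\<in>\<D>. emeasure \<mu> A \<in> I A)"
   proof (rule pred_Ball_finite[OF \<D>(1)])
    fix A assume "A \<in> \<D>"
    then have "(%\<mu>. emeasure \<mu> A) \<in> bm (MA E)"
     using \<D>(2) by (intro measurable_emeasure_measure_algebra) auto
    then show "Measurable.pred (MA E) (%\<mu>. emeasure \<mu> A \<in> I A)" using I[of A] by measurable
   qed
   then show ?thesis by (simp add: pred_def)
  qed
  have eq: "{N \<in> space lf. restr S N \<in> ?X} = {N \<in> space lf. \<forall>A\<in>\<D>. emeasure N (S \<inter> A) \<in> I A}"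
  proof -
   have "emeasure (restr S N) A = emeasure N (S \<inter> A)" if "N \<in> space lf" "A \<in> \<D>" for N A
    using S \<D>(2) that by (intro emeasure_restr) (auto simp: sets_lfD)
   moreover have "restr S N \<in> space (MA E)" if "N \<in> space lf" for N
    using that by (simp add: space_measure_algebra sets_lfD)
   ultimately show ?thesis by auto
  qed
  show "emeasure m1 ?X = emeasure m2 ?X"
   unfolding e1[OF X] e2[OF X] eq
   using mecke_indep_traces[OF S \<D> I C inv]
   by (simp add: P.emeasure_eq_measure ennreal_mult[symmetric])
 qed (simp_all add: m1_def m2_def)
 moreover have "G \<in> sets (MA E)" using G by (simp add: sets_lf_iff)
 ultimately have "emeasure P ({N \<in> space lf. restr S N \<in> G} \<inter> C) = emeasure P {N \<in> space lf. restr S N \<in> G} * emeasure P C"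
  using e1[of G] e2[of G] by simp
 then show ?thesis by (simp add: measure_def enn2real_mult)
qed

text \<open>One index is split off at a time: a point added in \<open>S i\<close> does not affect
  the restrictions to the other, disjoint sets, so their joint event is invariant.\<close>

lemma mecke_indep_vars_restr:
 assumes I: "finite I" and S: "!!i. i \<in> I ==> S i \<in> sets E" "disjoint_family_on S I"
 shows "P.indep_vars (%_. lf) (%i. restr (S i)) I"
proof (cases "I = {}")
 case True
 then show ?thesis using P.indep_vars_empty by simp
next
 case False
 have spP: "space P = space lf" using P_sets by (rule space_eq)
 have prod: "measure P {N \<in> space lf. \<forall>i\<in>J. restr (S i) N \<in> G i} = (\<Prod>i\<in>J. measure P {N \<in> space lf. restr (S i) N \<in> G i})"
  if J: "J \<subseteq> I" and G: "!!i. i \<in> I ==> G i \<in> sets lf" for J G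
  using finite_subset[OF J I] J
 proof (induction J)
  case empty
  then show ?case using P.prob_space spP by simp
 next
  case (insert i J)
  let ?C = "{N \<in> space lf. \<forall>i\<in>J. restr (S i) N \<in> G i}"
  have i: "i \<in> I" using insert.prems by auto
  have "{N \<in> space lf. \<forall>i\<in>insert i J. restr (S i) N \<in> G i} = {N \<in> space lf. restr (S i) N \<in> G i} \<inter> ?C" by auto
  also have "measure P \<dots> = measure P {N \<in> space lf. restr (S i) N \<in> G i} * measure P ?C"
  proof (rule mecke_indep_restr[OF S(1)[OF i] G[OF i]])
   have "Measurable.pred lf (%N. \<forall>i\<in>J. restr (S i) N \<in> G i)"
   proof (rule pred_Ball_finite[OF insert.hyps(1)])
    fix j assume "j \<in> J"
    then have j: "j \<in> I" using insert.prems by auto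
    from measurable_sets[OF restr_measurable[OF S(1)[OF j]] G[OF j]]
    show "Measurable.pred lf (%N. restr (S j) N \<in> G j)" by (simp add: pred_def vimage_def Int_def conj_commute)
   qed
   then show "?C \<in> sets lf" by (simp add: pred_def)
   fix N z assume N: "N \<in> space lf" and z: "z \<in> S i"
   have zE: "z \<in> space E" using z sets.sets_into_space[OF S(1)[OF i]] by auto
   have N': "add1 N z \<in> space lf" using measurable_space[OF measurable_add1_left[OF zE] N] .
   have "restr (S j) (add1 N z) = restr (S j) N" if j: "j \<in> J" for j
   proof (rule restr_add1[OF S(1) N])
    show "j \<in> I" using j insert.prems by auto
    moreover have "i \<noteq> j" using j insert.hyps(2) by auto
    ultimately have "S i \<inter> S j = {}" using disjoint_family_onD[OF S(2) i] by simp
    then show "z \<notin> S j" using z by blast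
   qed
   then show "add1 N z \<in> ?C \<longleftrightarrow> N \<in> ?C" using N N' by auto
  qed
  also have "measure P ?C = (\<Prod>i\<in>J. measure P {N \<in> space lf. restr (S i) N \<in> G i})"
   using insert by auto
  finally show ?case using insert.hyps by simp
 qed
 show ?thesis
 proof (subst P.indep_vars_finite[OF False I, where E="%_. sets lf"])
  show "!!i. i \<in> I ==> restr (S i) \<in> P ->M lf"
   using restr_measurable[OF S(1)] by (simp cong: m_cong_sets add: P_sets)
  show "\<forall>G\<in>I \<rightarrow> sets lf. P.prob (\<Inter>j\<in>I. restr (S j) -` G j \<inter> space P) = (\<Prod>j\<in>I. P.prob (restr (S j) -` G j \<inter> space P))"
  proof
   fix G assume G: "G \<in> I \<rightarrow> sets lf"
   have "(\<Inter>j\<in>I. restr (S j) -` G j \<inter> space P) = {N \<in> space lf. \<forall>i\<in>I. restr (S i) N \<in> G i}"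
    using False by (auto simp: spP)
   moreover have "restr (S j) -` G j \<inter> space P = {N \<in> space lf. restr (S j) N \<in> G j}" for j
    by (auto simp: spP)
   ultimately show "P.prob (\<Inter>j\<in>I. restr (S j) -` G j \<inter> space P) = (\<Prod>j\<in>I. P.prob (restr (S j) -` G j \<inter> space P))"
    using prod[OF order_refl, of G] G by (simp add: Pi_iff)
  qed
 qed (simp_all add: sets.sigma_sets_eq sets.Int_stable sets.space_closed)
qed

lemma mecke_indep_vars:
 assumes I: "finite I" and A: "!!i. i \<in> I ==> A i \<in> sets E" "disjoint_family_on A I"
 shows "P.indep_vars (%_. borel) (%i N. emeasure N (A i)) I"
proof (rule indep_vars_cong_space[OF P])
 show "P.indep_vars (%_. borel) (%i N. emeasure (restr (A i) N) (space E)) I"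
  by (rule P.indep_vars_compose2[OF mecke_indep_vars_restr[OF I A]]) auto
 show "(%N. emeasure (restr (A i) N) (space E)) \<in> bm P" if "i \<in> I" for i
  using m_comp[OF restr_measurable[OF A(1)[OF that]] measurable_emeasure_lf[OF sets.top]]
  by (simp cong: m_cong_sets add: P_sets)
 show "emeasure (restr (A i) N) (space E) = emeasure N (A i)" if "i \<in> I" "N \<in> space P" for i N
  using that A(1)[OF that(1)] space_eq[OF P_sets] sets.sets_into_space[OF A(1)[OF that(1)]]
  by (subst emeasure_restr) (auto simp: sets_lfD Int_absorb2)
qed

text \<open>The converse of \<open>poisson_mecke\<close> for integer-valued configurations. It
  identifies the tilted law as Poisson once \<open>mecke_density\<close> has given its Mecke
  equation.\<close>

theorem mecke_poisson: "poisson_random_measure P E \<nu> (%N. N)"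
 unfolding poisson_random_measure_def
proof (intro conjI ballI impI allI)
 have spP: "space P = space lf" using P_sets by (rule space_eq)
 have "(%N. N) \<in> lf ->M MA E" by (rule measurable_lfD) (rule m_id)
 then show "(%N. N) \<in> P ->M MA E" by (simp cong: m_cong_sets add: P_sets)
 fix A assume A: "A \<in> sets E"
 have natA: "AE N in P. emeasure N A = \<infinity> \<or> (\<exists>k. emeasure N A = of_nat k)"
  using nat by eventually_elim (use A in auto)
 show "AE N in P. emeasure N A = \<infinity>" if "emeasure \<nu> A = \<infinity>"
  by (rule mecke_emeasure_infinite[OF P P_sets \<nu> mecke A that natA])
 show "measure P {N \<in> space P. emeasure N A = of_nat k} = measure \<nu> A ^ k / fact k * exp (- measure \<nu> A)"
  if "emeasure \<nu> A < \<infinity>" for k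
 proof -
  have "measure P ({N \<in> space lf. emeasure N A = of_nat k} \<inter> space lf) = measure \<nu> A ^ k / fact k * exp (- measure \<nu> A) * measure P (space lf)"
   using measurable_space[OF measurable_add1_left] sets.sets_into_space[OF A]
   by (intro mecke_emeasure_invariant[OF P P_sets \<nu> mecke A that natA]) auto
  moreover have "measure P (space lf) = 1" using P.prob_space by (simp add: spP)
  moreover have "{N \<in> space lf. emeasure N A = of_nat k} \<inter> space lf = {N \<in> space P. emeasure N A = of_nat k}" by (auto simp: spP)
  ultimately show ?thesis by simp
 qed
next
 fix A :: "nat => 'e set" and k assume "A ` {..<k} \<subseteq> sets E" "disjoint_family_on A {..<k}"
 then show "P.indep_vars (%_. borel) (%i N. emeasure N (A i)) {..<k}"
  by (intro mecke_indep_vars) auto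
qed

end

end

section \<open>Countable configurations of unit atoms at distinct times\<close>

definition simple_config :: "'e measure => ('e => real) => 'e measure => 'e set => bool" where
 "simple_config E tm N Z \<longleftrightarrow> countable Z \<and> Z \<subseteq> space E \<and> inj_on tm Z \<and> N = distr (count_space Z) E (%z. z)"

text \<open>\<open>Z\<close> collects the good atoms. A set of finite mass holds only finitely many
  atoms of mass one, so sigma-finiteness makes \<open>Z\<close> countable; by \<open>ae\<close>
  there is no mass outside it, and two points at one time would give their fibre mass two.\<close>

lemma simple_configI:
 fixes N :: "'e measure"
 assumes sf: "sigma_finite_measure N" and N: "sets N = sets E" and tm[measurable]: "tm \<in> E ->M (borel :: real measure)"
  and sing: "!!z. z \<in> space E ==> {z} \<in> sets E"
  and ae: "AE z in N. emeasure N {z} = 1 \<and> emeasure N {z' \<in> space E. tm z' = tm z} = 1"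
 shows "\<exists>Z. simple_config E tm N Z"
proof -
 interpret sigma_finite_measure N by fact
 have sp: "space N = space E" using N by (rule space_eq)
 define Z where "Z = {z\<in>space E. emeasure N {z} = 1 \<and> emeasure N {z' \<in> space E. tm z' = tm z} = 1}"
 have ZE: "Z \<subseteq> space E" by (auto simp: Z_def)
 obtain D :: "nat => 'e set" where D: "range D \<subseteq> sets N" "(\<Union>i. D i) = space N" "!!i. emeasure N (D i) \<noteq> \<infinity>"
  by (rule sigma_finite) auto
 have "finite (Z \<inter> D i)" for i
 proof (rule ccontr)
  assume inf: "infinite (Z \<inter> D i)"
  obtain k :: nat where k: "emeasure N (D i) < of_nat k"
   using D(3)[of i] by (metis ennreal_Ex_less_of_nat infinity_ennreal_def less_top)
  obtain X where X: "X \<subseteq> Z \<inter> D i" "finite X" "card X = k"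
   using infinite_arbitrarily_large[OF inf] by blast
  have "of_nat k = (\<Sum>x\<in>X. emeasure N {x})"
   using X by (simp add: Z_def subset_eq)
  also have "\<dots> = emeasure N X"
   using X ZE sing by (intro emeasure_eq_sum_singleton[symmetric]) (auto simp: N)
  also have "\<dots> \<le> emeasure N (D i)"
   using X D(1) by (intro emeasure_mono) auto
  finally show False using k by simp
 qed
 then have "countable (\<Union>i. Z \<inter> D i)" by (intro countable_UN) (auto intro: countable_finite)
 moreover have "(\<Union>i. Z \<inter> D i) = Z" using D(2) ZE by (auto simp: sp)
 ultimately have Zc: "countable Z" by simp
 have sub_sets: "X \<in> sets E" if "X \<subseteq> Z" for X
 proof (rule sets.countable)
  show "countable X" using countable_subset[OF that Zc] .
  show "{a} \<in> sets E" if "a \<in> X" for a using that \<open>X \<subseteq> Z\<close> ZE by (intro sing) blast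
 qed
 have "inj_on tm Z"
 proof (rule inj_onI, rule ccontr)
  fix x y assume xy: "x \<in> Z" "y \<in> Z" "tm x = tm y" "x \<noteq> y"
  have "2 = (\<Sum>z\<in>{x, y}. emeasure N {z})" using xy by (simp add: Z_def)
  also have "\<dots> = emeasure N {x, y}"
   using xy ZE sing by (intro emeasure_eq_sum_singleton[symmetric]) (auto simp: N)
  also have "\<dots> \<le> emeasure N {z' \<in> space E. tm z' = tm x}"
   using xy ZE by (intro emeasure_mono) (auto simp: N)
  also have "\<dots> = 1" using xy by (simp add: Z_def)
  finally show False by simp
 qed
 moreover have "N = distr (count_space Z) E (%z. z)"
 proof (rule measure_eqI)
  fix A assume A: "A \<in> sets N"
  have AZ: "A \<inter> Z \<in> sets E" by (rule sub_sets) auto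
  have "AE z in N. z \<in> Z" using ae AE_space by eventually_elim (auto simp: Z_def sp)
  then have "emeasure N A = emeasure N (A \<inter> Z)"
   using A AZ N by (intro emeasure_eq_AE) (auto elim!: AE_mp)
  also have "\<dots> = (NN z. emeasure N {z} \<partial>count_space (A \<inter> Z))"
   using Zc ZE sing by (intro emeasure_countable_singleton) (auto simp: N)
  also have "\<dots> = (NN z. 1 \<partial>count_space (A \<inter> Z))"
   by (intro nn_cong) (simp add: Z_def)
  also have "\<dots> = emeasure (count_space Z) (A \<inter> Z)"
   by (simp add: emeasure_count_space nn_integral_count_space_indicator)
  also have "\<dots> = emeasure (distr (count_space Z) E (%z. z)) A"
   using A ZE N by (subst emeasure_distr) (auto simp: measurable_def)
  finally show "emeasure N A = emeasure (distr (count_space Z) E (%z. z)) A" .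
 qed (simp add: N)
 ultimately show ?thesis using Zc ZE by (auto simp: simple_config_def)
qed

lemma simple_config_sets: "simple_config E tm N Z ==> sets N = sets E"
 by (simp add: simple_config_def)

lemma nn_integral_simple_config:
 assumes "simple_config E tm N Z" "f \<in> bm E"
 shows "(NN z. f z \<partial>N) = (NN z. f z \<partial>count_space Z)"
proof -
 have "Z \<subseteq> space E" and N: "N = distr (count_space Z) E (%z. z)" using assms by (auto simp: simple_config_def)
 then show ?thesis unfolding N using assms(2) by (intro nn_integral_distr) (auto simp: measurable_def)
qed

lemma emeasure_simple_config:
 assumes "simple_config E tm N Z" "A \<in> sets E"
 shows "emeasure N A = emeasure (count_space UNIV) (A \<inter> Z)"
proof -
 have "Z \<subseteq> space E" and N: "N = distr (count_space Z) E (%z. z)" using assms by (auto simp: simple_config_def)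
 then show ?thesis unfolding N using assms(2)
  by (subst emeasure_distr) (auto simp: measurable_def emeasure_count_space)
qed

lemma simple_config_nat:
 assumes "simple_config E tm N Z" "A \<in> sets E"
 shows "emeasure N A = \<infinity> \<or> (\<exists>k. emeasure N A = of_nat k)"
 using emeasure_simple_config[OF assms] by (cases "finite (A \<inter> Z)") (auto simp: emeasure_count_space)

text \<open>Each point of \<open>Z\<close> has mass one and so escapes every null set.\<close>

lemma simple_config_AE:
 assumes "simple_config E tm N Z" and "AE z in N. P z" and "!!z. z \<in> space E ==> {z} \<in> sets E" and "z \<in> Z"
 shows "P z"
proof -
 have z: "z \<in> space E" using assms(1,4) by (auto simp: simple_config_def)
 obtain B where B: "{x\<in>space N. \<not> P x} \<subseteq> B" "emeasure N B = 0" "B \<in> sets N" using assms(2) by (rule AE_E)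
 have "z \<notin> B"
 proof
  assume "z \<in> B"
  then have "emeasure N {z} \<le> emeasure N B" using B by (intro emeasure_mono) auto
  moreover have "emeasure N {z} = 1"
   using emeasure_simple_config[OF assms(1) assms(3)[OF z]] assms(4) by (simp add: emeasure_count_space)
  ultimately show False using B by simp
 qed
 then show ?thesis using B(1) z space_eq[OF simple_config_sets[OF assms(1)]] by auto
qed

text \<open>\<open>exp (- a)\<close>, continued by \<open>0\<close> at infinity. It turns sums of
  \<open>- log (1 - u)\<close> into products of \<open>1 - u\<close>, including jumps
  \<open>u = 1\<close>.\<close>

definition exp_neg :: "ennreal => ennreal" where
 "exp_neg a = (if a = \<infinity> then 0 else ennreal (exp (- enn2real a)))"

lemma exp_neg_0 [simp]: "exp_neg 0 = 1" and exp_neg_top [simp]: "exp_neg \<infinity> = 0" "exp_neg top = 0"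
 by (simp_all add: exp_neg_def)

lemma exp_neg_ennreal: "0 \<le> r ==> exp_neg (ennreal r) = ennreal (exp (- r))"
 by (simp add: exp_neg_def)

lemma exp_neg_add: "exp_neg (a + b) = exp_neg a * exp_neg b"
 by (cases a; cases b) (simp_all add: exp_neg_ennreal ennreal_mult[symmetric] exp_add[symmetric] ennreal_plus[symmetric] del: ennreal_plus)

lemma exp_neg_antimono: "a \<le> b ==> exp_neg b \<le> exp_neg a"
 by (cases a; cases b) (auto simp: exp_neg_ennreal top_unique)

lemma exp_neg_le_1: "exp_neg a \<le> 1"
 using exp_neg_antimono[of 0 a] by simp

lemma borel_measurable_exp_neg [measurable]: "exp_neg \<in> bm borel"
 unfolding exp_neg_def by measurable

lemma exp_neg_sum: "exp_neg (\<Sum>i\<in>I. f i) = (\<Prod>i\<in>I. exp_neg (f i))"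
 by (induction I rule: infinite_finite_induct) (auto simp: exp_neg_add)

lemma exp_neg_SUP:
 assumes b: "incseq b"
 shows "exp_neg (SUP n. b n) = (INF n. exp_neg (b n))"
proof (rule LIMSEQ_unique)
 show "(%n. exp_neg (b n)) \<longlonglongrightarrow> (INF n. exp_neg (b n))"
  by (intro LIMSEQ_INF) (use b in \<open>auto simp: decseq_def incseq_def intro!: exp_neg_antimono\<close>)
 define S where "S = (SUP n. b n)"
 have lim: "b \<longlonglongrightarrow> S" unfolding S_def by (rule LIMSEQ_SUP[OF b])
 have "(%n. exp_neg (b n)) \<longlonglongrightarrow> exp_neg S"
 proof (cases "S = \<infinity>")
  case False
  then have S: "S < top" by (simp add: less_top)
  have "b n \<le> S" for n unfolding S_def by (rule SUP_upper) simp
  then have "b n < top" for n using S by (rule order_le_less_trans)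
  then have fin: "b n \<noteq> top" for n by (simp add: less_top[symmetric])
  have "(%n. enn2real (b n)) \<longlonglongrightarrow> enn2real S"
  proof (rule tendsto_enn2real)
   show "b \<longlonglongrightarrow> ennreal (enn2real S)" using lim S by simp
  qed simp
  then have "(%n. ennreal (exp (- enn2real (b n)))) \<longlonglongrightarrow> ennreal (exp (- enn2real S))"
   by (intro tendsto_ennrealI tendsto_exp tendsto_minus)
  then show ?thesis using False fin by (simp add: exp_neg_def)
 next
  case True
  have "(%n. exp_neg (b n)) \<longlonglongrightarrow> 0"
  proof (rule order_tendstoI)
   fix a :: ennreal assume "0 < a"
   obtain r where r: "0 < r" "ennreal r < a"
    using \<open>0 < a\<close> by (metis ennreal_0 ennreal_less_iff ennreal_rat_dense of_rat_0 dense le_less ennreal_cases ennreal_less_top gt_ex less_imp_le)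
   \<comment> \<open>Beyond \<open>- ln r\<close> the exponential is below \<open>r\<close>; the
     maximum with \<open>0\<close> is there because \<open>exp_neg_ennreal\<close> needs a
     nonnegative argument.\<close>
   define K where "K = max 0 (- ln r)"
   have "eventually (%n. ennreal K < b n) sequentially"
    using lim True by (intro order_tendstoD(1)[OF lim]) (simp add: ennreal_less_top)
   then show "eventually (%n. exp_neg (b n) < a) sequentially"
   proof eventually_elim
    fix n assume "ennreal K < b n"
    then have "exp_neg (b n) \<le> exp_neg (ennreal K)" by (intro exp_neg_antimono) simp
    also have "\<dots> = ennreal (exp (- K))" by (subst exp_neg_ennreal) (auto simp: K_def)
    also have "exp (- K) \<le> exp (ln r)" by (simp add: K_def)
    then have "ennreal (exp (- K)) \<le> ennreal r" using r by (simp add: ennreal_leI)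
    also have "ennreal r < a" by fact
    finally show "exp_neg (b n) < a" .
   qed
  qed simp
  then show ?thesis using True by simp
 qed
 then show "(%n. exp_neg (b n)) \<longlonglongrightarrow> exp_neg (SUP n. b n)" by (simp only: S_def)
qed

lemma exp_neg_neg_log_compl:
 assumes "u \<le> 1"
 shows "exp_neg (neg_log_compl (ennreal u)) = 1 - ennreal u"
proof (cases "0 \<le> u")
 case True
 show ?thesis
 proof (cases "u < 1")
  case True
  with \<open>0 \<le> u\<close> have "ln (1 - u) \<le> 0" by simp
  moreover have "1 - ennreal u = ennreal (1 - u)"
   using ennreal_minus[OF \<open>0 \<le> u\<close>, of 1] by simp
  moreover have "ennreal u < 1" using True by (simp add: ennreal_less_one_iff)
  ultimately show ?thesis
   using True \<open>0 \<le> u\<close> by (simp add: neg_log_compl_def exp_neg_ennreal)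
 next
  case False
  with assms have "u = 1" by simp
  then show ?thesis by (simp add: neg_log_compl_def)
 qed
next
 case False
 then have "ennreal u = 0" by (simp add: ennreal_neg)
 then show ?thesis by (simp add: neg_log_compl_def)
qed

lemma borel_measurable_neg_log_compl [measurable]: "neg_log_compl \<in> bm borel"
 unfolding neg_log_compl_def by measurable

lemma neg_log_compl_0 [simp]: "neg_log_compl 0 = 0"
 by (simp add: neg_log_compl_def)

lemma neg_log_compl_pos: "0 < u ==> 0 < neg_log_compl (ennreal u)"
proof (cases "u < 1")
 case True
 assume "0 < u"
 then have "ln (1 - u) < 0" using True by simp
 with True \<open>0 < u\<close> show ?thesis by (simp add: neg_log_compl_def ennreal_less_one_iff)
qed (auto simp: neg_log_compl_def ennreal_less_one_iff)

section \<open>Countable sums\<close>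

lemma countable_exhaustion:
 assumes "countable W"
 obtains G :: "nat => 'a set" where "!!n. finite (G n)" "!!n. G n \<subseteq> W" "incseq G" "(\<Union>n. G n) = W"
proof
 let ?G = "%n. W \<inter> from_nat_into W ` {..<n}"
 show "finite (?G n)" "?G n \<subseteq> W" for n by auto
 show "incseq ?G" by (auto simp: incseq_def)
 show "(\<Union>n. ?G n) = W"
 proof (intro equalityI subsetI)
  fix x assume x: "x \<in> W"
  then have "x = from_nat_into W (to_nat_on W x)" using assms by simp
  then have "x \<in> ?G (Suc (to_nat_on W x))" using x by (auto intro!: image_eqI[of _ _ "to_nat_on W x"])
  then show "x \<in> (\<Union>n. ?G n)" by blast
 qed auto
qed

lemma nn_integral_count_space_SUP:
 fixes f :: "'a => ennreal"
 assumes "!!n::nat. finite (G n)" "incseq G" "(\<Union>n. G n) = W"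
 shows "(NN z. f z \<partial>count_space W) = (SUP n. \<Sum>z\<in>G n. f z)"
proof -
 have GW: "G n \<subseteq> W" for n using assms(3) by blast
 have "(NN z. f z \<partial>count_space W) = (NN z. (SUP n. f z * ind1 (G n) z) \<partial>count_space W)"
 proof (rule nn_cong)
  fix z assume "z \<in> space (count_space W)"
  then obtain n where n: "z \<in> G n" using assms(3) by auto
  show "f z = (SUP n. f z * ind1 (G n) z)"
   by (rule antisym, rule SUP_upper2[of n]) (use n in \<open>auto intro!: SUP_least split: split_indicator\<close>)
 qed
 also have "\<dots> = (SUP n. NN z. f z * ind1 (G n) z \<partial>count_space W)"
  using assms(2) by (intro nn_integral_monotone_convergence_SUP)
   (auto simp: incseq_def le_fun_def split: split_indicator)
 also have "\<dots> = (SUP n. \<Sum>z\<in>G n. f z)"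
 proof (intro SUP_cong refl)
  fix n
  have "(NN z. f z * ind1 (G n) z \<partial>count_space W) = (NN z. f z \<partial>count_space (G n))"
   using GW[of n] by (subst (2) nn_integral_count_space_indicator) (auto simp: nn_integral_count_space_indicator intro!: nn_cong split: split_indicator)
  then show "(NN z. f z * ind1 (G n) z \<partial>count_space W) = (\<Sum>z\<in>G n. f z)"
   using assms(1) by (simp add: nn_integral_count_space_finite)
 qed
 finally show ?thesis .
qed

text \<open>Brings the exponential of a countable sum into the form of \<open>survival_left\<close>,
  an infimum of finite products. Finite partial sums give one inequality; for the other,
  \<open>exp_neg\<close> is continuous along an increasing sequence of finite sets that exhausts
  \<open>W\<close>.\<close>

lemma exp_neg_count_space:
 assumes "countable W"
 shows "exp_neg (NN z. f z \<partial>count_space W) = (INF F \<in> {F. finite F \<and> F \<subseteq> W}. \<Prod>z\<in>F. exp_neg (f z))"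
proof (rule antisym)
 obtain G :: "nat => 'a set" where G: "!!n. finite (G n)" "!!n. G n \<subseteq> W" "incseq G" "(\<Union>n. G n) = W"
  using countable_exhaustion[OF assms] by metis
 show "exp_neg (NN z. f z \<partial>count_space W) \<le> (INF F \<in> {F. finite F \<and> F \<subseteq> W}. \<Prod>z\<in>F. exp_neg (f z))"
 proof (rule INF_greatest)
  fix F assume F: "F \<in> {F. finite F \<and> F \<subseteq> W}"
  then have "(\<Sum>z\<in>F. f z) = (NN z. f z \<partial>count_space F)" by (simp add: nn_integral_count_space_finite)
  also have "\<dots> \<le> (NN z. f z \<partial>count_space W)"
   using F by (subst (1 2) nn_integral_count_space_indicator) (auto intro!: nn_integral_mono split: split_indicator)
  finally show "exp_neg (NN z. f z \<partial>count_space W) \<le> (\<Prod>z\<in>F. exp_neg (f z))"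
   unfolding exp_neg_sum[symmetric] by (rule exp_neg_antimono)
 qed
 have "incseq (%n. \<Sum>z\<in>G n. f z)"
  by (intro monoI sum_mono2 G(1) incseqD[OF G(3)]) auto
 then have "exp_neg (NN z. f z \<partial>count_space W) = (INF n. \<Prod>z\<in>G n. exp_neg (f z))"
  unfolding nn_integral_count_space_SUP[OF G(1,3,4)] by (subst exp_neg_SUP) (auto simp: exp_neg_sum)
 also have "\<dots> \<ge> (INF F \<in> {F. finite F \<and> F \<subseteq> W}. \<Prod>z\<in>F. exp_neg (f z))"
  using G by (intro INF_greatest INF_lower) auto
 finally show "(INF F \<in> {F. finite F \<and> F \<subseteq> W}. \<Prod>z\<in>F. exp_neg (f z)) \<le> exp_neg (NN z. f z \<partial>count_space W)" .
qed

lemma ennreal_add_compl: "u \<le> 1 ==> u + (1 - u) = (1 :: ennreal)"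
 by (metis add_diff_inverse_ennreal)

text \<open>Decomposes the certain event according to the first failure, with total survival as the
  remaining case. The induction removes the latest point, whose predecessors are all the
  others.\<close>

lemma sum_prod_compl_finite:
 fixes u :: "'a => ennreal" and \<tau> :: "'a => real"
 assumes "finite X" "inj_on \<tau> X" "!!z. z \<in> X ==> u z \<le> 1"
 shows "(\<Sum>z\<in>X. u z * (\<Prod>y\<in>{y\<in>X. \<tau> y < \<tau> z}. 1 - u y)) + (\<Prod>z\<in>X. 1 - u z) = 1"
 using assms
proof (induction "card X" arbitrary: X)
 case (Suc n)
 then have "X \<noteq> {}" by auto
 obtain m where m: "m \<in> X" "!!z. z \<in> X ==> \<tau> z \<le> \<tau> m"
  using Max_in[of "\<tau> ` X"] Max_ge[of "\<tau> ` X"] Suc.prems(1) \<open>X \<noteq> {}\<close>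
  by (metis (no_types, lifting) finite_imageI image_iff image_is_empty)
 let ?X = "X - {m}"
 have lt: "\<tau> z < \<tau> m" if "z \<in> ?X" for z
  using m(2)[of z] m(1) that Suc.prems(2) by (auto simp: inj_on_def le_less)
 have 1: "{y\<in>X. \<tau> y < \<tau> z} = {y\<in>?X. \<tau> y < \<tau> z}" if "z \<in> ?X" for z
  using lt[OF that] by auto
 have 2: "{y\<in>X. \<tau> y < \<tau> m} = ?X" using lt by auto
 have "(\<Sum>z\<in>X. u z * (\<Prod>y\<in>{y\<in>X. \<tau> y < \<tau> z}. 1 - u y)) + (\<Prod>z\<in>X. 1 - u z) =
   (u m * (\<Prod>y\<in>?X. 1 - u y) + (\<Sum>z\<in>?X. u z * (\<Prod>y\<in>{y\<in>?X. \<tau> y < \<tau> z}. 1 - u y))) + (1 - u m) * (\<Prod>z\<in>?X. 1 - u z)"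
  using m(1) Suc.prems(1) 1 by (simp add: sum.remove[of X m] prod.remove[of X m] 2)
 also have "\<dots> = (u m + (1 - u m)) * (\<Prod>y\<in>?X. 1 - u y) + (\<Sum>z\<in>?X. u z * (\<Prod>y\<in>{y\<in>?X. \<tau> y < \<tau> z}. 1 - u y))"
  by (simp add: distrib_right ac_simps)
 also have "\<dots> = (\<Sum>z\<in>?X. u z * (\<Prod>y\<in>{y\<in>?X. \<tau> y < \<tau> z}. 1 - u y)) + (\<Prod>z\<in>?X. 1 - u z)"
  using Suc.prems(3)[OF m(1)] by (simp add: ennreal_add_compl add.commute)
 also have "\<dots> = 1"
  using Suc m by (intro Suc.hyps(1)) (auto intro: inj_on_subset)
 finally show ?case .
qed simp

text \<open>The union bound, written with sums only because subtraction on \<open>ennreal\<close> is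
  truncated.\<close>

lemma one_le_sum_prod_compl:
 fixes u :: "'a => ennreal"
 assumes "finite X" "!!z. z \<in> X ==> u z \<le> 1"
 shows "1 \<le> (\<Sum>z\<in>X. u z) + (\<Prod>z\<in>X. 1 - u z)"
 using assms
proof (induction X)
 case (insert m X)
 have le1: "(\<Prod>z\<in>X. 1 - u z) \<le> 1"
  by (rule prod_le_1) auto
 have "1 \<le> (\<Sum>z\<in>X. u z) + (\<Prod>z\<in>X. 1 - u z)" using insert by simp
 also have "(\<Prod>z\<in>X. 1 - u z) = (u m + (1 - u m)) * (\<Prod>z\<in>X. 1 - u z)"
  using insert.prems[of m] by (simp add: ennreal_add_compl)
 also have "\<dots> \<le> u m * 1 + (1 - u m) * (\<Prod>z\<in>X. 1 - u z)"
  unfolding distrib_right using le1 by (intro add_mono mult_left_mono) auto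
 finally show ?case using insert.hyps by (simp add: ac_simps)
qed simp

text \<open>When \<open>exp_neg (h z) = 1 - u z\<close>, this is the possibly infinite product of
  \<open>1 - u\<close> over \<open>X\<close>.\<close>

definition pcompl :: "('a => ennreal) => 'a set => ennreal" where
 "pcompl h X = exp_neg (NN z. h z \<partial>count_space X)"

context
 fixes W :: "'a set" and \<tau> :: "'a => real" and u :: "'a => ennreal" and h :: "'a => ennreal"
 assumes W: "countable W" and inj: "inj_on \<tau> W"
  and u1: "!!z. z \<in> W ==> u z \<le> 1" and h: "!!z. z \<in> W ==> exp_neg (h z) = 1 - u z"
begin

lemma pcompl_finite: "finite X ==> X \<subseteq> W ==> pcompl h X = (\<Prod>z\<in>X. 1 - u z)"
 unfolding pcompl_def using h
 by (auto simp: nn_integral_count_space_finite exp_neg_sum intro!: prod.cong)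

lemma pcompl_INF: "X \<subseteq> W ==> pcompl h X = (INF F \<in> {F. finite F \<and> F \<subseteq> X}. \<Prod>z\<in>F. 1 - u z)"
 unfolding pcompl_def
 by (subst exp_neg_count_space[OF countable_subset[OF _ W]]) (auto intro!: INF_cong prod.cong h)

lemma pcompl_antimono: "X \<subseteq> Y ==> pcompl h Y \<le> pcompl h X"
 unfolding pcompl_def
 by (rule exp_neg_antimono, subst (1 2) nn_integral_count_space_indicator)
  (auto intro!: nn_integral_mono split: split_indicator)

lemma pcompl_Un: "X \<inter> Y = {} ==> pcompl h (X \<union> Y) = pcompl h X * pcompl h Y"
proof -
 assume XY: "X \<inter> Y = {}"
 have "(NN z. h z \<partial>count_space (X \<union> Y)) = (NN z. h z * ind1 X z + h z * ind1 Y z \<partial>count_space UNIV)"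
  using XY by (subst nn_integral_count_space_indicator) (auto intro!: nn_cong split: split_indicator)
 also have "\<dots> = (NN z. h z \<partial>count_space X) + (NN z. h z \<partial>count_space Y)"
  by (simp add: nn_integral_add nn_integral_count_space_indicator)
 finally show ?thesis unfolding pcompl_def by (simp add: exp_neg_add)
qed

lemma one_le_pcompl:
 assumes "X \<subseteq> W"
 shows "1 \<le> (NN z. u z \<partial>count_space X) + pcompl h X"
proof -
 have "1 - (NN z. u z \<partial>count_space X) \<le> pcompl h X"
  unfolding pcompl_INF[OF assms]
 proof (rule INF_greatest)
  fix F assume F: "F \<in> {F. finite F \<and> F \<subseteq> X}"
  have "1 \<le> (\<Sum>z\<in>F. u z) + (\<Prod>z\<in>F. 1 - u z)"
   using F assms u1 by (intro one_le_sum_prod_compl) auto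
  also have "(\<Sum>z\<in>F. u z) = (NN z. u z \<partial>count_space F)" using F by (simp add: nn_integral_count_space_finite)
  also have "\<dots> \<le> (NN z. u z \<partial>count_space X)"
   using F by (subst (1 2) nn_integral_count_space_indicator) (auto intro!: nn_integral_mono split: split_indicator)
  finally show "1 - (NN z. u z \<partial>count_space X) \<le> (\<Prod>z\<in>F. 1 - u z)"
   by (auto simp: ennreal_minus_le_iff add_right_mono)
 qed
 then show ?thesis by (simp add: ennreal_minus_le_iff)
qed

abbreviation before :: "'a => 'a set" where "before z \<equiv> {y\<in>W. \<tau> y < \<tau> z}"

text \<open>For finite sets there is equality, and admitting further predecessors only lowers
  survival factors. Equality may fail in the limit: if jumps with divergent sum accumulate at a time
  from the right, survival drops to zero although there is no first failure.\<close>

lemma sum_pcompl_le: "(NN z. u z * pcompl h (before z) \<partial>count_space W) + pcompl h W \<le> 1"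
proof -
 obtain G :: "nat => 'a set" where G: "!!n. finite (G n)" "!!n. G n \<subseteq> W" "incseq G" "(\<Union>n. G n) = W"
  using countable_exhaustion[OF W] by metis
 have *: "(\<Sum>z\<in>G n. u z * pcompl h (before z)) + pcompl h W \<le> 1" for n
 proof -
  have "pcompl h (before z) \<le> (\<Prod>y\<in>{y\<in>G n. \<tau> y < \<tau> z}. 1 - u y)" for z
   using pcompl_antimono[of "{y\<in>G n. \<tau> y < \<tau> z}" "before z"] pcompl_finite[of "{y\<in>G n. \<tau> y < \<tau> z}"] G
   by fastforce
  then have "(\<Sum>z\<in>G n. u z * pcompl h (before z)) + pcompl h W \<le>
   (\<Sum>z\<in>G n. u z * (\<Prod>y\<in>{y\<in>G n. \<tau> y < \<tau> z}. 1 - u y)) + (\<Prod>z\<in>G n. 1 - u z)"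
   using pcompl_antimono[OF G(2)[of n]] pcompl_finite[OF G(1,2), of n]
   by (intro add_mono sum_mono mult_left_mono) auto
  also have "\<dots> = 1"
   using G(1)[of n] G(2)[of n] u1 inj
   by (intro sum_prod_compl_finite) (auto intro: inj_on_subset simp: subset_eq)
  finally show ?thesis .
 qed
 have "(NN z. u z * pcompl h (before z) \<partial>count_space W) + pcompl h W =
   (SUP n. (\<Sum>z\<in>G n. u z * pcompl h (before z)) + pcompl h W)"
  unfolding nn_integral_count_space_SUP[OF G(1,3,4)] by (rule ennreal_SUP_add_left[symmetric]) simp
 also have "\<dots> \<le> 1" using * by (intro SUP_least) auto
 finally show ?thesis .
qed

text \<open>The finiteness assumption excludes such accumulation. Given a finite \<open>X\<close>, a
  finite \<open>F\<close> around it is chosen that misses jumps of total size at most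
  \<open>d\<close> up to the last time in \<open>X\<close>. The finite identity holds on
  \<open>F\<close>, and passing to all predecessors costs at most \<open>d\<close> at each point,
  weighted by its jump.\<close>

lemma sum_pcompl_eq:
 assumes fin: "!!z. z \<in> W ==> (NN y. u y \<partial>count_space {y\<in>W. \<tau> y \<le> \<tau> z}) < \<infinity>"
 shows "(NN z. u z * pcompl h (before z) \<partial>count_space W) + pcompl h W = 1"
proof (rule antisym[OF sum_pcompl_le])
 let ?I = "NN z. u z * pcompl h (before z) \<partial>count_space W"
 have "1 - ?I \<le> pcompl h W"
  unfolding pcompl_INF[OF order_refl]
 proof (rule INF_greatest)
  fix X assume X: "X \<in> {F. finite F \<and> F \<subseteq> W}"
  have "1 \<le> ?I + (\<Prod>z\<in>X. 1 - u z)"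
  proof (cases "X = {}")
   case False
   obtain m where m: "m \<in> X" "!!z. z \<in> X ==> \<tau> z \<le> \<tau> m"
    using Max_in[of "\<tau> ` X"] Max_ge[of "\<tau> ` X"] X False
    by (metis (no_types, lifting) finite_imageI image_iff image_is_empty mem_Collect_eq)
   define Y where "Y = {y\<in>W. \<tau> y \<le> \<tau> m}"
   have YW: "Y \<subseteq> W" and XY: "X \<subseteq> Y" using X m by (auto simp: Y_def)
   define U where "U = (NN y. u y \<partial>count_space Y)"
   have U: "U < \<infinity>" using fin[of m] X m by (auto simp: Y_def U_def)
   obtain G :: "nat => 'a set" where G: "!!n. finite (G n)" "!!n. G n \<subseteq> Y" "incseq G" "(\<Union>n. G n) = Y"
    using countable_exhaustion[OF countable_subset[OF YW W]] by metis
   show ?thesis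
   proof (rule ennreal_le_epsilon)
    fix e :: real assume e: "0 < e"
    \<comment> \<open>Chosen so that the accumulated error \<open>d * U\<close> is at most
      \<open>e\<close>; the summand one avoids division by zero.\<close>
    define d where "d = ennreal e / (1 + U)"
    have d: "0 < d" "d * U \<le> ennreal e"
    proof -
     show "0 < d" using e U by (simp add: d_def ennreal_zero_less_divide)
     have "d * U \<le> d * (1 + U)" by (intro mult_left_mono) auto
     also have "\<dots> = ennreal e" using U unfolding d_def by (intro ennreal_divide_times[THEN trans] ) (auto simp: ennreal_divide_times)
     finally show "d * U \<le> ennreal e" .
    qed
    have Ueq: "U = (SUP n. \<Sum>z\<in>G n. u z)" unfolding U_def by (rule nn_integral_count_space_SUP[OF G(1,3,4)])
    obtain n where n: "U - d \<le> (\<Sum>z\<in>G n. u z)"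
    proof (cases "U = 0")
     case False
     then have "U - d < U" using d U by (intro ennreal_between) (auto simp: zero_less_iff_neq_zero)
     with Ueq have "U - d < (SUP n. \<Sum>z\<in>G n. u z)" by simp
     then show ?thesis using that by (auto simp: less_SUP_iff intro: less_imp_le)
    qed (auto intro: that)
    define F where "F = G n \<union> X"
    have F: "finite F" "F \<subseteq> Y" "X \<subseteq> F" using G X XY by (auto simp: F_def)
    have split: "U = (NN y. u y \<partial>count_space (Y - F)) + (\<Sum>z\<in>F. u z)"
    proof -
     have "U = (NN z. u z * ind1 (Y - F) z + u z * ind1 F z \<partial>count_space UNIV)"
      unfolding U_def using F by (subst nn_integral_count_space_indicator) (auto intro!: nn_cong split: split_indicator)
     also have "\<dots> = (NN z. u z \<partial>count_space (Y - F)) + (NN z. u z \<partial>count_space F)"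
      by (simp add: nn_integral_add nn_integral_count_space_indicator)
     finally show ?thesis using F by (simp add: nn_integral_count_space_finite)
    qed
    have "(\<Sum>z\<in>G n. u z) \<le> (\<Sum>z\<in>F. u z)" using F by (intro sum_mono2) (auto simp: F_def)
    with n have n': "U - d \<le> (\<Sum>z\<in>F. u z)" by simp
    have SF: "(\<Sum>z\<in>F. u z) < \<infinity>" using split U by (auto simp: less_top[symmetric])
    have rest: "(NN y. u y \<partial>count_space (Y - F)) \<le> d"
    proof -
     have "U \<le> d + (\<Sum>z\<in>F. u z)" using n' by (simp add: ennreal_minus_le_iff)
     then show ?thesis using SF unfolding split by (subst (asm) (1 2) add.commute) (auto simp: ennreal_add_left_cancel_le)
    qed
    \<comment> \<open>The predecessors outside \<open>F\<close> have jumps of total size at most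
      \<open>d\<close>, so by the union bound the product over them is at least
      \<open>1 - d\<close>.\<close>
    have close: "(\<Prod>y\<in>{y\<in>F. \<tau> y < \<tau> z}. 1 - u y) \<le> pcompl h (before z) + d" if z: "z \<in> F" for z
    proof -
     let ?F = "{y\<in>F. \<tau> y < \<tau> z}" and ?R = "before z - {y\<in>F. \<tau> y < \<tau> z}"
     have zm: "\<tau> z \<le> \<tau> m" using z F by (auto simp: Y_def)
     have FW: "?F \<subseteq> W" using F YW by auto
     have pF: "pcompl h ?F = (\<Prod>y\<in>?F. 1 - u y)" using F FW by (intro pcompl_finite) auto
     have "?F \<union> ?R = before z" using FW by auto
     then have 1: "pcompl h (before z) = pcompl h ?F * pcompl h ?R" using pcompl_Un[of ?F ?R] by simp
     have "?R \<subseteq> Y - F" using zm by (auto simp: Y_def)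
     then have "(NN y. u y \<partial>count_space ?R) \<le> (NN y. u y \<partial>count_space (Y - F))"
      by (subst (1 2) nn_integral_count_space_indicator) (auto intro!: nn_integral_mono split: split_indicator)
     also note rest
     finally have R: "(NN y. u y \<partial>count_space ?R) \<le> d" .
     have "1 \<le> (NN y. u y \<partial>count_space ?R) + pcompl h ?R" by (rule one_le_pcompl) auto
     also have "\<dots> \<le> d + pcompl h ?R" using R by (rule add_right_mono)
     finally have 2: "1 \<le> d + pcompl h ?R" .
     have "pcompl h ?F = pcompl h ?F * 1" by simp
     also have "\<dots> \<le> pcompl h ?F * (d + pcompl h ?R)" by (intro mult_left_mono 2) simp
     also have "\<dots> = pcompl h ?F * d + pcompl h (before z)" by (simp add: 1 distrib_left)
     also have "pcompl h ?F * d \<le> 1 * d" unfolding pcompl_def by (intro mult_right_mono exp_neg_le_1) simp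
     finally show ?thesis unfolding pF by (simp add: add.commute)
    qed
    have "1 = (\<Sum>z\<in>F. u z * (\<Prod>y\<in>{y\<in>F. \<tau> y < \<tau> z}. 1 - u y)) + (\<Prod>z\<in>F. 1 - u z)"
     using F YW u1 inj by (intro sum_prod_compl_finite[symmetric]) (auto intro: inj_on_subset)
    also have "\<dots> \<le> (\<Sum>z\<in>F. u z * (pcompl h (before z) + d)) + (\<Prod>z\<in>X. 1 - u z)"
    proof (intro add_mono sum_mono mult_left_mono close)
     have "pcompl h F \<le> pcompl h X" by (rule pcompl_antimono) fact
     then show "(\<Prod>z\<in>F. 1 - u z) \<le> (\<Prod>z\<in>X. 1 - u z)"
      using pcompl_finite[of F] pcompl_finite[of X] F X YW by auto
    qed auto
    also have "(\<Sum>z\<in>F. u z * (pcompl h (before z) + d)) = (\<Sum>z\<in>F. u z * pcompl h (before z)) + d * (\<Sum>z\<in>F. u z)"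
     by (simp add: distrib_left sum.distrib sum_distrib_left mult.commute)
    also have "(\<Sum>z\<in>F. u z * pcompl h (before z)) \<le> ?I"
    proof -
     have "(\<Sum>z\<in>F. u z * pcompl h (before z)) = (NN z. u z * pcompl h (before z) \<partial>count_space F)"
      using F by (simp add: nn_integral_count_space_finite)
     also have "\<dots> \<le> ?I"
      using order_trans[OF F(2) YW] by (subst (1 2) nn_integral_count_space_indicator) (auto intro!: nn_integral_mono split: split_indicator)
     finally show ?thesis .
    qed
    also have "d * (\<Sum>z\<in>F. u z) \<le> ennreal e"
    proof -
     have "(\<Sum>z\<in>F. u z) \<le> U" unfolding split by simp
     then have "d * (\<Sum>z\<in>F. u z) \<le> d * U" by (intro mult_left_mono) auto
     then show ?thesis using d by simp
    qed
    finally show "1 \<le> ?I + (\<Prod>z\<in>X. 1 - u z) + ennreal e"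
     by (simp add: ac_simps)
   qed
  qed simp
  then show "1 - ?I \<le> (\<Prod>z\<in>X. 1 - u z)" by (simp add: ennreal_minus_le_iff)
 qed
 then show "1 \<le> ?I + pcompl h W" by (simp add: ennreal_minus_le_iff)
qed

end

section \<open>The mark space and the survival functional of a configuration\<close>

abbreviation tm :: "real \<times> real \<times> 'x => real" where "tm z \<equiv> fst (snd z)"

abbreviation EE :: "(real \<times> real \<times> 'x::polish_space) measure" where "EE \<equiv> unit_jumps \<Otimes>\<^sub>M base"

lemma space_unit_jumps [simp]: "space unit_jumps = {0<..1}"
 by (simp add: unit_jumps_def space_restrict_space)

lemma space_base [simp]: "space (base :: (real \<times> 'x::polish_space) measure) = {0<..} \<times> UNIV"
 by (simp add: base_def space_restrict_space)

lemma unit_jumps_borel: "(%u. u) \<in> unit_jumps ->M borel"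
 unfolding unit_jumps_def by (rule measurable_restrict_space1) simp

lemma base_borel: "(%p. p) \<in> base ->M (borel :: (real \<times> 'x::polish_space) measure)"
 unfolding base_def by (rule measurable_restrict_space1) simp

lemma measurable_fst_base [measurable]: "fst \<in> (base :: (real \<times> 'x::polish_space) measure) ->M borel"
 using m_comp[OF base_borel, of fst borel] by (simp add: borel_prod[symmetric])

lemma measurable_jump [measurable]: "fst \<in> (EE :: (real \<times> real \<times> 'x::polish_space) measure) ->M borel"
 by (rule m_comp[OF measurable_fst unit_jumps_borel])

lemma measurable_tm [measurable]: "(%z. fst (snd z)) \<in> (EE :: (real \<times> real \<times> 'x::polish_space) measure) ->M borel"
 by (rule m_comp[OF measurable_snd measurable_fst_base])

lemma diag_pred: "Measurable.pred (borel \<Otimes>\<^sub>M borel) (%x :: 'a \<times> 'a::{second_countable_topology,t2_space}. fst x = snd x)"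
proof -
 have "closed {x :: 'a \<times> 'a. fst x = snd x}" by (intro closed_Collect_eq continuous_intros)
 then show ?thesis unfolding borel_prod pred_def by simp
qed

lemma diag_base: "Measurable.pred (base \<Otimes>\<^sub>M base) (%x :: (real \<times> 'x::polish_space) \<times> _. fst x = snd x)"
proof -
 have "(%x :: (real \<times> 'x) \<times> (real \<times> 'x). (fst x, snd x)) \<in> base \<Otimes>\<^sub>M base ->M borel \<Otimes>\<^sub>M borel"
  by (intro measurable_Pair m_comp[OF measurable_fst base_borel] m_comp[OF measurable_snd base_borel])
 from m_comp[OF this diag_pred] show ?thesis by simp
qed

lemma diag_EE: "Measurable.pred (EE \<Otimes>\<^sub>M EE) (%x :: (real \<times> real \<times> 'x::polish_space) \<times> _. fst x = snd x)"
proof -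
 have 1: "(%x :: ('x mark) \<times> _. (snd (fst x), snd (snd x))) \<in> EE \<Otimes>\<^sub>M EE ->M base \<Otimes>\<^sub>M base"
  by measurable
 have 2: "(%x :: ('x mark) \<times> _. (fst (fst x), fst (snd x))) \<in> EE \<Otimes>\<^sub>M EE ->M borel \<Otimes>\<^sub>M borel"
  by (intro measurable_Pair m_comp[OF measurable_fst measurable_jump] m_comp[OF measurable_snd measurable_jump])
 have [measurable]: "Measurable.pred (EE \<Otimes>\<^sub>M EE) (%x :: ('x mark) \<times> _. fst (fst x) = fst (snd x))"
  "Measurable.pred (EE \<Otimes>\<^sub>M EE) (%x :: ('x mark) \<times> _. snd (fst x) = snd (snd x))"
  using m_comp[OF 1 diag_base] m_comp[OF 2 diag_pred] by simp_all
 show ?thesis by (subst prod_eq_iff) measurable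
qed

lemma singleton_sets:
 assumes "Measurable.pred (E \<Otimes>\<^sub>M E) (%x. fst x = snd x)" "z \<in> space E"
 shows "{z} \<in> sets E"
proof -
 have "Measurable.pred E (%y. y = z)"
  using m_comp[OF measurable_Pair2'[OF assms(2)] assms(1)] by simp
 then have "{y \<in> space E. y = z} \<in> sets E" by (simp add: pred_def)
 also have "{y \<in> space E. y = z} = {z}" using assms(2) by auto
 finally show ?thesis .
qed

lemmas singleton_EE = singleton_sets[OF diag_EE] and singleton_base = singleton_sets[OF diag_base]

text \<open>The product of \<open>1 - u\<close> over the points with time in \<open>T\<close>. As an
  exponential integral it makes sense for every configuration and not only for simple ones.\<close>

definition survT :: "(real \<times> real \<times> 'x::polish_space) measure => real set => ennreal" where
 "survT N T = exp_neg (NN z. neg_log_compl (ennreal (fst z)) * ind1 T (tm z) \<partial>N)"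

lemma survT_le_1: "survT N T \<le> 1"
 unfolding survT_def by (rule exp_neg_le_1)

lemma sets_crm [simp, measurable_cong]: "sets (crm N) = sets base"
 and space_crm [simp]: "space (crm N) = space base"
 by (simp_all add: crm_def jump_integral_def)

lemma nn_integral_jump_integral:
 assumes N[measurable_cong]: "sets N = sets (J \<Otimes>\<^sub>M (base :: (real \<times> 'x::polish_space) measure))"
  and \<phi>[measurable]: "\<phi> \<in> bm J" and f[measurable]: "f \<in> bm base"
 shows "(NN p. f p \<partial>jump_integral \<phi> N) = (NN z. \<phi> (fst z) * f (snd z) \<partial>N)"
proof -
 have "(NN p. f p \<partial>jump_integral \<phi> N) = (NN z. f (snd z) \<partial>density N (%(z, p). \<phi> z))"
  unfolding jump_integral_def by (rule nn_integral_distr) measurable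
 also have "\<dots> = (NN z. \<phi> (fst z) * f (snd z) \<partial>N)"
  by (subst nn_integral_density) (auto simp: case_prod_beta)
 finally show ?thesis .
qed

lemma sets_jump_integral [simp, measurable_cong]: "sets (jump_integral \<phi> N) = sets base"
 and space_jump_integral [simp]: "space (jump_integral \<phi> N) = space base"
 by (simp_all add: jump_integral_def)

lemma emeasure_jump_integral:
 assumes N: "sets N = sets (J \<Otimes>\<^sub>M (base :: (real \<times> 'x::polish_space) measure))"
  and \<phi>: "\<phi> \<in> bm J" and B: "B \<in> sets base"
 shows "emeasure (jump_integral \<phi> N) B = (NN z. \<phi> (fst z) * ind1 B (snd z) \<partial>N)"
 using nn_integral_jump_integral[OF N \<phi>, of "ind1 B"] B by simp

lemma ennreal_unit_jumps: "ennreal \<in> bm unit_jumps"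
 using m_comp[OF unit_jumps_borel measurable_ennreal] by simp

lemma nn_integral_crm:
 assumes "sets N = sets EE" "f \<in> bm base"
 shows "(NN p. f p \<partial>crm N) = (NN z. ennreal (fst z) * f (snd z) \<partial>N)"
 unfolding crm_def by (rule nn_integral_jump_integral[OF assms(1) ennreal_unit_jumps assms(2)])

lemma emeasure_crm:
 assumes "sets N = sets EE" "B \<in> sets base"
 shows "emeasure (crm N) B = (NN z. ennreal (fst z) * ind1 B (snd z) \<partial>N)"
 unfolding crm_def by (rule emeasure_jump_integral[OF assms(1) ennreal_unit_jumps assms(2)])

lemma restricted_time_sets: "T \<in> sets borel ==> T \<subseteq> {0<..} ==> T \<times> UNIV \<in> sets (base :: (real \<times> 'x::polish_space) measure)"
 unfolding base_def by (subst sets_restrict_space_iff) (auto simp: borel_prod[symmetric])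

lemma nn_integral_count_space_restrict:
 "(NN z. f z * ind1 T (g z) \<partial>count_space Z) = (NN z. f z \<partial>count_space {z\<in>Z. g z \<in> T})"
 by (subst (1 2) nn_integral_count_space_indicator) (auto intro!: nn_cong split: split_indicator)

context
 fixes N :: "(real \<times> real \<times> 'x::polish_space) measure" and Z
 assumes cfg: "simple_config EE tm N Z"
begin

lemma config_countable: "countable Z" and config_space: "Z \<subseteq> space EE" and config_inj: "inj_on tm Z"
 and config_sets: "sets N = sets EE"
 using cfg by (auto simp: simple_config_def)

lemma config_fst: "z \<in> Z ==> 0 < fst z \<and> fst z \<le> 1 \<and> 0 < tm z"
 using config_space by (auto simp: space_pair_measure)

lemma config_exp_neg: "z \<in> Z ==> exp_neg (neg_log_compl (ennreal (fst z))) = 1 - ennreal (fst z)"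
 using config_fst by (simp add: exp_neg_neg_log_compl)

lemma survT_config:
 assumes [measurable]: "T \<in> sets borel"
 shows "survT N T = exp_neg (NN z. neg_log_compl (ennreal (fst z)) \<partial>count_space {z\<in>Z. tm z \<in> T})"
 unfolding survT_def nn_integral_count_space_restrict[symmetric]
 by (subst nn_integral_simple_config[OF cfg]) auto

lemma crm_time:
 assumes v: "0 < v"
 shows "emeasure (crm N) ({v} \<times> UNIV) = (\<Sum>z\<in>{z\<in>Z. tm z = v}. ennreal (fst z))"
proof -
 have fin: "finite {z\<in>Z. tm z = v}"
 proof (cases "{z\<in>Z. tm z = v} = {}")
  case False
  then obtain z where "z \<in> Z" "tm z = v" by auto
  then have "{z\<in>Z. tm z = v} = {z}" using config_inj by (auto dest: inj_onD)
  then show ?thesis by simp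
 next
  case True
  show ?thesis unfolding True by simp
 qed
 have B: "{v} \<times> UNIV \<in> sets (base :: (real \<times> 'x) measure)" using v by (intro restricted_time_sets) auto
 have "emeasure (crm N) ({v} \<times> UNIV) = (NN z. ennreal (fst z) * ind1 ({v} \<times> UNIV) (snd z) \<partial>N)"
  by (rule emeasure_crm[OF config_sets B])
 also have "\<dots> = (NN z. ennreal (fst z) * ind1 ({v} \<times> UNIV) (snd z) \<partial>count_space Z)"
  using B by (intro nn_integral_simple_config[OF cfg]) auto
 also have "\<dots> = (NN z. ennreal (fst z) \<partial>count_space {z\<in>Z. snd z \<in> {v} \<times> UNIV})"
  by (rule nn_integral_count_space_restrict)
 also have "{z\<in>Z. snd z \<in> {v} \<times> UNIV} = {z\<in>Z. tm z = v}" by (auto simp: mem_Times_iff)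
 also have "(NN z. ennreal (fst z) \<partial>count_space {z\<in>Z. tm z = v}) = (\<Sum>z\<in>{z\<in>Z. tm z = v}. ennreal (fst z))"
  using fin by (rule nn_integral_count_space_finite)
 finally show ?thesis .
qed

lemma crm_time_atom: "z \<in> Z ==> emeasure (crm N) ({tm z} \<times> UNIV) = ennreal (fst z)"
proof -
 assume z: "z \<in> Z"
 then have "{y\<in>Z. tm y = tm z} = {z}" using config_inj by (auto dest: inj_onD)
 then show ?thesis using crm_time[of "tm z"] config_fst[OF z] by simp
qed

lemma crm_time_null: "v \<notin> tm ` Z ==> 0 < v ==> emeasure (crm N) ({v} \<times> UNIV) = 0"
proof -
 assume v: "v \<notin> tm ` Z" "0 < v"
 then have S: "{y\<in>Z. tm y = v} = {}" by force
 show ?thesis unfolding crm_time[OF v(2)] S by simp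
qed

text \<open>Distinct points have distinct times, so \<open>crm N\<close> has at a time either one
  jump or no mass. Finite sets of times and finite sets of points then give the same products, up to
  factors one.\<close>

theorem survival_left_crm: "survival_left (crm N) t = survT N {0<..<t}"
proof -
 let ?W = "{z\<in>Z. tm z \<in> {0<..<t}}"
 let ?f = "%v. 1 - emeasure (crm N) ({v} \<times> UNIV)"
 have *: "survT N {0<..<t} = (INF F \<in> {F. finite F \<and> F \<subseteq> ?W}. \<Prod>z\<in>F. 1 - ennreal (fst z))"
  unfolding survT_config[OF borel_open[OF open_greaterThanLessThan]]
  by (subst exp_neg_count_space)
   (auto intro!: INF_cong prod.cong config_exp_neg intro: countable_subset[OF _ config_countable])
 show ?thesis
 proof (rule antisym)
  show "survival_left (crm N) t \<le> survT N {0<..<t}"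
   unfolding *
  proof (rule INF_greatest)
   fix F assume F: "F \<in> {F. finite F \<and> F \<subseteq> ?W}"
   then have "survival_left (crm N) t \<le> (\<Prod>v\<in>tm ` F. ?f v)"
    unfolding survival_left_def by (intro INF_lower) auto
   also have "\<dots> = (\<Prod>z\<in>F. ?f (tm z))"
    using F config_inj by (subst prod.reindex) (auto intro: inj_on_subset)
   also have "\<dots> = (\<Prod>z\<in>F. 1 - ennreal (fst z))"
    using F crm_time_atom by (intro prod.cong) auto
   finally show "survival_left (crm N) t \<le> (\<Prod>z\<in>F. 1 - ennreal (fst z))" .
  qed
  show "survT N {0<..<t} \<le> survival_left (crm N) t"
   unfolding survival_left_def
  proof (rule INF_greatest)
   fix V assume V: "V \<in> {V. finite V \<and> V \<subseteq> {0<..<t}}"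
   let ?F = "{z\<in>Z. tm z \<in> V}"
   have inj: "inj_on tm ?F" using config_inj by (rule inj_on_subset) auto
   have im: "tm ` ?F = V \<inter> tm ` Z" by auto
   have "finite ?F" using V im inj by (metis (no_types, lifting) finite_Int finite_imageD mem_Collect_eq)
   then have "survT N {0<..<t} \<le> (\<Prod>z\<in>?F. 1 - ennreal (fst z))"
    unfolding * using V by (intro INF_lower) auto
   also have "\<dots> = (\<Prod>z\<in>?F. ?f (tm z))"
    using crm_time_atom by (intro prod.cong) auto
   also have "\<dots> = (\<Prod>v\<in>V \<inter> tm ` Z. ?f v)"
    using prod.reindex[OF inj, of ?f] im by simp
   also have "\<dots> = (\<Prod>v\<in>V. ?f v)"
   proof (rule prod.mono_neutral_left)
    show "\<forall>v\<in>V - V \<inter> tm ` Z. ?f v = 1"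
    proof
     fix v assume v: "v \<in> V - V \<inter> tm ` Z"
     then have "emeasure (crm N) ({v} \<times> UNIV) = 0" using V by (intro crm_time_null) auto
     then show "?f v = 1" by simp
    qed
   qed (use V in auto)
   finally show "survT N {0<..<t} \<le> (\<Prod>v\<in>V. ?f v)" .
  qed
 qed
qed

lemma survT_pcompl: "T \<in> sets borel ==> survT N T = pcompl (%z. neg_log_compl (ennreal (fst z))) {z\<in>Z. tm z \<in> T}"
 by (simp only: survT_config pcompl_def)

text \<open>The first-failure decomposition for the points in \<open>(a,b]\<close>. The bound always
  holds; equality is drawn from \<open>sum_pcompl_eq\<close>, for which the jumps up to each point
  must have finite sum.\<close>

lemma survT_sum_le:
 assumes meas: "(%s. survT N {a<..<s}) \<in> bm borel"
 shows "(NN z. ennreal (fst z) * ind1 {a<..b} (tm z) * survT N {a<..<tm z} \<partial>N) + survT N {a<..b} \<le> 1"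
  and "0 \<le> a ==> (!!z. z \<in> Z ==> (NN y. ennreal (fst y) * ind1 {0<..tm z} (tm y) \<partial>N) < \<infinity>) ==>
   (NN z. ennreal (fst z) * ind1 {a<..b} (tm z) * survT N {a<..<tm z} \<partial>N) + survT N {a<..b} = 1"
proof -
 let ?W = "{z\<in>Z. tm z \<in> {a<..b}}" and ?h = "%z::real \<times> real \<times> 'x. neg_log_compl (ennreal (fst z))"
 have [measurable]: "(%z. survT N {a<..<tm z}) \<in> bm EE"
  using m_comp[OF measurable_tm meas] .
 have "(NN z. ennreal (fst z) * ind1 {a<..b} (tm z) * survT N {a<..<tm z} \<partial>N) =
   (NN z. (ennreal (fst z) * survT N {a<..<tm z}) * ind1 {a<..b} (tm z) \<partial>count_space Z)"
  by (subst nn_integral_simple_config[OF cfg]) (auto simp: ac_simps)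
 also have "\<dots> = (NN z. ennreal (fst z) * survT N {a<..<tm z} \<partial>count_space ?W)"
  by (rule nn_integral_count_space_restrict)
 also have "\<dots> = (NN z. ennreal (fst z) * pcompl ?h {y\<in>?W. tm y < tm z} \<partial>count_space ?W)"
 proof (rule nn_cong)
  fix z assume "z \<in> space (count_space ?W)"
  then have "{y\<in>Z. tm y \<in> {a<..<tm z}} = {y\<in>?W. tm y < tm z}" by auto
  then show "ennreal (fst z) * survT N {a<..<tm z} = ennreal (fst z) * pcompl ?h {y\<in>?W. tm y < tm z}"
   by (simp add: survT_pcompl)
 qed
 finally have 1: "(NN z. ennreal (fst z) * ind1 {a<..b} (tm z) * survT N {a<..<tm z} \<partial>N) = \<dots>" .
 have 2: "survT N {a<..b} = pcompl ?h ?W" by (subst survT_pcompl) auto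
 have c: "countable ?W" "inj_on tm ?W" using config_countable config_inj by (auto intro: inj_on_subset countable_subset)
 have u: "ennreal (fst z) \<le> 1" if "z \<in> ?W" for z using config_fst that by auto
 have h: "exp_neg (?h z) = 1 - ennreal (fst z)" if "z \<in> ?W" for z using config_exp_neg that by auto
 show "(NN z. ennreal (fst z) * ind1 {a<..b} (tm z) * survT N {a<..<tm z} \<partial>N) + survT N {a<..b} \<le> 1"
  unfolding 1 2 by (rule sum_pcompl_le[OF c u h])
 show "(NN z. ennreal (fst z) * ind1 {a<..b} (tm z) * survT N {a<..<tm z} \<partial>N) + survT N {a<..b} = 1"
  if a: "0 \<le> a" and fin: "!!z. z \<in> Z ==> (NN y. ennreal (fst y) * ind1 {0<..tm z} (tm y) \<partial>N) < \<infinity>"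
  unfolding 1 2
 proof (rule sum_pcompl_eq[OF c u h])
  fix z assume z: "z \<in> ?W"
  have "(NN y. ennreal (fst y) \<partial>count_space {y\<in>?W. tm y \<le> tm z}) \<le>
    (NN y. ennreal (fst y) \<partial>count_space {y\<in>Z. tm y \<in> {0<..tm z}})"
   using a by (subst (1 2) nn_integral_count_space_indicator) (auto intro!: nn_integral_mono split: split_indicator)
  also have "\<dots> = (NN y. ennreal (fst y) * ind1 {0<..tm z} (tm y) \<partial>N)"
   unfolding nn_integral_count_space_restrict[symmetric]
   by (subst nn_integral_simple_config[OF cfg]) auto
  also have "\<dots> < \<infinity>" using fin z by auto
  finally show "(NN y. ennreal (fst y) \<partial>count_space {y\<in>?W. tm y \<le> tm z}) < \<infinity>" .
 qed
qed

text \<open>Distinct times give distinct locations, so the mass of \<open>crm N\<close> at a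
  location is a single jump, or zero off the points. The sum over all locations thus reduces to one
  over \<open>Z\<close>.\<close>

theorem levy_measure_of_crm:
 "levy_measure_of (crm N) = jump_integral (%u. neg_log_compl (ennreal u)) N"
proof (rule measure_eqI)
 fix B assume "B \<in> sets (levy_measure_of (crm N))"
 then have B: "B \<in> sets base" by (simp add: levy_measure_of_def)
 have snd_inj: "inj_on snd Z" using config_inj by (auto simp: inj_on_def)
 have atom: "emeasure (crm N) {snd z} = ennreal (fst z)" if z: "z \<in> Z" for z
 proof -
  have zE: "snd z \<in> space (base :: (real \<times> 'x) measure)" using config_space z by (auto simp: space_pair_measure)
  have S: "{snd z} \<in> sets base" using singleton_base[OF zE] .
  have "{y\<in>Z. snd y \<in> {snd z}} = {z}" using z snd_inj by (auto dest: inj_onD)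
  then have "(NN y. ennreal (fst y) * ind1 {snd z} (snd y) \<partial>count_space Z) = ennreal (fst z)"
   unfolding nn_integral_count_space_restrict by (simp add: nn_integral_count_space_finite)
  then show ?thesis
   using S by (simp add: emeasure_crm[OF config_sets] nn_integral_simple_config[OF cfg])
 qed
 have no_atom: "emeasure (crm N) {p} = 0" if p: "p \<in> space base" "p \<notin> snd ` Z" for p
 proof -
  have "{y\<in>Z. snd y \<in> {p}} = {}" using p by force
  then have "(NN y. ennreal (fst y) * ind1 {p} (snd y) \<partial>count_space Z) = 0"
   unfolding nn_integral_count_space_restrict by (simp add: nn_integral_empty)
  then show ?thesis
   using singleton_base[OF p(1)] by (simp add: emeasure_crm[OF config_sets] nn_integral_simple_config[OF cfg])
 qed
 let ?l = "%p. neg_log_compl (emeasure (crm N) {p})"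
 have sndZ: "snd ` Z \<subseteq> space (base :: (real \<times> 'x) measure)" using config_space by (auto simp: space_pair_measure)
 have BE: "B \<subseteq> space base" using sets.sets_into_space[OF B] .
 have "emeasure (levy_measure_of (crm N)) B = emeasure (density (count_space (space base)) ?l) B"
  unfolding levy_measure_of_def using B BE by (subst emeasure_distr) (auto simp: measurable_def Int_absorb2)
 also have "\<dots> = (NN p. ?l p * ind1 B p \<partial>count_space (space base))"
  using BE by (intro emeasure_density) auto
 also have "\<dots> = (NN p. ?l p * ind1 B p \<partial>count_space (snd ` Z))"
 proof -
  have "?l p * ind1 B p * ind1 (space base) p = ?l p * ind1 B p * ind1 (snd ` Z) p" for p
  proof (cases "p \<in> snd ` Z")
   case True
   then show ?thesis using subsetD[OF sndZ True] by simp
  next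
   case False
   then show ?thesis using no_atom[of p] by (cases "p \<in> space (base :: (real \<times> 'x) measure)") (simp_all del: space_base)
  qed
  then show ?thesis by (subst (1 2) nn_integral_count_space_indicator) auto
 qed
 also have "\<dots> = (NN z. ?l (snd z) * ind1 B (snd z) \<partial>count_space Z)"
  using snd_inj by (intro nn_integral_bij_count_space[symmetric]) (simp add: bij_betw_def)
 also have "\<dots> = (NN z. neg_log_compl (ennreal (fst z)) * ind1 B (snd z) \<partial>count_space Z)"
  by (intro nn_cong) (simp add: atom)
 also have "\<dots> = (NN z. neg_log_compl (ennreal (fst z)) * ind1 B (snd z) \<partial>N)"
  using B by (intro nn_integral_simple_config[OF cfg, symmetric]) auto
 also have "\<dots> = emeasure (jump_integral (%u. neg_log_compl (ennreal u)) N) B"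
  using B by (intro emeasure_jump_integral[OF config_sets, symmetric] m_comp[OF ennreal_unit_jumps]) auto
 finally show "emeasure (levy_measure_of (crm N)) B = \<dots>" .
qed (simp add: levy_measure_of_def)

end

section \<open>Hazard measures and kernels of jump laws\<close>

abbreviation halfline :: "real measure" where "halfline \<equiv> restrict_space borel {0<..}"

definition kappa1 :: "(real => real measure) => real => ennreal" where
 "kappa1 \<rho> s = (NN u. ennreal u \<partial>\<rho> s)"

lemma fst_base_times [measurable]: "fst \<in> (base :: (real \<times> 'x::polish_space) measure) ->M halfline"
 by (rule measurable_restrict_space2) (auto simp: measurable_fst_base)

lemma inverse_antimono_ennreal: "x \<le> y ==> inverse y \<le> inverse (x :: ennreal)"
 by (cases "x = 0"; cases x; cases y) (auto simp: inverse_ennreal ennreal_le_iff top_unique)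

text \<open>With \<open>G s\<close> the mass of \<open>F\<close> before \<open>s\<close>, the
  density \<open>1 / (1 - G)\<close> is infinite only where \<open>G = 1\<close>, and from such a
  time on \<open>F\<close> has no mass left. Since the density increases in time, on
  \<open>(0,s]\<close> it is bounded by its value at \<open>s\<close>, which gives finite mass
  there.\<close>

lemma hazard_measure_finite:
 fixes A :: "(real \<times> 'x::polish_space) measure"
 assumes "hazard_measure A"
 shows "sets A = sets base" "sigma_finite_measure A" "AE p in A. emeasure A ({0<..fst p} \<times> UNIV) < \<infinity>"
proof -
 obtain F where F[measurable_cong]: "sets F = sets base" and "subprob_space F"
  and A: "A = density F (%(s, x). 1 / (1 - emeasure F ({0<..<s} \<times> UNIV)))"
  using assms by (auto simp: hazard_measure_def)
 interpret F: subprob_space F by fact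
 define G where "G s = emeasure F ({0<..<s} \<times> UNIV)" for s
 have ivl_sets: "{0<..<s} \<times> UNIV \<in> sets (base :: (real \<times> 'x) measure)" "{0<..s} \<times> UNIV \<in> sets (base :: (real \<times> 'x) measure)" for s
  by (auto intro!: restricted_time_sets)
 have G_mono: "G s \<le> G t" if "s \<le> t" for s t
  unfolding G_def using that ivl_sets by (intro emeasure_mono) (auto simp: F)
 have G_le: "G s \<le> 1" for s unfolding G_def by (rule F.subprob_emeasure_le_1)
 have "mono (%s. enn2real (G s))"
  using G_mono G_le by (intro monoI enn2real_mono) (auto intro: order_le_less_trans[OF G_le])
 then have "(%s. enn2real (G s)) \<in> bm borel" by (rule borel_measurable_mono)
 then have "(%s. ennreal (enn2real (G s))) \<in> bm borel" by measurable
 moreover have "ennreal (enn2real (G s)) = G s" for s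
  by (intro ennreal_enn2real order_le_less_trans[OF G_le]) simp
 ultimately have [measurable]: "G \<in> bm borel" by (simp add: fun_eq_iff[symmetric] cong: measurable_cong)
 have A': "A = density F (%p. 1 / (1 - G (fst p)))"
  unfolding A G_def by (simp only: split_beta')
 have [measurable]: "(%p. 1 / (1 - G (fst p))) \<in> bm F" by measurable
 show "sets A = sets base" by (simp add: A' F)
 have spF: "space F = {0<..} \<times> UNIV" using space_eq[OF F] by simp
 \<comment> \<open>beyond the first time at which F has no mass left, F is null\<close>
 define U where "U = {s. 0 < s \<and> G s = 1}"
 have null: "emeasure F ({s..} \<times> UNIV) = 0" if "s \<in> U" for s
 proof -
  have s: "0 < s" "G s = 1" using that by (auto simp: U_def)
  have S: "{s..} \<times> UNIV \<in> sets (base :: (real \<times> 'x) measure)" using s by (intro restricted_time_sets) auto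
  have "G s + emeasure F ({s..} \<times> UNIV) = emeasure F (({0<..<s} \<times> UNIV) \<union> ({s..} \<times> UNIV))"
   unfolding G_def using S ivl_sets by (intro plus_emeasure) (auto simp: F)
  also have "\<dots> \<le> 1" by (rule F.subprob_emeasure_le_1)
  finally have "1 + emeasure F ({s..} \<times> UNIV) \<le> 1 + 0" using s by simp
  then show ?thesis by (subst (asm) ennreal_add_left_cancel_le) simp
 qed
 have "AE p in F. fst p \<notin> U"
 proof (cases "U = {}")
  case False
  define i where "i = Inf U"
  have bdd: "bdd_below U" by (auto simp: U_def bdd_below_def intro!: exI[of _ 0])
  have ae: "AE p in F. fst p < s" if "s \<in> U" for s
  proof (rule AE_I)
   show "{p \<in> space F. \<not> fst p < s} \<subseteq> {s..} \<times> UNIV" by (auto simp: spF)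
   show "{s..} \<times> UNIV \<in> sets F" using that unfolding F by (intro restricted_time_sets) (auto simp: U_def)
  qed (rule null[OF that])
  show ?thesis
  \<comment> \<open>The null half-lines form an uncountable family. One of them suffices if the
    infimum of \<open>U\<close> is attained, and a sequence of them otherwise.\<close>
  proof (cases "i \<in> U")
   case True
   show ?thesis using ae[OF True] by eventually_elim (use bdd in \<open>auto simp: i_def dest: cInf_lower\<close>)
  next
   case iU: False
   have "\<exists>s\<in>U. s < i + 1 / Suc n" for n
   proof -
    have "Inf U < i + 1 / Suc n" by (simp add: i_def)
    then show ?thesis using False cInf_lessD by blast
   qed
   then obtain c where c: "!!n. c n \<in> U" "!!n. c n < i + 1 / Suc n" by metis
   have "AE p in F. \<forall>n. fst p < c n" using ae[OF c(1)] by (simp add: AE_all_countable)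
   then show ?thesis
   proof eventually_elim
    fix p assume p: "\<forall>n. fst p < c n"
    show "fst p \<notin> U"
    proof
     assume pU: "fst p \<in> U"
     then have "i \<le> fst p" using bdd by (auto simp: i_def intro: cInf_lower)
     moreover have "fst p \<noteq> i" using pU iU by auto
     ultimately obtain n where "1 / Suc n < fst p - i"
      using reals_Archimedean[of "fst p - i"] by (auto simp: inverse_eq_divide)
     then show False using p[rule_format, of n] c(2)[of n] by simp
    qed
   qed
  qed
 qed auto
 then have fin: "AE p in F. 1 - G (fst p) \<noteq> 0"
  using AE_space
 proof eventually_elim
  fix p assume "fst p \<notin> U" "p \<in> space F"
  then have "G (fst p) < 1" using G_le[of "fst p"] by (auto simp: U_def spF le_less)
  then show "1 - G (fst p) \<noteq> 0" by (simp add: diff_gr0_ennreal zero_less_iff_neq_zero[symmetric])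
 qed
 show "sigma_finite_measure A"
  unfolding A'
 proof (subst F.sigma_finite_iff_density_finite)
  show "AE p in F. 1 / (1 - G (fst p)) \<noteq> \<infinity>"
   using fin by eventually_elim (simp add: ennreal_divide_eq_top_iff)
 qed measurable
 have "AE p in F. emeasure A ({0<..fst p} \<times> UNIV) < \<infinity>"
  using fin
 proof eventually_elim
  fix p assume p: "1 - G (fst p) \<noteq> 0"
  have "emeasure A ({0<..fst p} \<times> UNIV) = (NN q. 1 / (1 - G (fst q)) * ind1 ({0<..fst p} \<times> UNIV) q \<partial>F)"
   unfolding A' by (rule emeasure_density) (use ivl_sets in \<open>auto simp: F\<close>)
  also have "\<dots> \<le> (NN q. 1 / (1 - G (fst p)) \<partial>F)"
   using G_mono by (intro nn_integral_mono) (auto simp: divide_ennreal_def intro!: inverse_antimono_ennreal ennreal_minus_mono split: split_indicator)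
  also have "\<dots> = 1 / (1 - G (fst p)) * emeasure F (space F)" by simp
  also have "\<dots> < \<infinity>"
   using p F.emeasure_subprob_space_less_top by (auto simp: less_top[symmetric] ennreal_mult_eq_top_iff ennreal_divide_eq_top_iff)
  finally show "emeasure A ({0<..fst p} \<times> UNIV) < \<infinity>" .
 qed
 then show "AE p in A. emeasure A ({0<..fst p} \<times> UNIV) < \<infinity>"
  unfolding A' by (subst AE_density) (auto elim!: AE_mp)
qed

text \<open>A partition of \<open>(0,1]\<close> with \<open>u\<close> bounded away from zero on each
  part, so that a kernel with finite first moment gives every level finite mass.\<close>

definition jump_levels :: "nat => real set" where
 "jump_levels k = {1 / real (k + 2)<..1 / real (k + 1)}"

interpretation jl: exhaustion unit_jumps jump_levels
proof
 have sub: "jump_levels k \<subseteq> {0<..1}" for k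
 proof
  fix x assume "x \<in> jump_levels k"
  then have "1 / real (k + 2) < x" "x \<le> 1 / real (k + 1)"
   by (simp_all only: jump_levels_def greaterThanAtMost_iff)
  moreover have "0 < 1 / real (k + 2)" "1 / real (k + 1) \<le> 1" by auto
  ultimately have "0 < x \<and> x \<le> 1" by linarith
  then show "x \<in> {0<..1}" by simp
 qed
 then show "jump_levels k \<in> sets unit_jumps" for k
  unfolding unit_jumps_def by (subst sets_restrict_space_iff) (auto simp: jump_levels_def)
 show "disjoint_family jump_levels"
  unfolding disjoint_family_on_def
 proof (intro ballI impI)
  fix m n :: nat assume "m \<noteq> n"
  have *: "jump_levels m \<inter> jump_levels n = {}" if "m < n" for m n
  proof -
   have "1 / real (n + 1) \<le> 1 / real (m + 2)" using that by (intro divide_left_mono) auto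
   then show ?thesis by (auto simp: jump_levels_def)
  qed
  show "jump_levels m \<inter> jump_levels n = {}"
   using *[of m n] *[of n m] \<open>m \<noteq> n\<close> by (cases "m < n") auto
 qed
 show "(\<Union>k. jump_levels k) = space unit_jumps"
 proof (intro equalityI subsetI)
  fix u assume "u \<in> space unit_jumps"
  then have u: "0 < u" "u \<le> 1" by auto
  define k where "k = (LEAST k. 1 / real (k + 2) < u)"
  obtain n where n: "1 / real (n + 1) < u" using reals_Archimedean[OF u(1)] by (auto simp: inverse_eq_divide)
  have "1 / real (n + 2) \<le> 1 / real (n + 1)" by (intro divide_left_mono) auto
  then have "1 / real (n + 2) < u" using n by simp
  then have k: "1 / real (k + 2) < u" unfolding k_def by (rule LeastI)
  have "u \<le> 1 / real (k + 1)"
  proof (cases k)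
   case (Suc j)
   then have "j < (LEAST k. 1 / real (k + 2) < u)" by (simp only: k_def[symmetric] lessI)
   then have "\<not> 1 / real (j + 2) < u" by (rule not_less_Least)
   then show ?thesis using Suc by (simp add: add.commute)
  qed (use u in simp)
  then show "u \<in> (\<Union>k. jump_levels k)" using k by (auto simp: jump_levels_def)
 next
  fix u assume "u \<in> (\<Union>k. jump_levels k)"
  then obtain k where "u \<in> jump_levels k" by blast
  then show "u \<in> space unit_jumps" using sub[of k] by auto
 qed
qed

text \<open>The kernel is cut to zero at times of infinite first moment, so that it is finite on the
  jump levels at all times. By \<open>fin\<close> these times do not matter for integrals against
  \<open>\<eta>\<close>.\<close>

definition fker :: "(real => real measure) => real => real measure" where
 "fker \<rho> s = (if kappa1 \<rho> s < \<infinity> then \<rho> s else null_measure unit_jumps)"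

definition slice :: "(real => real measure) => real \<times> 'x::polish_space => ('x mark) measure" where
 "slice R p = distr (R (fst p)) EE (%u. (u, p))"

context
 fixes \<rho> :: "real => real measure" and \<eta> :: "(real \<times> 'x::polish_space) measure"
 assumes \<rho>: "\<rho> \<in> halfline ->M MA unit_jumps"
  and \<eta>[measurable_cong]: "sets \<eta> = sets base"
  and fin: "AE p in \<eta>. kappa1 \<rho> (fst p) < \<infinity>"
begin

lemma space_\<eta>: "space \<eta> = {0<..} \<times> UNIV"
 using space_eq[OF \<eta>] by (simp only: space_base)

lemma kernel_sets: "s > 0 ==> sets (\<rho> s) = sets unit_jumps"
 using measurable_space[OF \<rho>, of s] by (simp add: space_restrict_space space_measure_algebra)

lemma kernel_space: "s > 0 ==> space (\<rho> s) = {0<..1}"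
 using space_eq[OF kernel_sets] by simp

lemma kappa1_measurable: "kappa1 \<rho> \<in> bm halfline"
 unfolding kappa1_def[abs_def]
 by (rule m_comp[OF \<rho> nn_integral_measurable_measure_algebra[OF ennreal_unit_jumps]])

lemma fker: "fker \<rho> \<in> halfline ->M jl.lf"
proof (rule jl.measurable_lfI)
 have "{s \<in> space halfline. kappa1 \<rho> s < \<infinity>} \<in> sets halfline"
  using kappa1_measurable by measurable
 then show "fker \<rho> \<in> halfline ->M MA unit_jumps"
  unfolding fker_def by (intro measurable_If \<rho> measurable_const) (simp_all add: space_measure_algebra)
 fix s k assume "s \<in> space halfline"
 then have s: "s > 0" by (simp add: space_restrict_space)
 show "emeasure (fker \<rho> s) (jump_levels k) < \<infinity>"
 proof (cases "kappa1 \<rho> s < \<infinity>")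
  case True
  have J: "jump_levels k \<in> sets (\<rho> s)" using kernel_sets[OF s] jl.D_sets by simp
  have pos: "0 < 1 / real (k + 2)" by simp
  have "ennreal (1 / real (k + 2)) * emeasure (\<rho> s) (jump_levels k) = (NN u. ennreal (1 / real (k + 2)) * ind1 (jump_levels k) u \<partial>\<rho> s)"
   using J by (simp add: nn_integral_cmult_indicator)
  also have "\<dots> \<le> kappa1 \<rho> s"
   unfolding kappa1_def by (intro nn_integral_mono) (auto simp: jump_levels_def intro!: ennreal_leI split: split_indicator)
  also have "\<dots> < \<infinity>" by fact
  finally have "emeasure (\<rho> s) (jump_levels k) < \<infinity>"
   using pos by (auto simp: less_top[symmetric] ennreal_mult_eq_top_iff)
  then show ?thesis using True by (simp add: fker_def)
 qed (simp add: fker_def)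
qed

lemma fker_base: "(%p. fker \<rho> (fst p)) \<in> base ->M jl.lf"
 by (rule m_comp[OF fst_base_times fker])

lemma fker_sets: "s > 0 ==> sets (fker \<rho> s) = sets unit_jumps"
 by (simp add: fker_def kernel_sets)

lemma slice_sets: "p \<in> space base ==> sets R = sets unit_jumps ==> (%u. (u, p)) \<in> R ->M (EE :: ('x mark) measure)"
 by (simp cong: m_cong_sets)

lemma fslice: "slice (fker \<rho>) \<in> (base :: (real \<times> 'x) measure) ->M MA EE"
proof (rule measurable_measure_algebraI)
 fix B :: "('x mark) set" assume B: "B \<in> sets EE"
 have "(%p. NN u. ind1 B (u, p) \<partial>fker \<rho> (fst p) :: ennreal) \<in> bm base"
 proof (rule jl.measurable_nn_integral_lf'[OF fker_base])
  show "(%(p, u). ind1 B (u, p) :: ennreal) \<in> bm (base \<Otimes>\<^sub>M unit_jumps)"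
   using m_comp[OF measurable_pair_swap' bm_ind[OF B]]
   by (simp add: split_beta')
 qed
 moreover have "emeasure (slice (fker \<rho>) p) B = (NN u. ind1 B (u, p) \<partial>fker \<rho> (fst p))" if p: "p \<in> space base" for p
 proof -
  have s: "sets (fker \<rho> (fst p)) = sets unit_jumps" using p by (intro fker_sets) auto
  have "emeasure (slice (fker \<rho>) p) B = (NN z. ind1 B z \<partial>slice (fker \<rho>) p)"
   using B by (simp add: slice_def)
  also have "\<dots> = (NN u. ind1 B (u, p) \<partial>fker \<rho> (fst p))"
   unfolding slice_def by (rule nn_integral_distr[OF slice_sets[OF p s]]) (use B in simp)
  finally show ?thesis .
 qed
 then have "(%p. emeasure (slice (fker \<rho>) p) B) \<in> bm base \<longleftrightarrow>
   (%p. NN u. ind1 B (u, p) \<partial>fker \<rho> (fst p) :: ennreal) \<in> bm base"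
  by (rule measurable_cong)
 ultimately show "(%p. emeasure (slice (fker \<rho>) p) B) \<in> bm base"
  by (simp only:)
qed (simp add: slice_def)

lemma fslice_\<eta>: "slice (fker \<rho>) \<in> \<eta> ->M MA EE"
 unfolding m_cong_sets[OF \<eta> refl] by (rule fslice)

lemma fslice_AE: "AE p in \<eta>. slice \<rho> p = slice (fker \<rho>) p"
 using fin by eventually_elim (simp add: slice_def fker_def)

text \<open>Once the set function in \<open>intensity\<close> is seen to be a mixture of slices, it
  is a genuine measure; \<open>measure_of\<close> would turn a set function that is not a measure
  into zero.\<close>

lemma intensity_mixture: "intensity \<rho> \<eta> = data_marginal \<eta> EE (slice \<rho>)"
 unfolding intensity_def data_marginal_def
proof (rule measure_of_eq)
 fix B assume "B \<in> sigma_sets (space EE) (sets (EE :: ('x mark) measure))"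
 then have B: "B \<in> sets (EE :: ('x mark) measure)" by (simp add: sets.sigma_sets_eq)
 show "(NN p. emeasure (\<rho> (fst p)) {u \<in> {0<..1}. (u, p) \<in> B} \<partial>\<eta>) = (NN p. emeasure (slice \<rho> p) B \<partial>\<eta>)"
 proof (rule nn_cong)
  fix p assume "p \<in> space \<eta>"
  then have p: "p \<in> space base" "0 < fst p" by (simp_all add: space_\<eta> mem_Times_iff)
  have "emeasure (slice \<rho> p) B = emeasure (\<rho> (fst p)) ((%u. (u, p)) -` B \<inter> space (\<rho> (fst p)))"
   unfolding slice_def by (rule emeasure_distr[OF slice_sets[OF p(1) kernel_sets[OF p(2)]] B])
  also have "(%u. (u, p)) -` B \<inter> space (\<rho> (fst p)) = {u \<in> {0<..1}. (u, p) \<in> B}"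
   unfolding kernel_space[OF p(2)] by auto
  finally show "emeasure (\<rho> (fst p)) {u \<in> {0<..1}. (u, p) \<in> B} = emeasure (slice \<rho> p) B" ..
 qed
qed (rule sets.space_closed)

lemma sets_intensity: "sets (intensity \<rho> \<eta>) = sets EE"
 unfolding intensity_mixture by simp

lemma nn_integral_intensity:
 assumes g: "g \<in> bm EE"
 shows "(NN z. g z \<partial>intensity \<rho> \<eta>) = (NN p. NN u. g (u, p) \<partial>\<rho> (fst p) \<partial>\<eta>)"
proof -
 have "(NN z. g z \<partial>intensity \<rho> \<eta>) = (NN p. NN z. g z \<partial>slice (fker \<rho>) p \<partial>\<eta>)"
  using nn_integral_data_marginal[OF fslice_\<eta> fslice_AE g] by (simp only: intensity_mixture)
 also have "\<dots> = (NN p. NN u. g (u, p) \<partial>fker \<rho> (fst p) \<partial>\<eta>)"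
 proof (rule nn_cong)
  fix p assume "p \<in> space \<eta>"
  then have p: "p \<in> space base" "0 < fst p" by (simp_all add: space_\<eta> mem_Times_iff)
  show "(NN z. g z \<partial>slice (fker \<rho>) p) = (NN u. g (u, p) \<partial>fker \<rho> (fst p))"
   unfolding slice_def by (rule nn_integral_distr[OF slice_sets[OF p(1) fker_sets[OF p(2)]]]) (use g in simp)
 qed
 also have "\<dots> = (NN p. NN u. g (u, p) \<partial>\<rho> (fst p) \<partial>\<eta>)"
  by (rule nn_integral_cong_AE) (use fin in \<open>eventually_elim, simp add: fker_def\<close>)
 finally show ?thesis .
qed

end

section \<open>The prior: mean hazard, intensity and size-biased jumps\<close>

locale crm_model =
 fixes \<rho> :: "real => real measure" and \<eta> :: "(real \<times> 'x::polish_space) measure"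
 assumes \<rho>: "\<rho> \<in> halfline ->M MA unit_jumps"
  and \<eta>[measurable_cong]: "sets \<eta> = sets base"
  and diffuse: "!!s. s > 0 ==> emeasure \<eta> ({s} \<times> UNIV) = 0"
  and hazard: "hazard_measure (mean_hazard \<rho> \<eta>)"
begin

lemma \<eta>_space: "space \<eta> = {0<..} \<times> UNIV"
 using space_eq[OF \<eta>] by (simp only: space_base)

definition "A = mean_hazard \<rho> \<eta>"
definition "\<nu> = intensity \<rho> \<eta>"

lemma A_density: "A = density \<eta> (%p. kappa1 \<rho> (fst p))"
 by (simp add: A_def mean_hazard_def kappa1_def split_beta')

lemma \<kappa>_meas [measurable]: "(%p. kappa1 \<rho> (fst p)) \<in> bm (base :: (real \<times> 'x) measure)"
 unfolding kappa1_def
 by (rule m_comp[OF m_comp[OF fst_base_times \<rho>] nn_integral_measurable_measure_algebra[OF ennreal_unit_jumps]])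

lemma A_sets [measurable_cong]: "sets A = sets base"
 and A_sigma_finite: "sigma_finite_measure A"
 and A_finite: "AE p in A. emeasure A ({0<..fst p} \<times> UNIV) < \<infinity>"
 unfolding A_def by (rule hazard_measure_finite[OF hazard])+

lemma A_space: "space A = {0<..} \<times> UNIV"
 using space_eq[OF A_sets] by (simp only: space_base)

text \<open>\<open>A\<close> is sigma-finite and has density \<open>kappa1\<close> with respect to
  \<open>\<eta>\<close>. An infinite density on a set charged by \<open>\<eta>\<close> would give
  infinite mass inside some set of finite mass.\<close>

lemma \<kappa>_finite: "AE p in \<eta>. kappa1 \<rho> (fst p) < \<infinity>"
proof -
 interpret A: sigma_finite_measure A by (rule A_sigma_finite)
 obtain C :: "nat => (real \<times> 'x) set" where C: "range C \<subseteq> sets A" "(\<Union>i. C i) = space A" "!!i. emeasure A (C i) \<noteq> \<infinity>"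
  by (rule A.sigma_finite) auto
 have Cs[measurable]: "C i \<in> sets base" for i using C(1) A_sets by auto
 define B where "B = {p\<in>space (base :: (real \<times> 'x) measure). kappa1 \<rho> (fst p) = \<infinity>}"
 have "B = (%p. kappa1 \<rho> (fst p)) -` {\<infinity>} \<inter> space base" by (auto simp: B_def)
 then have [measurable]: "B \<in> sets base" using measurable_sets[OF \<kappa>_meas, of "{\<infinity>}"] by simp
 have "emeasure \<eta> (B \<inter> C i) = 0" for i
 proof -
  have "\<infinity> * emeasure \<eta> (B \<inter> C i) = (NN p. \<infinity> * ind1 (B \<inter> C i) p \<partial>\<eta>)"
   by (simp add: nn_integral_cmult_indicator \<eta>)
  also have "\<dots> = (NN p. kappa1 \<rho> (fst p) * ind1 (B \<inter> C i) p \<partial>\<eta>)"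
   by (intro nn_cong) (auto simp: B_def split: split_indicator)
  also have "\<dots> = emeasure A (B \<inter> C i)"
   unfolding A_density by (subst emeasure_density) (auto simp: \<eta>)
  also have "\<dots> \<le> emeasure A (C i)"
   by (intro emeasure_mono) (auto simp: A_sets)
  also have "\<dots> < \<infinity>" using C(3)[of i] by (simp add: less_top)
  finally show ?thesis by (auto simp: ennreal_top_mult split: if_splits)
 qed
 then have "AE p in \<eta>. p \<notin> B \<inter> C i" for i
  by (intro AE_not_in) (auto simp: null_sets_def \<eta>)
 then have "AE p in \<eta>. \<forall>i. p \<notin> B \<inter> C i" by (subst AE_all_countable) blast
 then show ?thesis
  using AE_space
 proof eventually_elim
  fix p assume p: "\<forall>i. p \<notin> B \<inter> C i" "p \<in> space \<eta>"
  have "p \<in> space base" using p(2) space_eq[OF \<eta>] by simp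
  moreover from this have "p \<in> (\<Union>i. C i)" unfolding C(2) using space_eq[OF A_sets] by simp
  ultimately have "kappa1 \<rho> (fst p) \<noteq> \<infinity>" using p(1) by (auto simp: B_def)
  then show "kappa1 \<rho> (fst p) < \<infinity>" by (simp add: less_top)
 qed
qed

lemma \<nu>_sets [measurable_cong]: "sets \<nu> = sets EE"
 unfolding \<nu>_def by (rule sets_intensity[OF \<rho> \<eta> \<kappa>_finite])

lemma \<nu>_space: "space \<nu> = space EE"
 by (rule space_eq[OF \<nu>_sets])

lemma nn_integral_\<nu>:
 "g \<in> bm EE ==> (NN z. g z \<partial>\<nu>) = (NN p. NN u. g (u, p) \<partial>\<rho> (fst p) \<partial>\<eta>)"
 unfolding \<nu>_def by (rule nn_integral_intensity[OF \<rho> \<eta> \<kappa>_finite])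

lemma \<rho>_sets: "s > 0 ==> sets (\<rho> s) = sets unit_jumps"
 by (rule kernel_sets[OF \<rho> \<eta> \<kappa>_finite])

lemma \<rho>_space: "s > 0 ==> space (\<rho> s) = {0<..1}"
 by (rule kernel_space[OF \<rho> \<eta> \<kappa>_finite])

text \<open>The normalised kernel \<open>u \<rho>(du|s) / \<kappa>\<^sub>1(s)\<close>; then \<open>u \<nu>(du,dp) = \<sigma>(du|s) A(dp)\<close>, with
 \<open>A\<close> sigma-finite although \<open>\<eta>\<close> and \<open>\<rho>\<close> need not be.\<close>

definition \<sigma> :: "real => real measure" where
 "\<sigma> s = (if 0 < kappa1 \<rho> s \<and> kappa1 \<rho> s < \<infinity> then density (\<rho> s) (%u. ennreal u / kappa1 \<rho> s)
  else return unit_jumps 1)"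

lemma measurable_ennreal_\<rho>: "s > 0 ==> ennreal \<in> bm (\<rho> s)"
 using ennreal_unit_jumps by (simp cong: m_cong_sets add: \<rho>_sets)

lemma \<sigma>_sets: "s > 0 ==> sets (\<sigma> s) = sets unit_jumps"
 by (simp add: \<sigma>_def \<rho>_sets)

lemma \<sigma>_prob: "s > 0 ==> prob_space (\<sigma> s)"
proof (cases "0 < kappa1 \<rho> s \<and> kappa1 \<rho> s < \<infinity>")
 case True
 assume s: "s > 0"
 have "emeasure (density (\<rho> s) (%u. ennreal u / kappa1 \<rho> s)) (space (\<rho> s)) = (NN u. ennreal u / kappa1 \<rho> s \<partial>\<rho> s)"
  using measurable_ennreal_\<rho>[OF s] by (subst emeasure_density) (auto intro!: nn_cong)
 also have "\<dots> = kappa1 \<rho> s / kappa1 \<rho> s"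
  unfolding kappa1_def using measurable_ennreal_\<rho>[OF s] by (rule nn_integral_divide)
 also have "\<dots> = 1" using True by (intro ennreal_divide_self) auto
 finally show ?thesis using True by (intro prob_spaceI) (simp add: \<sigma>_def)
qed (auto simp: \<sigma>_def intro!: prob_space_return)

lemma \<sigma>_measurable: "\<sigma> \<in> halfline ->M prob_algebra unit_jumps"
proof (rule measurable_prob_algebraI)
 fix s assume "s \<in> space halfline"
 then show "prob_space (\<sigma> s)" by (intro \<sigma>_prob) (simp add: space_restrict_space)
next
 have [measurable]: "kappa1 \<rho> \<in> bm halfline" by (rule kappa1_measurable[OF \<rho> \<eta> \<kappa>_finite])
 show "\<sigma> \<in> halfline ->M subprob_algebra unit_jumps"
 proof (rule measurable_subprob_algebra)
  fix s assume "s \<in> space halfline"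
  then have s: "s > 0" by (simp add: space_restrict_space)
  show "subprob_space (\<sigma> s)" using \<sigma>_prob[OF s] by (rule prob_space_imp_subprob_space)
  show "sets (\<sigma> s) = sets unit_jumps" by (rule \<sigma>_sets[OF s])
 next
  fix B assume B: "B \<in> sets unit_jumps"
  have f: "(%u. ennreal u * ind1 B u) \<in> bm unit_jumps"
   using ennreal_unit_jumps B by measurable
  have [measurable]: "(%s. NN u. ennreal u * ind1 B u \<partial>\<rho> s) \<in> bm halfline"
   by (rule m_comp[OF \<rho> nn_integral_measurable_measure_algebra[OF f]])
  have "emeasure (\<sigma> s) B = (if 0 < kappa1 \<rho> s \<and> kappa1 \<rho> s < \<infinity> then (NN u. ennreal u * ind1 B u \<partial>\<rho> s) / kappa1 \<rho> s
    else ind1 B 1)" if "s \<in> space halfline" for s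
  proof -
   have s: "s > 0" using that by (simp add: space_restrict_space)
   have B': "B \<in> sets (\<rho> s)" using B by (simp add: \<rho>_sets[OF s])
   have 1: "(%u. ennreal u * ind1 B u) \<in> bm (\<rho> s)"
    using f by (simp cong: m_cong_sets add: \<rho>_sets[OF s])
   have "emeasure (density (\<rho> s) (%u. ennreal u / kappa1 \<rho> s)) B = (NN u. (ennreal u * ind1 B u) / kappa1 \<rho> s \<partial>\<rho> s)"
    using measurable_ennreal_\<rho>[OF s] B'
    by (subst emeasure_density) (auto intro!: nn_cong split: split_indicator)
   also have "\<dots> = (NN u. ennreal u * ind1 B u \<partial>\<rho> s) / kappa1 \<rho> s"
    by (rule nn_integral_divide[OF 1])
   finally show ?thesis using B by (simp add: \<sigma>_def)
  qed
  note * = measurable_cong[OF this]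
  show "(%s. emeasure (\<sigma> s) B) \<in> bm halfline"
   by (subst *) measurable
 qed
qed

lemma A_AE_\<kappa>: "AE p in A. 0 < kappa1 \<rho> (fst p) \<and> kappa1 \<rho> (fst p) < \<infinity>"
 unfolding A_density
 by (subst AE_density) (use \<kappa>_finite in \<open>simp_all, eventually_elim, auto simp: zero_less_iff_neq_zero\<close>)

text \<open>The factor \<open>u\<close> is split as the first moment, which together with
  \<open>\<eta>\<close> makes up \<open>A\<close>, times the normalised density of
  \<open>\<sigma>\<close>. It is through this identity that every point added by the Mecke equation
  is resampled.\<close>

lemma nn_integral_size_biased:
 assumes g: "g \<in> bm EE"
 shows "(NN z. ennreal (fst z) * g z \<partial>\<nu>) = (NN p. NN u. g (u, p) \<partial>\<sigma> (fst p) \<partial>A)"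
proof -
 have [measurable]: "(%z. ennreal (fst z)) \<in> bm (EE :: ('x mark) measure)" by measurable
 have [measurable]: "(%p. NN u. g (u, p) \<partial>\<sigma> (fst p)) \<in> bm base"
 proof -
  have "(%p. \<sigma> (fst p)) \<in> base ->M subprob_algebra unit_jumps"
   by (rule measurable_prob_algebraD[OF m_comp[OF fst_base_times \<sigma>_measurable]])
  moreover have "(%(p, u). g (u, p)) \<in> bm (base \<Otimes>\<^sub>M unit_jumps)"
   using m_comp[OF measurable_pair_swap' g] by (simp add: split_beta')
  ultimately show ?thesis by (rule nn_integral_measurable_subprob_algebra2[rotated])
 qed
 have "(NN z. ennreal (fst z) * g z \<partial>\<nu>) = (NN p. NN u. ennreal u * g (u, p) \<partial>\<rho> (fst p) \<partial>\<eta>)"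
  using nn_integral_\<nu>[of "%z. ennreal (fst z) * g z"] g by simp
 also have "\<dots> = (NN p. kappa1 \<rho> (fst p) * (NN u. g (u, p) \<partial>\<sigma> (fst p)) \<partial>\<eta>)"
 proof (rule nn_integral_cong_AE)
  show "AE p in \<eta>. (NN u. ennreal u * g (u, p) \<partial>\<rho> (fst p)) = kappa1 \<rho> (fst p) * (NN u. g (u, p) \<partial>\<sigma> (fst p))"
   using \<kappa>_finite AE_space
  proof eventually_elim
   fix p assume fin: "kappa1 \<rho> (fst p) < \<infinity>" and p: "p \<in> space \<eta>"
   then have s: "fst p > 0" "p \<in> space base" by (simp_all add: \<eta>_space mem_Times_iff)
   let ?k = "kappa1 \<rho> (fst p)"
   have gp: "(%u. g (u, p)) \<in> bm (\<rho> (fst p))"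
    unfolding m_cong_sets[OF \<rho>_sets[OF s(1)] refl]
    by (rule m_comp[OF measurable_Pair2'[OF s(2)] g])
   note e = measurable_ennreal_\<rho>[OF s(1)]
   show "(NN u. ennreal u * g (u, p) \<partial>\<rho> (fst p)) = ?k * (NN u. g (u, p) \<partial>\<sigma> (fst p))"
   \<comment> \<open>A vanishing first moment forces \<open>u = 0\<close> almost everywhere, so the
     dummy value of \<open>\<sigma>\<close> at such times is multiplied by zero.\<close>
   proof (cases "?k = 0")
    case True
    then have "AE u in \<rho> (fst p). ennreal u = 0"
     unfolding kappa1_def using e by (subst (asm) nn_integral_0_iff_AE) auto
    then have "(NN u. ennreal u * g (u, p) \<partial>\<rho> (fst p)) = (NN u. 0 \<partial>\<rho> (fst p))"
     by (intro nn_integral_cong_AE) (auto elim!: AE_mp)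
    then show ?thesis using True by simp
   next
    case False
    then have "(NN u. g (u, p) \<partial>\<sigma> (fst p)) = (NN u. ennreal u / ?k * g (u, p) \<partial>\<rho> (fst p))"
     unfolding \<sigma>_def using fin e gp by (simp add: zero_less_iff_neq_zero nn_integral_density)
    also have "?k * \<dots> = (NN u. ?k * (ennreal u / ?k * g (u, p)) \<partial>\<rho> (fst p))"
     using e gp by (intro nn_integral_cmult[symmetric]) auto
    also have "\<dots> = (NN u. ennreal u * g (u, p) \<partial>\<rho> (fst p))"
    proof (rule nn_cong)
     fix u
     have "?k * (ennreal u / ?k) = ennreal u"
      using False fin by (simp add: ennreal_times_divide mult.commute[of ?k] ennreal_mult_divide_eq)
     then show "?k * (ennreal u / ?k * g (u, p)) = ennreal u * g (u, p)" by (simp add: mult.assoc[symmetric])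
    qed
    finally show ?thesis ..
   qed
  qed
 qed
 also have "\<dots> = (NN p. NN u. g (u, p) \<partial>\<sigma> (fst p) \<partial>A)"
  unfolding A_density by (rule nn_integral_density[symmetric]) measurable
 finally show ?thesis .
qed

lemma \<nu>_mean:
 assumes [measurable]: "B \<in> sets base"
 shows "(NN z. ennreal (fst z) * ind1 B (snd z) \<partial>\<nu>) = emeasure A B"
proof -
 have "(NN z. ennreal (fst z) * ind1 B (snd z) \<partial>\<nu>) = (NN p. NN u. ind1 B p \<partial>\<sigma> (fst p) \<partial>A)"
  using nn_integral_size_biased[of "%z. ind1 B (snd z)"] by simp
 also have "\<dots> = (NN p. ind1 B p \<partial>A)"
 proof (rule nn_cong)
  fix p assume "p \<in> space A"
  then have "prob_space (\<sigma> (fst p))" by (intro \<sigma>_prob) (auto simp: A_space)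
  then show "(NN u. ind1 B p \<partial>\<sigma> (fst p)) = ind1 B p" by (simp add: prob_space.emeasure_space_1)
 qed
 finally show ?thesis by (simp add: A_sets)
qed

text \<open>Products of a jump level and a set of finite \<open>A\<close>-mass have finite
  intensity: on the level \<open>u\<close> is bounded below, and weighting by \<open>u\<close>
  yields \<open>A\<close>.\<close>

lemma \<nu>_levels: "\<exists>D. exhaustion (EE :: ('x mark) measure) D \<and> (\<forall>k. emeasure \<nu> (D k) < \<infinity>)"
proof -
 interpret A: sigma_finite_measure A by (rule A_sigma_finite)
 obtain C :: "nat => (real \<times> 'x) set" where C: "range C \<subseteq> sets A" "(\<Union>i. C i) = space A" "!!i. emeasure A (C i) \<noteq> \<infinity>"
  by (rule A.sigma_finite) auto
 have Cs[measurable]: "C i \<in> sets base" for i using C(1) A_sets by auto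
 let ?L = "%(k, i). jump_levels k \<times> C i"
 have J[measurable]: "jump_levels k \<in> sets unit_jumps" for k by (rule jl.D_sets)
 have fin: "emeasure \<nu> (jump_levels k \<times> C i) < \<infinity>" for k i
 proof -
  have "ennreal (1 / real (k + 2)) * emeasure \<nu> (jump_levels k \<times> C i) =
    (NN z. ennreal (1 / real (k + 2)) * ind1 (jump_levels k \<times> C i) z \<partial>\<nu>)"
   by (subst nn_integral_cmult_indicator) (auto simp: \<nu>_sets)
  also have "\<dots> \<le> (NN z. ennreal (fst z) * ind1 (C i) (snd z) \<partial>\<nu>)"
   by (intro nn_integral_mono) (auto simp: jump_levels_def intro!: ennreal_leI split: split_indicator)
  also have "\<dots> < \<infinity>" using C(3)[of i] by (simp add: \<nu>_mean less_top)
  finally have 1: "ennreal (1 / real (k + 2)) * emeasure \<nu> (jump_levels k \<times> C i) < \<infinity>" .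
  have "0 < 1 / real (k + 2)" by simp
  with 1 show ?thesis by (auto simp: less_top[symmetric] ennreal_mult_eq_top_iff)
 qed
 have "sigma_finite_measure \<nu>"
 proof (rule sigma_finite_measure.intro, intro exI conjI)
  show "countable (range ?L)" by auto
  show "range ?L \<subseteq> sets \<nu>" by (auto simp: \<nu>_sets)
  have "\<Union> (range ?L) = (\<Union>k. jump_levels k) \<times> (\<Union>i. C i)" by auto
  then show "\<Union> (range ?L) = space \<nu>"
   using jl.D_UN C(2) A_space \<nu>_space by (simp add: space_pair_measure)
  show "\<forall>a\<in>range ?L. emeasure \<nu> a \<noteq> \<infinity>" using fin by (auto simp: less_top)
 qed
 then interpret \<nu>: sigma_finite_measure \<nu> .
 obtain D :: "nat => ('x mark) set" where D: "range D \<subseteq> sets \<nu>" "(\<Union>i. D i) = space \<nu>" "!!i. emeasure \<nu> (D i) \<noteq> \<infinity>" "disjoint_family D"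
  by (rule \<nu>.sigma_finite_disjoint) auto
 have "exhaustion EE D"
  using D(1,2,4) \<nu>_space by unfold_locales (auto simp: \<nu>_sets)
 then show ?thesis using D(3) by (auto simp: less_top)
qed

lemma A_time_null: "s > 0 ==> emeasure A ({s} \<times> UNIV) = 0"
proof -
 assume s: "s > 0"
 have S: "{s} \<times> UNIV \<in> sets (base :: (real \<times> 'x) measure)" using s by (intro restricted_time_sets) auto
 have "AE p in \<eta>. p \<notin> {s} \<times> UNIV"
  using diffuse[OF s] S by (intro AE_not_in) (auto simp: null_sets_def \<eta>)
 then have "(NN p. kappa1 \<rho> (fst p) * ind1 ({s} \<times> UNIV) p \<partial>\<eta>) = (NN p. 0 \<partial>\<eta>)"
  by (intro nn_integral_cong_AE) (auto elim!: AE_mp split: split_indicator)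
 then show ?thesis unfolding A_density using S by (subst emeasure_density) (auto simp: \<eta>)
qed

text \<open>\<open>A\<close> is the location marginal of \<open>\<nu>\<close> weighted by
  \<open>u\<close>, and all jumps are strictly positive, so a null integral of \<open>u\<close> over
  a set leaves no mass on it.\<close>

lemma \<nu>_null_from_A:
 assumes B[measurable]: "B \<in> sets base" and null: "emeasure A B = 0"
 shows "emeasure \<nu> {z \<in> space EE. snd z \<in> B} = 0"
proof -
 have "(NN z. ennreal (fst z) * ind1 B (snd z) \<partial>\<nu>) = 0" using \<nu>_mean[OF B] null by simp
 moreover have "(%z. ennreal (fst z) * ind1 B (snd z)) \<in> bm \<nu>"
  unfolding m_cong_sets[OF \<nu>_sets refl] by measurable
 ultimately have "AE z in \<nu>. ennreal (fst z) * ind1 B (snd z) = 0"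
  by (subst (asm) nn_integral_0_iff_AE) auto
 then have "AE z in \<nu>. z \<notin> {z \<in> space EE. snd z \<in> B}"
 proof (rule AE_mp[OF _ AE_I2], intro impI)
  fix z assume "z \<in> space \<nu>" "ennreal (fst z) * ind1 B (snd z) = 0"
  moreover from this(1) have "0 < fst z" by (simp add: \<nu>_space space_pair_measure mem_Times_iff)
  ultimately show "z \<notin> {z \<in> space EE. snd z \<in> B}" by (auto split: split_indicator_asm)
 qed
 moreover have "{z \<in> space EE. snd z \<in> B} \<in> sets \<nu>" unfolding \<nu>_sets by measurable
 ultimately have "{z \<in> space EE. snd z \<in> B} \<in> null_sets \<nu>" using AE_iff_null_sets by blast
 then show ?thesis by auto
qed

lemma \<nu>_time_null: "z \<in> space (EE :: ('x mark) measure) ==> emeasure \<nu> {z' \<in> space EE. tm z' = tm z} = 0"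
proof -
 assume "z \<in> space (EE :: ('x mark) measure)"
 then have s: "0 < tm z" by (auto simp: space_pair_measure)
 have S: "{tm z} \<times> UNIV \<in> sets (base :: (real \<times> 'x) measure)" using s by (intro restricted_time_sets) auto
 have "{z' \<in> space EE. tm z' = tm z} = {z' \<in> space (EE :: ('x mark) measure). snd z' \<in> {tm z} \<times> UNIV}" by (auto simp: mem_Times_iff)
 then show ?thesis using \<nu>_null_from_A[OF S A_time_null[OF s]] by simp
qed

section \<open>Tilting the jump law\<close>

context
 fixes Y :: "real => nat"
 assumes Y: "Y \<in> halfline ->M count_space UNIV"
begin

lemma tilt_measurable: "(%z. ennreal ((1 - fst z) ^ Y (tm z))) \<in> bm (EE :: ('x mark) measure)"
proof -
 have "(%z. Y (tm z)) \<in> (EE :: ('x mark) measure) ->M count_space UNIV"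
  by (rule m_comp[OF m_comp[OF measurable_snd fst_base_times] Y])
 then show ?thesis
  by (intro m_comp[OF _ measurable_ennreal] measurable_compose_countable'[where I=UNIV and f="%i z. (1 - fst z) ^ i" and g="%z. Y (tm z)"]) auto
qed

lemma tilt_power_measurable: "s > 0 ==> (%u. ennreal ((1 - u) ^ k)) \<in> bm (\<rho> s)"
 unfolding m_cong_sets[OF \<rho>_sets refl]
 by (rule m_comp[OF unit_jumps_borel]) measurable

lemma tilted_kernel: "tilted Y \<rho> \<in> halfline ->M MA unit_jumps"
proof (rule measurable_measure_algebraI)
 fix s assume "s \<in> space halfline"
 then show "sets (tilted Y \<rho> s) = sets unit_jumps" by (simp add: tilted_def \<rho>_sets space_restrict_space)
next
 fix B assume B: "B \<in> sets unit_jumps"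
 have f: "(%u. ennreal ((1 - u) ^ k) * ind1 B u) \<in> bm unit_jumps" for k
 proof -
  have [measurable]: "(%u. ennreal ((1 - u) ^ k)) \<in> bm unit_jumps"
   by (rule m_comp[OF unit_jumps_borel]) measurable
  show ?thesis using B by measurable
 qed
 have "(%s. NN u. ennreal ((1 - u) ^ k) * ind1 B u \<partial>\<rho> s) \<in> bm halfline" for k
  by (rule m_comp[OF \<rho> nn_integral_measurable_measure_algebra[OF f]])
 then have "(%s. NN u. ennreal ((1 - u) ^ Y s) * ind1 B u \<partial>\<rho> s) \<in> bm halfline"
  using Y by (rule measurable_compose_countable)
 moreover have eq: "emeasure (tilted Y \<rho> s) B = (NN u. ennreal ((1 - u) ^ Y s) * ind1 B u \<partial>\<rho> s)" if "s \<in> space halfline" for s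
  unfolding tilted_def using that B
  by (intro emeasure_density tilt_power_measurable) (auto simp: \<rho>_sets space_restrict_space)
 ultimately show "(%s. emeasure (tilted Y \<rho> s) B) \<in> bm halfline"
  by (subst measurable_cong[OF eq])
qed

lemma kappa1_tilted: "s > 0 ==> kappa1 (tilted Y \<rho>) s \<le> kappa1 \<rho> s"
proof -
 assume s: "s > 0"
 have "kappa1 (tilted Y \<rho>) s = (NN u. ennreal ((1 - u) ^ Y s) * ennreal u \<partial>\<rho> s)"
  unfolding kappa1_def tilted_def
  by (rule nn_integral_density[OF tilt_power_measurable[OF s] measurable_ennreal_\<rho>[OF s]])
 also have "\<dots> \<le> kappa1 \<rho> s"
  unfolding kappa1_def
 proof (rule nn_integral_mono)
  fix u assume "u \<in> space (\<rho> s)"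
  then have u: "0 < u" "u \<le> 1" by (auto simp: \<rho>_space[OF s])
  then have "(1 - u) ^ Y s * u \<le> 1 * u" by (intro mult_right_mono power_le_one) auto
  then show "ennreal ((1 - u) ^ Y s) * ennreal u \<le> ennreal u"
   using u by (simp add: ennreal_mult[symmetric] ennreal_leI)
 qed
 finally show ?thesis .
qed

lemma tilted_finite: "AE p in \<eta>. kappa1 (tilted Y \<rho>) (fst p) < \<infinity>"
 using \<kappa>_finite AE_space
proof eventually_elim
 fix p assume "kappa1 \<rho> (fst p) < \<infinity>" "p \<in> space \<eta>"
 moreover from this(2) have "0 < fst p" by (simp_all add: \<eta>_space mem_Times_iff)
 ultimately show "kappa1 (tilted Y \<rho>) (fst p) < \<infinity>" using kappa1_tilted order_le_less_trans by blast
qed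

text \<open>Matches the intensity built from the tilted kernel with the density on
  \<open>\<nu>\<close> that \<open>mecke_density\<close> produces.\<close>

lemma intensity_tilted: "intensity (tilted Y \<rho>) \<eta> = density \<nu> (%z. ennreal ((1 - fst z) ^ Y (tm z)))"
proof (rule measure_eqI)
 have s: "sets (intensity (tilted Y \<rho>) \<eta>) = sets EE" by (rule sets_intensity[OF tilted_kernel \<eta> tilted_finite])
 then show "sets (intensity (tilted Y \<rho>) \<eta>) = sets (density \<nu> (%z. ennreal ((1 - fst z) ^ Y (tm z))))"
  by (simp add: \<nu>_sets)
 fix B assume "B \<in> sets (intensity (tilted Y \<rho>) \<eta>)"
 then have B: "B \<in> sets (EE :: ('x mark) measure)" by (simp add: s)
 have "emeasure (intensity (tilted Y \<rho>) \<eta>) B = (NN z. ind1 B z \<partial>intensity (tilted Y \<rho>) \<eta>)"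
  using B s by simp
 also have "\<dots> = (NN p. NN u. ind1 B (u, p) \<partial>tilted Y \<rho> (fst p) \<partial>\<eta>)"
  by (rule nn_integral_intensity[OF tilted_kernel \<eta> tilted_finite]) (use B in simp)
 also have "\<dots> = (NN p. NN u. ennreal ((1 - u) ^ Y (fst p)) * ind1 B (u, p) \<partial>\<rho> (fst p) \<partial>\<eta>)"
 proof (rule nn_cong)
  fix p assume "p \<in> space \<eta>"
  then have p: "0 < fst p" "p \<in> space base" by (simp_all add: \<eta>_space mem_Times_iff)
  show "(NN u. ind1 B (u, p) \<partial>tilted Y \<rho> (fst p)) = (NN u. ennreal ((1 - u) ^ Y (fst p)) * ind1 B (u, p) \<partial>\<rho> (fst p))"
   unfolding tilted_def
  proof (rule nn_integral_density[OF tilt_power_measurable[OF p(1)]])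
   show "(%u. ind1 B (u, p) :: ennreal) \<in> bm (\<rho> (fst p))"
    unfolding m_cong_sets[OF \<rho>_sets[OF p(1)] refl]
    by (rule m_comp[OF measurable_Pair2'[OF p(2)] bm_ind[OF B]])
  qed
 qed
 also have "\<dots> = (NN z. ennreal ((1 - fst z) ^ Y (tm z)) * ind1 B z \<partial>\<nu>)"
  using nn_integral_\<nu>[of "%z. ennreal ((1 - fst z) ^ Y (tm z)) * ind1 B z"] tilt_measurable B by simp
 also have "\<dots> = emeasure (density \<nu> (%z. ennreal ((1 - fst z) ^ Y (tm z)))) B"
  using tilt_measurable B by (intro emeasure_density[symmetric]) (auto simp: \<nu>_sets cong: m_cong_sets)
 finally show "emeasure (intensity (tilted Y \<rho>) \<eta>) B = \<dots>" .
qed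

end

end

text \<open>One representative index for each cell of the partition. With it the jumps can be
  indexed by the fixed set \<open>{..<n}\<close>, whatever the partition; the remaining coordinates
  are dummies.\<close>

definition Fst :: "(nat => 'a) => nat => nat set" where
 "Fst d n = {i. i < n \<and> (\<forall>j<i. d j \<noteq> d i)}"

lemma Fst_subset: "Fst d n \<subseteq> {..<n}" and finite_Fst [simp]: "finite (Fst d n)"
 by (auto simp: Fst_def)

lemma bij_betw_Fst: "bij_betw d (Fst d n) (d ` {..<n})"
 unfolding bij_betw_def
proof
 show "inj_on d (Fst d n)"
  unfolding inj_on_def Fst_def by (metis (mono_tags, lifting) linorder_neqE_nat mem_Collect_eq)
 show "d ` Fst d n = d ` {..<n}"
 proof (intro equalityI image_subsetI)
  fix i assume i: "i \<in> {..<n}"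
  define j where "j = (LEAST j. d j = d i)"
  have "d j = d i" unfolding j_def by (rule LeastI[of _ i]) simp
  moreover have "j \<le> i" unfolding j_def by (rule Least_le) simp
  moreover have "d k \<noteq> d j" if "k < j" for k
   using not_less_Least[of k "%j. d j = d i"] that \<open>d j = d i\<close> unfolding j_def by metis
  ultimately have "j \<in> Fst d n" using i by (auto simp: Fst_def)
  then show "d i \<in> d ` Fst d n" using \<open>d j = d i\<close> by (metis imageI)
 qed (auto simp: Fst_def)
qed

text \<open>The exponent is the cell size less one because one factor \<open>u\<close> is already
  contained in \<open>\<sigma>\<close>.\<close>

definition wt :: "nat => (nat => real \<times> 'x) => (nat => real) => ennreal" where
 "wt n d u = (\<Prod>i\<in>Fst d n. ennreal (u i) ^ (cell_size n d (d i) - 1))"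

definition ptsN :: "('x mark) measure => nat => (nat => real \<times> 'x) => (nat => real)
  => ('x mark) measure" where
 "ptsN N n d u = add_pts N (Fst d n) (%i. (u i, d i))"

section \<open>Disintegration with respect to the data\<close>

text \<open>The functional \<open>h \<mapsto> \<integral> h d\<mu>\<close> for the measure \<open>\<mu>\<close> under which each new observation is
 either drawn from \<open>A\<close> or equals one of the earlier distinct values.\<close>

primrec Jd :: "'p measure => nat => ((nat => 'p) => ennreal) => ennreal" where
 "Jd A 0 h = h (%_. undefined)"
| "Jd A (Suc n) h = Jd A n (%d. (NN p. h (d(n := p)) \<partial>A) + (\<Sum>q\<in>d ` {..<n}. h (d(n := q))))"

lemma PiM_upd_space:
 "d \<in> space (\<Pi>\<^sub>M i\<in>{..<n}. B) ==> p \<in> space B ==> d(n := p) \<in> space (\<Pi>\<^sub>M i\<in>{..<Suc n}. B)"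
 by (auto simp: space_PiM PiE_iff extensional_def less_Suc_eq)

lemma Jd_cong_AE:
 assumes sA: "space A = space B" and "!!d. d \<in> space (\<Pi>\<^sub>M i\<in>{..<n}. B) ==> h d = h' d"
 shows "Jd A n h = Jd A n h'"
 using assms(2)
proof (induction n arbitrary: h h')
 case 0
 then show ?case by (simp add: space_PiM)
next
 case (Suc n)
 show ?case
  unfolding Jd.simps
 proof (rule Suc.IH)
  fix d assume d: "d \<in> space (\<Pi>\<^sub>M i\<in>{..<n}. B)"
  have "(NN p. h (d(n := p)) \<partial>A) = (NN p. h' (d(n := p)) \<partial>A)"
  proof (rule nn_cong)
   fix p assume "p \<in> space A"
   then show "h (d(n := p)) = h' (d(n := p))" by (intro Suc.prems PiM_upd_space[OF d]) (simp add: sA)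
  qed
  moreover have "h (d(n := q)) = h' (d(n := q))" if "q \<in> d ` {..<n}" for q
   using that d by (intro Suc.prems PiM_upd_space[OF d]) (auto simp: space_PiM PiE_iff)
  ultimately show "(NN p. h (d(n := p)) \<partial>A) + (\<Sum>q\<in>d ` {..<n}. h (d(n := q))) =
    (NN p. h' (d(n := p)) \<partial>A) + (\<Sum>q\<in>d ` {..<n}. h' (d(n := q)))"
   by (simp cong: sum.cong)
 qed
qed

abbreviation DD :: "nat => (nat => real \<times> 'x::polish_space) measure" where
 "DD n \<equiv> \<Pi>\<^sub>M i\<in>{..<n}. base"

abbreviation UU :: "nat => (nat => real) measure" where
 "UU n \<equiv> \<Pi>\<^sub>M i\<in>{..<n}. unit_jumps"

lemma measurable_eq_base:
 assumes "f \<in> M ->M (base :: (real \<times> 'x::polish_space) measure)" "g \<in> M ->M base"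
 shows "Measurable.pred M (%x. f x = g x)"
 using m_comp[OF measurable_Pair[OF assms] diag_base] by simp

lemma measurable_DD: "d \<in> M ->M DD n ==> i < n ==> (%x. d x i) \<in> M ->M base"
 by (rule m_comp[OF _ m_proj]) auto

lemma measurable_UU: "u \<in> M ->M UU n ==> i < n ==> (%x. u x i) \<in> M ->M unit_jumps"
 by (rule m_comp[OF _ m_proj]) auto

lemma pred_Fst:
 assumes d: "d \<in> M ->M DD n" and i: "i < n"
 shows "Measurable.pred M (%x. i \<in> Fst (d x) n)"
proof -
 have "{x \<in> space M. d x j = d x i} \<in> sets M" if "j < i" for j
  using measurable_eq_base[OF measurable_DD[OF d] measurable_DD[OF d i], of j] that i by (simp add: pred_def)
 then have "space M - (\<Union>j\<in>{..<i}. {x \<in> space M. d x j = d x i}) \<in> sets M"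
  by (intro sets.Diff sets.finite_UN) auto
 also have "space M - (\<Union>j\<in>{..<i}. {x \<in> space M. d x j = d x i}) = {x \<in> space M. i \<in> Fst (d x) n}"
  using i by (auto simp: Fst_def)
 finally show ?thesis by (simp add: pred_def)
qed

lemma cell_size_sum: "cell_size n d p = (\<Sum>j<n. if d j = p then 1 else 0)"
proof -
 have "{j. j < n \<and> d j = p} = {j\<in>{..<n}. d j = p}" by auto
 then show ?thesis unfolding cell_size_def by (simp add: sum.If_cases Int_def)
qed

lemma wt_prod: "wt n d u = (\<Prod>i<n. if i \<in> Fst d n then ennreal (u i) ^ (cell_size n d (d i) - 1) else 1)"
 unfolding wt_def using Fst_subset[of d n] by (simp add: prod.If_cases Int_absorb1)

lemma measurable_cell_size:
 assumes d: "d \<in> M ->M DD n" and i: "i < n"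
 shows "(%x. cell_size n (d x) (d x i)) \<in> M ->M count_space UNIV"
proof -
 have "(%x. if d x j = d x i then 1 else 0 :: nat) \<in> M ->M count_space UNIV" if "j < n" for j
  using measurable_eq_base[OF measurable_DD[OF d that] measurable_DD[OF d i]] by measurable
 then show ?thesis unfolding cell_size_sum
  by (intro measurable_sum_nat) auto
qed

lemma measurable_wt:
 assumes d: "d \<in> M ->M DD n" and u: "u \<in> M ->M UU n"
 shows "(%x. wt n (d x) (u x)) \<in> bm M"
proof -
 have "(%x. if i \<in> Fst (d x) n then ennreal (u x i) ^ (cell_size n (d x) (d x i) - 1) else 1) \<in> bm M" if i: "i < n" for i
 proof -
  have [measurable]: "(%x. u x i) \<in> bm M" by (rule m_comp[OF measurable_UU[OF u i] unit_jumps_borel])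
  have "(%x. ennreal (u x i) ^ (cell_size n (d x) (d x i) - 1)) \<in> bm M"
   by (rule measurable_compose_countable[OF _ measurable_cell_size[OF d i], where f="%k x. ennreal (u x i) ^ (k - 1)"]) measurable
  then show ?thesis using pred_Fst[OF d i] by measurable
 qed
 then show ?thesis unfolding wt_prod by (intro bm_prod) auto
qed

lemma measurable_ptsN:
 fixes D :: "nat => (real \<times> real \<times> 'x::polish_space) set"
 assumes "exhaustion EE D" and \<kappa>: "\<kappa> \<in> M ->M exhaustion.lf EE D" and d: "d \<in> M ->M DD n" and u: "u \<in> M ->M UU n"
 shows "(%x. ptsN (\<kappa> x) n (d x) (u x)) \<in> M ->M exhaustion.lf EE D"
proof -
 interpret exhaustion EE D by fact
 show ?thesis unfolding ptsN_def
 proof (rule measurable_add_pts[OF \<kappa>, where J="{..<n}"])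
  fix i assume "i \<in> {..<n}"
  then show "(%x. (u x i, d x i)) \<in> M ->M EE" "Measurable.pred M (%x. i \<in> Fst (d x) n)"
   using measurable_UU[OF u] measurable_DD[OF d] pred_Fst[OF d] by auto
 qed (use Fst_subset in auto)
qed

locale crm_pp = crm_model \<rho> \<eta> + exhaustion "EE :: ('x mark) measure" D
 for \<rho> and \<eta> :: "(real \<times> 'x::polish_space) measure" and D +
 fixes P :: "('x mark) measure measure"
 assumes \<nu>_fin: "!!k. emeasure \<nu> (D k) < \<infinity>"
  and P: "prob_space P" and P_sets[measurable_cong]: "sets P = sets lf" and P_mecke: "mecke \<nu> P"
begin

sublocale P: prob_space P by (rule P)

lemma P_space: "space P = space lf"
 by (rule space_eq[OF P_sets])

abbreviation SG :: "nat => (nat => real \<times> 'x) => (nat => real) measure" where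
 "SG n d \<equiv> \<Pi>\<^sub>M i\<in>{..<n}. \<sigma> (fst (d i))"

lemma DD_pos: "d \<in> space (DD n) ==> i < n ==> 0 < fst (d i)"
 by (auto simp: space_PiM PiE_iff mem_Times_iff)

lemma DD_base: "d \<in> space (DD n) ==> i < n ==> d i \<in> space base"
 by (auto simp: space_PiM PiE_iff)

lemma SG_sets: "d \<in> space (DD n) ==> sets (SG n d) = sets (UU n)"
 by (intro sets_PiM_cong) (auto simp: \<sigma>_sets DD_pos)

lemma SG_space: "d \<in> space (DD n) ==> space (SG n d) = space (UU n)"
 by (rule space_eq[OF SG_sets])

lemma SG_prob: "d \<in> space (DD n) ==> prob_space (SG n d)"
 by (intro prob_space_PiM) (auto simp: \<sigma>_prob DD_pos)

lemma H_compose: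
 "H \<in> bm (lf \<Otimes>\<^sub>M DD n) ==> \<kappa> \<in> M ->M lf ==> d \<in> M ->M DD n ==> (%x. H (\<kappa> x, d x)) \<in> bm M"
 by (rule m_comp[OF measurable_Pair])

lemmas pts_meas = measurable_ptsN[OF exhaustion_axioms]

text \<open>The part of the disintegration at fixed data: the jumps at the observed values are drawn
  from \<open>\<sigma>\<close>, their points are added to a configuration with law \<open>P\<close>,
  and \<open>wt\<close> accounts for the repetitions.\<close>

definition Phi :: "nat => (('x mark) measure \<times> (nat => real \<times> 'x) => ennreal) => (nat => real \<times> 'x) => ennreal" where
 "Phi n H d = (NN u. wt n d u * (NN N. H (ptsN N n d u, d) \<partial>P) \<partial>SG n d)"

lemma upd_meas: "d \<in> M ->M DD n ==> p \<in> M ->M base ==> (%x. (d x)(n := p x)) \<in> M ->M DD (Suc n)"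
 by (rule measurable_fun_upd[where J="{..<n}"]) (auto simp: lessThan_Suc)

text \<open>A new value opens a cell of size one, whose weight is a zeroth power. Its coordinate
  becomes a genuine jump, and the new point can be attached to \<open>N\<close> before the
  others.\<close>

lemma Phi_new:
 assumes H: "H \<in> bm (lf \<Otimes>\<^sub>M DD (Suc n))" and d: "d \<in> space (DD n)"
  and p: "p \<in> space base" "p \<notin> d ` {..<n}"
 shows "Phi (Suc n) H (d(n := p)) =
  (NN u. NN v. wt n d u * (NN N. H (ptsN (add1 N (v, p)) n d u, d(n := p)) \<partial>P) \<partial>\<sigma> (fst p) \<partial>SG n d)"
proof -
 let ?d = "d(n := p)"
 have d': "?d \<in> space (DD (Suc n))" by (rule PiM_upd_space[OF d p(1)])
 have F: "Fst ?d (Suc n) = insert n (Fst d n)"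
 proof (rule set_eqI)
  fix i show "i \<in> Fst ?d (Suc n) \<longleftrightarrow> i \<in> insert n (Fst d n)"
   using p(2) by (cases "i = n") (auto simp: Fst_def less_Suc_eq)
 qed
 have cs: "cell_size (Suc n) ?d (d i) = cell_size n d (d i)" if "i < n" for i
 proof -
  have "{j. j < Suc n \<and> ?d j = d i} = {j. j < n \<and> d j = d i}" using p(2) that by (auto simp: less_Suc_eq)
  then show ?thesis by (simp add: cell_size_def)
 qed
 have csn: "cell_size (Suc n) ?d p = 1"
 proof -
  have "{j. j < Suc n \<and> ?d j = p} = {n}" using p(2) by (auto simp: less_Suc_eq)
  then show ?thesis by (simp add: cell_size_def)
 qed
 have nF: "n \<notin> Fst d n" by (auto simp: Fst_def)
 have W: "wt (Suc n) ?d (u(n := v)) = wt n d u" for u v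
  unfolding wt_def F using nF csn cs
  by (auto simp: Fst_def intro!: prod.cong)
 have T: "ptsN N (Suc n) ?d (u(n := v)) = ptsN (add1 N (v, p)) n d u" for N u v
 proof (rule measure_eqI)
  fix B assume "B \<in> sets (ptsN N (Suc n) ?d (u(n := v)))"
  then have B: "B \<in> sets N" by (simp add: ptsN_def)
  have "(\<Sum>i\<in>Fst d n. ind1 B ((u(n := v)) i, ?d i)) = (\<Sum>i\<in>Fst d n. ind1 B (u i, d i) :: ennreal)"
   using nF by (intro sum.cong refl) auto
  moreover have "(\<Sum>i\<in>insert n (Fst d n). ind1 B ((u(n := v)) i, ?d i)) =
    ind1 B (v, p) + (\<Sum>i\<in>Fst d n. ind1 B ((u(n := v)) i, ?d i) :: ennreal)"
   using nF by (subst sum.insert) auto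
  moreover have "emeasure (ptsN N (Suc n) ?d (u(n := v))) B = emeasure N B + (\<Sum>i\<in>insert n (Fst d n). ind1 B ((u(n := v)) i, ?d i))"
   unfolding ptsN_def F by (rule emeasure_add_pts[OF B])
  moreover have "emeasure (ptsN (add1 N (v, p)) n d u) B = emeasure (add1 N (v, p)) B + (\<Sum>i\<in>Fst d n. ind1 B (u i, d i))"
   unfolding ptsN_def by (rule emeasure_add_pts) (simp add: B)
  moreover have "emeasure (add1 N (v, p)) B = emeasure N B + ind1 B (v, p)"
   using emeasure_add_pts[OF B, of "{()}" "%_. (v, p)"] by simp
  ultimately show "emeasure (ptsN N (Suc n) ?d (u(n := v))) B = emeasure (ptsN (add1 N (v, p)) n d u) B"
   by (simp only: ac_simps)
 qed (simp add: ptsN_def)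
 have SGeq: "SG (Suc n) ?d = (\<Pi>\<^sub>M i\<in>insert n {..<n}. \<sigma> (fst (?d i)))" by (simp only: lessThan_Suc)
 \<comment> \<open>The locale wants a sigma-finite measure at every natural number, so indices
   beyond \<open>n\<close> receive an arbitrary probability measure.\<close>
 interpret product_sigma_finite "%i. if i \<le> n then \<sigma> (fst (?d i)) else return unit_jumps 1"
 proof (rule product_sigma_finite.intro)
  fix k show "sigma_finite_measure (if k \<le> n then \<sigma> (fst (?d k)) else return unit_jumps 1)"
   using \<sigma>_prob[OF DD_pos[OF d', of k]] by (auto intro!: prob_space_imp_sigma_finite prob_space_return)
 qed
 have S1: "SG (Suc n) ?d = (\<Pi>\<^sub>M i\<in>insert n {..<n}. if i \<le> n then \<sigma> (fst (?d i)) else return unit_jumps 1)"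
  unfolding lessThan_Suc by (intro PiM_cong) auto
 have S2: "SG n d = (\<Pi>\<^sub>M i\<in>{..<n}. if i \<le> n then \<sigma> (fst (?d i)) else return unit_jumps 1)"
  by (intro PiM_cong) auto
 let ?f = "%u. wt (Suc n) ?d u * (NN N. H (ptsN N (Suc n) ?d u, ?d) \<partial>P)"
 have f: "?f \<in> bm (SG (Suc n) ?d)"
 proof -
  have 1: "(%x. H (ptsN (snd x) (Suc n) ?d (fst x), ?d)) \<in> bm (UU (Suc n) \<Otimes>\<^sub>M P)"
   by (intro H_compose[OF H] pts_meas) (use d' in measurable)
  have 2: "(%u. NN N. H (ptsN N (Suc n) ?d u, ?d) \<partial>P) \<in> bm (UU (Suc n))"
   using P.borel_measurable_nn_integral_fst[OF 1] by simp
  have 3: "(%u. wt (Suc n) ?d u) \<in> bm (UU (Suc n))"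
   by (rule measurable_wt) (use d' in auto)
  show ?thesis unfolding m_cong_sets[OF SG_sets[OF d'] refl] using 2 3 by measurable
 qed
 have "Phi (Suc n) H ?d = (NN u. NN v. ?f (u(n := v)) \<partial>\<sigma> (fst p) \<partial>SG n d)"
 proof -
  have "?f \<in> bm (\<Pi>\<^sub>M i\<in>insert n {..<n}. if i \<le> n then \<sigma> (fst (?d i)) else return unit_jumps 1)"
   using f unfolding S1 .
  from product_nn_integral_insert[OF _ _ this] show ?thesis
   unfolding Phi_def S1 S2 by simp
 qed
 also have "\<dots> = (NN u. NN v. wt n d u * (NN N. H (ptsN (add1 N (v, p)) n d u, ?d) \<partial>P) \<partial>\<sigma> (fst p) \<partial>SG n d)"
  unfolding W T ..
 finally show ?thesis .
qed

text \<open>A repeated value adds no point. It enlarges its cell by one, which multiplies the weight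
  by the jump \<open>u i\<close>, and the new coordinate is a dummy that integrates to one.\<close>

lemma Phi_old:
 assumes H: "H \<in> bm (lf \<Otimes>\<^sub>M DD (Suc n))" and d: "d \<in> space (DD n)" and i: "i \<in> Fst d n"
 shows "Phi (Suc n) H (d(n := d i)) =
  (NN u. wt n d u * (ennreal (u i) * (NN N. H (ptsN N n d u, d(n := d i)) \<partial>P)) \<partial>SG n d)"
proof -
 let ?d = "d(n := d i)"
 have i': "i < n" using i by (auto simp: Fst_def)
 have d': "?d \<in> space (DD (Suc n))" by (rule PiM_upd_space[OF d DD_base[OF d i']])
 have nF: "n \<notin> Fst d n" by (auto simp: Fst_def)
 have F: "Fst ?d (Suc n) = Fst d n"
 proof (rule set_eqI)
  fix j show "j \<in> Fst ?d (Suc n) \<longleftrightarrow> j \<in> Fst d n"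
  proof (cases "j = n")
   case True
   have "?d i = ?d n" using i' by simp
   then have "j \<notin> Fst ?d (Suc n)" using i' True unfolding Fst_def by blast
   then show ?thesis using True nF by blast
  next
   case jn: False
   show ?thesis
   proof (cases "j < n")
    case True
    then have "j < Suc n" "?d j = d j" "!!k. k < j ==> ?d k = d k" by auto
    then show ?thesis using True unfolding Fst_def mem_Collect_eq by metis
   next
    case False
    with jn have "\<not> j < Suc n" by simp
    with False show ?thesis unfolding Fst_def mem_Collect_eq by blast
   qed
  qed
 qed
 have inj: "inj_on d (Fst d n)" using bij_betw_Fst[of d n] by (simp add: bij_betw_def)
 have cs: "cell_size (Suc n) ?d (d j) = (if j = i then Suc (cell_size n d (d j)) else cell_size n d (d j))" if "j \<in> Fst d n" for j
 proof (cases "j = i")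
  case True
  have "{k. k < Suc n \<and> ?d k = d j} = insert n {k. k < n \<and> d k = d j}"
  proof (rule set_eqI)
   fix k show "k \<in> {k. k < Suc n \<and> ?d k = d j} \<longleftrightarrow> k \<in> insert n {k. k < n \<and> d k = d j}"
    using True by (cases "k = n") (simp_all add: less_Suc_eq)
  qed
  then show ?thesis using True by (simp add: cell_size_def)
 next
  case False
  have "d i \<noteq> d j" using False inj i that by (auto dest: inj_onD)
  have "{k. k < Suc n \<and> ?d k = d j} = {k. k < n \<and> d k = d j}"
  proof (rule set_eqI)
   fix k show "k \<in> {k. k < Suc n \<and> ?d k = d j} \<longleftrightarrow> k \<in> {k. k < n \<and> d k = d j}"
    using \<open>d i \<noteq> d j\<close> by (cases "k = n") (simp_all add: less_Suc_eq)
  qed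
  then show ?thesis using False by (simp add: cell_size_def)
 qed
 have pos: "0 < cell_size n d (d i)" using i' by (auto simp: cell_size_def card_gt_0_iff)
 have W: "wt (Suc n) ?d (u(n := v)) = wt n d u * ennreal (u i)" for u v
 proof -
  have "wt (Suc n) ?d (u(n := v)) = (\<Prod>j\<in>Fst d n. ennreal (u j) ^ (cell_size n d (d j) - 1) * (if j = i then ennreal (u j) else 1))"
   unfolding wt_def F
  proof (rule prod.cong[OF refl])
   fix j assume j: "j \<in> Fst d n"
   then have "j \<noteq> n" using nF by auto
   then have "(u(n := v)) j = u j" "?d j = d j" by simp_all
   then show "ennreal ((u(n := v)) j) ^ (cell_size (Suc n) ?d (?d j) - 1) =
     ennreal (u j) ^ (cell_size n d (d j) - 1) * (if j = i then ennreal (u j) else 1)"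
    using cs[OF j] pos power_minus_mult[of "cell_size n d (d i)" "ennreal (u i)"] by (simp only:) (simp split: if_split)
  qed
  also have "\<dots> = wt n d u * ennreal (u i)"
   using i by (simp add: prod.distrib wt_def prod.delta)
  finally show ?thesis .
 qed
 have T: "ptsN N (Suc n) ?d (u(n := v)) = ptsN N n d u" for N u v
 proof (rule measure_eqI)
  fix B assume "B \<in> sets (ptsN N (Suc n) ?d (u(n := v)))"
  then have B: "B \<in> sets N" by (simp add: ptsN_def)
  have "(\<Sum>j\<in>Fst d n. ind1 B ((u(n := v)) j, ?d j)) = (\<Sum>j\<in>Fst d n. ind1 B (u j, d j) :: ennreal)"
   using nF by (intro sum.cong refl) auto
  then show "emeasure (ptsN N (Suc n) ?d (u(n := v))) B = emeasure (ptsN N n d u) B"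
   unfolding ptsN_def F emeasure_add_pts[OF B] by simp
 qed (simp add: ptsN_def)
 interpret product_sigma_finite "%j. if j \<le> n then \<sigma> (fst (?d j)) else return unit_jumps 1"
 proof (rule product_sigma_finite.intro)
  fix k show "sigma_finite_measure (if k \<le> n then \<sigma> (fst (?d k)) else return unit_jumps 1)"
   using \<sigma>_prob[OF DD_pos[OF d', of k]] by (auto intro!: prob_space_imp_sigma_finite prob_space_return)
 qed
 have S1: "SG (Suc n) ?d = (\<Pi>\<^sub>M j\<in>insert n {..<n}. if j \<le> n then \<sigma> (fst (?d j)) else return unit_jumps 1)"
  unfolding lessThan_Suc by (intro PiM_cong) auto
 have S2: "SG n d = (\<Pi>\<^sub>M j\<in>{..<n}. if j \<le> n then \<sigma> (fst (?d j)) else return unit_jumps 1)"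
  by (intro PiM_cong) auto
 let ?f = "%u. wt (Suc n) ?d u * (NN N. H (ptsN N (Suc n) ?d u, ?d) \<partial>P)"
 have f: "?f \<in> bm (SG (Suc n) ?d)"
 proof -
  have 1: "(%x. H (ptsN (snd x) (Suc n) ?d (fst x), ?d)) \<in> bm (UU (Suc n) \<Otimes>\<^sub>M P)"
   by (intro H_compose[OF H] pts_meas) (use d' in measurable)
  have 2: "(%u. NN N. H (ptsN N (Suc n) ?d u, ?d) \<partial>P) \<in> bm (UU (Suc n))"
   using P.borel_measurable_nn_integral_fst[OF 1] by simp
  have 3: "(%u. wt (Suc n) ?d u) \<in> bm (UU (Suc n))"
   by (rule measurable_wt) (use d' in auto)
  show ?thesis unfolding m_cong_sets[OF SG_sets[OF d'] refl] using 2 3 by measurable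
 qed
 have "prob_space (\<sigma> (fst (d i)))" by (rule \<sigma>_prob[OF DD_pos[OF d i']])
 then have one: "emeasure (\<sigma> (fst (d i))) (space (\<sigma> (fst (d i)))) = 1" by (rule prob_space.emeasure_space_1)
 have "Phi (Suc n) H ?d = (NN u. NN v. ?f (u(n := v)) \<partial>\<sigma> (fst (d i)) \<partial>SG n d)"
 proof -
  have "?f \<in> bm (\<Pi>\<^sub>M i\<in>insert n {..<n}. if i \<le> n then \<sigma> (fst (?d i)) else return unit_jumps 1)"
   using f unfolding S1 .
  from product_nn_integral_insert[OF _ _ this] show ?thesis
   unfolding Phi_def S1 S2 by simp
 qed
 also have "\<dots> = (NN u. wt n d u * (ennreal (u i) * (NN N. H (ptsN N n d u, ?d) \<partial>P)) \<partial>SG n d)"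
  unfolding W T using one by (simp add: mult.assoc)
 finally show ?thesis .
qed

end

context crm_pp
begin

text \<open>One more observation means one more integral over the points of the enlarged
  configuration. For the points of \<open>N\<close> the Mecke equation supplies a fresh point, which
  with the factor \<open>u\<close> is a draw from \<open>A\<close> and a jump from
  \<open>\<sigma>\<close>; the added points contribute the sum over the values already seen.\<close>

lemma Phi_step:
 assumes H: "H \<in> bm (lf \<Otimes>\<^sub>M DD (Suc n))" and d: "d \<in> space (DD n)"
 shows "Phi n (%(N, d). NN z. ennreal (fst z) * H (N, d(n := snd z)) \<partial>N) d =
  (NN p. Phi (Suc n) H (d(n := p)) \<partial>A) + (\<Sum>q\<in>d ` {..<n}. Phi (Suc n) H (d(n := q)))"
proof -
 interpret A: sigma_finite_measure A by (rule A_sigma_finite)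
 interpret SG: prob_space "SG n d" by (rule SG_prob[OF d])
 define X where "X u p v = (NN N. H (ptsN (add1 N (v, p)) n d u, d(n := p)) \<partial>P)" for u p v
 have cd: "(%_. d) \<in> M ->M DD n" for M :: "'m measure" using d by simp
 have m1: "(%x. H (ptsN (add1 (snd x) (snd (snd (fst x)), fst (snd (fst x)))) n d (fst (fst x)), d(n := fst (snd (fst x)))))
   \<in> bm ((UU n \<Otimes>\<^sub>M (base \<Otimes>\<^sub>M unit_jumps)) \<Otimes>\<^sub>M P)"
  by (intro H_compose[OF H] pts_meas cd upd_meas measurable_add1) measurable
 have mX: "(%x. X (fst x) (fst (snd x)) (snd (snd x))) \<in> bm (UU n \<Otimes>\<^sub>M (base \<Otimes>\<^sub>M unit_jumps))"
  using P.borel_measurable_nn_integral_fst[OF m1] by (simp add: X_def)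
 have mwt: "(%u. wt n d u) \<in> bm (UU n)" by (rule measurable_wt[OF cd]) simp
 have mG0: "(%u. NN N. H (ptsN N n d u, d(n := d i)) \<partial>P) \<in> bm (UU n)" if "i < n" for i
 proof -
  have "(%x. H (ptsN (snd x) n d (fst x), d(n := d i))) \<in> bm (UU n \<Otimes>\<^sub>M P)"
   by (intro H_compose[OF H] pts_meas cd upd_meas measurable_const DD_base[OF d that]) measurable
  from P.borel_measurable_nn_integral_fst[OF this] show ?thesis by simp
 qed
 have mu: "(%u. ennreal (u i)) \<in> bm (UU n)" if "i < n" for i
  by (rule m_comp[OF measurable_UU[OF m_id that] ennreal_unit_jumps])
 have \<sigma>k: "(%x. \<sigma> (fst (snd x))) \<in> UU n \<Otimes>\<^sub>M base ->M subprob_algebra unit_jumps"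
  by (rule m_comp[OF _ measurable_prob_algebraD[OF \<sigma>_measurable]], rule m_comp[OF measurable_snd fst_base_times])
 have mXv: "(%x. NN v. X (fst x) (snd x) v \<partial>\<sigma> (fst (snd x))) \<in> bm (UU n \<Otimes>\<^sub>M base)"
 proof (rule nn_integral_measurable_subprob_algebra2[OF _ \<sigma>k])
  have "(%x. (fst (fst x), (snd (fst x), snd x))) \<in> (UU n \<Otimes>\<^sub>M base) \<Otimes>\<^sub>M unit_jumps ->M UU n \<Otimes>\<^sub>M (base \<Otimes>\<^sub>M unit_jumps)" by measurable
  from m_comp[OF this mX]
  show "(%(x, v). X (fst x) (snd x) v) \<in> bm ((UU n \<Otimes>\<^sub>M base) \<Otimes>\<^sub>M unit_jumps)" by (simp add: split_beta')
 qed
 note SGm = m_cong_sets[OF SG_sets[OF d] refl]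
 have pair_sets: "sets (SG n d \<Otimes>\<^sub>M A) = sets (UU n \<Otimes>\<^sub>M base)" by (rule sets_pair_measure_cong[OF SG_sets[OF d] A_sets])
 have main: "(NN N. (NN z. ennreal (fst z) * H (ptsN N n d u, d(n := snd z)) \<partial>ptsN N n d u) \<partial>P) =
   (NN p. NN v. X u p v \<partial>\<sigma> (fst p) \<partial>A) + (\<Sum>i\<in>Fst d n. ennreal (u i) * (NN N. H (ptsN N n d u, d(n := d i)) \<partial>P))"
  if u: "u \<in> space (UU n)" for u
 proof -
  have cu: "(%_. u) \<in> M ->M UU n" for M :: "'m measure" using u by simp
  have ui: "(u i, d i) \<in> space EE" if "i < n" for i
   using u that DD_base[OF d that] by (auto simp: space_PiM PiE_iff space_pair_measure)
  have mz: "(%z. ennreal (fst z) * H (N, d(n := snd z))) \<in> bm EE" if "N \<in> space lf" for N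
   using that by (intro bm_times H_compose[OF H] upd_meas cd measurable_const) measurable
  have pl: "ptsN N n d u \<in> space lf" if "N \<in> space lf" for N
   using measurable_space[OF pts_meas[OF measurable_const[OF that] cd cu], of undefined "count_space UNIV"] by simp
  have "(NN N. (NN z. ennreal (fst z) * H (ptsN N n d u, d(n := snd z)) \<partial>ptsN N n d u) \<partial>P) =
   (NN N. (NN z. ennreal (fst z) * H (ptsN N n d u, d(n := snd z)) \<partial>N) +
    (\<Sum>i\<in>Fst d n. ennreal (u i) * H (ptsN N n d u, d(n := d i))) \<partial>P)"
  proof (rule nn_cong)
   fix N assume "N \<in> space P"
   then have N: "N \<in> space lf" by (simp add: P_space)
   have "(%z. ennreal (fst z) * H (ptsN N n d u, d(n := snd z))) \<in> bm N"
    unfolding m_cong_sets[OF sets_lfD[OF N] refl] by (rule mz[OF pl[OF N]])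
   then have "(NN z. ennreal (fst z) * H (ptsN N n d u, d(n := snd z)) \<partial>add_pts N (Fst d n) (%i. (u i, d i))) =
    (NN z. ennreal (fst z) * H (ptsN N n d u, d(n := snd z)) \<partial>N) +
    (\<Sum>i\<in>Fst d n. ennreal (fst (u i, d i)) * H (ptsN N n d u, d(n := snd (u i, d i))))"
    using Fst_subset[of d n] ui by (intro nn_integral_add_pts) (auto simp: space_lfD[OF N] simp del: space_pair_measure)
   then show "(NN z. ennreal (fst z) * H (ptsN N n d u, d(n := snd z)) \<partial>ptsN N n d u) =
    (NN z. ennreal (fst z) * H (ptsN N n d u, d(n := snd z)) \<partial>N) +
    (\<Sum>i\<in>Fst d n. ennreal (u i) * H (ptsN N n d u, d(n := d i)))"
    by (simp add: ptsN_def)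
  qed
  also have "\<dots> = (NN N. (NN z. ennreal (fst z) * H (ptsN N n d u, d(n := snd z)) \<partial>N) \<partial>P) +
    (NN N. (\<Sum>i\<in>Fst d n. ennreal (u i) * H (ptsN N n d u, d(n := d i))) \<partial>P)"
  proof (rule nn_integral_add)
   have "(%x. ennreal (fst (snd x)) * H (ptsN (fst x) n d u, d(n := snd (snd x)))) \<in> bm (lf \<Otimes>\<^sub>M EE)"
    by (intro bm_times H_compose[OF H] pts_meas cd cu upd_meas) measurable
   from measurable_nn_integral_lf[OF m_id this]
   show "(%N. NN z. ennreal (fst z) * H (ptsN N n d u, d(n := snd z)) \<partial>N) \<in> bm P"
    unfolding m_cong_sets[OF P_sets refl] by simp
   have "(%N. ennreal (u i) * H (ptsN N n d u, d(n := d i))) \<in> bm lf" if "i < n" for i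
    by (intro bm_times H_compose[OF H] pts_meas cd cu upd_meas measurable_const DD_base[OF d that]) measurable
   then show "(%N. \<Sum>i\<in>Fst d n. ennreal (u i) * H (ptsN N n d u, d(n := d i))) \<in> bm P"
    unfolding m_cong_sets[OF P_sets refl] using Fst_subset[of d n] by (intro borel_measurable_sum) auto
  qed
  also have "(NN N. (\<Sum>i\<in>Fst d n. ennreal (u i) * H (ptsN N n d u, d(n := d i))) \<partial>P) =
    (\<Sum>i\<in>Fst d n. ennreal (u i) * (NN N. H (ptsN N n d u, d(n := d i)) \<partial>P))"
  proof -
   have m: "(%N. H (ptsN N n d u, d(n := d i))) \<in> bm P" if "i \<in> Fst d n" for i
   proof -
    have "i < n" using that by (simp add: Fst_def)
    then show ?thesis unfolding m_cong_sets[OF P_sets refl]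
     by (intro H_compose[OF H] pts_meas cd cu upd_meas measurable_const DD_base[OF d]) measurable
   qed
   then have "(NN N. (\<Sum>i\<in>Fst d n. ennreal (u i) * H (ptsN N n d u, d(n := d i))) \<partial>P) =
     (\<Sum>i\<in>Fst d n. NN N. ennreal (u i) * H (ptsN N n d u, d(n := d i)) \<partial>P)"
    by (intro nn_integral_sum) auto
   also have "\<dots> = (\<Sum>i\<in>Fst d n. ennreal (u i) * (NN N. H (ptsN N n d u, d(n := d i)) \<partial>P))"
    using m by (intro sum.cong refl nn_integral_cmult) auto
   finally show ?thesis .
  qed
  also have "(NN N. (NN z. ennreal (fst z) * H (ptsN N n d u, d(n := snd z)) \<partial>N) \<partial>P) =
    (NN z. NN N. ennreal (fst z) * H (ptsN (add1 N z) n d u, d(n := snd z)) \<partial>P \<partial>\<nu>)"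
  proof -
   have "(%x. ennreal (fst (snd x)) * H (ptsN (fst x) n d u, d(n := snd (snd x)))) \<in> bm (lf \<Otimes>\<^sub>M EE)"
    by (intro bm_times H_compose[OF H] pts_meas cd cu upd_meas) measurable
   from meckeD[OF P_mecke this] show ?thesis by simp
  qed
  also have "\<dots> = (NN z. ennreal (fst z) * (NN N. H (ptsN (add1 N z) n d u, d(n := snd z)) \<partial>P) \<partial>\<nu>)"
  proof (rule nn_cong)
   fix z assume "z \<in> space \<nu>"
   then have z: "z \<in> space EE" by (simp add: \<nu>_space)
   then have "snd z \<in> space base" by (auto simp: space_pair_measure)
   then have "(%N. H (ptsN (add1 N z) n d u, d(n := snd z))) \<in> bm P"
    unfolding m_cong_sets[OF P_sets refl]
    by (intro H_compose[OF H] pts_meas cd cu upd_meas measurable_const measurable_add1_left z)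
   then show "(NN N. ennreal (fst z) * H (ptsN (add1 N z) n d u, d(n := snd z)) \<partial>P) =
     ennreal (fst z) * (NN N. H (ptsN (add1 N z) n d u, d(n := snd z)) \<partial>P)"
    by (rule nn_integral_cmult)
  qed
  also have "\<dots> = (NN p. NN v. X u p v \<partial>\<sigma> (fst p) \<partial>A)"
  proof -
   have "(%z. (u, (snd z, fst z))) \<in> EE ->M UU n \<Otimes>\<^sub>M (base \<Otimes>\<^sub>M unit_jumps)" using u by measurable
   from m_comp[OF this mX]
   have "(%z. NN N. H (ptsN (add1 N z) n d u, d(n := snd z)) \<partial>P) \<in> bm EE" by (simp add: X_def)
   from nn_integral_size_biased[OF this] show ?thesis by (simp add: X_def)
  qed
  finally show ?thesis .
 qed
 \<comment> \<open>Time fibres are null for \<open>A\<close>, so a fresh draw almost surely differs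
   from the earlier values, as \<open>Phi_new\<close> requires.\<close>
 have dist: "AE p in A. p \<notin> d ` {..<n}"
 proof -
  have "AE p in A. p \<noteq> d i" if "i < n" for i
  proof (rule AE_I)
   have s: "0 < fst (d i)" by (rule DD_pos[OF d that])
   show "{p \<in> space A. \<not> p \<noteq> d i} \<subseteq> {fst (d i)} \<times> UNIV"
   proof
    fix p assume "p \<in> {p \<in> space A. \<not> p \<noteq> d i}"
    then have "p = d i" by simp
    then show "p \<in> {fst (d i)} \<times> UNIV" by (simp add: mem_Times_iff)
   qed
   show "emeasure A ({fst (d i)} \<times> UNIV) = 0" by (rule A_time_null[OF s])
   show "{fst (d i)} \<times> UNIV \<in> sets A" unfolding A_sets using s by (intro restricted_time_sets) auto
  qed
  then have "AE p in A. \<forall>i\<in>{..<n}. p \<noteq> d i" by (subst AE_ball_countable) auto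
  then show ?thesis by eventually_elim auto
 qed
 have "Phi n (%(N, d). NN z. ennreal (fst z) * H (N, d(n := snd z)) \<partial>N) d =
  (NN u. wt n d u * (NN p. NN v. X u p v \<partial>\<sigma> (fst p) \<partial>A) +
   (\<Sum>i\<in>Fst d n. wt n d u * (ennreal (u i) * (NN N. H (ptsN N n d u, d(n := d i)) \<partial>P))) \<partial>SG n d)"
  unfolding Phi_def
  by (intro nn_cong) (simp add: SG_space[OF d] main distrib_left sum_distrib_left)
 also have "\<dots> = (NN u. wt n d u * (NN p. NN v. X u p v \<partial>\<sigma> (fst p) \<partial>A) \<partial>SG n d) +
   (NN u. (\<Sum>i\<in>Fst d n. wt n d u * (ennreal (u i) * (NN N. H (ptsN N n d u, d(n := d i)) \<partial>P))) \<partial>SG n d)"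
 proof (rule nn_integral_add)
  have "(%u. NN p. NN v. X u p v \<partial>\<sigma> (fst p) \<partial>A) \<in> bm (UU n)"
   using A.borel_measurable_nn_integral_fst[of "%x. NN v. X (fst x) (snd x) v \<partial>\<sigma> (fst (snd x))" "UU n"] mXv
   by (simp cong: m_cong_sets sets_pair_measure_cong add: A_sets)
  then show "(%u. wt n d u * (NN p. NN v. X u p v \<partial>\<sigma> (fst p) \<partial>A)) \<in> bm (SG n d)"
   unfolding SGm by (intro bm_times mwt)
  show "(%u. \<Sum>i\<in>Fst d n. wt n d u * (ennreal (u i) * (NN N. H (ptsN N n d u, d(n := d i)) \<partial>P))) \<in> bm (SG n d)"
   unfolding SGm using Fst_subset[of d n]
   by (intro borel_measurable_sum bm_times mwt mu mG0) auto
 qed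
 also have "(NN u. (\<Sum>i\<in>Fst d n. wt n d u * (ennreal (u i) * (NN N. H (ptsN N n d u, d(n := d i)) \<partial>P))) \<partial>SG n d) =
   (\<Sum>i\<in>Fst d n. Phi (Suc n) H (d(n := d i)))"
 proof -
  have "(NN u. (\<Sum>i\<in>Fst d n. wt n d u * (ennreal (u i) * (NN N. H (ptsN N n d u, d(n := d i)) \<partial>P))) \<partial>SG n d) =
   (\<Sum>i\<in>Fst d n. NN u. wt n d u * (ennreal (u i) * (NN N. H (ptsN N n d u, d(n := d i)) \<partial>P)) \<partial>SG n d)"
   using Fst_subset[of d n]
   by (intro nn_integral_sum) (unfold SGm, intro bm_times mwt mu mG0, auto)
  then show ?thesis using Phi_old[OF H d] by simp
 qed
 also have "(\<Sum>i\<in>Fst d n. Phi (Suc n) H (d(n := d i))) = (\<Sum>q\<in>d ` {..<n}. Phi (Suc n) H (d(n := q)))"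
  by (rule sum.reindex_bij_betw[OF bij_betw_Fst])
 also have "(NN u. wt n d u * (NN p. NN v. X u p v \<partial>\<sigma> (fst p) \<partial>A) \<partial>SG n d) =
   (NN u. NN p. wt n d u * (NN v. X u p v \<partial>\<sigma> (fst p)) \<partial>A \<partial>SG n d)"
 proof (rule nn_cong, rule nn_integral_cmult[symmetric])
  fix u assume "u \<in> space (SG n d)"
  then have u: "u \<in> space (UU n)" by (simp add: SG_space[OF d])
  from m_comp[OF measurable_Pair1'[OF this] mXv]
  show "(%p. NN v. X u p v \<partial>\<sigma> (fst p)) \<in> bm A"
   unfolding m_cong_sets[OF A_sets refl] by simp
 qed
 also have "\<dots> = (NN p. NN u. wt n d u * (NN v. X u p v \<partial>\<sigma> (fst p)) \<partial>SG n d \<partial>A)"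
 proof -
  interpret pair_sigma_finite "SG n d" A ..
  have "(%x. wt n d (fst x) * (NN v. X (fst x) (snd x) v \<partial>\<sigma> (fst (snd x)))) \<in> bm (SG n d \<Otimes>\<^sub>M A)"
   unfolding m_cong_sets[OF pair_sets refl]
   by (intro bm_times mXv m_comp[OF measurable_fst mwt])
  from Fubini[OF this] show ?thesis by simp
 qed
 also have "\<dots> = (NN p. Phi (Suc n) H (d(n := p)) \<partial>A)"
 proof (rule nn_integral_cong_AE)
  show "AE p in A. (NN u. wt n d u * (NN v. X u p v \<partial>\<sigma> (fst p)) \<partial>SG n d) = Phi (Suc n) H (d(n := p))"
   using dist AE_space
  proof eventually_elim
   fix p assume pd: "p \<notin> d ` {..<n}" and "p \<in> space A"
   then have p: "p \<in> space base" "0 < fst p" by (auto simp: A_space mem_Times_iff)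
   have "(NN u. wt n d u * (NN v. X u p v \<partial>\<sigma> (fst p)) \<partial>SG n d) = (NN u. NN v. wt n d u * X u p v \<partial>\<sigma> (fst p) \<partial>SG n d)"
   proof (rule nn_cong, rule nn_integral_cmult[symmetric])
    fix u assume "u \<in> space (SG n d)"
    then have u: "u \<in> space (UU n)" by (simp add: SG_space[OF d])
    have "(%v. (u, (p, v))) \<in> unit_jumps ->M UU n \<Otimes>\<^sub>M (base \<Otimes>\<^sub>M unit_jumps)" using u p by measurable
    from m_comp[OF this mX]
    show "(%v. X u p v) \<in> bm (\<sigma> (fst p))"
     unfolding m_cong_sets[OF \<sigma>_sets[OF p(2)] refl] by simp
   qed
   also have "\<dots> = Phi (Suc n) H (d(n := p))"
    unfolding X_def by (rule Phi_new[OF H d p(1) pd, symmetric])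
   finally show "(NN u. wt n d u * (NN v. X u p v \<partial>\<sigma> (fst p)) \<partial>SG n d) = Phi (Suc n) H (d(n := p))" .
  qed
 qed
 finally show ?thesis .
qed

text \<open>Integrating out the last observation first turns \<open>H\<close> into the functional
  \<open>?H\<close> of one observation less, to which the induction hypothesis applies;
  \<open>Phi_step\<close> then reproduces the recursion of \<open>Jd\<close>.\<close>

theorem disintegration:
 assumes "H \<in> bm (lf \<Otimes>\<^sub>M DD n)"
 shows "(NN N. NN y. (\<Prod>i<n. ennreal (fst (y i))) * H (N, \<lambda>i\<in>{..<n}. snd (y i)) \<partial>(\<Pi>\<^sub>M i\<in>{..<n}. N) \<partial>P) =
  Jd A n (Phi n H)"
 using assms
proof (induction n arbitrary: H)
 case 0
 interpret E: prob_space "count_space {%_. undefined :: real}"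
  by (rule prob_spaceI) simp
 have "ptsN N 0 (%_. undefined) u = N" if "N \<in> space P" for N u
  by (rule measure_eqI) (auto simp: ptsN_def emeasure_add_pts Fst_def)
 then show ?case
  by (simp add: PiM_empty Phi_def wt_def Fst_def nn_integral_count_space_finite restrict_def cong: nn_cong)
next
 case (Suc n)
 let ?H = "%(N, d). NN z. ennreal (fst z) * H (N, d(n := snd z)) \<partial>N"
 have m: "(%x. ennreal (fst (snd x)) * H (fst (fst x), (snd (fst x))(n := snd (snd x)))) \<in> bm ((lf \<Otimes>\<^sub>M DD n) \<Otimes>\<^sub>M EE)"
  by (intro bm_times H_compose[OF Suc.prems] upd_meas) measurable
 have H': "?H \<in> bm (lf \<Otimes>\<^sub>M DD n)"
  using measurable_nn_integral_lf[OF measurable_fst m] by (simp add: split_beta')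
 have "(NN N. NN y. (\<Prod>i<Suc n. ennreal (fst (y i))) * H (N, \<lambda>i\<in>{..<Suc n}. snd (y i)) \<partial>(\<Pi>\<^sub>M i\<in>{..<Suc n}. N) \<partial>P) =
   (NN N. NN y. (\<Prod>i<n. ennreal (fst (y i))) * ?H (N, \<lambda>i\<in>{..<n}. snd (y i)) \<partial>(\<Pi>\<^sub>M i\<in>{..<n}. N) \<partial>P)"
 proof (rule nn_cong)
  fix N assume "N \<in> space P"
  then have N: "N \<in> space lf" by (simp add: P_space)
  interpret product_sigma_finite "%_. N" using sigma_finite_lf[OF N] by (intro product_sigma_finite.intro)
  have s: "sets (\<Pi>\<^sub>M i\<in>I. N) = sets (\<Pi>\<^sub>M i\<in>I. EE)" for I :: "nat set" using sets_lfD[OF N] by (intro sets_PiM_cong) auto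
  let ?f = "%y. (\<Prod>i<Suc n. ennreal (fst (y i))) * H (N, \<lambda>i\<in>{..<Suc n}. snd (y i))"
  have comp: "(%y. y i) \<in> (\<Pi>\<^sub>M i\<in>{..<Suc n}. EE) ->M EE" if "i < Suc n" for i
   using that by (intro m_proj) auto
  have f: "?f \<in> bm (\<Pi>\<^sub>M i\<in>insert n {..<n}. N)"
   unfolding lessThan_Suc[symmetric] m_cong_sets[OF s refl]
  proof (intro bm_times bm_prod H_compose[OF Suc.prems] measurable_const N measurable_restrict)
   fix i assume "i \<in> {..<Suc n}"
   then have i: "i < Suc n" by simp
   show "(%y. ennreal (fst (y i))) \<in> bm (\<Pi>\<^sub>M i\<in>{..<Suc n}. EE)"
    by (rule m_comp[OF m_comp[OF comp[OF i] measurable_jump] measurable_ennreal])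
   show "(%y. snd (y i)) \<in> (\<Pi>\<^sub>M i\<in>{..<Suc n}. EE) ->M base"
    by (rule m_comp[OF comp[OF i] measurable_snd])
  qed
  have upd: "(\<lambda>i\<in>{..<Suc n}. snd ((y(n := z)) i)) = (\<lambda>i\<in>{..<n}. snd (y i))(n := snd z)" for y :: "nat => real \<times> real \<times> 'x" and z
   by (auto simp: restrict_def fun_eq_iff less_Suc_eq)
  have "(NN y. ?f y \<partial>(\<Pi>\<^sub>M i\<in>{..<Suc n}. N)) = (NN y. NN z. ?f (y(n := z)) \<partial>N \<partial>(\<Pi>\<^sub>M i\<in>{..<n}. N))"
   using product_nn_integral_insert[OF _ _ f] by (simp add: lessThan_Suc)
  also have "\<dots> = (NN y. (\<Prod>i<n. ennreal (fst (y i))) * ?H (N, \<lambda>i\<in>{..<n}. snd (y i)) \<partial>(\<Pi>\<^sub>M i\<in>{..<n}. N))"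
  proof (rule nn_cong)
   fix y assume "y \<in> space (\<Pi>\<^sub>M i\<in>{..<n}. N)"
   then have y: "y \<in> space (\<Pi>\<^sub>M i\<in>{..<n}. EE)" using space_eq[OF s] by blast
   have y': "(\<lambda>i\<in>{..<n}. snd (y i)) \<in> space (DD n)" using y by (auto simp: space_PiM PiE_iff space_pair_measure mem_Times_iff)
   have "(NN z. ?f (y(n := z)) \<partial>N) = (NN z. (\<Prod>i<n. ennreal (fst (y i))) * (ennreal (fst z) * H (N, (\<lambda>i\<in>{..<n}. snd (y i))(n := snd z))) \<partial>N)"
    unfolding upd by (intro nn_cong) (simp add: mult.assoc)
   also have "\<dots> = (\<Prod>i<n. ennreal (fst (y i))) * ?H (N, \<lambda>i\<in>{..<n}. snd (y i))"
    unfolding split_conv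
   proof (rule nn_integral_cmult)
    show "(%z. ennreal (fst z) * H (N, (\<lambda>i\<in>{..<n}. snd (y i))(n := snd z))) \<in> bm N"
     unfolding m_cong_sets[OF sets_lfD[OF N] refl]
     by (intro bm_times H_compose[OF Suc.prems] upd_meas measurable_const N y') measurable
   qed
   finally show "(NN z. ?f (y(n := z)) \<partial>N) = \<dots>" .
  qed
  finally show "(NN y. ?f y \<partial>(\<Pi>\<^sub>M i\<in>{..<Suc n}. N)) = (NN y. (\<Prod>i<n. ennreal (fst (y i))) * ?H (N, \<lambda>i\<in>{..<n}. snd (y i)) \<partial>(\<Pi>\<^sub>M i\<in>{..<n}. N))" .
 qed
 also have "\<dots> = Jd A n (Phi n ?H)" by (rule Suc.IH[OF H'])
 also have "\<dots> = Jd A (Suc n) (Phi (Suc n) H)"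
  unfolding Jd.simps
 proof (rule Jd_cong_AE)
  show "space A = space (base :: (real \<times> 'x) measure)" by (simp add: A_space)
  fix d :: "nat => real \<times> 'x" assume d: "d \<in> space (DD n)"
  show "Phi n ?H d = (NN p. Phi (Suc n) H (d(n := p)) \<partial>A) + (\<Sum>q\<in>d ` {..<n}. Phi (Suc n) H (d(n := q)))"
   by (rule Phi_step[OF Suc.prems d])
 qed
 finally show ?case .
qed

end

section \<open>Survival factors and the posterior kernel\<close>

lemma ennreal_one_minus: "0 \<le> u ==> 1 - ennreal u = ennreal (1 - u)"
 using ennreal_minus[of u 1] by simp

text \<open>Every observation or censoring time after \<open>s\<close> contributes one factor to a
  jump at time \<open>s\<close>: this is the origin of the exponent \<open>Y\<close>.\<close>

lemma at_risk_product:
 fixes c :: ennreal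
 shows "(\<Prod>l<m. if s < C l then c else 1) * (\<Prod>i<n. if s < fst (d i) then c else 1) = c ^ at_risk n m C d s"
proof -
 have *: "(\<Prod>i<k. if P i then c else 1) = c ^ card {i. i < k \<and> P i}" for k and P :: "nat => bool"
 proof -
  have "{i. i < k \<and> P i} = {..<k} \<inter> {i. P i}" by auto
  then show ?thesis by (simp add: prod.If_cases)
 qed
 show ?thesis unfolding * at_risk_def by (simp add: power_add mult.commute)
qed

locale crm_data = crm_pp \<rho> \<eta> D P for \<rho> and \<eta> :: "(real \<times> 'x::polish_space) measure" and D P +
 fixes n m :: nat and C :: "nat => real"
begin

abbreviation Ydm :: "(nat => real \<times> 'x) => real => nat" where "Ydm d \<equiv> at_risk n m C d"

text \<open>The survival factors only. The factors \<open>\<Lambda>(dT,dX)\<close> are represented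
  by points drawn from \<open>N\<close> and weighted by their jumps.\<close>

definition lik :: "('x mark) measure => (nat => real \<times> 'x) => ennreal" where
 "lik N d = (\<Prod>l<m. survT N {0<..<C l}) * (\<Prod>i<n. survT N {0<..<fst (d i)})"

lemma survT_measurable:
 assumes \<kappa>: "\<kappa> \<in> M ->M lf" and t[measurable]: "t \<in> bm M"
 shows "(%x. survT (\<kappa> x) {a<..<t x}) \<in> bm M"
proof -
 have "(%x. neg_log_compl (ennreal (fst (snd x))) * (if a < tm (snd x) \<and> tm (snd x) < t (fst x) then 1 else 0)) \<in> bm (M \<Otimes>\<^sub>M EE)"
  by measurable
 also have "(%x. neg_log_compl (ennreal (fst (snd x))) * (if a < tm (snd x) \<and> tm (snd x) < t (fst x) then 1 else 0)) =
   (%x. neg_log_compl (ennreal (fst (snd x))) * ind1 {a<..<t (fst x)} (tm (snd x)))"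
  by (auto simp: fun_eq_iff indicator_def)
 finally have 1: "(%x. neg_log_compl (ennreal (fst (snd x))) * ind1 {a<..<t (fst x)} (tm (snd x))) \<in> bm (M \<Otimes>\<^sub>M EE)" .
 show ?thesis
  unfolding survT_def
  by (rule m_comp[OF _ borel_measurable_exp_neg])
   (use measurable_nn_integral_lf[OF \<kappa> 1] in simp)
qed

lemma survT_time_measurable: "N \<in> space lf ==> (%s. survT N {a<..<s}) \<in> bm borel"
 by (rule survT_measurable[OF measurable_const]) simp_all

lemma survT_integrand: "T \<in> sets borel ==> (%z. neg_log_compl (ennreal (fst z)) * ind1 T (tm z)) \<in> bm (EE :: ('x mark) measure)"
 by (rule bm_times[OF m_comp[OF m_comp[OF measurable_jump measurable_ennreal] borel_measurable_neg_log_compl]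
   m_comp[OF measurable_tm bm_ind]])

lemma survT_add_pts:
 assumes N: "N \<in> space lf" and I: "finite I" and z: "!!i. i \<in> I ==> z i \<in> space EE" and T: "T \<in> sets borel"
 shows "survT (add_pts N I z) T = survT N T * (\<Prod>i\<in>I. if tm (z i) \<in> T then 1 - ennreal (fst (z i)) else 1)"
proof -
 have "(NN z. neg_log_compl (ennreal (fst z)) * ind1 T (tm z) \<partial>add_pts N I z) =
  (NN z. neg_log_compl (ennreal (fst z)) * ind1 T (tm z) \<partial>N) +
   (\<Sum>i\<in>I. neg_log_compl (ennreal (fst (z i))) * ind1 T (tm (z i)))"
  using survT_integrand[OF T] z
  by (intro nn_integral_add_pts) (simp_all cong: m_cong_sets add: sets_lfD[OF N] space_lfD[OF N] del: space_pair_measure)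
 then have "survT (add_pts N I z) T = survT N T * (\<Prod>i\<in>I. exp_neg (neg_log_compl (ennreal (fst (z i))) * ind1 T (tm (z i))))"
  by (simp add: survT_def exp_neg_add exp_neg_sum)
 also have "(\<Prod>i\<in>I. exp_neg (neg_log_compl (ennreal (fst (z i))) * ind1 T (tm (z i)))) =
   (\<Prod>i\<in>I. if tm (z i) \<in> T then 1 - ennreal (fst (z i)) else 1)"
 proof (rule prod.cong[OF refl])
  fix i assume "i \<in> I"
  then have "fst (z i) \<le> 1" using z[of i] by (auto simp: space_pair_measure mem_Times_iff)
  then show "exp_neg (neg_log_compl (ennreal (fst (z i))) * ind1 T (tm (z i))) = (if tm (z i) \<in> T then 1 - ennreal (fst (z i)) else 1)"
   by (simp add: exp_neg_neg_log_compl)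
 qed
 finally show ?thesis .
qed

lemma lik_measurable:
 assumes \<kappa>: "\<kappa> \<in> M ->M lf" and d: "d \<in> M ->M DD n"
 shows "(%x. lik (\<kappa> x) (d x)) \<in> bm M"
 unfolding lik_def
 by (intro bm_times bm_prod survT_measurable[OF \<kappa>]
   m_comp[OF measurable_DD[OF d] measurable_fst_base]) auto

lemma lik_le_1: "lik N d \<le> 1"
 unfolding lik_def by (intro mult_le_one prod_le_1) (auto intro: survT_le_1)

text \<open>Exchanging the products over data and over points collects the factors of each point.
  The time intervals are open on the right, so an observation does not tilt the jump at its own
  time; this fits the strict inequality in \<open>at_risk\<close>.\<close>

lemma lik_add_pts:
 assumes N: "N \<in> space lf" and I: "finite I" and z: "!!i. i \<in> I ==> z i \<in> space EE"
 shows "lik (add_pts N I z) d = lik N d * (\<Prod>i\<in>I. ennreal ((1 - fst (z i)) ^ Ydm d (tm (z i))))"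
proof -
 have pos: "0 < tm (z i)" "0 \<le> fst (z i)" "fst (z i) \<le> 1" if "i \<in> I" for i
  using z[OF that] by (auto simp: space_pair_measure mem_Times_iff)
 have S: "survT (add_pts N I z) {0<..<t} = survT N {0<..<t} * (\<Prod>i\<in>I. if tm (z i) < t then ennreal (1 - fst (z i)) else 1)" for t
 proof -
  have "survT (add_pts N I z) {0<..<t} = survT N {0<..<t} * (\<Prod>i\<in>I. if tm (z i) \<in> {0<..<t} then 1 - ennreal (fst (z i)) else 1)"
   by (rule survT_add_pts[OF N I z]) auto
  also have "(\<Prod>i\<in>I. if tm (z i) \<in> {0<..<t} then 1 - ennreal (fst (z i)) else 1) = (\<Prod>i\<in>I. if tm (z i) < t then ennreal (1 - fst (z i)) else 1)"
   using pos by (intro prod.cong refl) (auto simp: ennreal_one_minus)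
  finally show ?thesis .
 qed
 have "lik (add_pts N I z) d = lik N d *
   ((\<Prod>l<m. \<Prod>i\<in>I. if tm (z i) < C l then ennreal (1 - fst (z i)) else 1) *
   (\<Prod>j<n. \<Prod>i\<in>I. if tm (z i) < fst (d j) then ennreal (1 - fst (z i)) else 1))"
  unfolding lik_def S by (simp add: prod.distrib ac_simps)
 also have "(\<Prod>l<m. \<Prod>i\<in>I. if tm (z i) < C l then ennreal (1 - fst (z i)) else 1) *
   (\<Prod>j<n. \<Prod>i\<in>I. if tm (z i) < fst (d j) then ennreal (1 - fst (z i)) else 1) =
   (\<Prod>i\<in>I. (\<Prod>l<m. if tm (z i) < C l then ennreal (1 - fst (z i)) else 1) *
    (\<Prod>j<n. if tm (z i) < fst (d j) then ennreal (1 - fst (z i)) else 1))"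
  unfolding prod.distrib by (intro arg_cong2[where f="(*)"]) (rule prod.swap)+
 also have "\<dots> = (\<Prod>i\<in>I. ennreal (1 - fst (z i)) ^ Ydm d (tm (z i)))"
  by (simp only: at_risk_product)
 also have "\<dots> = (\<Prod>i\<in>I. ennreal ((1 - fst (z i)) ^ Ydm d (tm (z i))))"
  using pos by (intro prod.cong refl) (simp add: ennreal_power)
 finally show ?thesis .
qed

lemma at_risk_measurable:
 assumes d: "d \<in> M ->M DD n" and t[measurable]: "t \<in> bm M"
 shows "(%x. Ydm (d x) (t x)) \<in> M ->M count_space UNIV"
proof -
 have eq: "Ydm d s = (\<Sum>i<n. if s < fst (d i) then 1 else 0) + (\<Sum>l<m. if s < C l then 1 else 0)" for d s
 proof -
  have *: "{i. i < k \<and> P i} = {..<k} \<inter> {i. P i}" for k and P :: "nat => bool" by auto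
  show ?thesis unfolding at_risk_def * by (simp add: sum.If_cases)
 qed
 have "(%x. if t x < fst (d x i) then 1 else 0 :: nat) \<in> M ->M count_space UNIV" if "i < n" for i
 proof -
  have [measurable]: "(%x. fst (d x i)) \<in> bm M"
   by (rule m_comp[OF measurable_DD[OF d that] measurable_fst_base])
  show ?thesis by measurable
 qed
 moreover have "(%x. if t x < C l then 1 else 0 :: nat) \<in> M ->M count_space UNIV" for l
  by measurable
 ultimately have "(%x. \<Sum>i<n. if t x < fst (d x i) then 1 else 0 :: nat) \<in> M ->M count_space UNIV"
  "(%x. \<Sum>l<m. if t x < C l then 1 else 0 :: nat) \<in> M ->M count_space UNIV"
  by (auto intro!: measurable_sum_nat)
 then show ?thesis unfolding eq by measurable
qed

text \<open>The unnormalised density of the fixed jumps with respect to \<open>\<Prod>\<^sub>i \<sigma>(du\<^sub>i|t\<^sub>i)\<close>; jumps at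
 indices that repeat an earlier observation are dummies.\<close>

definition jd :: "(nat => real \<times> 'x) => nat => real => ennreal" where
 "jd d i u = (if i \<in> Fst d n then ennreal u ^ (cell_size n d (d i) - 1) * ennreal ((1 - u) ^ Ydm d (fst (d i))) else 1)"

definition jw :: "(nat => real \<times> 'x) => (nat => real) => ennreal" where
 "jw d u = (\<Prod>i<n. jd d i (u i))"

lemma jd_measurable:
 assumes d: "d \<in> M ->M DD n" and u: "u \<in> M ->M unit_jumps" and i: "i < n"
 shows "(%x. jd (d x) i (u x)) \<in> bm M"
proof -
 have [measurable]: "u \<in> bm M" using m_comp[OF u unit_jumps_borel] by simp
 have [measurable]: "(%x. fst (d x i)) \<in> bm M"
  by (rule m_comp[OF measurable_DD[OF d i] measurable_fst_base])
 have 1: "(%x. ennreal (u x) ^ (cell_size n (d x) (d x i) - 1)) \<in> bm M"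
  by (rule measurable_compose_countable[OF _ measurable_cell_size[OF d i], where f="%k x. ennreal (u x) ^ (k - 1)"]) measurable
 have Y: "(%x. Ydm (d x) (fst (d x i))) \<in> M ->M count_space UNIV"
  by (rule at_risk_measurable[OF d]) measurable
 have 2: "(%x. ennreal ((1 - u x) ^ Ydm (d x) (fst (d x i)))) \<in> bm M"
  by (rule measurable_compose_countable[OF _ Y, where f="%k x. ennreal ((1 - u x) ^ k)"]) measurable
 show ?thesis
  unfolding jd_def using pred_Fst[OF d i] 1 2 by measurable
qed

lemma jw_measurable: "d \<in> M ->M DD n ==> u \<in> M ->M UU n ==> (%x. jw (d x) (u x)) \<in> bm M"
 unfolding jw_def by (intro bm_prod jd_measurable measurable_UU) auto

lemma jw_eq: "jw d u = wt n d u * (\<Prod>i\<in>Fst d n. ennreal ((1 - u i) ^ Ydm d (fst (d i))))"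
proof -
 have *: "(\<Prod>i\<in>Fst d n. f i) = (\<Prod>i<n. if i \<in> Fst d n then f i else 1)" for f :: "nat => ennreal"
  using Fst_subset[of d n] by (simp add: prod.If_cases Int_absorb1)
 show ?thesis unfolding wt_def prod.distrib[symmetric] * jw_def jd_def by (intro prod.cong refl) simp
qed

lemma pts_space: "d \<in> space (DD n) ==> u \<in> space (UU n) ==> i \<in> Fst d n ==> (u i, d i) \<in> space EE"
 by (auto simp: Fst_def space_PiM PiE_iff space_pair_measure)

text \<open>All powers of the added jumps go into \<open>jw\<close>, and the likelihood of the bare
  configuration remains. This factorisation is the source of the posterior independence of the jumps
  and the Poisson part.\<close>

lemma lik_ptsN:
 assumes "N \<in> space lf" "d \<in> space (DD n)" "u \<in> space (UU n)"
 shows "wt n d u * lik (ptsN N n d u) d = jw d u * lik N d"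
 unfolding ptsN_def jw_eq by (subst lik_add_pts[OF assms(1)]) (auto simp: pts_space[OF assms(2,3)] ac_simps simp del: space_pair_measure)

text \<open>The unnormalised posterior expectation of \<open>g\<close> at data
  \<open>d\<close>.\<close>

definition Fun :: "(('x mark) measure => ennreal) => (nat => real \<times> 'x) => ennreal" where
 "Fun g d = (NN u. NN N. jw d u * lik N d * g (ptsN N n d u) \<partial>P \<partial>SG n d)"

lemma integrand_measurable:
 assumes g: "g \<in> bm lf"
 shows "(%x. jw (fst (fst x)) (snd (fst x)) * lik (snd x) (fst (fst x)) * g (ptsN (snd x) n (fst (fst x)) (snd (fst x))))
  \<in> bm ((DD n \<Otimes>\<^sub>M UU n) \<Otimes>\<^sub>M P)"
 by (intro bm_times jw_measurable lik_measurable m_comp[OF pts_meas g]) measurable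

lemma SG_measurable: "SG n \<in> DD n ->M prob_algebra (UU n)"
proof (rule measurable_prob_algebra_generated[OF sets_PiM Int_stable_prod_algebra prod_algebra_sets_into_space])
 fix d :: "nat => real \<times> 'x" assume d: "d \<in> space (DD n)"
 show "prob_space (SG n d)" by (rule SG_prob[OF d])
 show "sets (SG n d) = sets (UU n)" by (rule SG_sets[OF d])
next
 fix B :: "(nat => real) set" assume "B \<in> prod_algebra {..<n} (%i. unit_jumps)"
 then obtain X where B: "B = Pi\<^sub>E {..<n} X" and X: "X \<in> (\<Pi> i\<in>{..<n}. sets unit_jumps)"
  by (auto simp: prod_algebra_eq_finite)
 have "emeasure (SG n d) B = (\<Prod>i<n. emeasure (\<sigma> (fst (d i))) (X i))" if d: "d \<in> space (DD n)" for d
 proof -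
  interpret product_sigma_finite "%i. if i < n then \<sigma> (fst (d i)) else return unit_jumps 1"
  proof (rule product_sigma_finite.intro)
   fix k show "sigma_finite_measure (if k < n then \<sigma> (fst (d k)) else return unit_jumps 1)"
    using \<sigma>_prob[OF DD_pos[OF d, of k]] by (auto intro!: prob_space_imp_sigma_finite prob_space_return)
  qed
  have "SG n d = (\<Pi>\<^sub>M i\<in>{..<n}. if i < n then \<sigma> (fst (d i)) else return unit_jumps 1)"
   by (intro PiM_cong) auto
  then show ?thesis unfolding B
   using X by (simp, subst emeasure_PiM) (auto simp: \<sigma>_sets DD_pos[OF d])
 qed
 moreover have "(%d. \<Prod>i<n. emeasure (\<sigma> (fst (d i))) (X i)) \<in> bm (DD n)"
 proof (rule bm_prod)
  fix i assume i: "i \<in> {..<n}"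
  have "(%d. \<sigma> (fst (d i))) \<in> DD n ->M subprob_algebra unit_jumps"
   by (rule measurable_prob_algebraD, rule m_comp[OF _ \<sigma>_measurable],
     rule m_comp[OF measurable_DD[OF m_id] fst_base_times]) (use i in auto)
  from m_comp[OF this measurable_emeasure_subprob_algebra]
  show "(%d. emeasure (\<sigma> (fst (d i))) (X i)) \<in> bm (DD n)"
   using X i by auto
 qed
 ultimately show "(%d. emeasure (SG n d) B) \<in> bm (DD n)"
  by (simp cong: measurable_cong)
qed

lemma Fun_measurable:
 assumes g: "g \<in> bm lf"
 shows "Fun g \<in> bm (DD n)"
proof -
 from P.borel_measurable_nn_integral_fst[OF integrand_measurable[OF g]]
 have "(%(d, u). NN N. jw d u * lik N d * g (ptsN N n d u) \<partial>P) \<in> bm (DD n \<Otimes>\<^sub>M UU n)"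
  by (simp add: split_beta')
 from nn_integral_measurable_subprob_algebra2[OF this measurable_prob_algebraD[OF SG_measurable]]
 show ?thesis unfolding Fun_def .
qed

lemma Phi_Fun:
 assumes g: "g \<in> bm lf" and h: "h \<in> bm (DD n)" and d: "d \<in> space (DD n)"
 shows "Phi n (%(N, d). h d * (lik N d * g N)) d = h d * Fun g d"
proof -
 have m1: "(%N. jw d u * lik N d * g (ptsN N n d u)) \<in> bm P" if u: "u \<in> space (UU n)" for u
  using m_comp[OF measurable_Pair1'[of "(d, u)" "DD n \<Otimes>\<^sub>M UU n" P] integrand_measurable[OF g]] d u
  by (simp add: space_pair_measure)
 have m2: "(%N. lik (ptsN N n d u) d * g (ptsN N n d u)) \<in> bm P" if u: "u \<in> space (UU n)" for u
  unfolding m_cong_sets[OF P_sets refl]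
  by (intro bm_times lik_measurable m_comp[OF pts_meas g] pts_meas measurable_const d u) measurable
 have m3: "(%u. NN N. jw d u * lik N d * g (ptsN N n d u) \<partial>P) \<in> bm (SG n d)"
 proof -
  have "(%x. (d, x)) \<in> UU n ->M DD n \<Otimes>\<^sub>M UU n" using d by measurable
  from m_comp[OF this P.borel_measurable_nn_integral_fst[OF integrand_measurable[OF g]]]
  show ?thesis unfolding m_cong_sets[OF SG_sets[OF d] refl] by simp
 qed
 have "Phi n (%(N, d). h d * (lik N d * g N)) d =
   (NN u. h d * (NN N. jw d u * lik N d * g (ptsN N n d u) \<partial>P) \<partial>SG n d)"
  unfolding Phi_def split_conv
 proof (rule nn_cong)
  fix u assume "u \<in> space (SG n d)"
  then have u: "u \<in> space (UU n)" by (simp add: SG_space[OF d])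
  have "wt n d u * (NN N. h d * (lik (ptsN N n d u) d * g (ptsN N n d u)) \<partial>P) =
   h d * (NN N. wt n d u * (lik (ptsN N n d u) d * g (ptsN N n d u)) \<partial>P)"
   using m2[OF u] by (simp add: nn_integral_cmult ac_simps)
  also have "(NN N. wt n d u * (lik (ptsN N n d u) d * g (ptsN N n d u)) \<partial>P) = (NN N. jw d u * lik N d * g (ptsN N n d u) \<partial>P)"
   by (intro nn_cong) (simp add: mult.assoc[symmetric] lik_ptsN[OF _ d u] P_space)
  finally show "wt n d u * (NN N. h d * (lik (ptsN N n d u) d * g (ptsN N n d u)) \<partial>P) =
   h d * (NN N. jw d u * lik N d * g (ptsN N n d u) \<partial>P)" .
 qed
 also have "\<dots> = h d * Fun g d"
  unfolding Fun_def by (rule nn_integral_cmult[OF m3])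
 finally show ?thesis .
qed

end

context crm_data
begin

lemma Fun_mono: "(!!N. g N \<le> g' N) ==> Fun g d \<le> Fun g' d"
 unfolding Fun_def by (intro nn_integral_mono mult_left_mono) auto

lemma jw_le_1: "u \<in> space (UU n) ==> jw d u \<le> 1"
proof -
 assume u: "u \<in> space (UU n)"
 have "jd d i (u i) \<le> 1" if "i < n" for i
 proof -
  have ui: "0 < u i" "u i \<le> 1" using u that by (auto simp: space_PiM PiE_iff)
  have "ennreal (u i) ^ k \<le> 1" for k using ui by (intro power_le_one) auto
  moreover have "ennreal ((1 - u i) ^ k) \<le> 1" for k using ui by (simp add: power_le_one)
  ultimately show ?thesis unfolding jd_def by (auto intro: mult_le_one)
 qed
 then show ?thesis unfolding jw_def by (intro prod_le_1) auto
qed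

abbreviation F1 :: "(nat => real \<times> 'x) => ennreal" where "F1 \<equiv> Fun (%_. 1)"

lemma F1_le_1: "d \<in> space (DD n) ==> F1 d \<le> 1"
proof -
 assume d: "d \<in> space (DD n)"
 interpret SG: prob_space "SG n d" by (rule SG_prob[OF d])
 have "(NN N. jw d u * lik N d * 1 \<partial>P) \<le> 1" if u: "u \<in> space (SG n d)" for u
 proof (rule P.nn_integral_le_const)
  have "jw d u * lik N d \<le> 1" for N
   using jw_le_1[of u d] u by (intro mult_le_one lik_le_1) (simp_all add: SG_space[OF d])
  then show "AE N in P. jw d u * lik N d * 1 \<le> 1" by simp
 qed simp
 then show ?thesis unfolding Fun_def by (intro SG.nn_integral_le_const AE_I2) auto
qed

text \<open>\<open>Fun\<close> normalised, realised as the law of \<open>W\<close> under the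
  augmented configuration. Where the normaliser vanishes any probability measure will do, since such
  data turn out to be null; the prior law keeps the kernel measurable.\<close>

definition Kern :: "'v measure => (('x mark) measure => 'v) => (nat => real \<times> 'x) => 'v measure" where
 "Kern V W d = (if F1 d = 0 then distr P V W
  else distr (density (SG n d \<Otimes>\<^sub>M P) (%(u, N). jw d u * lik N d / F1 d)) V (%(u, N). W (ptsN N n d u)))"

lemma sets_Kern: "sets (Kern V W d) = sets V"
 by (simp add: Kern_def)

context
 fixes V :: "'v measure" and W :: "('x mark) measure => 'v"
 assumes W: "W \<in> lf ->M V"
begin

lemma ptsN_space: "N \<in> space lf ==> d \<in> space (DD n) ==> u \<in> space (UU n) ==> ptsN N n d u \<in> space lf"
 using measurable_space[OF pts_meas[OF measurable_const measurable_const measurable_const], of N d n u undefined "count_space UNIV"] by simp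

lemma pair_sets: "d \<in> space (DD n) ==> sets (SG n d \<Otimes>\<^sub>M P) = sets (UU n \<Otimes>\<^sub>M lf)"
 by (rule sets_pair_measure_cong[OF SG_sets P_sets])

lemma W_pts: "d \<in> space (DD n) ==> (%(u, N). W (ptsN N n d u)) \<in> SG n d \<Otimes>\<^sub>M P ->M V"
 unfolding split_beta' m_cong_sets[OF pair_sets refl]
 by (rule m_comp[OF pts_meas W]) measurable

lemma dens_pts: "d \<in> space (DD n) ==> (%(u, N). jw d u * lik N d / F1 d) \<in> bm (SG n d \<Otimes>\<^sub>M P)"
 unfolding split_beta' m_cong_sets[OF pair_sets refl]
 by (intro bm_div bm_times jw_measurable lik_measurable) measurable

lemma emeasure_Kern:
 assumes d: "d \<in> space (DD n)" and F: "F1 d \<noteq> 0" and X: "X \<in> sets V"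
 shows "emeasure (Kern V W d) X = Fun (%N. ind1 X (W N)) d / F1 d"
proof -
 let ?D = "density (SG n d \<Otimes>\<^sub>M P) (%(u, N). jw d u * lik N d / F1 d)"
 have g: "(%N. ind1 X (W N)) \<in> bm lf"
  by (rule m_comp[OF W bm_ind[OF X]])
 have W': "(%(u, N). W (ptsN N n d u)) \<in> ?D ->M V" using W_pts[OF d] by simp
 have i: "(%x. ind1 X (case x of (u, N) => W (ptsN N n d u))) \<in> bm (SG n d \<Otimes>\<^sub>M P)"
  using m_comp[OF W_pts[OF d] bm_ind[OF X]] .
 have m: "(%x. jw d (fst x) * lik (snd x) d * ind1 X (W (ptsN (snd x) n d (fst x)))) \<in> bm (SG n d \<Otimes>\<^sub>M P)"
  unfolding m_cong_sets[OF pair_sets[OF d] refl] using d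
  by (intro bm_times jw_measurable lik_measurable m_comp[OF pts_meas g]) measurable
 have "emeasure (Kern V W d) X = (NN x. ind1 X x \<partial>Kern V W d)"
  using X by (simp add: sets_Kern)
 also have "\<dots> = (NN x. ind1 X (case x of (u, N) => W (ptsN N n d u)) \<partial>?D)"
  unfolding Kern_def if_not_P[OF F] by (rule nn_integral_distr[OF W']) (use bm_ind[OF X] in simp)
 also have "\<dots> = (NN x. (case x of (u, N) => jw d u * lik N d / F1 d) * ind1 X (case x of (u, N) => W (ptsN N n d u)) \<partial>(SG n d \<Otimes>\<^sub>M P))"
  by (rule nn_integral_density[OF dens_pts[OF d] i])
 also have "\<dots> = (NN x. jw d (fst x) * lik (snd x) d * ind1 X (W (ptsN (snd x) n d (fst x))) / F1 d \<partial>(SG n d \<Otimes>\<^sub>M P))"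
  by (intro nn_cong) (simp add: split_beta' divide_ennreal_def ac_simps)
 also have "\<dots> = (NN x. jw d (fst x) * lik (snd x) d * ind1 X (W (ptsN (snd x) n d (fst x))) \<partial>(SG n d \<Otimes>\<^sub>M P)) / F1 d"
  by (rule nn_integral_divide[OF m])
 also have "(NN x. jw d (fst x) * lik (snd x) d * ind1 X (W (ptsN (snd x) n d (fst x))) \<partial>(SG n d \<Otimes>\<^sub>M P)) = Fun (%N. ind1 X (W N)) d"
  unfolding Fun_def using P.nn_integral_fst[OF m] by simp
 finally show ?thesis .
qed

text \<open>Holds at all data: if the normaliser is zero, then so is the smaller left-hand
  side.\<close>

lemma Fun_Kern:
 assumes d: "d \<in> space (DD n)" and X: "X \<in> sets V"
 shows "Fun (%N. ind1 X (W N)) d = F1 d * emeasure (Kern V W d) X"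
proof (cases "F1 d = 0")
 case True
 have "Fun (%N. ind1 X (W N)) d \<le> F1 d" by (intro Fun_mono) (simp split: split_indicator)
 then show ?thesis using True by simp
next
 case False
 have "F1 d \<noteq> top" using F1_le_1[OF d] by (auto simp: top_unique)
 then show ?thesis
  unfolding emeasure_Kern[OF d False X] using False
  by (simp add: ennreal_times_divide mult.commute[of "F1 d"] ennreal_mult_divide_eq)
qed

lemma Kern_prob: "d \<in> space (DD n) ==> prob_space (Kern V W d)"
proof -
 assume d: "d \<in> space (DD n)"
 show ?thesis
 proof (cases "F1 d = 0")
  case True
  then show ?thesis unfolding Kern_def
   using W by (simp, intro P.prob_space_distr) (simp cong: m_cong_sets add: P_sets)
 next
  case False
  have "F1 d \<noteq> top" using F1_le_1[OF d] by (auto simp: top_unique)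
  have "Fun (%N. ind1 (space V) (W N)) d = F1 d"
   unfolding Fun_def
  proof (intro nn_cong)
   fix u N assume "u \<in> space (SG n d)" "N \<in> space P"
   then have "ptsN N n d u \<in> space lf"
    using ptsN_space[OF _ d] by (simp add: SG_space[OF d] P_space)
   then show "jw d u * lik N d * ind1 (space V) (W (ptsN N n d u)) = jw d u * lik N d * 1"
    using measurable_space[OF W] by simp
  qed
  then have "emeasure (Kern V W d) (space V) = 1"
   using emeasure_Kern[OF d False, of "space V"] False \<open>F1 d \<noteq> top\<close> by (simp add: ennreal_divide_self less_top)
  then show ?thesis by (intro prob_spaceI) (simp add: space_eq[OF sets_Kern])
 qed
qed

lemma Kern_measurable: "Kern V W \<in> DD n ->M prob_algebra V"
proof (rule measurable_prob_algebraI[OF Kern_prob])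
 show "Kern V W \<in> DD n ->M subprob_algebra V"
 proof (rule measurable_subprob_algebra)
  fix d :: "nat => real \<times> 'x" assume "d \<in> space (DD n)"
  then show "subprob_space (Kern V W d)" by (intro prob_space_imp_subprob_space Kern_prob)
 next
  fix X assume X: "X \<in> sets V"
  have g: "(%N. ind1 X (W N) :: ennreal) \<in> bm lf"
   by (rule m_comp[OF W bm_ind[OF X]])
  have m[measurable]: "Fun (%N. ind1 X (W N)) \<in> bm (DD n)" "F1 \<in> bm (DD n)"
   by (intro Fun_measurable g) (intro Fun_measurable, simp)
  have eq: "emeasure (Kern V W d) X = (if F1 d = 0 then emeasure (distr P V W) X else Fun (%N. ind1 X (W N)) d / F1 d)"
   if "d \<in> space (DD n)" for d
   using emeasure_Kern[OF that _ X] by (simp add: Kern_def)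
  show "(%d. emeasure (Kern V W d) X) \<in> bm (DD n)"
   by (subst measurable_cong[OF eq]) measurable
 qed (simp add: sets_Kern)
qed

end

section \<open>The likelihood\<close>

abbreviation pos_of :: "(nat => 'x mark) => nat => real \<times> 'x" where
 "pos_of y \<equiv> \<lambda>i\<in>{..<n}. snd (y i)"

text \<open>A version of the likelihood that is measurable in \<open>N\<close>: \<open>n\<close>
  points of \<open>N\<close>, weighted by jumps and survival factors, are projected to their
  locations.\<close>

definition lik_measure :: "('x mark) measure => (nat => real \<times> 'x) measure" where
 "lik_measure N = distr (density (\<Pi>\<^sub>M i\<in>{..<n}. N) (%y. (\<Prod>i<n. ennreal (fst (y i))) * lik N (pos_of y))) (DD n) pos_of"

lemma pos_of_measurable: "pos_of \<in> (\<Pi>\<^sub>M i\<in>{..<n}. (EE :: ('x mark) measure)) ->M DD n"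
proof (rule measurable_restrict)
 fix i assume "i \<in> {..<n}"
 then have "(%y. y i) \<in> (\<Pi>\<^sub>M i\<in>{..<n}. (EE :: ('x mark) measure)) ->M EE" by (rule m_proj)
 then show "(%y. snd (y i)) \<in> (\<Pi>\<^sub>M i\<in>{..<n}. (EE :: ('x mark) measure)) ->M base"
  by (rule m_comp[OF _ measurable_snd])
qed

lemma jumps_measurable: "(%y. \<Prod>i<n. ennreal (fst (y i))) \<in> bm (\<Pi>\<^sub>M i\<in>{..<n}. (EE :: ('x mark) measure))"
proof (rule bm_prod)
 fix i assume "i \<in> {..<n}"
 then have "(%y. y i) \<in> (\<Pi>\<^sub>M i\<in>{..<n}. (EE :: ('x mark) measure)) ->M EE" by (rule m_proj)
 from m_comp[OF m_comp[OF this measurable_jump] measurable_ennreal]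
 show "(%y. ennreal (fst (y i))) \<in> bm (\<Pi>\<^sub>M i\<in>{..<n}. (EE :: ('x mark) measure))" .
qed

lemma PiM_lf_sets: "N \<in> space lf ==> sets (\<Pi>\<^sub>M i\<in>{..<n}. N) = sets (\<Pi>\<^sub>M i\<in>{..<n}. EE)"
 by (intro sets_PiM_cong) (auto simp: sets_lfD)

lemma nn_integral_lik_measure:
 assumes N: "N \<in> space lf" and h: "h \<in> bm (DD n)"
 shows "(NN d. h d \<partial>lik_measure N) =
  (NN y. (\<Prod>i<n. ennreal (fst (y i))) * (h (pos_of y) * lik N (pos_of y)) \<partial>(\<Pi>\<^sub>M i\<in>{..<n}. N))"
proof -
 note ms = m_cong_sets[OF PiM_lf_sets[OF N] refl]
 have p: "pos_of \<in> (\<Pi>\<^sub>M i\<in>{..<n}. N) ->M DD n" unfolding ms by (rule pos_of_measurable)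
 have w: "(%y. (\<Prod>i<n. ennreal (fst (y i))) * lik N (pos_of y)) \<in> bm (\<Pi>\<^sub>M i\<in>{..<n}. N)"
  unfolding ms by (intro bm_times jumps_measurable lik_measurable measurable_const N pos_of_measurable)
 have "(NN d. h d \<partial>lik_measure N) = (NN y. h (pos_of y) \<partial>density (\<Pi>\<^sub>M i\<in>{..<n}. N) (%y. (\<Prod>i<n. ennreal (fst (y i))) * lik N (pos_of y)))"
  unfolding lik_measure_def using p h by (intro nn_integral_distr) auto
 also have "\<dots> = (NN y. (\<Prod>i<n. ennreal (fst (y i))) * lik N (pos_of y) * h (pos_of y) \<partial>(\<Pi>\<^sub>M i\<in>{..<n}. N))"
  using w m_comp[OF p h] by (rule nn_integral_density)
 finally show ?thesis by (simp add: ac_simps)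
qed

lemma lik_measure_measurable: "lik_measure \<in> lf ->M MA (DD n)"
proof (rule measurable_measure_algebraI)
 fix B assume B: "B \<in> sets (DD n :: (nat => real \<times> 'x) measure)"
 have eq: "emeasure (lik_measure N) B = (NN y. (\<Prod>i<n. ennreal (fst (y i))) * (ind1 B (pos_of y) * lik N (pos_of y)) \<partial>(\<Pi>\<^sub>M i\<in>{..<n}. N))"
  if "N \<in> space lf" for N
  using nn_integral_lik_measure[OF that bm_ind[OF B]] B by (simp add: lik_measure_def)
 have m: "(%x. (\<Prod>i<n. ennreal (fst (snd x i))) * (ind1 B (pos_of (snd x)) * lik (fst x) (pos_of (snd x)))) \<in> bm (lf \<Otimes>\<^sub>M (\<Pi>\<^sub>M i\<in>{..<n}. EE))"
  by (intro bm_times m_comp[OF measurable_snd jumps_measurable] lik_measurable measurable_fst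
   m_comp[OF measurable_snd pos_of_measurable] m_comp[OF m_comp[OF measurable_snd pos_of_measurable] bm_ind[OF B]])
 show "(%N. emeasure (lik_measure N) B) \<in> bm lf"
  using measurable_nn_integral_PiM_lf[OF m_id m]
  by (subst measurable_cong[OF eq]) simp_all
qed (simp add: lik_measure_def)

text \<open>Equals \<open>ntr (crm N)\<close> on simple configurations and is measurable in
  \<open>N\<close> on all of \<open>lf\<close>.\<close>

definition ntrN :: "('x mark) measure => (real \<times> 'x) measure" where
 "ntrN N = distr (density N (%z. ennreal (fst z) * survT N {0<..<tm z})) base snd"

lemma sets_ntrN [simp]: "sets (ntrN N) = sets base" and space_ntrN [simp]: "space (ntrN N) = space base"
 by (simp_all add: ntrN_def)

lemma survT_tm_measurable: "N \<in> space lf ==> (%z. survT N {a<..<tm z}) \<in> bm (EE :: ('x mark) measure)"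
 by (rule m_comp[OF measurable_tm survT_time_measurable])

lemma jump_ennreal: "(%z. ennreal (fst z)) \<in> bm (EE :: ('x mark) measure)"
 by (rule m_comp[OF measurable_jump measurable_ennreal])

lemma nn_integral_ntrN:
 assumes N: "N \<in> space lf" and f: "f \<in> bm base"
 shows "(NN p. f p \<partial>ntrN N) = (NN z. ennreal (fst z) * survT N {0<..<tm z} * f (snd z) \<partial>N)"
proof -
 note ms = m_cong_sets[OF sets_lfD[OF N] refl]
 have s: "snd \<in> N ->M base" unfolding ms by measurable
 have "(NN p. f p \<partial>ntrN N) = (NN z. f (snd z) \<partial>density N (%z. ennreal (fst z) * survT N {0<..<tm z}))"
  unfolding ntrN_def using s f by (intro nn_integral_distr) auto
 also have "\<dots> = (NN z. ennreal (fst z) * survT N {0<..<tm z} * f (snd z) \<partial>N)"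
  using m_comp[OF s f]
  by (intro nn_integral_density) (unfold ms, intro bm_times jump_ennreal survT_tm_measurable N)
 finally show ?thesis .
qed

lemma emeasure_ntrN:
 assumes N: "N \<in> space lf" and B: "B \<in> sets base"
 shows "emeasure (ntrN N) B = (NN z. ennreal (fst z) * survT N {0<..<tm z} * ind1 B (snd z) \<partial>N)"
 using nn_integral_ntrN[OF N bm_ind[OF B]] B by simp

lemma ntrN_measurable: "ntrN \<in> lf ->M MA base"
proof (rule measurable_measure_algebraI)
 fix B assume B: "B \<in> sets (base :: (real \<times> 'x) measure)"
 have m: "(%x. ennreal (fst (snd x)) * survT (fst x) {0<..<tm (snd x)} * ind1 B (snd (snd x))) \<in> bm (lf \<Otimes>\<^sub>M EE)"
  by (intro bm_times m_comp[OF measurable_snd jump_ennreal] survT_measurable measurable_fst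
    m_comp[OF measurable_snd measurable_tm] m_comp[OF m_comp[OF measurable_snd measurable_snd] bm_ind[OF B]])
 show "(%N. emeasure (ntrN N) B) \<in> bm lf"
  using measurable_nn_integral_lf[OF m_id m]
  by (subst measurable_cong[OF emeasure_ntrN[OF _ B]]) simp_all
qed simp

lemma crm_measurable: "crm \<in> lf ->M MA base"
proof (rule measurable_measure_algebraI)
 fix B assume B: "B \<in> sets (base :: (real \<times> 'x) measure)"
 have m: "(%z. ennreal (fst z) * ind1 B (snd z)) \<in> bm EE"
  by (intro bm_times jump_ennreal m_comp[OF measurable_snd bm_ind[OF B]])
 have "(%N. NN z. ennreal (fst z) * ind1 B (snd z) \<partial>N) \<in> bm lf"
  using m_comp[OF measurable_lfD[OF m_id] nn_integral_measurable_measure_algebra[OF m]] by simp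
 then show "(%N. emeasure (crm N) B) \<in> bm lf"
  using B by (subst measurable_cong[OF emeasure_crm]) (simp_all add: sets_lfD)
qed simp

definition levyN :: "('x mark) measure => (real \<times> 'x) measure" where
 "levyN N = jump_integral (%u. neg_log_compl (ennreal u)) N"

lemma nlc_unit_jumps: "(%u. neg_log_compl (ennreal u)) \<in> bm unit_jumps"
 by (rule m_comp[OF ennreal_unit_jumps borel_measurable_neg_log_compl])

lemma levyN_measurable: "levyN \<in> lf ->M MA base"
proof (rule measurable_measure_algebraI)
 fix B assume B: "B \<in> sets (base :: (real \<times> 'x) measure)"
 have m: "(%z. neg_log_compl (ennreal (fst z)) * ind1 B (snd z)) \<in> bm EE"
  by (intro bm_times m_comp[OF jump_ennreal borel_measurable_neg_log_compl] m_comp[OF measurable_snd bm_ind[OF B]])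
 have "(%N. NN z. neg_log_compl (ennreal (fst z)) * ind1 B (snd z) \<partial>N) \<in> bm lf"
  using m_comp[OF measurable_lfD[OF m_id] nn_integral_measurable_measure_algebra[OF m]] by simp
 moreover have "emeasure (levyN N) B = (NN z. neg_log_compl (ennreal (fst z)) * ind1 B (snd z) \<partial>N)" if "N \<in> space lf" for N
  unfolding levyN_def by (rule emeasure_jump_integral[OF sets_lfD[OF that] nlc_unit_jumps B])
 ultimately show "(%N. emeasure (levyN N) B) \<in> bm lf" by (subst measurable_cong)
qed (simp add: levyN_def)

context
 fixes N :: "('x mark) measure" and Z
 assumes N: "N \<in> space lf" and cfg: "simple_config EE tm N Z"
begin

lemma ntr_config: "ntr (crm N) = ntrN N"
proof (rule measure_eqI)
 fix B assume "B \<in> sets (ntr (crm N))"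
 then have B: "B \<in> sets base" by (simp add: ntr_def)
 have eq: "ntr (crm N) = density (crm N) (%p. survT N {0<..<fst p})"
  unfolding ntr_def survival_left_crm[OF cfg] by (simp add: split_beta')
 have m: "(%p. survT N {0<..<fst p}) \<in> bm base"
  by (rule m_comp[OF measurable_fst_base survT_time_measurable[OF N]])
 have "emeasure (ntr (crm N)) B = (NN p. survT N {0<..<fst p} * ind1 B p \<partial>crm N)"
  unfolding eq by (rule emeasure_density) (use m B in \<open>auto cong: m_cong_sets\<close>)
 also have "\<dots> = (NN z. ennreal (fst z) * (survT N {0<..<tm z} * ind1 B (snd z)) \<partial>N)"
  by (rule nn_integral_crm[OF sets_lfD[OF N]]) (intro bm_times m bm_ind B)
 also have "\<dots> = emeasure (ntrN N) B"
  unfolding emeasure_ntrN[OF N B] by (simp add: mult.assoc)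
 finally show "emeasure (ntr (crm N)) B = emeasure (ntrN N) B" .
qed (simp add: ntr_def)

lemma survT_sum_le_space: "(NN z. ennreal (fst z) * survT N {0<..<tm z} \<partial>N) \<le> 1"
proof -
 have "(NN z. ennreal (fst z) * survT N {0<..<tm z} \<partial>N) =
   (SUP k::nat. NN z. ennreal (fst z) * ind1 {0<..real k} (tm z) * survT N {0<..<tm z} \<partial>N)"
 proof -
  have "(NN z. ennreal (fst z) * survT N {0<..<tm z} \<partial>N) =
    (NN z. (SUP k::nat. ennreal (fst z) * ind1 {0<..real k} (tm z) * survT N {0<..<tm z}) \<partial>N)"
  proof (rule nn_cong)
   fix z assume "z \<in> space N"
   then have z: "0 < tm z" by (simp add: space_lfD[OF N] space_pair_measure mem_Times_iff)
   obtain k where k: "tm z \<le> real k" using real_arch_simple by blast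
   show "ennreal (fst z) * survT N {0<..<tm z} = (SUP k::nat. ennreal (fst z) * ind1 {0<..real k} (tm z) * survT N {0<..<tm z})"
    by (rule antisym, rule SUP_upper2[of k]) (use k z in \<open>auto intro!: SUP_least split: split_indicator\<close>)
  qed
  also have "\<dots> = (SUP k::nat. NN z. ennreal (fst z) * ind1 {0<..real k} (tm z) * survT N {0<..<tm z} \<partial>N)"
  proof (rule nn_integral_monotone_convergence_SUP)
   show "incseq (%k z. ennreal (fst z) * ind1 {0<..real k} (tm z) * survT N {0<..<tm z})"
    by (auto simp: incseq_def le_fun_def split: split_indicator)
   show "(%z. ennreal (fst z) * ind1 {0<..real k} (tm z) * survT N {0<..<tm z}) \<in> bm N" for k
    unfolding m_cong_sets[OF sets_lfD[OF N] refl]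
    by (intro bm_times jump_ennreal survT_tm_measurable N m_comp[OF measurable_tm bm_ind]) auto
  qed
  finally show ?thesis .
 qed
 also have "\<dots> \<le> 1"
 proof (rule SUP_least)
  fix k :: nat
  have "(NN z. ennreal (fst z) * ind1 {0<..real k} (tm z) * survT N {0<..<tm z} \<partial>N)
   \<le> (NN z. ennreal (fst z) * ind1 {0<..real k} (tm z) * survT N {0<..<tm z} \<partial>N) + survT N {0<..real k}" by simp
  also have "\<dots> \<le> 1" by (rule survT_sum_le(1)[OF cfg survT_time_measurable[OF N]])
  finally show "(NN z. ennreal (fst z) * ind1 {0<..real k} (tm z) * survT N {0<..<tm z} \<partial>N) \<le> 1" .
 qed
 finally show ?thesis .
qed

lemma ntrN_le_1: "emeasure (ntrN N) B \<le> 1"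
proof -
 have "emeasure (ntrN N) B \<le> emeasure (ntrN N) (space (ntrN N))" by (rule emeasure_space)
 also have "\<dots> = (NN p. 1 \<partial>ntrN N)" by simp
 also have "\<dots> = (NN z. ennreal (fst z) * survT N {0<..<tm z} \<partial>N)"
  using nn_integral_ntrN[OF N, of "%_. 1"] by simp
 also have "\<dots> \<le> 1" by (rule survT_sum_le_space)
 finally show ?thesis .
qed

text \<open>On a simple configuration \<open>ntrN N\<close> has mass at most one, so its n-fold
  product is determined by boxes; on a box the integral over \<open>n\<close> points of
  \<open>N\<close> factorises into the masses under \<open>ntrN N\<close>.\<close>

theorem likelihood_config: "likelihood n m C (crm N) = lik_measure N"
proof -
 interpret N: product_sigma_finite "%_. N" using sigma_finite_lf[OF N] by (intro product_sigma_finite.intro)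
 have "finite_measure (ntrN N)" using ntrN_le_1 
  by (intro finite_measureI) (metis ennreal_one_less_top infinity_ennreal_def leD)
 then interpret F: product_sigma_finite "%_. ntrN N"
  by (intro product_sigma_finite.intro finite_measure.axioms(1))
 note ms = m_cong_sets[OF PiM_lf_sets[OF N] refl]
 let ?w = "%y. \<Prod>i<n. ennreal (fst (y i)) * survT N {0<..<tm (y i)}"
 have p: "pos_of \<in> (\<Pi>\<^sub>M i\<in>{..<n}. N) ->M DD n" unfolding ms by (rule pos_of_measurable)
 have fac: "(%z. ennreal (fst z) * survT N {0<..<tm z}) \<in> bm (EE :: ('x mark) measure)"
  by (intro bm_times jump_ennreal survT_tm_measurable N)
 have w: "?w \<in> bm (\<Pi>\<^sub>M i\<in>{..<n}. N)"
  unfolding ms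
  by (rule bm_prod, rule m_comp[OF _ fac], rule m_proj) simp
 define R where "R = distr (density (\<Pi>\<^sub>M i\<in>{..<n}. N) ?w) (DD n) pos_of"
 have R_em: "emeasure R B = (NN y. ?w y * ind1 B (pos_of y) \<partial>(\<Pi>\<^sub>M i\<in>{..<n}. N))" if B: "B \<in> sets (DD n)" for B
 proof -
  have "emeasure R B = (NN d. ind1 B d \<partial>R)" using B by (simp add: R_def)
  also have "\<dots> = (NN y. ind1 B (pos_of y) \<partial>density (\<Pi>\<^sub>M i\<in>{..<n}. N) ?w)"
   unfolding R_def using p B by (intro nn_integral_distr) auto
  also have "\<dots> = (NN y. ?w y * ind1 B (pos_of y) \<partial>(\<Pi>\<^sub>M i\<in>{..<n}. N))"
   by (rule nn_integral_density[OF w m_comp[OF p bm_ind[OF B]]])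
  finally show ?thesis .
 qed
 have "R = (\<Pi>\<^sub>M i\<in>{..<n}. ntrN N)"
 proof (rule F.PiM_eqI)
  show "sets R = sets (\<Pi>\<^sub>M i\<in>{..<n}. ntrN N)"
   unfolding R_def by (simp, intro sets_PiM_cong) auto
  fix B :: "nat => (real \<times> 'x) set" assume "!!i. i \<in> {..<n} ==> B i \<in> sets (ntrN N)"
  then have B: "B i \<in> sets base" if "i < n" for i using that by simp
  have PB: "Pi\<^sub>E {..<n} B \<in> sets (DD n)" using B by (intro sets_PiM_I_finite) auto
  have "emeasure R (Pi\<^sub>E {..<n} B) = (NN y. (\<Prod>i<n. ennreal (fst (y i)) * survT N {0<..<tm (y i)} * ind1 (B i) (snd (y i))) \<partial>(\<Pi>\<^sub>M i\<in>{..<n}. N))"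
   unfolding R_em[OF PB]
  proof (rule nn_cong)
   fix y
   have "ind1 (Pi\<^sub>E {..<n} B) (pos_of y) = (\<Prod>i<n. ind1 (B i) (snd (y i)) :: ennreal)"
    by (auto simp: indicator_def PiE_iff prod_zero_iff)
   then show "?w y * ind1 (Pi\<^sub>E {..<n} B) (pos_of y) = (\<Prod>i<n. ennreal (fst (y i)) * survT N {0<..<tm (y i)} * ind1 (B i) (snd (y i)))"
    by (simp add: prod.distrib)
  qed
  also have "\<dots> = (\<Prod>i<n. NN z. ennreal (fst z) * survT N {0<..<tm z} * ind1 (B i) (snd z) \<partial>N)"
  proof (rule N.product_nn_integral_prod)
   fix i assume "i \<in> {..<n}"
   then show "(%z. ennreal (fst z) * survT N {0<..<tm z} * ind1 (B i) (snd z)) \<in> bm N"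
    unfolding m_cong_sets[OF sets_lfD[OF N] refl]
    by (intro bm_times[OF fac] m_comp[OF measurable_snd bm_ind] B) auto
  qed simp
  also have "\<dots> = (\<Prod>i<n. emeasure (ntrN N) (B i))"
   using B by (intro prod.cong refl emeasure_ntrN[OF N, symmetric]) auto
  finally show "emeasure R (Pi\<^sub>E {..<n} B) = (\<Prod>i<n. emeasure (ntrN N) (B i))" .
 qed simp
 then have L: "likelihood n m C (crm N) = scale_measure (\<Prod>l<m. survT N {0<..<C l}) R"
  unfolding likelihood_def survival_left_crm[OF cfg] ntr_config by simp
 show ?thesis
 proof (rule measure_eqI)
  show "sets (likelihood n m C (crm N)) = sets (lik_measure N)" unfolding L by (simp add: R_def lik_measure_def)
  fix B assume "B \<in> sets (likelihood n m C (crm N))"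
  then have B: "B \<in> sets (DD n)" unfolding L by (simp add: R_def)
  have "emeasure (likelihood n m C (crm N)) B = (NN y. (\<Prod>l<m. survT N {0<..<C l}) * (?w y * ind1 B (pos_of y)) \<partial>(\<Pi>\<^sub>M i\<in>{..<n}. N))"
   unfolding L by (simp add: R_em[OF B], rule nn_integral_cmult[symmetric],
    rule bm_times[OF w m_comp[OF p bm_ind[OF B]]])
  also have "\<dots> = (NN y. (\<Prod>i<n. ennreal (fst (y i))) * (ind1 B (pos_of y) * lik N (pos_of y)) \<partial>(\<Pi>\<^sub>M i\<in>{..<n}. N))"
   by (intro nn_cong) (simp add: lik_def prod.distrib ac_simps)
  also have "\<dots> = emeasure (lik_measure N) B"
   using nn_integral_lik_measure[OF N bm_ind[OF B]] B by (simp add: lik_measure_def)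
  finally show "emeasure (likelihood n m C (crm N)) B = emeasure (lik_measure N) B" .
 qed
qed

end

text \<open>The integrand is put into the form required by \<open>disintegration\<close>, with the
  test function \<open>h\<close> of the data and the functional \<open>g\<close> of the
  configuration side by side; \<open>Phi_Fun\<close> then pulls \<open>h\<close> out.\<close>

lemma likelihood_disintegration:
 fixes h :: "(nat => real \<times> 'x) => ennreal"
 assumes N0: "N0 \<in> M ->M lf" and P_eq: "P = distr M lf N0"
  and g: "g \<in> bm lf" and h: "h \<in> bm (DD n)"
 shows "(NN w. g (N0 w) * (NN d. h d \<partial>lik_measure (N0 w)) \<partial>M) = Jd A n (%d. h d * Fun g d)"
proof -
  have m: "(%(N, d). h d * (lik N d * g N)) \<in> bm (lf \<Otimes>\<^sub>M DD n)"
   unfolding split_beta'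
   by (intro bm_times m_comp[OF measurable_snd h] m_comp[OF measurable_fst g] lik_measurable) measurable
  have "(NN w. g (N0 w) * (NN d. h d \<partial>lik_measure (N0 w)) \<partial>M) = (NN N. g N * (NN d. h d \<partial>lik_measure N) \<partial>P)"
   unfolding P_eq
   by (rule nn_integral_distr[OF N0, symmetric])
    (simp, intro bm_times g m_comp[OF lik_measure_measurable nn_integral_measurable_measure_algebra[OF h]])
  also have "\<dots> = (NN N. NN y. (\<Prod>i<n. ennreal (fst (y i))) * (case (N, pos_of y) of (N, d) => h d * (lik N d * g N)) \<partial>(\<Pi>\<^sub>M i\<in>{..<n}. N) \<partial>P)"
  proof (rule nn_cong)
   fix N assume "N \<in> space P"
   then have N: "N \<in> space lf" by (simp add: P_space)
   have "(%y. (\<Prod>i<n. ennreal (fst (y i))) * (h (pos_of y) * lik N (pos_of y))) \<in> bm (\<Pi>\<^sub>M i\<in>{..<n}. N)"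
    unfolding m_cong_sets[OF PiM_lf_sets[OF N] refl]
    by (intro bm_times jumps_measurable m_comp[OF pos_of_measurable h] lik_measurable measurable_const N pos_of_measurable)
   then have "g N * (NN d. h d \<partial>lik_measure N) =
     (NN y. g N * ((\<Prod>i<n. ennreal (fst (y i))) * (h (pos_of y) * lik N (pos_of y))) \<partial>(\<Pi>\<^sub>M i\<in>{..<n}. N))"
    unfolding nn_integral_lik_measure[OF N h] by (rule nn_integral_cmult[symmetric])
   then show "g N * (NN d. h d \<partial>lik_measure N) =
     (NN y. (\<Prod>i<n. ennreal (fst (y i))) * (case (N, pos_of y) of (N, d) => h d * (lik N d * g N)) \<partial>(\<Pi>\<^sub>M i\<in>{..<n}. N))"
    by (simp add: ac_simps)
  qed
  also have "\<dots> = Jd A n (Phi n (%(N, d). h d * (lik N d * g N)))"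
   by (rule disintegration[OF m])
  also have "\<dots> = Jd A n (%d. h d * Fun g d)"
   by (rule Jd_cong_AE[where B="base :: (real \<times> 'x) measure"]) (auto simp: A_space Phi_Fun[OF g h])
  finally show ?thesis .
 qed

lemma nn_integral_data_marginal_Jd:
 fixes h :: "(nat => real \<times> 'x) => ennreal"
 assumes N0: "N0 \<in> M ->M lf" and P_eq: "P = distr M lf N0" and L: "AE w in M. L w = lik_measure (N0 w)"
  and h: "h \<in> bm (DD n)"
 shows "(NN d. h d \<partial>data_marginal M (DD n) L) = Jd A n (%d. h d * F1 d)"
 using likelihood_disintegration[OF N0 P_eq _ h, of "%_. 1"]
 unfolding nn_integral_data_marginal[OF m_comp[OF N0 lik_measure_measurable] L h] by simp

text \<open>Both sides of the defining identity become \<open>Jd\<close> of a function of the data: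
  \<open>Fun\<close> of the event on one side, the kernel times the normaliser \<open>F1\<close> on
  the other. They agree pointwise by \<open>Fun_Kern\<close>.\<close>

theorem posterior:
 assumes M: "prob_space M" and N0: "N0 \<in> M ->M lf" and P_eq: "P = distr M lf N0"
  and L: "AE w in M. L w = lik_measure (N0 w)"
  and W: "W \<in> lf ->M V" and W': "AE w in M. W' w = W (N0 w)"
 shows "posterior_kernel M (DD n) L V W' (Kern V W)"
 unfolding posterior_kernel_def
proof (intro conjI ballI)
 show "Kern V W \<in> DD n ->M prob_algebra V" by (rule Kern_measurable[OF W])
 fix X and B :: "(nat => real \<times> 'x) set" assume X: "X \<in> sets V" and B: "B \<in> sets (DD n)"
 have gX: "(%N. ind1 X (W N) :: ennreal) \<in> bm lf"
  by (rule m_comp[OF W bm_ind[OF X]])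
 have hK: "(%d. emeasure (Kern V W d) X * ind1 B d) \<in> bm (DD n)"
  using m_comp[OF measurable_prob_algebraD[OF Kern_measurable[OF W]] measurable_emeasure_subprob_algebra[OF X]] B by measurable
 have "(NN w. ind1 X (W' w) * emeasure (L w) B \<partial>M) = (NN w. ind1 X (W (N0 w)) * (NN d. ind1 B d \<partial>lik_measure (N0 w)) \<partial>M)"
 proof (rule nn_integral_cong_AE)
  show "AE w in M. ind1 X (W' w) * emeasure (L w) B = ind1 X (W (N0 w)) * (NN d. ind1 B d \<partial>lik_measure (N0 w))"
   using L W' by eventually_elim (use B in \<open>simp add: lik_measure_def\<close>)
 qed
 also have "\<dots> = Jd A n (%d. ind1 B d * Fun (%N. ind1 X (W N)) d)"
  by (rule likelihood_disintegration[OF N0 P_eq gX bm_ind[OF B]])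
 also have "\<dots> = Jd A n (%d. (emeasure (Kern V W d) X * ind1 B d) * F1 d)"
  by (rule Jd_cong_AE[where B="base :: (real \<times> 'x) measure"]) (auto simp: A_space Fun_Kern[OF W _ X] ac_simps)
 also have "\<dots> = (\<integral>\<^sup>+ d\<in>B. emeasure (Kern V W d) X \<partial>data_marginal M (DD n) L)"
  by (rule nn_integral_data_marginal_Jd[OF N0 P_eq L hK, symmetric])
 finally show "(NN w. ind1 X (W' w) * emeasure (L w) B \<partial>M) = (\<integral>\<^sup>+ d\<in>B. emeasure (Kern V W d) X \<partial>data_marginal M (DD n) L)" .
qed

end

section \<open>Poisson random measures under measurable maps\<close>

lemma indep_vars_distr_iff:
 assumes M: "prob_space M" and T: "T \<in> M ->M Q" and X: "!!i. i \<in> I ==> X i \<in> Q ->M M' i"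
 shows "prob_space.indep_vars (distr M Q T) M' X I \<longleftrightarrow> prob_space.indep_vars M M' (%i w. X i (T w)) I"
proof (cases "I = {}")
 case True
 then show ?thesis
  using prob_space.indep_vars_empty[OF M] prob_space.indep_vars_empty[OF prob_space.prob_space_distr[OF M T]] by blast
next
 case False
 have XT: "(%w. X i (T w)) \<in> M ->M M' i" if "i \<in> I" for i
  by (rule m_comp[OF T X[OF that]])
 have R: "(%x. \<lambda>i\<in>I. X i x) \<in> Q ->M (\<Pi>\<^sub>M i\<in>I. M' i)" by (rule measurable_restrict) (rule X)
 have "distr (distr M Q T) (\<Pi>\<^sub>M i\<in>I. M' i) (%x. \<lambda>i\<in>I. X i x) = distr M (\<Pi>\<^sub>M i\<in>I. M' i) (%x. \<lambda>i\<in>I. X i (T x))"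
  using distr_distr[OF R T] by (simp add: o_def)
 moreover have "(\<Pi>\<^sub>M i\<in>I. distr (distr M Q T) (M' i) (X i)) = (\<Pi>\<^sub>M i\<in>I. distr M (M' i) (%w. X i (T w)))"
  by (intro PiM_cong refl) (simp add: distr_distr[OF X T] o_def)
 ultimately show ?thesis
  using prob_space.indep_vars_iff_distr_eq_PiM'[OF M False, where M'=M' and X="%i w. X i (T w)"] XT
   prob_space.indep_vars_iff_distr_eq_PiM'[OF prob_space.prob_space_distr[OF M T] False, where M'=M' and X=X] X
  by simp
qed

lemma poisson_random_measure_distr_iff:
 assumes M: "prob_space M" and T: "T \<in> M ->M Q" and N: "N \<in> Q ->M MA E"
 shows "poisson_random_measure (distr M Q T) E \<nu> N \<longleftrightarrow> poisson_random_measure M E \<nu> (%w. N (T w))"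
proof -
 have NT: "(%w. N (T w)) \<in> M ->M MA E" by (rule m_comp[OF T N])
 note em = emeasure_fun_measurable[OF N]
 have 1: "measure (distr M Q T) {w \<in> space (distr M Q T). emeasure (N w) A = c} = measure M {w \<in> space M. emeasure (N (T w)) A = c}"
  if A: "A \<in> sets E" for A c
 proof -
  have "{w \<in> space Q. emeasure (N w) A = c} \<in> sets Q" using em[OF A] by measurable
  then have "measure (distr M Q T) {w \<in> space Q. emeasure (N w) A = c} = measure M (T -` {w \<in> space Q. emeasure (N w) A = c} \<inter> space M)"
   by (rule measure_distr[OF T])
  also have "T -` {w \<in> space Q. emeasure (N w) A = c} \<inter> space M = {w \<in> space M. emeasure (N (T w)) A = c}"
   using measurable_space[OF T] by auto
  finally show ?thesis by simp
 qed
 have 2: "(AE w in distr M Q T. emeasure (N w) A = \<infinity>) \<longleftrightarrow> (AE w in M. emeasure (N (T w)) A = \<infinity>)" if A: "A \<in> sets E" for A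
  by (rule AE_distr_iff[OF T]) (use em[OF A] in measurable)
 have 3: "prob_space.indep_vars (distr M Q T) (%_. borel) (%i w. emeasure (N w) (A i)) {..<k} \<longleftrightarrow>
   prob_space.indep_vars M (%_. borel) (%i w. emeasure (N (T w)) (A i)) {..<k}"
  if "A ` {..<k} \<subseteq> sets E" for A :: "nat => 'c set" and k
  by (rule indep_vars_distr_iff[OF M T]) (use em that in blast)
 show ?thesis
  unfolding poisson_random_measure_def using N NT 1 2 3 by (simp cong: conj_cong)
qed

lemma measurable_distr_measure_algebra:
 assumes g: "g \<in> E ->M F"
 shows "(%\<mu>. distr \<mu> F g) \<in> MA E ->M MA F"
proof (rule measurable_measure_algebraI)
 fix B assume B: "B \<in> sets F"
 have "emeasure (distr \<mu> F g) B = emeasure \<mu> (g -` B \<inter> space E)" if "\<mu> \<in> space (MA E)" for \<mu>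
 proof -
  have s: "sets \<mu> = sets E" using that by (simp add: space_measure_algebra)
  show ?thesis using g B space_eq[OF s] s by (subst emeasure_distr) (auto cong: m_cong_sets)
 qed
 note * = measurable_cong[OF this]
 show "(%\<mu>. emeasure (distr \<mu> F g) B) \<in> bm (MA E)"
  by (subst *) (auto intro!: measurable_emeasure_measure_algebra measurable_sets[OF g B])
qed simp

text \<open>The mapping theorem: masses under the image are masses of preimages, and preimages of
  disjoint sets are disjoint.\<close>

lemma poisson_random_measure_map:
 assumes M: "prob_space M" and N: "poisson_random_measure M E \<nu> N" and g: "g \<in> E ->M F" and \<nu>: "sets \<nu> = sets E"
 shows "poisson_random_measure M F (distr \<nu> F g) (%w. distr (N w) F g)"
proof -
 have Nm: "N \<in> M ->M MA E" using N by (simp add: poisson_random_measure_def)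
 have g\<nu>: "g \<in> \<nu> ->M F" using g \<nu> by (simp cong: m_cong_sets)
 let ?p = "%A. g -` A \<inter> space E"
 have ps: "?p A \<in> sets E" if "A \<in> sets F" for A by (rule measurable_sets[OF g that])
 have e\<nu>: "emeasure (distr \<nu> F g) A = emeasure \<nu> (?p A)" if "A \<in> sets F" for A
  using emeasure_distr[OF g\<nu> that] space_eq[OF \<nu>] by simp
 have m\<nu>: "measure (distr \<nu> F g) A = measure \<nu> (?p A)" if "A \<in> sets F" for A
  using e\<nu>[OF that] by (simp add: measure_def)
 have eN: "emeasure (distr (N w) F g) A = emeasure (N w) (?p A)" if "w \<in> space M" "A \<in> sets F" for w A
 proof -
  have s: "sets (N w) = sets E" using measurable_space[OF Nm that(1)] by (simp add: space_measure_algebra)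
  have "g \<in> N w ->M F" using g s by (simp cong: m_cong_sets)
  from emeasure_distr[OF this that(2)] show ?thesis using space_eq[OF s] by simp
 qed
 show ?thesis
  unfolding poisson_random_measure_def
 proof (intro conjI ballI impI allI)
  show "(%w. distr (N w) F g) \<in> M ->M MA F"
   by (rule m_comp[OF Nm measurable_distr_measure_algebra[OF g]])
  fix A assume A: "A \<in> sets F"
  show "measure M {w \<in> space M. emeasure (distr (N w) F g) A = of_nat k} =
    measure (distr \<nu> F g) A ^ k / fact k * exp (- measure (distr \<nu> F g) A)"
   if "emeasure (distr \<nu> F g) A < \<infinity>" for k
  proof -
   have "{w \<in> space M. emeasure (distr (N w) F g) A = of_nat k} = {w \<in> space M. emeasure (N w) (?p A) = of_nat k}"
    using eN[OF _ A] by auto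
   then show ?thesis using N ps[OF A] that unfolding poisson_random_measure_def m\<nu>[OF A] e\<nu>[OF A] by simp
  qed
  show "AE w in M. emeasure (distr (N w) F g) A = \<infinity>" if "emeasure (distr \<nu> F g) A = \<infinity>"
  proof -
   have "AE w in M. emeasure (N w) (?p A) = \<infinity>"
    using N ps[OF A] that unfolding poisson_random_measure_def e\<nu>[OF A] by simp
   then show ?thesis using AE_space by eventually_elim (simp add: eN[OF _ A])
  qed
 next
  fix A :: "nat => _ set" and k assume A: "A ` {..<k} \<subseteq> sets F" "disjoint_family_on A {..<k}"
  have "prob_space.indep_vars M (%_. borel) (%i w. emeasure (N w) (?p (A i))) {..<k}"
  proof -
   have "(%i. ?p (A i)) ` {..<k} \<subseteq> sets E" using A ps by auto
   moreover have "disjoint_family_on (%i. ?p (A i)) {..<k}" using A(2) unfolding disjoint_family_on_def by blast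
   ultimately show ?thesis using N unfolding poisson_random_measure_def by blast
  qed
  then show "prob_space.indep_vars M (%_. borel) (%i w. emeasure (distr (N w) F g) (A i)) {..<k}"
  proof (rule indep_vars_cong_space[OF M, rotated 2])
   fix i assume "i \<in> {..<k}"
   then have Ai: "A i \<in> sets F" using A by auto
   show "(%w. emeasure (N w) (?p (A i))) \<in> bm M" by (rule emeasure_fun_measurable[OF Nm ps[OF Ai]])
   show "emeasure (N w) (?p (A i)) = emeasure (distr (N w) F g) (A i)" if "w \<in> space M" for w
    using eN[OF that Ai] by simp
  qed
 qed
qed

section \<open>Products of probability spaces\<close>

lemma indep_vars_PiM_components:
 assumes \<tau>: "!!p. p \<in> K ==> prob_space (\<tau> p)"
 shows "prob_space.indep_vars (\<Pi>\<^sub>M p\<in>K. \<tau> p) \<tau> (%p w. w p) K"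
proof (cases "K = {}")
 case True
 show ?thesis unfolding True by (rule prob_space.indep_vars_empty, rule prob_space_PiM) simp
next
 case False
 interpret prob_space "\<Pi>\<^sub>M p\<in>K. \<tau> p" by (rule prob_space_PiM[OF \<tau>])
 have "distr (\<Pi>\<^sub>M p\<in>K. \<tau> p) (\<Pi>\<^sub>M p\<in>K. \<tau> p) (%x. \<lambda>i\<in>K. x i) = distr (\<Pi>\<^sub>M p\<in>K. \<tau> p) (\<Pi>\<^sub>M p\<in>K. \<tau> p) (%x. x)"
  by (intro distr_cong refl) (auto simp: space_PiM PiE_def extensional_restrict)
 moreover have "(\<Pi>\<^sub>M p\<in>K. \<tau> p) = (\<Pi>\<^sub>M i\<in>K. distr (\<Pi>\<^sub>M p\<in>K. \<tau> p) (\<tau> i) (%w. w i))"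
  by (rule PiM_cong[OF refl], rule distr_PiM_component[OF \<tau>, symmetric])
 ultimately show ?thesis using False by (subst indep_vars_iff_distr_eq_PiM') auto
qed

lemma distr_pair_snd':
 assumes "prob_space N" "prob_space M"
 shows "distr (N \<Otimes>\<^sub>M M) M snd = M"
proof (rule measure_eqI)
 interpret N: prob_space N by fact
 interpret M: prob_space M by fact
 fix A assume "A \<in> sets (distr (N \<Otimes>\<^sub>M M) M snd)"
 then have A: "A \<in> sets M" by simp
 have "snd -` A \<inter> space (N \<Otimes>\<^sub>M M) = space N \<times> A" using sets.sets_into_space[OF A] by (auto simp: space_pair_measure)
 then show "emeasure (distr (N \<Otimes>\<^sub>M M) M snd) A = emeasure M A"
  using A by (simp add: emeasure_distr M.emeasure_pair_measure_Times N.emeasure_space_1)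
qed simp

text \<open>On boxes the integral of a product density factorises. Outside \<open>I\<close> a
  one-point space with density one is inserted, because \<open>product_sigma_finite\<close> speaks
  of all indices.\<close>

lemma density_PiM:
 assumes I: "finite I" and M: "!!i. i \<in> I ==> prob_space (M i)" and f: "!!i. i \<in> I ==> f i \<in> bm (M i)"
  and Mf: "!!i. i \<in> I ==> prob_space (density (M i) (f i))"
 shows "density (\<Pi>\<^sub>M i\<in>I. M i) (%x. \<Prod>i\<in>I. f i (x i)) = (\<Pi>\<^sub>M i\<in>I. density (M i) (f i))"
proof -
 define M' where "M' i = (if i \<in> I then M i else count_space {undefined})" for i
 define f' where "f' i = (if i \<in> I then f i else (%_. 1))" for i
 have p1: "prob_space (count_space {undefined :: 'b})" by (rule prob_spaceI) simp
 interpret P: product_sigma_finite M'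
  by (rule product_sigma_finite.intro) (use M p1 in \<open>auto simp: M'_def intro: prob_space_imp_sigma_finite\<close>)
 interpret D: product_sigma_finite "%i. density (M' i) (f' i)"
  by (rule product_sigma_finite.intro)
   (use Mf p1 in \<open>auto simp: M'_def f'_def density_1 intro: prob_space_imp_sigma_finite\<close>)
 have f'm: "f' i \<in> bm (M' i)" for i using f by (auto simp: f'_def M'_def)
 have m: "(%x. \<Prod>i\<in>I. f' i (x i)) \<in> bm (Pi\<^sub>M I M')"
  by (rule bm_prod, rule m_comp[OF _ f'm], rule m_proj)
 have "density (Pi\<^sub>M I M') (%x. \<Prod>i\<in>I. f' i (x i)) = (\<Pi>\<^sub>M i\<in>I. density (M' i) (f' i))"
 proof (rule D.PiM_eqI[OF I])
  show "sets (density (Pi\<^sub>M I M') (%x. \<Prod>i\<in>I. f' i (x i))) = sets (\<Pi>\<^sub>M i\<in>I. density (M' i) (f' i))"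
   by (simp, intro sets_PiM_cong) auto
  fix B assume "!!i. i \<in> I ==> B i \<in> sets (density (M' i) (f' i))"
  then have B: "B i \<in> sets (M' i)" if "i \<in> I" for i using that by simp
  have "emeasure (density (Pi\<^sub>M I M') (%x. \<Prod>i\<in>I. f' i (x i))) (Pi\<^sub>E I B) =
    (NN x. (\<Prod>i\<in>I. f' i (x i)) * ind1 (Pi\<^sub>E I B) x \<partial>Pi\<^sub>M I M')"
   using B I by (intro emeasure_density m) (auto intro: sets_PiM_I_finite)
  also have "\<dots> = (NN x. (\<Prod>i\<in>I. f' i (x i) * ind1 (B i) (x i)) \<partial>Pi\<^sub>M I M')"
  proof (rule nn_cong)
   fix x assume "x \<in> space (Pi\<^sub>M I M')"
   then have "ind1 (Pi\<^sub>E I B) x = (\<Prod>i\<in>I. ind1 (B i) (x i) :: ennreal)"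
    using I by (auto simp: indicator_def PiE_iff prod_zero_iff space_PiM)
   then show "(\<Prod>i\<in>I. f' i (x i)) * ind1 (Pi\<^sub>E I B) x = (\<Prod>i\<in>I. f' i (x i) * ind1 (B i) (x i))"
    by (simp add: prod.distrib)
  qed
  also have "\<dots> = (\<Prod>i\<in>I. NN x. f' i x * ind1 (B i) x \<partial>M' i)"
   using B by (intro P.product_nn_integral_prod[OF I] bm_times f'm bm_ind)
  also have "\<dots> = (\<Prod>i\<in>I. emeasure (density (M' i) (f' i)) (B i))"
   using B by (intro prod.cong refl emeasure_density[symmetric] f'm)
  finally show "emeasure (density (Pi\<^sub>M I M') (%x. \<Prod>i\<in>I. f' i (x i))) (Pi\<^sub>E I B) = (\<Prod>i\<in>I. emeasure (density (M' i) (f' i)) (B i))" .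
 qed
 moreover have "Pi\<^sub>M I M' = (\<Pi>\<^sub>M i\<in>I. M i)" by (intro PiM_cong) (auto simp: M'_def)
 moreover have "(\<Pi>\<^sub>M i\<in>I. density (M' i) (f' i)) = (\<Pi>\<^sub>M i\<in>I. density (M i) (f i))"
  by (intro PiM_cong) (auto simp: M'_def f'_def)
 moreover have "(%x. \<Prod>i\<in>I. f' i (x i)) = (%x. \<Prod>i\<in>I. f i (x i))"
  by (intro ext prod.cong) (auto simp: f'_def)
 ultimately show ?thesis by simp
qed

text \<open>The required independence is that of the two factors of a product space, and the jumps
  are the coordinates of the second factor.\<close>

theorem poisson_and_jumps_product:
 fixes Q :: "'e measure measure"
 assumes Q: "prob_space Q" and PRM: "poisson_random_measure Q E \<nu> (%N. N)"
  and \<tau>: "!!p. p \<in> d ` {..<n} ==> prob_space (\<tau> p)" "!!p. p \<in> d ` {..<n} ==> \<tau> p = jump_law n d \<rho> p"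
   "!!p. p \<in> d ` {..<n} ==> sets (\<tau> p) = sets unit_jumps"
 shows "poisson_and_jumps (Q \<Otimes>\<^sub>M (\<Pi>\<^sub>M p\<in>d ` {..<n}. \<tau> p)) E \<nu> n d \<rho> fst (%p w. snd w p)"
 unfolding poisson_and_jumps_def
proof (intro conjI ballI)
 let ?K = "d ` {..<n}"
 let ?J = "\<Pi>\<^sub>M p\<in>?K. \<tau> p"
 have J: "prob_space ?J" by (rule prob_space_PiM[OF \<tau>(1)])
 interpret Q: prob_space Q by fact
 interpret J: prob_space ?J by (rule J)
 interpret QJ: pair_prob_space Q ?J ..
 have Qm: "(%N. N) \<in> Q ->M MA E" using PRM by (simp add: poisson_random_measure_def)
 have sJ: "sets ?J = sets (\<Pi>\<^sub>M p\<in>?K. unit_jumps)" by (rule sets_PiM_cong[OF refl \<tau>(3)])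
 have Jp: "(%w. w p) \<in> ?J ->M unit_jumps" if "p \<in> ?K" for p
  using m_proj[OF that, of "%_. unit_jumps"]
  unfolding m_cong_sets[OF sJ refl] .
 show "prob_space (Q \<Otimes>\<^sub>M ?J)" by (rule QJ.prob_space_axioms)
 have "poisson_random_measure (distr (Q \<Otimes>\<^sub>M ?J) Q fst) E \<nu> (%N. N)"
  unfolding J.distr_pair_fst by (rule PRM)
 then show "poisson_random_measure (Q \<Otimes>\<^sub>M ?J) E \<nu> fst"
  using poisson_random_measure_distr_iff[OF QJ.prob_space_axioms measurable_fst Qm] by simp
 show "(%w. snd w p) \<in> Q \<Otimes>\<^sub>M ?J ->M unit_jumps" if "p \<in> ?K" for p
  by (rule m_comp[OF measurable_snd Jp[OF that]])
 show "distr (Q \<Otimes>\<^sub>M ?J) unit_jumps (%w. snd w p) = jump_law n d \<rho> p" if "p \<in> ?K" for p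
 proof -
  have "distr (Q \<Otimes>\<^sub>M ?J) unit_jumps (%w. snd w p) = distr (distr (Q \<Otimes>\<^sub>M ?J) ?J snd) unit_jumps (%w. w p)"
   by (subst distr_distr[OF Jp[OF that] measurable_snd]) (simp add: o_def)
  also have "\<dots> = distr ?J (\<tau> p) (%w. w p)"
   unfolding distr_pair_snd'[OF Q J] by (intro distr_cong refl) (simp add: \<tau>(3)[OF that])
  also have "\<dots> = jump_law n d \<rho> p" unfolding \<tau>(2)[OF that, symmetric] by (rule distr_PiM_component[OF \<tau>(1) that])
  finally show ?thesis .
 qed
 have "prob_space.indep_vars (distr (Q \<Otimes>\<^sub>M ?J) ?J snd) \<tau> (%p w. w p) ?K"
  unfolding distr_pair_snd'[OF Q J] by (rule indep_vars_PiM_components[OF \<tau>(1)])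
 then have "prob_space.indep_vars (Q \<Otimes>\<^sub>M ?J) \<tau> (%p w. snd w p) ?K"
  by (subst (asm) indep_vars_distr_iff[OF QJ.prob_space_axioms measurable_snd]) auto
 then show "prob_space.indep_vars (Q \<Otimes>\<^sub>M ?J) (%_. unit_jumps) (%p w. snd w p) ?K"
  unfolding QJ.indep_vars_def using \<tau>(3) space_eq[OF \<tau>(3)]
  by (simp cong: m_cong_sets QJ.indep_sets_cong)
 show "QJ.indep_set (sets (vimage_algebra (space (Q \<Otimes>\<^sub>M ?J)) fst (MA E)))
   (sets (vimage_algebra (space (Q \<Otimes>\<^sub>M ?J)) (%w. \<lambda>p\<in>?K. snd w p) (\<Pi>\<^sub>M p\<in>?K. unit_jumps)))"
 proof (rule QJ.indep_setI)
  have f: "fst \<in> Q \<Otimes>\<^sub>M ?J ->M MA E" using m_comp[OF measurable_fst Qm] by simp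
  have r: "(%w. \<lambda>p\<in>?K. snd w p) \<in> Q \<Otimes>\<^sub>M ?J ->M (\<Pi>\<^sub>M p\<in>?K. unit_jumps)"
   by (rule measurable_restrict) (rule m_comp[OF measurable_snd Jp])
  show "sets (vimage_algebra (space (Q \<Otimes>\<^sub>M ?J)) fst (MA E)) \<subseteq> sets (Q \<Otimes>\<^sub>M ?J)"
   
   using measurable_space[OF f] measurable_sets[OF f] by (auto simp: sets_vimage_algebra2 Pi_iff)
  show "sets (vimage_algebra (space (Q \<Otimes>\<^sub>M ?J)) (%w. \<lambda>p\<in>?K. snd w p) (\<Pi>\<^sub>M p\<in>?K. unit_jumps)) \<subseteq> sets (Q \<Otimes>\<^sub>M ?J)"
   
   using measurable_space[OF r] measurable_sets[OF r] by (auto simp: sets_vimage_algebra2 Pi_iff)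
  fix a b assume "a \<in> sets (vimage_algebra (space (Q \<Otimes>\<^sub>M ?J)) fst (MA E))"
   "b \<in> sets (vimage_algebra (space (Q \<Otimes>\<^sub>M ?J)) (%w. \<lambda>p\<in>?K. snd w p) (\<Pi>\<^sub>M p\<in>?K. unit_jumps))"
  then obtain A B where A: "A \<in> sets (MA E)" "a = fst -` A \<inter> space (Q \<Otimes>\<^sub>M ?J)"
   and B: "B \<in> sets (\<Pi>\<^sub>M p\<in>?K. unit_jumps)" "b = (%w. \<lambda>p\<in>?K. snd w p) -` B \<inter> space (Q \<Otimes>\<^sub>M ?J)"
   using measurable_space[OF f] measurable_space[OF r] by (auto simp: sets_vimage_algebra2 Pi_iff)
  have A': "A \<inter> space Q \<in> sets Q" using measurable_sets[OF Qm A(1)] by (simp add: vimage_def)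
  have B': "B \<in> sets ?J" using B(1) sJ by simp
  have Bs: "B \<subseteq> space ?J" by (rule sets.sets_into_space[OF B'])
  have a: "a = (A \<inter> space Q) \<times> space ?J" using A(2) by (auto simp: space_pair_measure)
  have b: "b = space Q \<times> B"
   using Bs unfolding B(2) by (auto simp: space_pair_measure space_PiM PiE_def extensional_restrict subset_eq)
  have ab: "a \<inter> b = (A \<inter> space Q) \<times> B" unfolding a b using Bs by auto
  show "QJ.prob (a \<inter> b) = QJ.prob a * QJ.prob b"
   unfolding ab unfolding a b using A' B'
   by (simp add: measure_def J.emeasure_pair_measure_Times enn2real_mult Q.emeasure_space_1 J.emeasure_space_1)
 qed
qed

text \<open>Preimages under \<open>g\<close> differ from those under \<open>f\<close> by subsets of
  a null set, and the completion contains these. It is applied to \<open>ntr\<close> of the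
  posterior hazard, which is known to be measurable only up to such a set.\<close>

lemma completion_cong_AE:
 assumes f: "f \<in> M ->M N" and ae: "AE x in M. f x = g x" and g: "!!x. x \<in> space M ==> g x \<in> space N"
 shows "g \<in> completion M ->M N" "distr (completion M) N g = distr M N f"
proof -
 have fc: "f \<in> completion M ->M N" by (rule measurable_completion[OF f])
 have ae': "AE x in completion M. f x = g x" by (rule AE_completion[OF ae])
 show gc: "g \<in> completion M ->M N"
 proof (rule measurableI)
  fix A assume A: "A \<in> sets N"
  have "Measurable.pred (completion M) (%x. f x \<noteq> g x)" by (rule sets_completion_AE) (use ae in simp)
  then have D: "{x\<in>space M. f x \<noteq> g x} \<in> null_sets (completion M)"
   using ae' by (simp add: pred_def AE_iff_null)
  have "g -` A \<inter> space M = (f -` A \<inter> space M - {x\<in>space M. f x \<noteq> g x}) \<union> (g -` A \<inter> {x\<in>space M. f x \<noteq> g x})"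
   by auto
  moreover have "g -` A \<inter> {x\<in>space M. f x \<noteq> g x} \<in> null_sets (completion M)"
   by (rule null_sets_completion_subset[OF _ D]) auto
  moreover have "f -` A \<inter> space M \<in> sets (completion M)" using measurable_sets[OF fc A] by simp
  ultimately show "g -` A \<inter> space (completion M) \<in> sets (completion M)"
   unfolding space_completion using sets.Un[OF sets.Diff[OF _ null_setsD2[OF D]] null_setsD2] by simp
 qed (use g in auto)
 show "distr (completion M) N g = distr M N f"
  unfolding distr_completion[OF f, symmetric]
  by (rule distr_cong_AE) (use ae' fc gc in auto)
qed

section \<open>The structure of the posterior\<close>

context crm_pp
begin

lemma AE_simple_config: "AE N in P. \<exists>Z. simple_config EE tm N Z"
proof -
 have "AE N in P. AE z in N. emeasure N {z} = 1 \<and> emeasure N {z' \<in> space EE. tm z' = tm z} = 1"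
  by (rule mecke_AE_simple[OF P P_sets \<nu>_sets P_mecke measurable_tm diag_EE \<nu>_time_null])
 then show ?thesis using AE_space
 proof eventually_elim
  fix N assume "AE z in N. emeasure N {z} = 1 \<and> emeasure N {z' \<in> space EE. tm z' = tm z} = 1" "N \<in> space P"
  then show "\<exists>Z. simple_config EE tm N Z"
   by (intro simple_configI sigma_finite_lf sets_lfD measurable_tm singleton_EE) (simp_all add: P_space)
 qed
qed

lemma AE_integer_valued: "AE N in P. \<forall>B\<in>sets EE. emeasure N B = \<infinity> \<or> (\<exists>k. emeasure N B = of_nat k)"
 using AE_simple_config by eventually_elim (metis simple_config_nat)

lemma AE_no_time:
 assumes s: "s > 0"
 shows "AE N in P. emeasure N {z \<in> space EE. tm z = s} = 0"
proof -
 let ?F = "{z \<in> space (EE :: ('x mark) measure). tm z = s}"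
 have F: "?F \<in> sets EE" using measurable_sets[OF measurable_tm, of "{s}"] by (simp add: vimage_def Int_def conj_commute)
 \<comment> \<open>Any mark at time \<open>s\<close> represents the fibre; \<open>1\<close> is an
   admissible jump.\<close>
 have "emeasure \<nu> ?F = 0" using \<nu>_time_null[of "(1, s, undefined)"] s by (simp add: space_pair_measure)
 then have "(NN N. emeasure N ?F \<partial>P) = 0"
  using mecke_mean_emeasure[OF P_mecke P P_sets \<nu>_sets F] by simp
 moreover have "(%N. emeasure N ?F) \<in> bm P"
  unfolding m_cong_sets[OF P_sets refl]
  by (rule emeasure_fun_measurable[OF measurable_lfD[OF m_id] F])
 ultimately show ?thesis by (simp add: nn_integral_0_iff_AE)
qed

lemma hazard_integrand: "(%y. ennreal (fst y) * ind1 {0<..t} (tm y)) \<in> bm (EE :: ('x mark) measure)"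
 by (intro bm_times m_comp[OF measurable_jump measurable_ennreal]
   m_comp[OF measurable_tm bm_ind]) auto

lemma hazard_mean: "(NN N. NN y. ennreal (fst y) * ind1 {0<..t} (tm y) \<partial>N \<partial>P) = emeasure A ({0<..t} \<times> UNIV)"
proof -
 have S: "{0<..t} \<times> UNIV \<in> sets (base :: (real \<times> 'x) measure)" by (intro restricted_time_sets) auto
 have "ind1 ({0<..t} \<times> UNIV) (snd y) = (ind1 {0<..t} (tm y) :: ennreal)" for y :: "real \<times> real \<times> 'x"
  by (auto simp: indicator_def mem_Times_iff)
 then show ?thesis using \<nu>_mean[OF S] mecke_mean[OF P_mecke P hazard_integrand] by simp
qed

lemma AE_hazard_finite:
 assumes "emeasure A ({0<..t} \<times> UNIV) < \<infinity>"
 shows "AE N in P. (NN y. ennreal (fst y) * ind1 {0<..t} (tm y) \<partial>N) < \<infinity>"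
proof -
 have "(%N. NN y. ennreal (fst y) * ind1 {0<..t} (tm y) \<partial>N) \<in> bm P"
  unfolding m_cong_sets[OF P_sets refl]
  by (rule m_comp[OF measurable_lfD[OF m_id] nn_integral_measurable_measure_algebra[OF hazard_integrand]])
 then show ?thesis
  using nn_integral_PInf_AE[of "%N. NN y. ennreal (fst y) * ind1 {0<..t} (tm y) \<partial>N" P] hazard_mean[of t] assms
  by (auto simp: less_top)
qed

text \<open>By the Mecke equation the hazard up to a typical point of \<open>N\<close> is the hazard
  of an unconditioned configuration up to that time plus the jump of the point. The former has mean
  \<open>A\<close> of the time interval, which is finite for almost every location.\<close>

lemma AE_hazard_finite_atoms:
 "AE N in P. AE z in N. (NN y. ennreal (fst y) * ind1 {0<..tm z} (tm y) \<partial>N) < \<infinity>"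
proof -
 define H where "H = (%(N, z :: 'x mark). NN y. ennreal (fst y) * ind1 {0<..tm z} (tm y) \<partial>(N :: ('x mark) measure))"
 have m: "(%x. ennreal (fst (snd x)) * ind1 {0<..tm (snd (fst x))} (tm (snd x)))
  \<in> bm ((lf \<Otimes>\<^sub>M EE) \<Otimes>\<^sub>M (EE :: ('x mark) measure))"
 proof -
  have "(%x. ennreal (fst (snd x)) * (if 0 < tm (snd x) \<and> tm (snd x) \<le> tm (snd (fst x)) then 1 else 0))
   \<in> bm ((lf \<Otimes>\<^sub>M EE) \<Otimes>\<^sub>M (EE :: ('x mark) measure))" by measurable
  then show ?thesis by (simp add: indicator_def)
 qed
 have Hm: "H \<in> bm (lf \<Otimes>\<^sub>M EE)"
  unfolding H_def split_beta' using measurable_nn_integral_lf[OF measurable_fst m] by simp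
 define g where "g = (%x. if H x = \<infinity> then 1 else 0 :: ennreal)"
 have gm: "g \<in> bm (lf \<Otimes>\<^sub>M EE)" unfolding g_def using Hm by measurable
 have z0: "(NN N. g (add1 N z, z) \<partial>P) = 0" if z: "z \<in> space EE" and fin: "emeasure A ({0<..tm z} \<times> UNIV) < \<infinity>" for z
 proof -
  have "AE N in P. g (add1 N z, z) = 0"
   using AE_hazard_finite[OF fin] AE_space
  proof eventually_elim
   fix N assume f: "(NN y. ennreal (fst y) * ind1 {0<..tm z} (tm y) \<partial>N) < \<infinity>" and "N \<in> space P"
   then have N: "N \<in> space lf" by (simp add: P_space)
   have "H (add1 N z, z) = (NN y. ennreal (fst y) * ind1 {0<..tm z} (tm y) \<partial>N) + ennreal (fst z) * ind1 {0<..tm z} (tm z)"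
    unfolding H_def
    using hazard_integrand z by (simp, subst nn_integral_add_pts)
     (simp_all cong: m_cong_sets add: sets_lfD[OF N] space_lfD[OF N] del: space_pair_measure)
   also have "\<dots> < \<infinity>" using f by (simp add: less_top ennreal_mult_eq_top_iff split: split_indicator)
   finally show "g (add1 N z, z) = 0" by (simp add: g_def)
  qed
  then show ?thesis by (simp cong: nn_integral_cong_AE)
 qed
 have "(NN N. NN z. g (N, z) \<partial>N \<partial>P) = (NN z. NN N. g (add1 N z, z) \<partial>P \<partial>\<nu>)" by (rule meckeD[OF P_mecke gm])
 also have "\<dots> = (NN z. 0 \<partial>\<nu>)"
 proof (rule nn_integral_cong_AE)
  obtain B where B: "{p\<in>space A. \<not> emeasure A ({0<..fst p} \<times> UNIV) < \<infinity>} \<subseteq> B" "emeasure A B = 0" "B \<in> sets A"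
   using A_finite by (rule AE_E)
  have "emeasure \<nu> {z \<in> space EE. snd z \<in> B} = 0" by (rule \<nu>_null_from_A) (use B A_sets in auto)
  moreover have "{z \<in> space EE. snd z \<in> B} \<in> sets \<nu>"
  proof -
   have "snd -` B \<inter> space EE \<in> sets EE" by (rule measurable_sets[OF measurable_snd]) (use B(3) A_sets in simp)
   then show ?thesis by (simp add: \<nu>_sets vimage_def Int_def conj_commute)
  qed
  ultimately have "AE z in \<nu>. z \<notin> {z \<in> space EE. snd z \<in> B}" by (intro AE_not_in) auto
  then show "AE z in \<nu>. (NN N. g (add1 N z, z) \<partial>P) = 0"
   using AE_space
  proof eventually_elim
   fix z assume "z \<notin> {z \<in> space EE. snd z \<in> B}" "z \<in> space \<nu>"
   then have z: "z \<in> space EE" "snd z \<notin> B" by (auto simp: \<nu>_space)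
   then have "snd z \<in> space A" by (auto simp: A_space space_pair_measure)
   then show "(NN N. g (add1 N z, z) \<partial>P) = 0" using z B(1) by (intro z0) auto
  qed
 qed
 finally have "(NN N. NN z. g (N, z) \<partial>N \<partial>P) = 0" by simp
 moreover have "(%N. NN z. g (N, z) \<partial>N) \<in> bm P"
  unfolding m_cong_sets[OF P_sets refl]
  using measurable_nn_integral_lf[OF m_id, of g] gm by simp
 ultimately have "AE N in P. (NN z. g (N, z) \<partial>N) = 0" by (simp add: nn_integral_0_iff_AE)
 then show ?thesis using AE_space
 proof eventually_elim
  fix N assume 0: "(NN z. g (N, z) \<partial>N) = 0" and "N \<in> space P"
  then have N: "N \<in> space lf" by (simp add: P_space)
  have "(%z. g (N, z)) \<in> bm N"
   unfolding m_cong_sets[OF sets_lfD[OF N] refl] by (rule m_comp[OF measurable_Pair1'[OF N] gm])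
  then have "AE z in N. g (N, z) = 0" using 0 by (simp add: nn_integral_0_iff_AE)
  then show "AE z in N. (NN y. ennreal (fst y) * ind1 {0<..tm z} (tm y) \<partial>N) < \<infinity>"
   by eventually_elim (auto simp: g_def H_def less_top split: if_splits)
 qed
qed

end

section \<open>The posterior at one good data point\<close>

locale crm_posterior = crm_data \<rho> \<eta> D P n m C
 for \<rho> and \<eta> :: "(real \<times> 'x::polish_space) measure" and D P n m C +
 fixes d :: "nat => real \<times> 'x"
 assumes d: "d \<in> space (DD n)" and F1: "F1 d \<noteq> 0"
  and \<kappa>d: "!!i. i < n ==> 0 < kappa1 \<rho> (fst (d i)) \<and> kappa1 \<rho> (fst (d i)) < \<infinity>"
begin

abbreviation \<rho>' :: "real => real measure" where "\<rho>' \<equiv> tilted (Ydm d) \<rho>"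

text \<open>At fixed data the unnormalised posterior is a product of one factor for each index and
  one for the configuration. The numbers \<open>z i\<close> and \<open>c\<close> normalise these
  factors, and \<open>F1 d\<close> is the product of all of them.\<close>

definition z :: "nat => ennreal" where "z i = (NN u. jd d i u \<partial>\<sigma> (fst (d i)))"
definition c :: ennreal where "c = (NN N. lik N d \<partial>P)"
definition Q :: "('x mark) measure measure" where "Q = density P (%N. lik N d / c)"
definition \<tau>0 :: "nat => real measure" where "\<tau>0 i = density (\<sigma> (fst (d i))) (%u. jd d i u / z i)"

lemma d_pos: "i < n ==> 0 < fst (d i)"
 by (rule DD_pos[OF d])

lemma lik_meas: "(%N. lik N d) \<in> bm P"
 unfolding m_cong_sets[OF P_sets refl]
 by (rule lik_measurable[OF m_id measurable_const[OF d]])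

lemma jd_meas: "i < n ==> jd d i \<in> bm (\<sigma> (fst (d i)))"
 using jd_measurable[OF measurable_const[OF d] m_id]
 by (simp cong: m_cong_sets add: \<sigma>_sets d_pos)

lemma F1_eq: "F1 d = (\<Prod>i<n. z i) * c"
proof -
 define M' where "M' i = (if i < n then \<sigma> (fst (d i)) else return unit_jumps 1)" for i
 interpret product_sigma_finite M'
 proof (rule product_sigma_finite.intro)
  fix k show "sigma_finite_measure (M' k)"
   using \<sigma>_prob[OF d_pos, of k] by (auto intro!: prob_space_imp_sigma_finite prob_space_return simp: M'_def)
 qed
 have M': "SG n d = Pi\<^sub>M {..<n} M'" by (intro PiM_cong) (auto simp: M'_def)
 have "F1 d = (NN u. jw d u * c \<partial>SG n d)"
  unfolding Fun_def c_def by (simp add: nn_integral_cmult[OF lik_meas])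
 also have "\<dots> = (NN u. jw d u \<partial>SG n d) * c"
  by (rule nn_integral_multc)
   (simp cong: m_cong_sets add: SG_sets[OF d] jw_measurable[OF measurable_const[OF d] m_id])
 also have "(NN u. jw d u \<partial>SG n d) = (\<Prod>i<n. NN u. jd d i u \<partial>M' i)"
  unfolding jw_def M' by (rule product_nn_integral_prod) (auto simp: M'_def jd_meas)
 also have "\<dots> = (\<Prod>i<n. z i)" by (intro prod.cong) (auto simp: M'_def z_def)
 finally show ?thesis .
qed

lemma c_bounds: "0 < c" "c \<le> 1" "c < \<infinity>"
proof -
 show "0 < c" using F1 F1_eq by (auto simp: zero_less_iff_neq_zero)
 show "c \<le> 1" unfolding c_def by (intro P.nn_integral_le_const AE_I2 lik_le_1) auto
 then show "c < \<infinity>" using le_less_trans ennreal_one_less_top by (metis infinity_ennreal_def)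
qed

lemma \<sigma>_space: "i < n ==> space (\<sigma> (fst (d i))) = {0<..1}"
 using space_eq[OF \<sigma>_sets[OF d_pos]] by simp

lemma jd_le_1: "0 < u ==> u \<le> 1 ==> jd d i u \<le> 1"
proof -
 assume u: "0 < u" "u \<le> 1"
 have "ennreal u ^ k \<le> 1" for k using u by (intro power_le_one) auto
 moreover have "ennreal ((1 - u) ^ k) \<le> 1" for k using u by (simp add: power_le_one)
 ultimately show "jd d i u \<le> 1" unfolding jd_def by (auto intro: mult_le_one)
qed

lemma z_bounds:
 assumes i: "i < n" shows "0 < z i" "z i \<le> 1" "z i < \<infinity>"
proof -
 interpret S: prob_space "\<sigma> (fst (d i))" by (rule \<sigma>_prob[OF d_pos[OF i]])
 show "0 < z i" using F1 F1_eq i by (auto simp: zero_less_iff_neq_zero)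
 show "z i \<le> 1" unfolding z_def
  by (intro S.nn_integral_le_const AE_I2) (auto simp: \<sigma>_space[OF i] intro!: jd_le_1)
 then show "z i < \<infinity>" using le_less_trans ennreal_one_less_top by (metis infinity_ennreal_def)
qed

lemma \<tau>0_sets: "i < n ==> sets (\<tau>0 i) = sets unit_jumps"
 by (simp add: \<tau>0_def \<sigma>_sets d_pos)

lemma \<tau>0_prob: assumes i: "i < n" shows "prob_space (\<tau>0 i)"
proof (rule prob_spaceI)
 have "emeasure (\<tau>0 i) (space (\<tau>0 i)) = (NN u. jd d i u / z i \<partial>\<sigma> (fst (d i)))"
  unfolding \<tau>0_def using jd_meas[OF i]
  by (subst emeasure_density) (auto intro!: nn_cong bm_div)
 also have "\<dots> = z i / z i" unfolding nn_integral_divide[OF jd_meas[OF i]] z_def ..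
 also have "\<dots> = 1" using z_bounds[OF i] by (intro ennreal_divide_self) auto
 finally show "emeasure (\<tau>0 i) (space (\<tau>0 i)) = 1" .
qed

lemma SG_density: "density (SG n d) (%u. jw d u / (\<Prod>i<n. z i)) = (\<Pi>\<^sub>M i\<in>{..<n}. \<tau>0 i)"
proof -
 \<comment> \<open>The rule for the inverse of a product is used on finite factors; a product of
   zero and infinity would break it.\<close>
 have inv: "inverse (\<Prod>i\<in>I. z i) = (\<Prod>i\<in>I. inverse (z i))" if "I \<subseteq> {..<n}" for I
  using finite_subset[OF that finite_lessThan] that
 proof (induction I rule: finite_induct)
  case (insert i I)
  have "prod z I \<le> 1" using insert.prems z_bounds(2) by (intro prod_le_1) auto
  then have "prod z I < top" using ennreal_one_less_top le_less_trans by blast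
  moreover have "z i < top" using insert.prems z_bounds(3)[of i] by simp
  ultimately show ?case using insert by (simp add: ennreal_inverse_mult)
 qed simp
 have "jw d u / (\<Prod>i<n. z i) = (\<Prod>i<n. jd d i (u i) / z i)" for u
  unfolding divide_ennreal_def jw_def prod.distrib inv[OF order_refl] ..
 then have "density (SG n d) (%u. jw d u / (\<Prod>i<n. z i)) = density (SG n d) (%u. \<Prod>i<n. jd d i (u i) / z i)" by simp
 also have "\<dots> = (\<Pi>\<^sub>M i\<in>{..<n}. density (\<sigma> (fst (d i))) (%u. jd d i u / z i))"
  by (rule density_PiM) (auto intro!: \<sigma>_prob d_pos bm_div jd_meas simp: \<tau>0_prob[unfolded \<tau>0_def])
 finally show ?thesis by (simp add: \<tau>0_def)
qed

lemma Y: "Ydm d \<in> halfline ->M count_space UNIV"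
 using at_risk_measurable[OF measurable_const[OF d], of "%s. s" halfline] by (simp add: measurable_restrict_space1)

text \<open>The survival factors form a multiplicative functional by \<open>lik_add_pts\<close>, so
  \<open>mecke_density\<close> applies; \<open>c_bounds\<close> supplies the positive finite
  normaliser.\<close>

lemma Q_prob: "prob_space Q" and Q_mecke: "mecke (intensity \<rho>' \<eta>) Q"
proof -
 have mult: "lik (add1 N z) d = lik N d * ennreal ((1 - fst z) ^ Ydm d (tm z))" if "N \<in> space lf" "z \<in> space EE" for N z
  using lik_add_pts[OF that(1), of "{()}" "%_. z" d] that(2) by simp
 have lm: "(%N. lik N d) \<in> bm lf"
  by (rule lik_measurable[OF m_id measurable_const[OF d]])
 note * = mecke_density[OF P P_sets \<nu>_sets P_mecke lm tilt_measurable[OF Y] c_def c_bounds(1,3) mult]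
 show "prob_space Q" unfolding Q_def by (rule *(1))
 show "mecke (intensity \<rho>' \<eta>) Q" unfolding Q_def intensity_tilted[OF Y] by (rule *(2))
qed

lemma Q_sets: "sets Q = sets lf"
 by (simp add: Q_def P_sets)

lemma AE_Q: "AE N in P. R N ==> AE N in Q. R N"
 unfolding Q_def by (subst AE_density) (auto intro!: bm_div lik_meas elim: eventually_mono)

lemma Q_poisson: "poisson_random_measure Q EE (intensity \<rho>' \<eta>) (%N. N)"
 by (rule mecke_poisson[OF Q_prob Q_sets _ Q_mecke AE_Q[OF AE_integer_valued]])
  (rule sets_intensity[OF tilted_kernel[OF Y] \<eta> tilted_finite[OF Y]])

text \<open>Sends an observed value to its first index and so links jumps indexed by values, as in
  \<open>poisson_and_jumps\<close>, with jumps indexed by \<open>{..<n}\<close>.\<close>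

definition idx :: "real \<times> 'x => nat" where "idx p = the_inv_into (Fst d n) d p"

abbreviation K :: "(real \<times> 'x) set" where "K \<equiv> d ` {..<n}"

definition \<tau> :: "real \<times> 'x => real measure" where "\<tau> p = \<tau>0 (idx p)"

lemma idx: "p \<in> K ==> idx p \<in> Fst d n" "p \<in> K ==> d (idx p) = p" "i \<in> Fst d n ==> idx (d i) = i" "p \<in> K ==> idx p < n"
proof -
 have b: "bij_betw d (Fst d n) K" by (rule bij_betw_Fst)
 then have inj: "inj_on d (Fst d n)" and im: "d ` Fst d n = K" by (auto simp: bij_betw_def)
 show 1: "p \<in> K ==> idx p \<in> Fst d n" for p unfolding idx_def using im by (intro the_inv_into_into[OF inj]) auto
 show "p \<in> K ==> d (idx p) = p" unfolding idx_def using im by (intro f_the_inv_into_f[OF inj]) auto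
 show "i \<in> Fst d n ==> idx (d i) = i" unfolding idx_def by (rule the_inv_into_f_f[OF inj])
 show "p \<in> K ==> idx p < n" using 1 Fst_subset[of d n] by blast
qed

lemma \<tau>_prob: "p \<in> K ==> prob_space (\<tau> p)"
 unfolding \<tau>_def by (rule \<tau>0_prob[OF idx(4)])

lemma \<tau>_sets: "p \<in> K ==> sets (\<tau> p) = sets unit_jumps"
 unfolding \<tau>_def by (rule \<tau>0_sets[OF idx(4)])

text \<open>\<open>\<sigma>\<close> contributes \<open>u\<close> over the first moment
  \<open>k\<close>, the repetitions contribute \<open>u ^ (e - 1)\<close>, and survival contributes
  \<open>(1 - u) ^ y\<close>: together the numerator of the jump law. The constants combine because
  \<open>kappa e \<rho>' s = z i * k\<close>.\<close>

lemma \<tau>_eq: assumes p: "p \<in> K" shows "\<tau> p = jump_law n d \<rho>' p"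
proof -
 define i where "i = idx p"
 define s where "s = fst p"
 define k where "k = kappa1 \<rho> s"
 define e where "e = cell_size n d p"
 define y where "y = Ydm d s"
 have i: "i \<in> Fst d n" "d i = p" "i < n" using p by (simp_all only: i_def idx)
 have s: "0 < s" using d_pos[OF i(3)] i(2) by (simp add: s_def)
 have k: "0 < k" "k < \<infinity>" using \<kappa>d[OF i(3)] by (auto simp: k_def s_def i(2))
 have "i \<in> {j. j < n \<and> d j = p}" using i by simp
 then have e: "0 < e" unfolding e_def cell_size_def by (subst card_gt_0_iff) auto
 have ms: "(%u. ennreal u) \<in> bm (\<rho> s)" by (rule measurable_ennreal_\<rho>[OF s])
 have my: "(%u. ennreal ((1 - u) ^ y)) \<in> bm (\<rho> s)" by (rule tilt_power_measurable[OF Y s])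
 have me: "(%u. ennreal (u ^ e)) \<in> bm (\<rho> s)"
  unfolding m_cong_sets[OF \<rho>_sets[OF s] refl]
  by (rule m_comp[OF unit_jumps_borel]) measurable
 have mj: "(%u. ennreal u ^ (e - 1) * ennreal ((1 - u) ^ y)) \<in> bm (\<rho> s)"
  using ms my by measurable
 have jd: "jd d i u = ennreal u ^ (e - 1) * ennreal ((1 - u) ^ y)" for u
  using i by (simp add: jd_def e_def y_def s_def)
 have \<sigma>: "\<sigma> s = density (\<rho> s) (%u. ennreal u / k)" using k by (simp add: \<sigma>_def k_def)
 have msk: "(%u. ennreal u / k) \<in> bm (\<rho> s)" using ms by measurable
 have pw: "ennreal u * ennreal u ^ (e - 1) = ennreal (u ^ e)" if "0 < u" for u
  using e that by (cases e) (simp_all add: ennreal_power ennreal_mult')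
 have zk: "z i = (NN u. ennreal (u ^ e) * ennreal ((1 - u) ^ y) \<partial>\<rho> s) / k"
 proof -
  have "z i = (NN u. ennreal u / k * (ennreal u ^ (e - 1) * ennreal ((1 - u) ^ y)) \<partial>\<rho> s)"
   unfolding z_def i(2) s_def[symmetric] \<sigma> jd by (rule nn_integral_density[OF msk mj])
  also have "\<dots> = (NN u. ennreal (u ^ e) * ennreal ((1 - u) ^ y) / k \<partial>\<rho> s)"
  proof (rule nn_cong)
   fix u assume "u \<in> space (\<rho> s)"
   then have "0 < u" by (simp add: \<rho>_space[OF s])
   then show "ennreal u / k * (ennreal u ^ (e - 1) * ennreal ((1 - u) ^ y)) = ennreal (u ^ e) * ennreal ((1 - u) ^ y) / k"
    unfolding pw[OF \<open>0 < u\<close>, symmetric] by (simp add: divide_ennreal_def ac_simps)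
  qed
  also have "\<dots> = (NN u. ennreal (u ^ e) * ennreal ((1 - u) ^ y) \<partial>\<rho> s) / k"
   by (intro nn_integral_divide bm_times me my)
  finally show ?thesis .
 qed
 have kap: "kappa e \<rho>' s = z i * k"
 proof -
  have "kappa e \<rho>' s = (NN u. ennreal ((1 - u) ^ y) * ennreal (u ^ e) \<partial>\<rho> s)"
   unfolding kappa_def tilted_def y_def[symmetric] by (rule nn_integral_density[OF my me])
  also have "\<dots> = (NN u. ennreal (u ^ e) * ennreal ((1 - u) ^ y) \<partial>\<rho> s)" by (simp only: mult.commute)
  also have "\<dots> = z i * k"
  proof -
   have "k / k = 1" using k by (intro ennreal_divide_self) auto
   then show ?thesis unfolding zk ennreal_divide_times by simp
  qed
  finally show ?thesis .
 qed
 have mjz: "(%u. ennreal u ^ (e - 1) * ennreal ((1 - u) ^ y) / z i) \<in> bm (\<rho> s)"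
  by (intro bm_div[OF mj]) simp
 have mek: "(%u. ennreal (u ^ e) / kappa e \<rho>' s) \<in> bm (\<rho> s)"
  by (intro bm_div[OF me]) simp
 have "\<tau> p = density (density (\<rho> s) (%u. ennreal u / k)) (%u. ennreal u ^ (e - 1) * ennreal ((1 - u) ^ y) / z i)"
  unfolding \<tau>_def i_def[symmetric] \<tau>0_def i(2) s_def[symmetric] \<sigma> jd ..
 also have "\<dots> = density (\<rho> s) (%u. (ennreal u / k) * (ennreal u ^ (e - 1) * ennreal ((1 - u) ^ y) / z i))"
  by (rule density_density_eq[OF msk mjz])
 also have "\<dots> = density (\<rho> s) (%u. ennreal ((1 - u) ^ y) * (ennreal (u ^ e) / kappa e \<rho>' s))"
 proof (rule density_cong)
  show "AE u in \<rho> s. ennreal u / k * (ennreal u ^ (e - 1) * ennreal ((1 - u) ^ y) / z i) =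
    ennreal ((1 - u) ^ y) * (ennreal (u ^ e) / kappa e \<rho>' s)"
   using AE_space
  proof eventually_elim
   fix u assume "u \<in> space (\<rho> s)"
   then have "0 < u" by (simp add: \<rho>_space[OF s])
   have "inverse (kappa e \<rho>' s) = inverse (z i) * inverse k"
    unfolding kap using z_bounds[OF i(3)] k by (intro ennreal_inverse_mult) auto
   then show "ennreal u / k * (ennreal u ^ (e - 1) * ennreal ((1 - u) ^ y) / z i) =
    ennreal ((1 - u) ^ y) * (ennreal (u ^ e) / kappa e \<rho>' s)"
    unfolding pw[OF \<open>0 < u\<close>, symmetric] by (simp add: divide_ennreal_def ac_simps)
  qed
 qed (intro bm_times msk mjz my mek)+
 also have "\<dots> = density (density (\<rho> s) (%u. ennreal ((1 - u) ^ y))) (%u. ennreal (u ^ e) / kappa e \<rho>' s)"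
  by (rule density_density_eq[OF my mek, symmetric])
 finally show ?thesis by (simp add: jump_law_def tilted_def e_def s_def y_def)
qed

definition MP :: "(('x mark) measure \<times> (real \<times> 'x => real)) measure" where
 "MP = Q \<Otimes>\<^sub>M (\<Pi>\<^sub>M p\<in>K. \<tau> p)"

definition ptsJ :: "('x mark) measure => (real \<times> 'x => real) => ('x mark) measure" where
 "ptsJ N J = add_pts N K (%p. (J p, p))"

lemma J_prob: "prob_space (\<Pi>\<^sub>M p\<in>K. \<tau> p)"
 by (rule prob_space_PiM[OF \<tau>_prob])

sublocale MP: pair_prob_space Q "\<Pi>\<^sub>M p\<in>K. \<tau> p"
 using Q_prob J_prob by (simp add: pair_prob_space_def pair_sigma_finite_def prob_space_imp_sigma_finite)

lemma MP_prob: "prob_space MP"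
 unfolding MP_def by (rule MP.prob_space_axioms)

lemma K_space: "p \<in> K ==> p \<in> space base"
 using d by (auto simp: space_PiM PiE_iff)

lemma MP_sets: "sets MP = sets (lf \<Otimes>\<^sub>M (\<Pi>\<^sub>M p\<in>K. unit_jumps))"
 unfolding MP_def by (intro sets_pair_measure_cong Q_sets sets_PiM_cong refl \<tau>_sets)

lemma MP_jump: "p \<in> K ==> (%w. snd w p) \<in> MP ->M unit_jumps"
 unfolding m_cong_sets[OF MP_sets refl]
 by (rule m_comp[OF measurable_snd m_proj])

lemma MP_fst: "fst \<in> MP ->M lf"
 unfolding m_cong_sets[OF MP_sets refl] by simp

lemma ptsJ_measurable: "(%w. ptsJ (fst w) (snd w)) \<in> MP ->M lf"
 unfolding ptsJ_def
proof (rule measurable_add_pts[OF MP_fst, where J=K])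
 fix p assume p: "p \<in> K"
 show "(%w. (snd w p, p)) \<in> MP ->M EE"
  by (rule measurable_Pair[OF MP_jump[OF p] measurable_const[OF K_space[OF p]]])
qed auto

text \<open>The density in \<open>Kern\<close> splits into one for the jumps and one for the
  configuration, so the underlying law is a product measure. Keeping the coordinates at first
  occurrences turns the jumps on \<open>{..<n}\<close> into independent jumps on \<open>K\<close>;
  the dummies disappear because \<open>idx\<close> is injective.\<close>

theorem Kern_eq:
 assumes W: "W \<in> lf ->M V"
 shows "Kern V W d = distr MP V (%w. W (ptsJ (fst w) (snd w)))"
proof -
 let ?S = "\<Pi>\<^sub>M i\<in>{..<n}. \<tau>0 i" and ?R = "%u. \<lambda>p\<in>K. u (idx p)"
 have S: "prob_space ?S" by (rule prob_space_PiM) (rule \<tau>0_prob, simp)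
 interpret S: prob_space ?S by (rule S)
 interpret Q: prob_space Q by (rule Q_prob)
 interpret SQ: pair_prob_space ?S Q ..
 interpret QS: pair_prob_space Q ?S ..
 have Z: "(\<Prod>i<n. z i) \<noteq> 0" using z_bounds(1) by (auto simp: zero_less_iff_neq_zero)
 have "(\<Prod>i<n. z i) \<le> 1" using z_bounds(2) by (intro prod_le_1) auto
 then have Z': "(\<Prod>i<n. z i) < top" using ennreal_one_less_top le_less_trans by blast
 have dens: "density (SG n d \<Otimes>\<^sub>M P) (%(u, N). jw d u * lik N d / F1 d) = ?S \<Otimes>\<^sub>M Q"
 proof -
  have "jw d u * lik N d / F1 d = (jw d u / (\<Prod>i<n. z i)) * (lik N d / c)" for u N
  proof -
   have "inverse (F1 d) = inverse (\<Prod>i<n. z i) * inverse c"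
    unfolding F1_eq using Z Z' c_bounds by (intro ennreal_inverse_mult) auto
   then show ?thesis by (simp add: divide_ennreal_def ac_simps)
  qed
  then have "density (SG n d \<Otimes>\<^sub>M P) (%(u, N). jw d u * lik N d / F1 d) =
    density (SG n d \<Otimes>\<^sub>M P) (%(u, N). (jw d u / (\<Prod>i<n. z i)) * (lik N d / c))" by simp
  also have "\<dots> = density (SG n d) (%u. jw d u / (\<Prod>i<n. z i)) \<Otimes>\<^sub>M density P (%N. lik N d / c)"
  proof (rule pair_measure_density[symmetric])
   show "(%u. jw d u / (\<Prod>i<n. z i)) \<in> bm (SG n d)"
    unfolding m_cong_sets[OF SG_sets[OF d] refl]
    by (intro bm_div jw_measurable[OF measurable_const[OF d] m_id]) simp
   show "(%N. lik N d / c) \<in> bm P" by (intro bm_div lik_meas) simp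
   show "sigma_finite_measure (density P (%N. lik N d / c))" using prob_space_imp_sigma_finite[OF Q_prob] by (simp add: Q_def)
  qed (rule P.sigma_finite_measure_axioms)
  finally show ?thesis unfolding SG_density Q_def .
 qed
 have Rm: "?R \<in> ?S ->M (\<Pi>\<^sub>M p\<in>K. \<tau> p)"
  by (rule measurable_restrict, unfold \<tau>_def, rule m_proj) (simp add: idx(4))
 have R: "distr ?S (\<Pi>\<^sub>M p\<in>K. \<tau> p) ?R = (\<Pi>\<^sub>M p\<in>K. \<tau> p)"
  unfolding \<tau>_def
 proof (rule distr_PiM_reindex)
  show "inj_on idx K" by (rule inj_on_inverseI[where g=d]) (rule idx(2))
  show "idx \<in> K \<rightarrow> {..<n}" using idx(4) by auto
 qed (rule \<tau>0_prob, simp)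
 have T: "(%(u, N). (N, ?R u)) \<in> ?S \<Otimes>\<^sub>M Q ->M Q \<Otimes>\<^sub>M (\<Pi>\<^sub>M p\<in>K. \<tau> p)"
  unfolding split_beta' by (intro measurable_Pair measurable_snd m_comp[OF measurable_fst Rm])
 have MP: "MP = distr (?S \<Otimes>\<^sub>M Q) (Q \<Otimes>\<^sub>M (\<Pi>\<^sub>M p\<in>K. \<tau> p)) (%(u, N). (N, ?R u))"
 proof -
  have "MP = distr Q Q (%N. N) \<Otimes>\<^sub>M distr ?S (\<Pi>\<^sub>M p\<in>K. \<tau> p) ?R" unfolding MP_def R by simp
  also have "\<dots> = distr (Q \<Otimes>\<^sub>M ?S) (Q \<Otimes>\<^sub>M (\<Pi>\<^sub>M p\<in>K. \<tau> p)) (%(N, u). (N, ?R u))"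
   by (rule pair_measure_distr[OF m_id Rm]) (simp add: R prob_space_imp_sigma_finite J_prob)
  also have "Q \<Otimes>\<^sub>M ?S = distr (?S \<Otimes>\<^sub>M Q) (Q \<Otimes>\<^sub>M ?S) (%(x, y). (y, x))" by (rule QS.distr_pair_swap)
  also have "distr (distr (?S \<Otimes>\<^sub>M Q) (Q \<Otimes>\<^sub>M ?S) (%(x, y). (y, x))) (Q \<Otimes>\<^sub>M (\<Pi>\<^sub>M p\<in>K. \<tau> p)) (%(N, u). (N, ?R u)) =
    distr (?S \<Otimes>\<^sub>M Q) (Q \<Otimes>\<^sub>M (\<Pi>\<^sub>M p\<in>K. \<tau> p)) (%(u, N). (N, ?R u))"
  proof (subst distr_distr)
   show "(%(N, u). (N, ?R u)) \<in> Q \<Otimes>\<^sub>M ?S ->M Q \<Otimes>\<^sub>M (\<Pi>\<^sub>M p\<in>K. \<tau> p)"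
    unfolding split_beta' by (intro measurable_Pair measurable_fst m_comp[OF measurable_snd Rm])
   show "(%(x, y). (y, x)) \<in> ?S \<Otimes>\<^sub>M Q ->M Q \<Otimes>\<^sub>M ?S" by (rule measurable_pair_swap')
   show "distr (?S \<Otimes>\<^sub>M Q) (Q \<Otimes>\<^sub>M (\<Pi>\<^sub>M p\<in>K. \<tau> p)) ((%(N, u). (N, ?R u)) \<circ> (%(x, y). (y, x))) =
    distr (?S \<Otimes>\<^sub>M Q) (Q \<Otimes>\<^sub>M (\<Pi>\<^sub>M p\<in>K. \<tau> p)) (%(u, N). (N, ?R u))"
    by (intro distr_cong refl) auto
  qed
  finally show ?thesis .
 qed
 have pts: "ptsN N n d u = ptsJ N (?R u)" for N u
  unfolding ptsN_def ptsJ_def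
 proof (rule measure_eqI)
  fix B assume "B \<in> sets (add_pts N (Fst d n) (%i. (u i, d i)))"
  then have B: "B \<in> sets N" by simp
  have "(\<Sum>i\<in>Fst d n. ind1 B (u i, d i) :: ennreal) = (\<Sum>p\<in>K. ind1 B (?R u p, p))"
   by (rule sum.reindex_bij_betw[OF bij_betw_Fst, of "%p. ind1 B (?R u p, p)", THEN subst, rotated]) (auto intro!: sum.cong simp: idx Fst_def)
  then show "emeasure (add_pts N (Fst d n) (%i. (u i, d i))) B = emeasure (add_pts N K (%p. (?R u p, p))) B"
   using B by (simp add: emeasure_add_pts)
 qed simp
 have Wm: "(%w. W (ptsJ (fst w) (snd w))) \<in> MP ->M V" by (rule m_comp[OF ptsJ_measurable W])
 have "distr MP V (%w. W (ptsJ (fst w) (snd w))) =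
   distr (distr (?S \<Otimes>\<^sub>M Q) MP (%(u, N). (N, ?R u))) V (%w. W (ptsJ (fst w) (snd w)))"
  using MP by (metis MP_def)
 also have "\<dots> = distr (?S \<Otimes>\<^sub>M Q) V ((%w. W (ptsJ (fst w) (snd w))) \<circ> (%(u, N). (N, ?R u)))"
  by (rule distr_distr[OF Wm]) (use T in \<open>simp add: MP_def\<close>)
 also have "\<dots> = Kern V W d"
  unfolding Kern_def if_not_P[OF F1] dens by (intro distr_cong refl) (auto simp: pts)
 finally show ?thesis ..
qed

lemma MP_poisson: "poisson_and_jumps MP EE (intensity \<rho>' \<eta>) n d \<rho>' fst (%p w. snd w p)"
 unfolding MP_def by (rule poisson_and_jumps_product[OF Q_prob Q_poisson \<tau>_prob \<tau>_eq \<tau>_sets])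

end

section \<open>Fixed atoms added to a random configuration\<close>

lemma sets_add_atoms [simp]: "sets (add_atoms \<mu> P w) = sets base"
 unfolding add_atoms_def by (rule sets.sets_measure_of_eq)

lemma emeasure_add_atoms:
 fixes \<mu> :: "(real \<times> 'x::polish_space) measure"
 assumes \<mu>: "sets \<mu> = sets base" and B: "B \<in> sets base"
 shows "emeasure (add_atoms \<mu> P w) B = emeasure \<mu> B + (\<Sum>p\<in>P. w p * ind1 B p)"
 using add_atoms_def
proof (rule emeasure_measure_of)
 show "countably_additive (sets (add_atoms \<mu> P w)) (%B. emeasure \<mu> B + (\<Sum>p\<in>P. w p * ind1 B p))"
  unfolding countably_additive_def
 proof safe
  fix F :: "nat => (real \<times> 'x) set" assume F: "range F \<subseteq> sets (add_atoms \<mu> P w)" "disjoint_family F"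
  have "(\<Sum>i. emeasure \<mu> (F i) + (\<Sum>p\<in>P. w p * ind1 (F i) p)) =
    (\<Sum>i. emeasure \<mu> (F i)) + (\<Sum>i. \<Sum>p\<in>P. w p * ind1 (F i) p)"
   by (rule suminf_add[symmetric]) auto
  also have "(\<Sum>i. emeasure \<mu> (F i)) = emeasure \<mu> (\<Union>i. F i)"
   using F by (intro suminf_emeasure) (auto simp: \<mu>)
  also have "(\<Sum>i. \<Sum>p\<in>P. w p * ind1 (F i) p) = (\<Sum>p\<in>P. \<Sum>i. w p * ind1 (F i) p)"
   by (rule suminf_sum) auto
  also have "\<dots> = (\<Sum>p\<in>P. w p * ind1 (\<Union>i. F i) p)"
   by (simp add: suminf_indicator[OF F(2)])
  finally show "(\<Sum>i. emeasure \<mu> (F i) + (\<Sum>p\<in>P. w p * ind1 (F i) p)) =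
    emeasure \<mu> (\<Union>i. F i) + (\<Sum>p\<in>P. w p * ind1 (\<Union>i. F i) p)" .
 qed
 show "sets base \<subseteq> Pow (space (base :: (real \<times> 'x) measure))" by (rule sets.space_closed)
qed (use B in \<open>simp_all add: positive_def\<close>)

lemma jump_integral_add_pts:
 fixes N :: "('j \<times> real \<times> 'x::polish_space) measure"
 assumes N: "sets N = sets (J \<Otimes>\<^sub>M base)" and \<phi>: "\<phi> \<in> bm J"
  and z: "!!p. p \<in> K ==> (j p, p) \<in> space (J \<Otimes>\<^sub>M base)"
 shows "jump_integral \<phi> (add_pts N K (%p. (j p, p))) = add_atoms (jump_integral \<phi> N) K (%p. \<phi> (j p))"
proof (rule measure_eqI)
 fix B assume "B \<in> sets (jump_integral \<phi> (add_pts N K (%p. (j p, p))))"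
 then have B: "B \<in> sets base" by (simp add: jump_integral_def)
 have m: "(%z. \<phi> (fst z) * ind1 B (snd z)) \<in> bm N"
  unfolding m_cong_sets[OF N refl]
  by (intro bm_times m_comp[OF measurable_fst \<phi>] m_comp[OF measurable_snd bm_ind[OF B]])
 have "emeasure (jump_integral \<phi> (add_pts N K (%p. (j p, p)))) B = (NN z. \<phi> (fst z) * ind1 B (snd z) \<partial>add_pts N K (%p. (j p, p)))"
  by (rule emeasure_jump_integral[OF _ \<phi> B]) (simp add: N)
 also have "\<dots> = (NN z. \<phi> (fst z) * ind1 B (snd z) \<partial>N) + (\<Sum>p\<in>K. \<phi> (j p) * ind1 B p)"
  using z by (subst nn_integral_add_pts[OF m]) (simp_all add: space_eq[OF N])
 also have "\<dots> = emeasure (add_atoms (jump_integral \<phi> N) K (%p. \<phi> (j p))) B"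
  by (simp add: emeasure_add_atoms[OF sets_jump_integral B] emeasure_jump_integral[OF N \<phi> B])
 finally show "emeasure (jump_integral \<phi> (add_pts N K (%p. (j p, p)))) B = emeasure (add_atoms (jump_integral \<phi> N) K (%p. \<phi> (j p))) B" .
qed (simp add: jump_integral_def)

text \<open>\<open>new\<close> keeps the fixed atoms off the times of \<open>Z\<close>, and
  injectivity of \<open>fst\<close> on \<open>K\<close> keeps them off each other's times, so
  simplicity is preserved.\<close>

lemma simple_config_add_pts:
 fixes N :: "(real \<times> real \<times> 'x::polish_space) measure" and K :: "(real \<times> 'x) set"
 assumes cfg: "simple_config EE tm N Z" and K: "finite K" "inj_on fst K"
  and z: "!!p. p \<in> K ==> (j p, p) \<in> space EE" and new: "!!p. p \<in> K ==> emeasure N {z \<in> space EE. tm z = fst p} = 0"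
 shows "simple_config EE tm (add_pts N K (%p. (j p, p))) (Z \<union> (%p. (j p, p)) ` K)"
proof -
 let ?z = "%p. (j p, p)"
 have Z: "countable Z" "Z \<subseteq> space EE" "inj_on tm Z" using cfg by (auto simp: simple_config_def)
 have sN: "sets N = sets EE" by (rule simple_config_sets[OF cfg])
 have ne: "tm y \<noteq> fst p" if "y \<in> Z" "p \<in> K" for y p
 proof
  assume eq: "tm y = fst p"
  have y: "y \<in> space EE" using Z that by auto
  have F: "{z \<in> space (EE :: ('x mark) measure). tm z = fst p} \<in> sets EE"
   using measurable_sets[OF measurable_tm, of "{fst p}"] by (simp add: vimage_def Int_def conj_commute)
  have "{y} \<in> sets EE" by (rule singleton_EE[OF y])
  then have "emeasure N {y} = 1" using emeasure_simple_config[OF cfg, of "{y}"] that by (simp add: emeasure_count_space)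
  moreover have "emeasure N {y} \<le> emeasure N {z \<in> space EE. tm z = fst p}"
   using y eq F sN by (intro emeasure_mono) auto
  ultimately show False using new[OF that(2)] by simp
 qed
 have "Z \<inter> ?z ` K = {}" using ne by force
 have inj: "inj_on ?z K" by (auto simp: inj_on_def)
 show ?thesis
  unfolding simple_config_def
 proof (intro conjI)
  show "countable (Z \<union> ?z ` K)" using Z K by (auto intro: countable_finite)
  show sub: "Z \<union> ?z ` K \<subseteq> space EE" using Z z by auto
  show "inj_on tm (Z \<union> ?z ` K)"
  proof (rule inj_onI)
   fix a b assume ab: "a \<in> Z \<union> ?z ` K" "b \<in> Z \<union> ?z ` K" "tm a = tm b"
   consider "a \<in> Z" "b \<in> Z" | "a \<in> ?z ` K" "b \<in> ?z ` K" | "a \<in> Z" "b \<in> ?z ` K" | "a \<in> ?z ` K" "b \<in> Z"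
    using ab by blast
   then show "a = b"
   proof cases
    case 1 then show ?thesis using Z(3) ab(3) by (auto dest: inj_onD)
   next
    case 2 then show ?thesis using K(2) ab(3) by (auto dest: inj_onD)
   next
    case 3 then show ?thesis using ne ab(3) by fastforce
   next
    case 4 then show ?thesis using ne ab(3) by fastforce
   qed
  qed
  show "add_pts N K ?z = distr (count_space (Z \<union> ?z ` K)) EE (%z. z)"
  proof (rule measure_eqI)
   show "sets (add_pts N K ?z) = sets (distr (count_space (Z \<union> ?z ` K)) EE (%z. z))" by (simp add: sN)
   fix B assume "B \<in> sets (add_pts N K ?z)"
   then have B: "B \<in> sets EE" "B \<in> sets N" by (simp_all add: sN)
   have "emeasure (add_pts N K ?z) B = emeasure (count_space UNIV) (B \<inter> Z) + (\<Sum>p\<in>K. ind1 B (?z p))"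
    by (simp add: emeasure_add_pts[OF B(2)] emeasure_simple_config[OF cfg B(1)])
   also have "(\<Sum>p\<in>K. ind1 B (?z p)) = (\<Sum>y\<in>?z ` K. ind1 B y :: ennreal)"
    by (simp add: sum.reindex[OF inj])
   also have "\<dots> = of_nat (card (B \<inter> ?z ` K))"
    using K by (simp add: sum_indicator_eq_card Int_commute sum.If_cases indicator_def)
   also have "\<dots> = emeasure (count_space UNIV) (B \<inter> ?z ` K)" using K by (simp add: emeasure_count_space)
   also have "emeasure (count_space UNIV) (B \<inter> Z) + \<dots> = emeasure (count_space UNIV) (B \<inter> Z \<union> B \<inter> ?z ` K)"
    using \<open>Z \<inter> ?z ` K = {}\<close> by (intro plus_emeasure) auto
   also have "B \<inter> Z \<union> B \<inter> ?z ` K = B \<inter> (Z \<union> ?z ` K)" by blast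
   also have "emeasure (count_space UNIV) \<dots> = emeasure (distr (count_space (Z \<union> ?z ` K)) EE (%z. z)) B"
    using sub B by (subst emeasure_distr) (auto simp: measurable_def emeasure_count_space)
   finally show "emeasure (add_pts N K ?z) B = emeasure (distr (count_space (Z \<union> ?z ` K)) EE (%z. z)) B" .
  qed
 qed
qed

text \<open>Further properties of almost all data. \<open>times\<close> keeps the augmented
  configuration simple, as \<open>ntr\<close> needs; \<open>hazd\<close> makes the strip identity
  exact at the fixed atoms.\<close>

locale crm_posterior_ae = crm_posterior \<rho> \<eta> D P n m C d
 for \<rho> and \<eta> :: "(real \<times> 'x::polish_space) measure" and D P n m C d +
 assumes times: "!!i j. i < n ==> j < n ==> fst (d i) = fst (d j) ==> d i = d j"
  and hazd: "!!i. i < n ==> emeasure A ({0<..fst (d i)} \<times> UNIV) < \<infinity>"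

context crm_posterior
begin

lemma MP_space: "w \<in> space MP ==> fst w \<in> space lf" "w \<in> space MP ==> p \<in> K ==> snd w p \<in> {0<..1}"
 using measurable_space[OF MP_fst] measurable_space[OF MP_jump, of p w] by auto

lemma ptsJ_space: "w \<in> space MP ==> p \<in> K ==> (snd w p, p) \<in> space EE"
 using MP_space(2) K_space by (auto simp: space_pair_measure)

lemma jump_integral_ptsJ:
 assumes "w \<in> space MP" "\<phi> \<in> bm unit_jumps"
 shows "jump_integral \<phi> (ptsJ (fst w) (snd w)) = add_atoms (jump_integral \<phi> (fst w)) K (%p. \<phi> (snd w p))"
 unfolding ptsJ_def
 by (rule jump_integral_add_pts[OF sets_lfD[OF MP_space(1)[OF assms(1)]] assms(2) ptsJ_space[OF assms(1)]])

lemma posterior_hazard_eq: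
 "w \<in> space MP ==> posterior_hazard n d fst (%p w. snd w p) w = crm (ptsJ (fst w) (snd w))"
 unfolding posterior_hazard_def crm_def by (simp add: jump_integral_ptsJ ennreal_unit_jumps)

lemma posterior_crm:
 shows "posterior_hazard n d fst (%p w. snd w p) \<in> MP ->M MA base"
  and "Kern (MA base) crm d = distr MP (MA base) (posterior_hazard n d fst (%p w. snd w p))"
proof -
 show "posterior_hazard n d fst (%p w. snd w p) \<in> MP ->M MA base"
  using m_comp[OF ptsJ_measurable crm_measurable] by (simp add: posterior_hazard_eq cong: measurable_cong)
 show "Kern (MA base) crm d = distr MP (MA base) (posterior_hazard n d fst (%p w. snd w p))"
  unfolding Kern_eq[OF crm_measurable] by (intro distr_cong refl) (simp add: posterior_hazard_eq)
qed

abbreviation LL :: "(ennreal \<times> real \<times> 'x) measure" where "LL \<equiv> levy_jumps \<Otimes>\<^sub>M base"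
abbreviation lv :: "real \<times> real \<times> 'x => ennreal \<times> real \<times> 'x" where "lv \<equiv> %(u, p). (neg_log_compl (ennreal u), p)"

text \<open>The Poisson configuration behind \<open>Z\<close> has marks \<open>- log (1 - u)\<close>
  in place of \<open>u\<close>. It is a random measure in its own right, so the law \<open>Q\<close>
  is pushed forward point by point.\<close>

definition QL :: "(ennreal \<times> real \<times> 'x) measure measure" where
 "QL = distr Q (MA LL) (%N. distr N LL lv)"

definition MPL :: "((ennreal \<times> real \<times> 'x) measure \<times> (real \<times> 'x => real)) measure" where
 "MPL = QL \<Otimes>\<^sub>M (\<Pi>\<^sub>M p\<in>K. \<tau> p)"

lemma nlc_levy: "(%u. neg_log_compl (ennreal u)) \<in> unit_jumps ->M levy_jumps"
 unfolding levy_jumps_def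
 by (rule measurable_restrict_space2[OF _ nlc_unit_jumps]) (auto intro!: neg_log_compl_pos)

lemma lv_measurable: "lv \<in> EE ->M LL"
 unfolding split_beta' by (rule measurable_Pair[OF m_comp[OF measurable_fst nlc_levy] measurable_snd])

lemma Q_measurable: "(%N. N) \<in> Q ->M MA EE"
 using Q_poisson by (simp add: poisson_random_measure_def)

lemma QL_map: "(%N. distr N LL lv) \<in> Q ->M MA LL"
 by (rule m_comp[OF Q_measurable measurable_distr_measure_algebra[OF lv_measurable]])

lemma QL_prob: "prob_space QL"
 unfolding QL_def by (rule prob_space.prob_space_distr[OF Q_prob QL_map])

lemma QL_poisson: "poisson_random_measure QL LL (levy_intensity \<rho>' \<eta>) (%N. N)"
proof -
 have s: "sets (intensity \<rho>' \<eta>) = sets EE" by (rule sets_intensity[OF tilted_kernel[OF Y] \<eta> tilted_finite[OF Y]])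
 have "poisson_random_measure Q LL (distr (intensity \<rho>' \<eta>) LL lv) (%N. distr N LL lv)"
  by (rule poisson_random_measure_map[OF Q_prob Q_poisson lv_measurable s])
 then show ?thesis
  unfolding QL_def levy_intensity_def
  by (subst poisson_random_measure_distr_iff[OF Q_prob QL_map]) (auto intro: measurable_ident_sets)
qed

lemma MPL_poisson: "poisson_and_jumps MPL LL (levy_intensity \<rho>' \<eta>) n d \<rho>' fst (%p w. snd w p)"
 unfolding MPL_def by (rule poisson_and_jumps_product[OF QL_prob QL_poisson \<tau>_prob \<tau>_eq \<tau>_sets])

lemma levy_ident: "(%z. z) \<in> bm levy_jumps"
 unfolding levy_jumps_def by (rule measurable_restrict_space1) simp

lemma MPL_sets: "sets MPL = sets (MA LL \<Otimes>\<^sub>M (\<Pi>\<^sub>M p\<in>K. unit_jumps))"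
 unfolding MPL_def QL_def by (intro sets_pair_measure_cong sets_PiM_cong refl \<tau>_sets) simp

lemma posterior_levy_measurable: "posterior_levy n d fst (%p w. snd w p) \<in> MPL ->M MA base"
proof (rule measurable_measure_algebraI)
 fix B assume B: "B \<in> sets (base :: (real \<times> 'x) measure)"
 have f: "fst \<in> MPL ->M MA LL" unfolding m_cong_sets[OF MPL_sets refl] by simp
 have j: "(%w. snd w p) \<in> MPL ->M unit_jumps" if "p \<in> K" for p
  unfolding m_cong_sets[OF MPL_sets refl]
  by (rule m_comp[OF measurable_snd m_proj[OF that]])
 have m: "(%z. fst z * ind1 B (snd z)) \<in> bm LL"
  by (intro bm_times m_comp[OF measurable_fst levy_ident] m_comp[OF measurable_snd bm_ind[OF B]])
 have "emeasure (posterior_levy n d fst (%p w. snd w p) w) B =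
   (NN z. fst z * ind1 B (snd z) \<partial>fst w) + (\<Sum>p\<in>K. neg_log_compl (ennreal (snd w p)) * ind1 B p)"
  if "w \<in> space MPL" for w
 proof -
  have s: "sets (fst w) = sets LL" using measurable_space[OF f that] by (simp add: space_measure_algebra)
  show ?thesis
   unfolding posterior_levy_def
   by (simp add: emeasure_add_atoms[OF sets_jump_integral B] emeasure_jump_integral[OF s levy_ident B])
 qed
 moreover have "(%w. (NN z. fst z * ind1 B (snd z) \<partial>fst w) + (\<Sum>p\<in>K. neg_log_compl (ennreal (snd w p)) * ind1 B p)) \<in> bm MPL"
  by (intro borel_measurable_add borel_measurable_sum bm_times measurable_const
    m_comp[OF f nn_integral_measurable_measure_algebra[OF m]] m_comp[OF j nlc_unit_jumps]) simp_all
 ultimately show "(%w. emeasure (posterior_levy n d fst (%p w. snd w p) w) B) \<in> bm MPL"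
  by (subst measurable_cong)
qed (simp add: posterior_levy_def)

text \<open>Integrating the mark against the image configuration is integrating
  \<open>- log (1 - u)\<close> against \<open>N\<close>. The two constructions therefore agree at
  every sample point, and \<open>MPL\<close> is the image of \<open>MP\<close>.\<close>

lemma Kern_levy: "Kern (MA base) levyN d = distr MPL (MA base) (posterior_levy n d fst (%p w. snd w p))"
proof -
 let ?J = "\<Pi>\<^sub>M p\<in>K. \<tau> p" and ?G = "%N. distr N LL lv"
 have "(%x. (?G (fst x), snd x)) \<in> MP ->M MA LL \<Otimes>\<^sub>M ?J"
  unfolding MP_def by (rule measurable_Pair[OF m_comp[OF measurable_fst QL_map] measurable_snd])
 then have T: "(%(N, J). (?G N, J)) \<in> MP ->M MA LL \<Otimes>\<^sub>M ?J"
  by (simp only: split_beta')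
 have "MPL = distr Q (MA LL) ?G \<Otimes>\<^sub>M distr ?J ?J (%J. J)" unfolding MPL_def QL_def by simp
 also have "\<dots> = distr (Q \<Otimes>\<^sub>M ?J) (MA LL \<Otimes>\<^sub>M ?J) (%(N, J). (?G N, J))"
  by (rule pair_measure_distr[OF QL_map m_id]) (simp add: prob_space_imp_sigma_finite J_prob)
 finally have MPL: "MPL = distr MP (MA LL \<Otimes>\<^sub>M ?J) (%(N, J). (?G N, J))" unfolding MP_def .
 have eq: "posterior_levy n d fst (%p w. snd w p) (case w of (N, J) => (?G N, J)) = levyN (ptsJ (fst w) (snd w))"
  if w: "w \<in> space MP" for w
 proof -
  have N: "sets (fst w) = sets EE" by (rule sets_lfD[OF MP_space(1)[OF w]])
  have "jump_integral (%z. z) (?G (fst w)) = jump_integral (%u. neg_log_compl (ennreal u)) (fst w)"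
  proof (rule measure_eqI)
   fix B assume "B \<in> sets (jump_integral (%z. z) (?G (fst w)))"
   then have B: "B \<in> sets base" by (simp add: jump_integral_def)
   have m: "(%z. fst z * ind1 B (snd z)) \<in> bm LL"
    by (intro bm_times m_comp[OF measurable_fst levy_ident] m_comp[OF measurable_snd bm_ind[OF B]])
   have l: "lv \<in> fst w ->M LL" unfolding m_cong_sets[OF N refl] by (rule lv_measurable)
   have "emeasure (jump_integral (%z. z) (?G (fst w))) B = (NN z. fst z * ind1 B (snd z) \<partial>?G (fst w))"
    by (rule emeasure_jump_integral[OF _ levy_ident B]) simp
   also have "\<dots> = (NN z. fst (lv z) * ind1 B (snd (lv z)) \<partial>fst w)"
    using m by (intro nn_integral_distr[OF l]) simp
   also have "\<dots> = (NN z. neg_log_compl (ennreal (fst z)) * ind1 B (snd z) \<partial>fst w)" by (simp add: split_beta')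
   also have "\<dots> = emeasure (jump_integral (%u. neg_log_compl (ennreal u)) (fst w)) B"
    by (rule emeasure_jump_integral[OF N nlc_unit_jumps B, symmetric])
   finally show "emeasure (jump_integral (%z. z) (?G (fst w))) B = emeasure (jump_integral (%u. neg_log_compl (ennreal u)) (fst w)) B" .
  qed (simp add: jump_integral_def)
  then show ?thesis
   unfolding levyN_def jump_integral_ptsJ[OF w nlc_unit_jumps] by (simp add: posterior_levy_def split_beta')
 qed
 have "distr MPL (MA base) (posterior_levy n d fst (%p w. snd w p)) =
   distr MP (MA base) (posterior_levy n d fst (%p w. snd w p) \<circ> (%(N, J). (?G N, J)))"
 proof -
  have "posterior_levy n d fst (%p w. snd w p) \<in> MA LL \<Otimes>\<^sub>M ?J ->M MA base"
   using posterior_levy_measurable unfolding MPL by simp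
  from distr_distr[OF this T] show ?thesis unfolding MPL .
 qed
 also have "\<dots> = Kern (MA base) levyN d"
  unfolding Kern_eq[OF levyN_measurable] by (intro distr_cong refl) (simp add: eq)
 finally show ?thesis ..
qed

end

context crm_posterior_ae
begin

lemma inj_times: "inj_on fst K"
 using times by (auto simp: inj_on_def)

lemma AE_Q_config:
 "AE N in Q. (\<exists>Z. simple_config EE tm N Z) \<and> (\<forall>p\<in>K. emeasure N {z \<in> space EE. tm z = fst p} = 0)"
proof (rule AE_Q)
 have "AE N in P. \<forall>p\<in>K. emeasure N {z \<in> space EE. tm z = fst p} = 0"
  by (rule AE_finite_allI) (use d_pos in \<open>auto intro!: AE_no_time\<close>)
 then show "AE N in P. (\<exists>Z. simple_config EE tm N Z) \<and> (\<forall>p\<in>K. emeasure N {z \<in> space EE. tm z = fst p} = 0)"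
  using AE_simple_config by eventually_elim blast
qed

lemma AE_MP: "AE N in Q. R N ==> AE w in MP. R (fst w)"
proof -
 assume R: "AE N in Q. R N"
 have eq: "distr MP Q fst = Q" unfolding MP_def
  using prob_space.distr_pair_fst[OF J_prob] by simp
 have f: "fst \<in> MP ->M Q" unfolding MP_def by simp
 have "AE N in distr MP Q fst. R N" unfolding eq by (rule R)
 from AE_distrD[OF f this] show ?thesis .
qed

lemma AE_MP_config: "AE w in MP. \<exists>Z. simple_config EE tm (ptsJ (fst w) (snd w)) Z"
 using AE_MP[OF AE_Q_config] AE_space
proof eventually_elim
 fix w assume *: "(\<exists>Z. simple_config EE tm (fst w) Z) \<and> (\<forall>p\<in>K. emeasure (fst w) {z \<in> space EE. tm z = fst p} = 0)"
  and w: "w \<in> space MP"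
 then obtain Z where Z: "simple_config EE tm (fst w) Z" by blast
 have "simple_config EE tm (ptsJ (fst w) (snd w)) (Z \<union> (%p. (snd w p, p)) ` K)"
  unfolding ptsJ_def by (rule simple_config_add_pts[OF Z _ inj_times ptsJ_space[OF w]]) (use * in auto)
 then show "\<exists>Z. simple_config EE tm (ptsJ (fst w) (snd w)) Z" by blast
qed

lemma posterior_ntr:
 shows "(%w. ntr (posterior_hazard n d fst (%p w. snd w p) w)) \<in> completion MP ->M MA base"
  and "Kern (MA base) ntrN d =
   distr (completion MP) (MA base) (%w. ntr (posterior_hazard n d fst (%p w. snd w p) w))"
proof -
 have m: "(%w. ntrN (ptsJ (fst w) (snd w))) \<in> MP ->M MA base"
  by (rule m_comp[OF ptsJ_measurable ntrN_measurable])
 have ae: "AE w in MP. ntrN (ptsJ (fst w) (snd w)) = ntr (posterior_hazard n d fst (%p w. snd w p) w)"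
  using AE_MP_config AE_space
 proof eventually_elim
  fix w assume "\<exists>Z. simple_config EE tm (ptsJ (fst w) (snd w)) Z" and w: "w \<in> space MP"
  then obtain Z where "simple_config EE tm (ptsJ (fst w) (snd w)) Z" by blast
  from ntr_config[OF measurable_space[OF ptsJ_measurable w] this]
  show "ntrN (ptsJ (fst w) (snd w)) = ntr (posterior_hazard n d fst (%p w. snd w p) w)"
   unfolding posterior_hazard_eq[OF w] ..
 qed
 have s: "ntr (posterior_hazard n d fst (%p w. snd w p) w) \<in> space (MA base)" for w :: "('x mark) measure \<times> (real \<times> 'x => real)"
  by (simp add: space_measure_algebra ntr_def posterior_hazard_def)
 note * = completion_cong_AE[OF m ae s]
 show "(%w. ntr (posterior_hazard n d fst (%p w. snd w p) w)) \<in> completion MP ->M MA base" by (rule *(1))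
 show "Kern (MA base) ntrN d =
   distr (completion MP) (MA base) (%w. ntr (posterior_hazard n d fst (%p w. snd w p) w))"
  unfolding Kern_eq[OF ntrN_measurable] *(2) ..
qed

end

text \<open>\<open>Jd\<close> never sees sequences outside a property that a fresh draw from
  \<open>A\<close> preserves almost surely and a repetition preserves always. This serves as an
  almost everywhere argument for a measure that is present only as a functional.\<close>

lemma Jd_cong_invariant:
 assumes sA: "space A = space B" and Q0: "Q 0 (%_. undefined)"
  and Q1: "!!k d. d \<in> space (\<Pi>\<^sub>M i\<in>{..<k}. B) ==> Q k d ==> AE p in A. Q (Suc k) (d(k := p))"
  and Q2: "!!k d q. d \<in> space (\<Pi>\<^sub>M i\<in>{..<k}. B) ==> Q k d ==> q \<in> d ` {..<k} ==> Q (Suc k) (d(k := q))"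
  and "!!d. d \<in> space (\<Pi>\<^sub>M i\<in>{..<n}. B) ==> Q n d ==> h d = h' d"
 shows "Jd A n h = Jd A n h'"
 using assms(5)
proof (induction n arbitrary: h h')
 case 0
 then show ?case using Q0 by (simp add: space_PiM)
next
 case (Suc n)
 show ?case
  unfolding Jd.simps
 proof (rule Suc.IH)
  fix d assume d: "d \<in> space (\<Pi>\<^sub>M i\<in>{..<n}. B)" and Q: "Q n d"
  have "(NN p. h (d(n := p)) \<partial>A) = (NN p. h' (d(n := p)) \<partial>A)"
  proof (rule nn_integral_cong_AE)
   show "AE p in A. h (d(n := p)) = h' (d(n := p))"
    using Q1[OF d Q] AE_space
   proof eventually_elim
    fix p assume "Q (Suc n) (d(n := p))" "p \<in> space A"
    then show "h (d(n := p)) = h' (d(n := p))" unfolding sA by (intro Suc.prems[of "d(n := p)"] PiM_upd_space[OF d])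
   qed
  qed
  moreover have "h (d(n := q)) = h' (d(n := q))" if "q \<in> d ` {..<n}" for q
  proof (rule Suc.prems[of "d(n := q)"])
   show "d(n := q) \<in> space (\<Pi>\<^sub>M i\<in>{..<Suc n}. B)"
    using that d by (intro PiM_upd_space[OF d]) (auto simp: space_PiM PiE_iff)
   show "Q (Suc n) (d(n := q))" by (rule Q2[OF d Q that])
  qed
  ultimately show "(NN p. h (d(n := p)) \<partial>A) + (\<Sum>q\<in>d ` {..<n}. h (d(n := q))) =
    (NN p. h' (d(n := p)) \<partial>A) + (\<Sum>q\<in>d ` {..<n}. h' (d(n := q)))"
   by (simp cong: sum.cong)
 qed
qed

context crm_data
begin

text \<open>\<open>R\<close> says that the values avoid an exceptional \<open>A\<close>-null set and
  that equal times mean equal values. Both moves in \<open>Jd\<close> preserve it. Data with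
  \<open>F1 d = 0\<close> are null because \<open>F1\<close> appears as the density of the data
  marginal relative to \<open>Jd\<close>.\<close>

theorem AE_data:
 assumes N0: "N0 \<in> M ->M lf" and P_eq: "P = distr M lf N0" and L: "AE w in M. L w = lik_measure (N0 w)"
 shows "AE d in data_marginal M (DD n) L. crm_posterior_ae \<rho> \<eta> D P n m C d"
proof -
 have "AE p in A. (0 < kappa1 \<rho> (fst p) \<and> kappa1 \<rho> (fst p) < \<infinity>) \<and> emeasure A ({0<..fst p} \<times> UNIV) < \<infinity>"
  using A_AE_\<kappa> A_finite by eventually_elim auto
 then obtain B where B: "{p\<in>space A. \<not> ((0 < kappa1 \<rho> (fst p) \<and> kappa1 \<rho> (fst p) < \<infinity>) \<and> emeasure A ({0<..fst p} \<times> UNIV) < \<infinity>)} \<subseteq> B"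
  "emeasure A B = 0" "B \<in> sets A" by (rule AE_E)
 define R where "R k d \<longleftrightarrow> (\<forall>i<k. d i \<notin> B) \<and> (\<forall>i<k. \<forall>j<k. fst (d i) = fst (d j) --> d i = d j)"
  for k and d :: "nat => real \<times> 'x"
 have AB: "AE p in A. p \<notin> B" using B by (intro AE_not_in) auto
 define G where "G d \<longleftrightarrow> R n d \<and> F1 d \<noteq> 0" for d
 have pR: "Measurable.pred (DD n) (R n)"
 proof -
  have c: "(%d. d i) \<in> DD n ->M (base :: (real \<times> 'x) measure)" if "i < n" for i
   by (rule measurable_DD[OF m_id that])
  have 1: "Measurable.pred (DD n) (%d :: nat => real \<times> 'x. d i \<notin> B)" if "i < n" for i
  proof -
   have "Measurable.pred (DD n) (%d :: nat => real \<times> 'x. d i \<in> B)"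
    using measurable_sets[OF c[OF that], of B] B(3) A_sets by (simp add: pred_def vimage_def Int_def conj_commute)
   then show ?thesis by measurable
  qed
  have f: "(%d :: nat => real \<times> 'x. fst (d i)) \<in> bm (DD n)" if "i < n" for i
   by (rule m_comp[OF c[OF that] measurable_fst_base])
  have 2: "Measurable.pred (DD n) (%d :: nat => real \<times> 'x. fst (d i) = fst (d j) --> d i = d j)" if "i < n" "j < n" for i j
  proof -
   have "Measurable.pred (DD n) (%d :: nat => real \<times> 'x. fst (d i) = fst (d j))"
    unfolding pred_def by (rule borel_measurable_eq[OF f[OF that(1)] f[OF that(2)]])
   then show ?thesis using measurable_eq_base[OF c[OF that(1)] c[OF that(2)]] by (rule pred_intros_logic)
  qed
  have "Measurable.pred (DD n) (%d :: nat => real \<times> 'x. (\<forall>i\<in>{..<n}. d i \<notin> B) \<and> (\<forall>i\<in>{..<n}. \<forall>j\<in>{..<n}. fst (d i) = fst (d j) --> d i = d j))"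
  proof (rule pred_intros_logic(3))
   show "Measurable.pred (DD n) (%d :: nat => real \<times> 'x. \<forall>i\<in>{..<n}. d i \<notin> B)"
    by (rule pred_Ball_finite[OF finite_lessThan]) (use 1 in simp)
   show "Measurable.pred (DD n) (%d :: nat => real \<times> 'x. \<forall>i\<in>{..<n}. \<forall>j\<in>{..<n}. fst (d i) = fst (d j) --> d i = d j)"
    by (rule pred_Ball_finite[OF finite_lessThan], rule pred_Ball_finite[OF finite_lessThan]) (use 2 in simp)
  qed
  moreover have "R n = (%d. (\<forall>i\<in>{..<n}. d i \<notin> B) \<and> (\<forall>i\<in>{..<n}. \<forall>j\<in>{..<n}. fst (d i) = fst (d j) --> d i = d j))"
   unfolding R_def[abs_def] by (intro ext) auto
  ultimately show ?thesis by simp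
 qed
 have F1m: "F1 \<in> bm (DD n)" by (rule Fun_measurable) simp
 have pG: "Measurable.pred (DD n) G" 
 proof -
  have "Measurable.pred (DD n) (%d. F1 d \<noteq> 0)" using F1m by measurable
  with pR show ?thesis unfolding G_def[abs_def] by (rule pred_intros_logic(3))
 qed
 let ?h = "%d. if G d then 0 else 1 :: ennreal"
 have hm: "?h \<in> bm (DD n)" 
  by (rule measurable_If) (use pG in \<open>simp_all only: pred_def measurable_const space_borel UNIV_I\<close>)
 have "(NN d. ?h d \<partial>data_marginal M (DD n) L) = Jd A n (%d. ?h d * F1 d)"
  by (rule nn_integral_data_marginal_Jd[OF N0 P_eq L hm])
 also have "\<dots> = Jd A n (%d. 0)"
 proof (rule Jd_cong_invariant[where B="base :: (real \<times> 'x) measure" and Q=R])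
  show "AE p in A. R (Suc k) (d(k := p))" if d: "d \<in> space (DD k)" and R: "R k d" for k d
  proof -
   have "AE p in A. fst p \<noteq> fst (d i)" if "i < k" for i
   proof -
    have s: "0 < fst (d i)" using d that by (auto simp: space_PiM PiE_iff mem_Times_iff)
    have "{fst (d i)} \<times> UNIV \<in> sets (base :: (real \<times> 'x) measure)" using s by (intro restricted_time_sets) auto
    then have "AE p in A. p \<notin> {fst (d i)} \<times> UNIV"
     using A_time_null[OF s] by (intro AE_not_in) (auto simp: null_sets_def A_sets)
    then show ?thesis by eventually_elim (auto simp: mem_Times_iff)
   qed
   then have "AE p in A. \<forall>i\<in>{..<k}. fst p \<noteq> fst (d i)" by (intro AE_finite_allI) auto
   then show ?thesis using AB
   proof eventually_elim
    fix p assume p: "\<forall>i\<in>{..<k}. fst p \<noteq> fst (d i)" "p \<notin> B"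
    have 1: "fst p \<noteq> fst (d i)" if "i < k" for i using p(1) that by blast
    have "fst (d i) \<noteq> fst p" if "i < k" for i using 1[OF that] by (rule not_sym)
    with 1 show "R (Suc k) (d(k := p))" using R p(2) by (auto simp: R_def less_Suc_eq)
   qed
  qed
  show "R (Suc k) (d(k := q))" if "R k d" "q \<in> d ` {..<k}" for k d q
  proof -
   from that(2) obtain i0 where i0: "i0 < k" "q = d i0" by auto
   then show ?thesis using that(1) unfolding R_def less_Suc_eq by auto
  qed
  show "?h d * F1 d = 0" if "R n d" for d using that by (auto simp: G_def)
 qed (auto simp: A_space R_def)
 also have "Jd A n (%d. 0) = 0" for n by (induction n) simp_all
 finally have "(NN d. ?h d \<partial>data_marginal M (DD n) L) = 0" .
 moreover have dm: "sets (data_marginal M (DD n) L) = sets (DD n)"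
  by (simp add: data_marginal_def sets.sigma_sets_eq sets.space_closed)
 ultimately have "AE d in data_marginal M (DD n) L. ?h d = 0"
  using hm by (subst (asm) nn_integral_0_iff_AE) (simp_all cong: m_cong_sets)
 then show ?thesis using AE_space
 proof eventually_elim
  fix d assume "?h d = 0" and "d \<in> space (data_marginal M (DD n) L)"
  then have G: "G d" and d: "d \<in> space (DD n)" by (auto simp: space_eq[OF dm] split: if_splits)
  have dA: "d i \<in> space A" if "i < n" for i using d that by (auto simp: A_space space_PiM PiE_iff)
  show "crm_posterior_ae \<rho> \<eta> D P n m C d"
  proof unfold_locales
   show "d \<in> space (DD n)" by (rule d)
   show "F1 d \<noteq> 0" using G by (simp add: G_def)
   show "0 < kappa1 \<rho> (fst (d i)) \<and> kappa1 \<rho> (fst (d i)) < \<infinity>" "emeasure A ({0<..fst (d i)} \<times> UNIV) < \<infinity>" if "i < n" for i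
    using G B(1) dA[OF that] that by (auto simp: G_def R_def)
   show "d i = d j" if "i < n" "j < n" "fst (d i) = fst (d j)" for i j
    using G that by (auto simp: G_def R_def)
  qed
 qed
qed

end

text \<open>Checked on rectangles, which generate the product algebras: there each probability
  splits into its two factors, and independence holds in each factor separately.\<close>

lemma indep_vars_pair:
 assumes M1: "prob_space M1" and M2: "prob_space M2" and I: "finite I"
  and X: "prob_space.indep_vars M1 A X I" and Y: "prob_space.indep_vars M2 B Y I"
 shows "prob_space.indep_vars (M1 \<Otimes>\<^sub>M M2) (%i. A i \<Otimes>\<^sub>M B i) (%i w. (X i (fst w), Y i (snd w))) I"
proof -
 interpret M1: prob_space M1 by fact
 interpret M2: prob_space M2 by fact
 interpret PP: pair_prob_space M1 M2 ..
 have Xm: "X i \<in> M1 ->M A i" if "i \<in> I" for i using X that by (simp add: M1.indep_vars_def2)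
 have Ym: "Y i \<in> M2 ->M B i" if "i \<in> I" for i using Y that by (simp add: M2.indep_vars_def2)
 have times: "measure (M1 \<Otimes>\<^sub>M M2) (a \<times> b) = measure M1 a * measure M2 b" if "a \<in> sets M1" "b \<in> sets M2" for a b
  using that by (simp add: measure_def M2.emeasure_pair_measure_Times enn2real_mult)
 show ?thesis
 proof (cases "I = {}")
  case True
  then show ?thesis using PP.indep_vars_empty by simp
 next
  case False
  let ?E = "%i. {a \<times> b | a b. a \<in> sets (A i) \<and> b \<in> sets (B i)}"
  show ?thesis
  proof (subst PP.indep_vars_finite[OF False I, where E="?E"])
   show "sets (A i \<Otimes>\<^sub>M B i) = sigma_sets (space (A i \<Otimes>\<^sub>M B i)) (?E i)" for i
    by (simp add: sets_pair_measure space_pair_measure)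
   show "(%w. (X i (fst w), Y i (snd w))) \<in> M1 \<Otimes>\<^sub>M M2 ->M A i \<Otimes>\<^sub>M B i" if "i \<in> I" for i
    by (rule measurable_Pair[OF m_comp[OF measurable_fst Xm[OF that]] m_comp[OF measurable_snd Ym[OF that]]])
   show "Int_stable (?E i)" for i by (rule Int_stable_pair_measure_generator)
   show "space (A i \<Otimes>\<^sub>M B i) \<in> ?E i" for i by (auto simp: space_pair_measure)
   show "?E i \<subseteq> Pow (space (A i \<Otimes>\<^sub>M B i))" for i
    by (auto simp: space_pair_measure dest: sets.sets_into_space)
   show "\<forall>G\<in>Pi I ?E. PP.prob (\<Inter>j\<in>I. (%w. (X j (fst w), Y j (snd w))) -` G j \<inter> space (M1 \<Otimes>\<^sub>M M2)) =
     (\<Prod>j\<in>I. PP.prob ((%w. (X j (fst w), Y j (snd w))) -` G j \<inter> space (M1 \<Otimes>\<^sub>M M2)))"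
   proof
    fix G assume "G \<in> Pi I ?E"
    then have "\<forall>j\<in>I. \<exists>a b. G j = a \<times> b \<and> a \<in> sets (A j) \<and> b \<in> sets (B j)" by auto
    then obtain a b where G: "!!j. j \<in> I ==> G j = a j \<times> b j" "!!j. j \<in> I ==> a j \<in> sets (A j)" "!!j. j \<in> I ==> b j \<in> sets (B j)"
     by metis
    let ?a = "%j. X j -` a j \<inter> space M1" and ?b = "%j. Y j -` b j \<inter> space M2"
    have ab: "?a j \<in> sets M1" "?b j \<in> sets M2" if "j \<in> I" for j
     using measurable_sets[OF Xm[OF that] G(2)[OF that]] measurable_sets[OF Ym[OF that] G(3)[OF that]] by auto
    have 1: "(%w. (X j (fst w), Y j (snd w))) -` G j \<inter> space (M1 \<Otimes>\<^sub>M M2) = ?a j \<times> ?b j" if "j \<in> I" for j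
     using G(1)[OF that] by (auto simp: space_pair_measure)
    have "(\<Inter>j\<in>I. (%w. (X j (fst w), Y j (snd w))) -` G j \<inter> space (M1 \<Otimes>\<^sub>M M2)) = (\<Inter>j\<in>I. ?a j) \<times> (\<Inter>j\<in>I. ?b j)"
     using False by (simp add: 1) auto
    also have "PP.prob \<dots> = M1.prob (\<Inter>j\<in>I. ?a j) * M2.prob (\<Inter>j\<in>I. ?b j)"
     using ab False I by (intro times sets.finite_INT) auto
    also have "M1.prob (\<Inter>j\<in>I. ?a j) = (\<Prod>j\<in>I. M1.prob (?a j))"
     using X M1.indep_vars_finite[OF False I, where E="%i. sets (A i)" and M'=A and X=X] Xm G(2)
     by (auto simp: sets.sigma_sets_eq sets.Int_stable sets.space_closed Pi_iff)
    also have "M2.prob (\<Inter>j\<in>I. ?b j) = (\<Prod>j\<in>I. M2.prob (?b j))"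
     using Y M2.indep_vars_finite[OF False I, where E="%i. sets (B i)" and M'=B and X=Y] Ym G(3)
     by (auto simp: sets.sigma_sets_eq sets.Int_stable sets.space_closed Pi_iff)
    also have "(\<Prod>j\<in>I. M1.prob (?a j)) * (\<Prod>j\<in>I. M2.prob (?b j)) = (\<Prod>j\<in>I. PP.prob ((%w. (X j (fst w), Y j (snd w))) -` G j \<inter> space (M1 \<Otimes>\<^sub>M M2)))"
     unfolding prod.distrib[symmetric] using ab by (intro prod.cong refl) (simp add: 1 times)
    finally show "PP.prob (\<Inter>j\<in>I. (%w. (X j (fst w), Y j (snd w))) -` G j \<inter> space (M1 \<Otimes>\<^sub>M M2)) =
     (\<Prod>j\<in>I. PP.prob ((%w. (X j (fst w), Y j (snd w))) -` G j \<inter> space (M1 \<Otimes>\<^sub>M M2)))" .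
   qed
  qed
 qed
qed

section \<open>The extended neutral to the right property\<close>

lemma time_rect_sets:
 assumes "T \<in> sets borel" "T \<subseteq> {0<..}" "B \<in> sets (borel :: 'x::polish_space measure)"
 shows "T \<times> B \<in> sets (base :: (real \<times> 'x) measure)"
 unfolding base_def using assms by (subst sets_restrict_space_iff) (auto simp: borel_prod[symmetric])

lemma measurable_location: "(%z. snd (snd z)) \<in> (EE :: (real \<times> real \<times> 'x::polish_space) measure) ->M borel"
proof -
 have "snd \<in> (base :: (real \<times> 'x) measure) ->M borel"
  unfolding base_def by (intro measurable_restrict_space1 borel_measurable_continuous_onI continuous_intros)
 from m_comp[OF measurable_snd this] show ?thesis .
qed

abbreviation strip :: "real => real => (real \<times> real \<times> 'x::polish_space) set" where
 "strip a b \<equiv> {z \<in> space EE. tm z \<in> {a<..b}}"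

lemma strip_sets: "strip a b \<in> sets (EE :: (real \<times> real \<times> 'x::polish_space) measure)"
 using measurable_sets[OF measurable_tm, of "{a<..b}"] by (simp add: vimage_def Int_def conj_commute)

lemma survT_Un:
 fixes N :: "(real \<times> real \<times> 'x::polish_space) measure"
 assumes N: "sets N = sets EE" and T: "T \<in> sets borel" "T' \<in> sets borel" "T \<inter> T' = {}"
 shows "survT N (T \<union> T') = survT N T * survT N T'"
proof -
 have m: "(%z. neg_log_compl (ennreal (fst z)) * ind1 T (tm z)) \<in> bm N" if "T \<in> sets borel" for T
  unfolding m_cong_sets[OF N refl] using that
  by (intro bm_times m_comp[OF m_comp[OF measurable_jump measurable_ennreal] borel_measurable_neg_log_compl]
    m_comp[OF measurable_tm bm_ind])
 have "ind1 (T \<union> T') s = (ind1 T s + ind1 T' s :: ennreal)" for s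
  using T(3) by (auto simp: indicator_def)
 then have "(NN z. neg_log_compl (ennreal (fst z)) * ind1 (T \<union> T') (tm z) \<partial>N) =
   (NN z. neg_log_compl (ennreal (fst z)) * ind1 T (tm z) + neg_log_compl (ennreal (fst z)) * ind1 T' (tm z) \<partial>N)"
  by (simp add: distrib_left)
 also have "\<dots> = (NN z. neg_log_compl (ennreal (fst z)) * ind1 T (tm z) \<partial>N) + (NN z. neg_log_compl (ennreal (fst z)) * ind1 T' (tm z) \<partial>N)"
  by (rule nn_integral_add[OF m[OF T(1)] m[OF T(2)]])
 finally show ?thesis unfolding survT_def exp_neg_add[symmetric] by simp
qed

text \<open>The conditional probability, given survival up to time \<open>a\<close>, of failing in \<open>(a,b]\<close> with
 mark in \<open>B\<close>. It only depends on the jumps in that strip.\<close>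

definition strip_mass :: "(real \<times> real \<times> 'x::polish_space) measure => real => real => 'x set => ennreal" where
 "strip_mass N a b B =
  (NN z. ennreal (fst z) * ind1 {a<..b} (tm z) * ind1 B (snd (snd z)) * survT N {a<..<tm z} \<partial>N)"

context crm_data
begin

lemma strip_mass_integrand:
 fixes B :: "'x set"
 assumes "N \<in> space lf" "B \<in> sets borel"
 shows "(%z. ennreal (fst z) * ind1 {a<..b} (tm z) * ind1 B (snd (snd z)) * survT N {a<..<tm z}) \<in> bm EE"
 using assms
 by (intro bm_times jump_ennreal survT_tm_measurable
   m_comp[OF measurable_tm bm_ind] m_comp[OF measurable_location bm_ind]) auto

lemma strip_mass_measurable:
 assumes B: "B \<in> sets borel" shows "(%N. strip_mass N a b B) \<in> bm lf"
proof -
 have "(%x. ennreal (fst (snd x)) * ind1 {a<..b} (tm (snd x)) * ind1 B (snd (snd (snd x))) * survT (fst x) {a<..<tm (snd x)})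
   \<in> bm (lf \<Otimes>\<^sub>M EE)"
  using B by (intro bm_times m_comp[OF measurable_snd jump_ennreal]
    survT_measurable measurable_fst m_comp[OF measurable_snd measurable_tm]
    m_comp[OF m_comp[OF measurable_snd measurable_tm] bm_ind]
    m_comp[OF m_comp[OF measurable_snd measurable_location] bm_ind]) auto
 from measurable_nn_integral_lf[OF m_id this] show ?thesis
  unfolding strip_mass_def by simp
qed

text \<open>The mass in \<open>(a,b]\<close> and the survival factors over \<open>(a,s)\<close> with
  \<open>s \<le> b\<close> involve only points with times in \<open>(a,b]\<close>.\<close>

lemma strip_mass_cong:
 assumes N: "N \<in> space lf" and N': "N' \<in> space lf" and B: "B \<in> sets borel"
  and eq: "!!f. f \<in> bm EE ==>
   (NN z. f z * ind1 (strip a b) z \<partial>N) = (NN z. f z * ind1 (strip a b) z \<partial>N')"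
 shows "strip_mass N a b B = strip_mass N' a b B"
proof -
 have surv: "survT N {a<..<s} = survT N' {a<..<s}" if s: "s \<le> b" for s
 proof -
  let ?f = "%z :: real \<times> real \<times> 'x. neg_log_compl (ennreal (fst z)) * ind1 {a<..<s} (tm z)"
  have *: "(NN z. ?f z \<partial>L) = (NN z. ?f z * ind1 (strip a b) z \<partial>L)" if L: "L \<in> space lf" for L
  proof (rule nn_cong)
   fix z assume "z \<in> space L"
   then show "?f z = ?f z * ind1 (strip a b) z"
    using s by (simp only: space_lfD[OF L]) (simp split: split_indicator)
  qed
  have "?f \<in> bm EE" by (rule survT_integrand) simp
  then show ?thesis unfolding survT_def *[OF N] *[OF N'] by (simp only: eq)
 qed
 let ?g = "%L z. ennreal (fst z) * ind1 {a<..b} (tm z) * ind1 B (snd (snd z)) * survT L {a<..<tm z}"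
 have "strip_mass N a b B = (NN z. ?g N z * ind1 (strip a b) z \<partial>N)"
  unfolding strip_mass_def
 proof (rule nn_cong)
  fix z assume "z \<in> space N"
  then show "?g N z = ?g N z * ind1 (strip a b) z"
   by (simp only: space_lfD[OF N]) (simp split: split_indicator)
 qed
 also have "\<dots> = (NN z. ?g N z * ind1 (strip a b) z \<partial>N')" by (rule eq[OF strip_mass_integrand[OF N B]])
 also have "\<dots> = strip_mass N' a b B"
  unfolding strip_mass_def
 proof (rule nn_cong)
  fix z assume z: "z \<in> space N'"
  show "?g N z * ind1 (strip a b) z = ?g N' z"
  proof (cases "tm z \<in> {a<..b}")
   case True
   then have "z \<in> strip a b" using z by (simp only: space_lfD[OF N'] mem_Collect_eq)
   then show ?thesis using True surv[of "tm z"] by simp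
  qed simp
 qed
 finally show ?thesis .
qed

lemma strip_mass_compl:
 assumes N: "N \<in> space lf" and B: "B \<in> sets borel"
 shows "strip_mass N a b UNIV = strip_mass N a b B + strip_mass N a b (- B)"
proof -
 note ms = m_cong_sets[OF sets_lfD[OF N] refl]
 have B': "- B \<in> sets borel" using B by (metis borel_comp)
 have "strip_mass N a b B + strip_mass N a b (- B) =
  (NN z. ennreal (fst z) * ind1 {a<..b} (tm z) * ind1 B (snd (snd z)) * survT N {a<..<tm z} +
   ennreal (fst z) * ind1 {a<..b} (tm z) * ind1 (- B) (snd (snd z)) * survT N {a<..<tm z} \<partial>N)"
  unfolding strip_mass_def
  by (rule nn_integral_add[symmetric]; unfold ms; rule strip_mass_integrand[OF N]) (use B B' in auto)
 also have "\<dots> = strip_mass N a b UNIV"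
  unfolding strip_mass_def by (intro nn_cong) (simp split: split_indicator)
 finally show ?thesis ..
qed

text \<open>For a point with time \<open>s\<close> in \<open>(a,b]\<close> survival up to
  \<open>s\<close> factorises at \<open>a\<close>, and the factor for \<open>(0,a]\<close> is common
  to all these points.\<close>

lemma emeasure_ntrN_strip:
 assumes N: "N \<in> space lf" and a: "0 \<le> a" and B: "B \<in> sets borel"
 shows "emeasure (ntrN N) ({a<..b} \<times> B) = survT N {0<..a} * strip_mass N a b B"
proof -
 note ms = m_cong_sets[OF sets_lfD[OF N] refl]
 have S: "{a<..b} \<times> B \<in> sets base" using a B by (intro time_rect_sets) auto
 have "emeasure (ntrN N) ({a<..b} \<times> B) =
   (NN z. survT N {0<..a} * (ennreal (fst z) * ind1 {a<..b} (tm z) * ind1 B (snd (snd z)) * survT N {a<..<tm z}) \<partial>N)"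
  unfolding emeasure_ntrN[OF N S]
 proof (rule nn_cong)
  fix z
  show "ennreal (fst z) * survT N {0<..<tm z} * ind1 ({a<..b} \<times> B) (snd z) =
    survT N {0<..a} * (ennreal (fst z) * ind1 {a<..b} (tm z) * ind1 B (snd (snd z)) * survT N {a<..<tm z})"
  proof (cases "tm z \<in> {a<..b}")
   case True
   then have "{0<..<tm z} = {0<..a} \<union> {a<..<tm z}" using a by auto
   then have "survT N {0<..<tm z} = survT N {0<..a} * survT N {a<..<tm z}"
    using survT_Un[OF sets_lfD[OF N], of "{0<..a}" "{a<..<tm z}"] by (simp add: Int_def)
   moreover have "ind1 ({a<..b} \<times> B) (snd z) = (ind1 B (snd (snd z)) :: ennreal)"
    using True by (simp add: indicator_def mem_Times_iff)
   ultimately show ?thesis using True by (simp add: ac_simps)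
  qed (auto simp: indicator_def mem_Times_iff)
 qed
 also have "\<dots> = survT N {0<..a} * strip_mass N a b B"
  unfolding strip_mass_def by (rule nn_integral_cmult) (unfold ms, rule strip_mass_integrand[OF N B])
 finally show ?thesis .
qed

context
 fixes N :: "('x mark) measure" and Z
 assumes N: "N \<in> space lf" and cfg: "simple_config EE tm N Z"
  and fin: "!!z. z \<in> Z ==> (NN y. ennreal (fst y) * ind1 {0<..tm z} (tm y) \<partial>N) < \<infinity>"
begin

lemma strip_mass_total: "0 \<le> a ==> strip_mass N a b UNIV + survT N {a<..b} = 1"
 using survT_sum_le(2)[OF cfg survT_time_measurable[OF N], of a b] fin by (simp add: strip_mass_def)

lemma strip_mass_le_1: "0 \<le> a ==> B \<in> sets borel ==> strip_mass N a b B \<le> 1"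
 using strip_mass_total[of a b] strip_mass_compl[OF N, of B a b] by (metis add.assoc le_iff_add)

lemma survT_strip:
 assumes a: "0 \<le> a" shows "survT N {a<..b} = ennreal (1 - enn2real (strip_mass N a b UNIV))"
proof -
 have "strip_mass N a b UNIV \<le> 1" by (rule strip_mass_le_1[OF a]) simp
 then obtain v where v: "strip_mass N a b UNIV = ennreal v" "0 \<le> v" "v \<le> 1"
  by (cases "strip_mass N a b UNIV") (auto simp: top_unique)
 obtain w where w: "survT N {a<..b} = ennreal w" "0 \<le> w"
  using survT_le_1[of N "{a<..b}"] by (cases "survT N {a<..b}") (auto simp: top_unique)
 have "ennreal (v + w) = ennreal 1" using strip_mass_total[OF a, of b] v w by simp
 then have "w = 1 - v" using v w by (simp del: ennreal_plus ennreal_1)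
 then show ?thesis using v w by simp
qed

lemma survT_prod:
 assumes t0: "t 0 = 0" and mono: "!!i. i < j ==> t i \<le> (t (Suc i) :: real)"
 shows "survT N {0<..t j} = ennreal (\<Prod>i\<in>{1..<Suc j}. 1 - enn2real (strip_mass N (t (i - 1)) (t i) UNIV))"
 using mono
proof (induction j)
 case 0
 then show ?case using t0 by (simp add: survT_def)
next
 case (Suc j)
 have le: "0 \<le> t i" if "i \<le> j" for i
  using that
 proof (induction i)
  case (Suc i)
  then show ?case using Suc.prems \<open>!!i. i < Suc j ==> t i \<le> t (Suc i)\<close>[of i] by simp
 qed (simp add: t0)
 have nn: "0 \<le> 1 - enn2real (strip_mass N (t (i - 1)) (t i) UNIV)" if "i \<le> Suc j" for i
 proof -
  have "strip_mass N (t (i - 1)) (t i) UNIV \<le> 1" by (rule strip_mass_le_1) (use that in \<open>auto intro!: le\<close>)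
  then have "enn2real (strip_mass N (t (i - 1)) (t i) UNIV) \<le> 1" by (intro enn2real_leI) auto
  then show ?thesis by simp
 qed
 have "{0<..t (Suc j)} = {0<..t j} \<union> {t j<..t (Suc j)}" using le[of j] Suc.prems[of j] by auto
 then have "survT N {0<..t (Suc j)} = survT N {0<..t j} * survT N {t j<..t (Suc j)}"
  using survT_Un[OF sets_lfD[OF N], of "{0<..t j}" "{t j<..t (Suc j)}"] by auto
 also have "survT N {0<..t j} = ennreal (\<Prod>i\<in>{1..<Suc j}. 1 - enn2real (strip_mass N (t (i - 1)) (t i) UNIV))"
  by (rule Suc.IH) (use Suc.prems in auto)
 also have "survT N {t j<..t (Suc j)} = ennreal (1 - enn2real (strip_mass N (t j) (t (Suc j)) UNIV))"
  by (rule survT_strip) (simp add: le)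
 also have "ennreal (\<Prod>i\<in>{1..<Suc j}. 1 - enn2real (strip_mass N (t (i - 1)) (t i) UNIV)) * \<dots> =
   ennreal ((\<Prod>i\<in>{1..<Suc j}. 1 - enn2real (strip_mass N (t (i - 1)) (t i) UNIV)) * (1 - enn2real (strip_mass N (t j) (t (Suc j)) UNIV)))"
 proof (rule ennreal_mult[symmetric])
  show "0 \<le> (\<Prod>i\<in>{1..<Suc j}. 1 - enn2real (strip_mass N (t (i - 1)) (t i) UNIV))"
   by (rule prod_nonneg, rule nn) simp
  show "0 \<le> 1 - enn2real (strip_mass N (t j) (t (Suc j)) UNIV)" using nn[of "Suc j"] by simp
 qed
 finally show ?case by simp
qed

text \<open>Survival up to \<open>t (j - 1)\<close> is the product of the survival factors of the
  earlier strips, and each of these is the complement of a total strip mass; so the increment has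
  the form that \<open>extended_ntr_law\<close> prescribes.\<close>

lemma ntrN_increment:
 assumes t0: "t 0 = 0" and mono: "!!i. i < j ==> t i \<le> (t (Suc i) :: real)" and j: "j \<ge> 1" and B: "B \<in> sets borel"
 shows "measure (ntrN N) ({0<..t j} \<times> B) - measure (ntrN N) ({0<..t (j - 1)} \<times> B) =
  enn2real (strip_mass N (t (j - 1)) (t j) B) * (\<Prod>i\<in>{1..<j}. 1 - enn2real (strip_mass N (t (i - 1)) (t i) UNIV))"
proof -
 obtain i where i: "j = Suc i" using j by (cases j) auto
 have ti: "0 \<le> t k" if "k \<le> i" for k
  using that
 proof (induction k)
  case (Suc k)
  then show ?case using mono[of k] i by simp
 qed (simp add: t0)
 have le: "t i \<le> t j" using mono[of i] i by simp
 have fm: "finite_measure (ntrN N)"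
  using ntrN_le_1[OF N cfg, of "space (ntrN N)"] by (intro finite_measureI) (auto simp: top_unique)
 interpret finite_measure "ntrN N" by (rule fm)
 have s: "{0<..t i} \<times> B \<in> sets (ntrN N)" "{t i<..t j} \<times> B \<in> sets (ntrN N)"
  unfolding sets_ntrN by (rule time_rect_sets[OF _ _ B]; use ti[of i] in auto)+
 have "{0<..t j} \<times> B = {0<..t i} \<times> B \<union> {t i<..t j} \<times> B" using le ti[of i] by auto
 then have "measure (ntrN N) ({0<..t j} \<times> B) = measure (ntrN N) ({0<..t i} \<times> B) + measure (ntrN N) ({t i<..t j} \<times> B)"
  using s by (simp only:) (rule finite_measure_Union, auto)
 then have "measure (ntrN N) ({0<..t j} \<times> B) - measure (ntrN N) ({0<..t (j - 1)} \<times> B) = measure (ntrN N) ({t i<..t j} \<times> B)"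
  by (simp add: i)
 also have "\<dots> = enn2real (survT N {0<..t i} * strip_mass N (t i) (t j) B)"
  unfolding measure_def emeasure_ntrN_strip[OF N ti[OF order_refl] B] ..
 also have "\<dots> = enn2real (survT N {0<..t i}) * enn2real (strip_mass N (t i) (t j) B)"
  by (rule enn2real_mult)
 also have "survT N {0<..t i} = ennreal (\<Prod>i\<in>{1..<Suc i}. 1 - enn2real (strip_mass N (t (i - 1)) (t i) UNIV))"
  by (rule survT_prod[where t=t, OF t0]) (use mono i in auto)
 also have "enn2real \<dots> = (\<Prod>i\<in>{1..<Suc i}. 1 - enn2real (strip_mass N (t (i - 1)) (t i) UNIV))"
 proof (rule enn2real_ennreal, rule prod_nonneg)
  fix k assume "k \<in> {1..<Suc i}"
  then have "strip_mass N (t (k - 1)) (t k) UNIV \<le> 1" by (intro strip_mass_le_1 ti) auto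
  then have "enn2real (strip_mass N (t (k - 1)) (t k) UNIV) \<le> 1" by (intro enn2real_leI) auto
  then show "0 \<le> 1 - enn2real (strip_mass N (t (k - 1)) (t k) UNIV)" by simp
 qed
 finally show ?thesis by (simp add: i mult.commute)
qed

end

end

context crm_posterior_ae
begin

text \<open>Finite hazard is required at two kinds of points: at those of \<open>N\<close> it comes
  from the Mecke equation, at the fixed atoms from \<open>hazd\<close>. The fixed jumps themselves
  add only finitely many finite terms.\<close>

lemma AE_MP_finite:
 "AE w in MP. \<exists>Z. simple_config EE tm (ptsJ (fst w) (snd w)) Z \<and>
  (\<forall>z\<in>Z. (NN y. ennreal (fst y) * ind1 {0<..tm z} (tm y) \<partial>ptsJ (fst w) (snd w)) < \<infinity>)"
proof -
 have "AE N in P. \<forall>p\<in>K. (NN y. ennreal (fst y) * ind1 {0<..fst p} (tm y) \<partial>N) < \<infinity>"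
 proof (rule AE_finite_allI)
  fix p assume "p \<in> K"
  then obtain i where i: "i < n" "p = d i" by auto
  show "AE N in P. (NN y. ennreal (fst y) * ind1 {0<..fst p} (tm y) \<partial>N) < \<infinity>"
   unfolding i(2) by (rule AE_hazard_finite[OF hazd[OF i(1)]])
 qed simp
 note 1 = AE_MP[OF AE_Q[OF this]] and 2 = AE_MP[OF AE_Q[OF AE_hazard_finite_atoms]]
 show ?thesis
  using AE_MP[OF AE_Q_config] 1 2 AE_space
 proof eventually_elim
  fix w assume *: "(\<exists>Z. simple_config EE tm (fst w) Z) \<and> (\<forall>p\<in>K. emeasure (fst w) {z \<in> space EE. tm z = fst p} = 0)"
   and fp: "\<forall>p\<in>K. (NN y. ennreal (fst y) * ind1 {0<..fst p} (tm y) \<partial>fst w) < \<infinity>"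
   and fz: "AE z in fst w. (NN y. ennreal (fst y) * ind1 {0<..tm z} (tm y) \<partial>fst w) < \<infinity>"
   and w: "w \<in> space MP"
  then obtain Z where Z: "simple_config EE tm (fst w) Z" by blast
  let ?Z = "Z \<union> (%p. (snd w p, p)) ` K"
  have c: "simple_config EE tm (ptsJ (fst w) (snd w)) ?Z"
   unfolding ptsJ_def by (rule simple_config_add_pts[OF Z _ inj_times ptsJ_space[OF w]]) (use * in auto)
  have N: "fst w \<in> space lf" by (rule MP_space(1)[OF w])
  have "(NN y. ennreal (fst y) * ind1 {0<..tm z} (tm y) \<partial>ptsJ (fst w) (snd w)) < \<infinity>" if z: "z \<in> ?Z" for z
  proof -
   have "(NN y. ennreal (fst y) * ind1 {0<..tm z} (tm y) \<partial>fst w) < \<infinity>"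
    using z
   proof
    assume "z \<in> Z"
    from simple_config_AE[OF Z fz singleton_EE this] show ?thesis by simp
   next
    assume "z \<in> (%p. (snd w p, p)) ` K"
    then show ?thesis using fp by auto
   qed
   moreover have "(NN y. ennreal (fst y) * ind1 {0<..tm z} (tm y) \<partial>ptsJ (fst w) (snd w)) =
     (NN y. ennreal (fst y) * ind1 {0<..tm z} (tm y) \<partial>fst w) + (\<Sum>p\<in>K. ennreal (snd w p) * ind1 {0<..tm z} (fst p))"
    unfolding ptsJ_def using ptsJ_space[OF w] hazard_integrand[of "tm z"]
    by (subst nn_integral_add_pts) (simp_all cong: m_cong_sets add: sets_lfD[OF N] space_lfD[OF N] del: space_pair_measure)
   moreover have "(\<Sum>p\<in>K. ennreal (snd w p) * ind1 {0<..tm z} (fst p)) < \<infinity>"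
    by (simp add: less_top ennreal_mult_eq_top_iff split: split_indicator)
   ultimately show ?thesis by simp
  qed
  with c show "\<exists>Z. simple_config EE tm (ptsJ (fst w) (snd w)) Z \<and>
   (\<forall>z\<in>Z. (NN y. ennreal (fst y) * ind1 {0<..tm z} (tm y) \<partial>ptsJ (fst w) (snd w)) < \<infinity>)" by blast
 qed
qed

text \<open>\<open>V j B\<close> is the strip mass over the j-th time strip. It depends on the
  Poisson points and on the fixed jumps inside that strip; over disjoint strips both families are
  independent, and so are the pairs, since the Poisson part and the jumps are independent of each
  other.\<close>

theorem extended_ntr: "extended_ntr_law (Kern (MA base) ntrN d)"
 unfolding extended_ntr_law_def
proof (intro allI impI)
 fix k :: nat and t :: "nat => real" assume t0: "t 0 = 0" and mono: "strict_mono_on {0..k} t"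
 have tle: "t i \<le> t j" if "i \<le> j" "j \<le> k" for i j
  using that mono by (cases "i = j") (auto simp: strict_mono_on_def intro!: less_imp_le)
 have t_nonneg: "0 \<le> t j" if "j \<le> k" for j using tle[of 0 j] that t0 by simp
 let ?N = "%w. ptsJ (fst w) (snd w)"
 define U where "U j B w = enn2real (strip_mass (?N w) (t (j - 1)) (t j) B)"
  for j and B :: "'x set" and w :: "('x mark) measure \<times> (real \<times> 'x => real)"
 let ?PB = "\<Pi>\<^sub>M B\<in>sets (borel :: 'x measure). (borel :: real measure)"
 let ?PP = "\<Pi>\<^sub>M j\<in>{1..k}. ?PB"
 \<comment> \<open>The definition fixes the space of arrays as sample space. The strip masses are
   transported to it by \<open>UU\<close>, after which \<open>V\<close> is the coordinate
   process.\<close>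
 define UU where "UU w = (\<lambda>j\<in>{1..k}. \<lambda>B\<in>sets borel. U j B w)" for w
 have U_meas: "U j B \<in> bm MP" if "B \<in> sets borel" for j B
  unfolding U_def by (intro m_comp[OF m_comp[OF ptsJ_measurable strip_mass_measurable[OF that]]]) simp
 have UU_meas: "UU \<in> MP ->M ?PP" unfolding UU_def by (intro measurable_restrict U_meas)
 define M where "M = distr MP ?PP UU"
 define V where "V j B w = w j B" for j :: nat and B :: "'x set" and w :: "nat => 'x set => real"
 have M: "prob_space M" unfolding M_def by (rule prob_space.prob_space_distr[OF MP_prob UU_meas])
 have V_PP: "V j B \<in> bm ?PP" if "j \<in> {1..k}" "B \<in> sets borel" for j B
  unfolding V_def by (rule m_comp[OF m_proj[OF that(1)] m_proj[OF that(2)]])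
 have V_meas: "V j B \<in> bm M" if "j \<in> {1..k}" "B \<in> sets borel" for j B
  using V_PP[OF that] by (simp add: M_def)
 have VU: "V j B (UU w) = U j B w" if "j \<in> {1..k}" "B \<in> sets borel" for j B w
  using that by (simp add: V_def UU_def)
 have cB: "- B \<in> sets borel" if "B \<in> sets borel" for B :: "'x set" using that by (metis borel_comp)
 have part1: "AE w in M. V j B w \<in> {0..1} \<and> V j UNIV w = V j B w + V j (- B) w"
  if j: "j \<in> {1..k}" and B: "B \<in> sets borel" for j B
 proof -
  have p: "Measurable.pred ?PP (%w. V j B w \<in> {0..1} \<and> V j UNIV w = V j B w + V j (- B) w)"
  proof (rule pred_intros_logic(3))
   show "Measurable.pred ?PP (%w. V j B w \<in> {0..1})"
    using measurable_sets[OF V_PP[OF j B], of "{0..1}"] by (simp add: pred_def vimage_def Int_def conj_commute)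
   show "Measurable.pred ?PP (%w. V j UNIV w = V j B w + V j (- B) w)"
    unfolding pred_def using V_PP[OF j B] V_PP[OF j cB[OF B]] V_PP[OF j, of UNIV] by (intro borel_measurable_eq borel_measurable_add) auto
  qed
  have "AE w in MP. V j B (UU w) \<in> {0..1} \<and> V j UNIV (UU w) = V j B (UU w) + V j (- B) (UU w)"
   using AE_MP_finite AE_space
  proof eventually_elim
   fix w assume *: "\<exists>Z. simple_config EE tm (?N w) Z \<and> (\<forall>z\<in>Z. (NN y. ennreal (fst y) * ind1 {0<..tm z} (tm y) \<partial>?N w) < \<infinity>)"
    and w: "w \<in> space MP"
   then obtain Z where Z: "simple_config EE tm (?N w) Z" "!!z. z \<in> Z ==> (NN y. ennreal (fst y) * ind1 {0<..tm z} (tm y) \<partial>?N w) < \<infinity>" by blast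
   have N: "?N w \<in> space lf" by (rule measurable_space[OF ptsJ_measurable w])
   have a: "0 \<le> t (j - 1)" using j by (intro t_nonneg) auto
   have le1: "strip_mass (?N w) (t (j - 1)) (t j) X \<le> 1" if "X \<in> sets borel" for X
    by (rule strip_mass_le_1[OF N Z a that])
   have "strip_mass (?N w) (t (j - 1)) (t j) X < top" if "X \<in> sets borel" for X
    using le_less_trans[OF le1[OF that] ennreal_one_less_top] .
   then have "U j UNIV w = U j B w + U j (- B) w"
    unfolding U_def strip_mass_compl[OF N B] using B cB[OF B] by (intro enn2real_plus) auto
   moreover have "U j B w \<in> {0..1}" unfolding U_def using le1[OF B] by (auto intro: enn2real_leI)
   ultimately show "V j B (UU w) \<in> {0..1} \<and> V j UNIV (UU w) = V j B (UU w) + V j (- B) (UU w)"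
    using VU[OF j] B cB[OF B] by simp
  qed
  then show ?thesis unfolding M_def using p by (subst AE_distr_iff[OF UU_meas]) (simp_all add: pred_def)
 qed
 have disj: "{t (i - 1)<..t i} \<inter> {t (j - 1)<..t j} = {}" if "i \<in> {1..k}" "j \<in> {1..k}" "i \<noteq> j" for i j
 proof -
  have "{t (i - 1)<..t i} \<inter> {t (j - 1)<..t j} = {}" if "i < j" "j \<le> k" for i j
  proof -
   have "t i \<le> t (j - 1)" using that by (intro tle) auto
   then show ?thesis by auto
  qed
  then show ?thesis using that by (metis Int_commute atLeastAtMost_iff nat_neq_iff)
 qed
 have part2: "prob_space.indep_vars M (%_. ?PB) (%j w. \<lambda>B\<in>sets borel. V j B w) {1..k}"
 proof -
  let ?S = "%j. strip (t (j - 1)) (t j) :: ('x mark) set"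
  let ?K = "%j. {p\<in>K. fst p \<in> {t (j - 1)<..t j}}"
  have s: "sets (intensity \<rho>' \<eta>) = sets EE" by (rule sets_intensity[OF tilted_kernel[OF Y] \<eta> tilted_finite[OF Y]])
  have dS: "disjoint_family_on ?S {1..k}" and dK: "disjoint_family_on ?K {1..k}"
   unfolding disjoint_family_on_def
  proof (intro ballI impI)
   fix i j assume "i \<in> {1..k}" "j \<in> {1..k}" "i \<noteq> j"
   then have "{t (i - 1)<..t i} \<inter> {t (j - 1)<..t j} = {}" by (rule disj)
   then show "?S i \<inter> ?S j = {}" by blast
  next
   show "\<forall>i\<in>{1..k}. \<forall>j\<in>{1..k}. i \<noteq> j --> ?K i \<inter> ?K j = {}"
   proof (intro ballI impI)
    fix i j assume "i \<in> {1..k}" "j \<in> {1..k}" "i \<noteq> j"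
    then have "{t (i - 1)<..t i} \<inter> {t (j - 1)<..t j} = {}" by (rule disj)
    then show "?K i \<inter> ?K j = {}" by blast
   qed
  qed
  \<comment> \<open>The strip masses as functions of the points and fixed jumps of their own strip
    alone; by \<open>strip_mass_cong\<close> discarding the rest changes nothing.\<close>
  let ?X = "%j w. (%(N, J). \<lambda>B\<in>sets borel. enn2real (strip_mass (add_pts N (?K j) (%p. (J p, p))) (t (j - 1)) (t j) B))
     (restr (?S j) (fst w), restrict (%p. snd w p) (?K j))"
  have QI: "prob_space.indep_vars Q (%_. lf) (%j. restr (?S j)) {1..k}"
   by (rule mecke_indep_vars_restr[OF Q_prob Q_sets s Q_mecke AE_Q[OF AE_integer_valued]])
    (simp_all only: finite_atLeastAtMost strip_sets dS)
  have JI: "prob_space.indep_vars (\<Pi>\<^sub>M p\<in>K. \<tau> p) (%j. PiM (?K j) \<tau>) (%j w. restrict (%p. w p) (?K j)) {1..k}"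
   by (rule prob_space.indep_vars_restrict[OF J_prob indep_vars_PiM_components[OF \<tau>_prob]])
    (assumption, blast, rule dK)
  have "prob_space.indep_vars MP (%j. lf \<Otimes>\<^sub>M PiM (?K j) \<tau>)
    (%j w. (restr (?S j) (fst w), restrict (%p. snd w p) (?K j))) {1..k}"
   unfolding MP_def by (rule indep_vars_pair[OF Q_prob J_prob finite_atLeastAtMost QI JI])
  then have CI: "prob_space.indep_vars MP (%_. ?PB) ?X {1..k}"
  proof (rule prob_space.indep_vars_compose2[OF MP_prob])
   fix j assume "j \<in> {1..k}"
   have "(%x. add_pts (fst x) (?K j) (%p. (snd x p, p))) \<in> lf \<Otimes>\<^sub>M PiM (?K j) \<tau> ->M lf"
   proof (rule measurable_add_pts[OF measurable_fst, where J="?K j"])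
    fix p assume p: "p \<in> ?K j"
    have "(%x. snd x p) \<in> lf \<Otimes>\<^sub>M PiM (?K j) \<tau> ->M \<tau> p"
     by (rule m_comp[OF measurable_snd m_proj[OF p]])
    then have "(%x. snd x p) \<in> lf \<Otimes>\<^sub>M PiM (?K j) \<tau> ->M unit_jumps"
     using p by (simp cong: m_cong_sets add: \<tau>_sets)
    then show "(%x. (snd x p, p)) \<in> lf \<Otimes>\<^sub>M PiM (?K j) \<tau> ->M EE"
     using p by (intro measurable_Pair measurable_const K_space) auto
   qed auto
   then show "(%(N, J). \<lambda>B\<in>sets borel. enn2real (strip_mass (add_pts N (?K j) (%p. (J p, p))) (t (j - 1)) (t j) B))
     \<in> lf \<Otimes>\<^sub>M PiM (?K j) \<tau> ->M ?PB"
    unfolding split_beta'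
    by (intro measurable_restrict m_comp[OF _ borel_measurable_enn2real[OF m_id]] m_comp[OF _ strip_mass_measurable])
  qed
  have CE: "?X j w = (\<lambda>B\<in>sets borel. V j B (UU w))"
   if j: "j \<in> {1..k}" and w: "w \<in> space MP" for j w
  proof -
   let ?N' = "add_pts (restr (?S j) (fst w)) (?K j) (%p. (restrict (%p. snd w p) (?K j) p, p))"
   have N: "fst w \<in> space lf" by (rule MP_space(1)[OF w])
   have Nr: "restr (?S j) (fst w) \<in> space lf" by (rule measurable_space[OF restr_measurable[OF strip_sets] N])
   have NN: "?N w \<in> space lf" by (rule measurable_space[OF ptsJ_measurable w])
   have pts: "(restrict (%p. snd w p) (?K j) p, p) \<in> space EE" if "p \<in> ?K j" for p
    using ptsJ_space[OF w, of p] that by simp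
   have N': "?N' \<in> space lf"
    using measurable_space[OF measurable_add_pts[OF measurable_const[OF Nr], where J="?K j" and I="%_. ?K j" and M="count_space UNIV"
     and z="%p _. (restrict (%p. snd w p) (?K j) p, p)"], of undefined] pts by auto
   have eqs: "strip_mass ?N' (t (j - 1)) (t j) B = strip_mass (?N w) (t (j - 1)) (t j) B" if B: "B \<in> sets borel" for B
   proof (rule strip_mass_cong[OF N' NN B])
    fix f :: "real \<times> real \<times> 'x => ennreal" assume f: "f \<in> bm EE"
    let ?g = "%z. f z * ind1 (?S j) z"
    have g: "?g \<in> bm EE" by (intro bm_times f bm_ind strip_sets)
    have gN: "?g \<in> bm (fst w)" "ind1 (?S j) \<in> bm (fst w)" "?g \<in> bm (restr (?S j) (fst w))"
     using g strip_sets by (simp_all cong: m_cong_sets add: sets_lfD[OF N])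
    have "(NN z. ?g z \<partial>?N') = (NN z. ?g z \<partial>restr (?S j) (fst w)) + (\<Sum>p\<in>?K j. ?g (restrict (%p. snd w p) (?K j) p, p))"
     by (rule nn_integral_add_pts[OF gN(3)]) (use pts space_lfD[OF Nr] in auto)
    also have "(NN z. ?g z \<partial>restr (?S j) (fst w)) = (NN z. ind1 (?S j) z * ?g z \<partial>fst w)"
     unfolding restr_def by (rule nn_integral_density[OF gN(2,1)])
    also have "\<dots> = (NN z. ?g z \<partial>fst w)" by (intro nn_cong) (simp split: split_indicator)
    also have "(\<Sum>p\<in>?K j. ?g (restrict (%p. snd w p) (?K j) p, p)) = (\<Sum>p\<in>K. ?g (snd w p, p))"
    proof (rule sum.mono_neutral_cong_left)
     show "\<forall>p\<in>K - ?K j. ?g (snd w p, p) = 0" by (auto simp: indicator_def)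
    qed auto
    also have "(NN z. ?g z \<partial>fst w) + (\<Sum>p\<in>K. ?g (snd w p, p)) = (NN z. ?g z \<partial>?N w)"
     unfolding ptsJ_def by (rule nn_integral_add_pts[OF gN(1), symmetric]) (use ptsJ_space[OF w] space_lfD[OF N] in auto)
    finally show "(NN z. ?g z \<partial>?N') = (NN z. ?g z \<partial>?N w)" .
   qed
   show ?thesis unfolding prod.case by (rule restrict_ext) (simp only: eqs VU[OF j] U_def)
  qed
  have Xm: "?X j \<in> MP ->M ?PB" if "j \<in> {1..k}" for j
   using CI that unfolding prob_space.indep_vars_def2[OF MP_prob] by blast
  have "prob_space.indep_vars MP (%_. ?PB) (%j w. \<lambda>B\<in>sets borel. V j B (UU w)) {1..k}"
   by (rule indep_vars_cong_space[OF MP_prob Xm CE CI])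
  then show ?thesis
   unfolding M_def by (subst indep_vars_distr_iff[OF MP_prob UU_meas]) (rule measurable_restrict, rule V_PP)
 qed
 have part3: "distr (Kern (MA base) ntrN d) (\<Pi>\<^sub>M j\<in>{1..k}. borel)
   (%\<Phi>. \<lambda>j\<in>{1..k}. measure \<Phi> ({0<..t j} \<times> B) - measure \<Phi> ({0<..t (j - 1)} \<times> B)) =
  distr M (\<Pi>\<^sub>M j\<in>{1..k}. borel) (%w. \<lambda>j\<in>{1..k}. V j B w * (\<Prod>i\<in>{1..<j}. 1 - V i UNIV w))"
  if B: "B \<in> sets borel" for B
 proof -
  let ?F = "%\<Phi>. \<lambda>j\<in>{1..k}. measure \<Phi> ({0<..t j} \<times> B) - measure \<Phi> ({0<..t (j - 1)} \<times> B)"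
  let ?G = "%w. \<lambda>j\<in>{1..k}. V j B w * (\<Prod>i\<in>{1..<j}. 1 - V i UNIV w)"
  have mm: "(%\<Phi>. measure \<Phi> ({0<..s} \<times> B)) \<in> bm (MA base)" for s
   unfolding measure_def
   by (intro borel_measurable_enn2real measurable_emeasure_measure_algebra time_rect_sets B) auto
  have F: "?F \<in> MA base ->M (\<Pi>\<^sub>M j\<in>{1..k}. borel)"
   by (intro measurable_restrict borel_measurable_diff mm)
  have G: "?G \<in> ?PP ->M (\<Pi>\<^sub>M j\<in>{1..k}. borel)"
   by (intro measurable_restrict borel_measurable_times borel_measurable_prod borel_measurable_diff measurable_const V_PP B) auto
  have W: "(%w. ntrN (?N w)) \<in> MP ->M MA base" by (rule m_comp[OF ptsJ_measurable ntrN_measurable])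
  have "distr (Kern (MA base) ntrN d) (\<Pi>\<^sub>M j\<in>{1..k}. borel) ?F = distr MP (\<Pi>\<^sub>M j\<in>{1..k}. borel) (%w. ?F (ntrN (?N w)))"
   unfolding Kern_eq[OF ntrN_measurable] using distr_distr[OF F W] by (simp add: o_def)
  also have "\<dots> = distr MP (\<Pi>\<^sub>M j\<in>{1..k}. borel) (%w. ?G (UU w))"
  proof (rule distr_cong_AE)
   show "AE w in MP. ?F (ntrN (?N w)) = ?G (UU w)"
    using AE_MP_finite AE_space
   proof eventually_elim
    fix w assume *: "\<exists>Z. simple_config EE tm (?N w) Z \<and> (\<forall>z\<in>Z. (NN y. ennreal (fst y) * ind1 {0<..tm z} (tm y) \<partial>?N w) < \<infinity>)"
     and w: "w \<in> space MP"
    then obtain Z where Z: "simple_config EE tm (?N w) Z" "!!z. z \<in> Z ==> (NN y. ennreal (fst y) * ind1 {0<..tm z} (tm y) \<partial>?N w) < \<infinity>" by blast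
    have N: "?N w \<in> space lf" by (rule measurable_space[OF ptsJ_measurable w])
    show "?F (ntrN (?N w)) = ?G (UU w)"
    proof (rule restrict_ext)
     fix j assume j: "j \<in> {1..k}"
     have "measure (ntrN (?N w)) ({0<..t j} \<times> B) - measure (ntrN (?N w)) ({0<..t (j - 1)} \<times> B) =
       U j B w * (\<Prod>i\<in>{1..<j}. 1 - U i UNIV w)"
      unfolding U_def by (rule ntrN_increment[where t=t, OF N Z t0 _ _ B]) (use j tle in auto)
     also have "\<dots> = V j B (UU w) * (\<Prod>i\<in>{1..<j}. 1 - V i UNIV (UU w))"
      using j B by (intro arg_cong2[where f="(*)"] prod.cong refl) (auto simp: VU)
     finally show "measure (ntrN (?N w)) ({0<..t j} \<times> B) - measure (ntrN (?N w)) ({0<..t (j - 1)} \<times> B) =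
       V j B (UU w) * (\<Prod>i\<in>{1..<j}. 1 - V i UNIV (UU w))" .
    qed
   qed
  qed (use m_comp[OF W F] m_comp[OF UU_meas G] in simp_all)
  also have "\<dots> = distr M (\<Pi>\<^sub>M j\<in>{1..k}. borel) ?G"
   unfolding M_def using distr_distr[OF G UU_meas] by (simp add: o_def)
  finally show ?thesis .
 qed
 show "\<exists>(M :: (nat => 'x set => real) measure) V. prob_space M \<and>
   (\<forall>j\<in>{1..k}. \<forall>B\<in>sets borel. V j B \<in> bm M \<and>
    (AE w in M. V j B w \<in> {0..1} \<and> V j UNIV w = V j B w + V j (- B) w)) \<and>
   prob_space.indep_vars M (%_. ?PB) (%j w. \<lambda>B\<in>sets borel. V j B w) {1..k} \<and>
   (\<forall>B\<in>sets borel. distr (Kern (MA base) ntrN d) (\<Pi>\<^sub>M j\<in>{1..k}. borel)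
     (%\<Phi>. \<lambda>j\<in>{1..k}. measure \<Phi> ({0<..t j} \<times> B) - measure \<Phi> ({0<..t (j - 1)} \<times> B)) =
    distr M (\<Pi>\<^sub>M j\<in>{1..k}. borel) (%w. \<lambda>j\<in>{1..k}. V j B w * (\<Prod>i\<in>{1..<j}. 1 - V i UNIV w)))"
  using M V_meas part1 part2 part3 by (intro exI[of _ M] exI[of _ V]) blast
qed

end

context crm_posterior_ae
begin

lemma posterior_hazard_model:
 "\<exists>(M' :: (('x mark) measure \<times> (real \<times> 'x => real)) measure) N' J.
  poisson_and_jumps M' EE (intensity (tilted (Ydm d) \<rho>) \<eta>) n d (tilted (Ydm d) \<rho>) N' J \<and>
  posterior_hazard n d N' J \<in> M' ->M MA base \<and>
  Kern (MA base) crm d = distr M' (MA base) (posterior_hazard n d N' J)"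
 using MP_poisson posterior_crm by blast

lemma posterior_ntr_model:
 "\<exists>(M' :: (('x mark) measure \<times> (real \<times> 'x => real)) measure) N' J.
  poisson_and_jumps M' EE (intensity (tilted (Ydm d) \<rho>) \<eta>) n d (tilted (Ydm d) \<rho>) N' J \<and>
  (%w. ntr (posterior_hazard n d N' J w)) \<in> completion M' ->M MA base \<and>
  Kern (MA base) ntrN d = distr (completion M') (MA base) (%w. ntr (posterior_hazard n d N' J w))"
 using MP_poisson posterior_ntr by blast

lemma posterior_levy_model:
 "\<exists>(M' :: ((ennreal \<times> real \<times> 'x) measure \<times> (real \<times> 'x => real)) measure) N' J.
  poisson_and_jumps M' (levy_jumps \<Otimes>\<^sub>M base) (levy_intensity (tilted (Ydm d) \<rho>) \<eta>) n d (tilted (Ydm d) \<rho>) N' J \<and>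
  posterior_levy n d N' J \<in> M' ->M MA base \<and>
  Kern (MA base) levyN d = distr M' (MA base) (posterior_levy n d N' J)"
 using MPL_poisson posterior_levy_measurable Kern_levy by blast

end

theorem theorem7p1:
  fixes M :: "'w measure"
    and \<rho> :: "real \<Rightarrow> real measure"
    and \<eta> :: "(real \<times> 'x::polish_space) measure"
    and N :: "'w \<Rightarrow> (real \<times> real \<times> 'x) measure"
    and \<Lambda> :: "'w \<Rightarrow> (real \<times> 'x) measure"
    and n m :: nat
    and C :: "nat \<Rightarrow> real"
  assumes "prob_space M"
    and "\<rho> \<in> restrict_space borel {0<..} \<rightarrow>\<^sub>M measure_algebra unit_jumps"
    and "sets \<eta> = sets base"
    and "\<And>s. s > 0 \<Longrightarrow> emeasure \<eta> ({s} \<times> UNIV) = 0"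
    and "hazard_measure (mean_hazard \<rho> \<eta>)"
    and "poisson_random_measure M (unit_jumps \<Otimes>\<^sub>M base) (intensity \<rho> \<eta>) N"
    and "\<And>\<omega>. \<Lambda> \<omega> = crm (N \<omega>)"
    and "n \<ge> 1"
    and "\<And>l. l < m \<Longrightarrow> C l > 0"
  defines "\<M> \<equiv> measure_algebra (base :: (real \<times> 'x) measure)"
    and "L \<equiv> \<lambda>\<omega>. likelihood n m C (\<Lambda> \<omega>)"
    and "\<rho>' \<equiv> \<lambda>d :: nat \<Rightarrow> real \<times> 'x. tilted (at_risk n m C d) \<rho>"
  shows
    "(\<exists>K. posterior_kernel M (data_space n) L \<M> \<Lambda> K \<and>
       (AE d in data_marginal M (data_space n) L.
          \<exists>(M' :: ((real \<times> real \<times> 'x) measure \<times> (real \<times> 'x \<Rightarrow> real)) measure) N' J.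
            poisson_and_jumps M' (unit_jumps \<Otimes>\<^sub>M base) (intensity (\<rho>' d) \<eta>) n d (\<rho>' d) N' J \<and>
            posterior_hazard n d N' J \<in> M' \<rightarrow>\<^sub>M \<M> \<and>
            K d = distr M' \<M> (posterior_hazard n d N' J))) \<and>
    (\<exists>K. posterior_kernel M (data_space n) L \<M> (\<lambda>\<omega>. ntr (\<Lambda> \<omega>)) K \<and>
       (AE d in data_marginal M (data_space n) L.
          extended_ntr_law (K d) \<and>
          (\<exists>(M' :: ((real \<times> real \<times> 'x) measure \<times> (real \<times> 'x \<Rightarrow> real)) measure) N' J.
            poisson_and_jumps M' (unit_jumps \<Otimes>\<^sub>M base) (intensity (\<rho>' d) \<eta>) n d (\<rho>' d) N' J \<and>
            (\<lambda>\<omega>. ntr (posterior_hazard n d N' J \<omega>)) \<in> completion M' \<rightarrow>\<^sub>M \<M> \<and>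
            K d = distr (completion M') \<M> (\<lambda>\<omega>. ntr (posterior_hazard n d N' J \<omega>))))) \<and>
    (\<exists>K. posterior_kernel M (data_space n) L \<M> (\<lambda>\<omega>. levy_measure_of (\<Lambda> \<omega>)) K \<and>
       (AE d in data_marginal M (data_space n) L.
          \<exists>(M' :: ((ennreal \<times> real \<times> 'x) measure \<times> (real \<times> 'x \<Rightarrow> real)) measure) N' J.
            poisson_and_jumps M' (levy_jumps \<Otimes>\<^sub>M base) (levy_intensity (\<rho>' d) \<eta>) n d (\<rho>' d) N' J \<and>
            posterior_levy n d N' J \<in> M' \<rightarrow>\<^sub>M \<M> \<and>
            K d = distr M' \<M> (posterior_levy n d N' J)))"
proof -
  interpret prob_space M by fact
  have model: "crm_model \<rho> \<eta>" by unfold_locales fact+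
  interpret crm_model \<rho> \<eta> by (rule model)
  obtain D where D: "exhaustion (EE :: (real \<times> real \<times> 'x) measure) D" "\<And>k. emeasure \<nu> (D k) < \<infinity>"
    using \<nu>_levels by blast
  interpret exhaustion "EE :: (real \<times> real \<times> 'x) measure" D by (rule D(1))
  \<comment> \<open>\<open>N\<close> lies in \<open>lf\<close> only almost surely; the default value
    makes \<open>N0\<close> a map into \<open>lf\<close> at every sample point.\<close>
  define N0 where "N0 \<omega> = (if N \<omega> \<in> space lf then N \<omega> else null_measure EE)" for \<omega>
  have N_poisson: "poisson_random_measure M EE \<nu> N" using assms(6) by (simp add: \<nu>_def)
  note pm = poisson_mecke[OF \<open>prob_space M\<close> N_poisson \<nu>_sets D(2), folded N0_def]
  define P where "P = distr M lf N0"
  interpret crm_data \<rho> \<eta> D P n m C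
  proof (intro crm_data.intro crm_pp.intro crm_pp_axioms.intro)
    show "crm_model \<rho> \<eta>" "exhaustion EE D" "\<And>k. emeasure \<nu> (D k) < \<infinity>" by fact+
    show "prob_space P" "sets P = sets lf" "mecke \<nu> P" using pm(3) prob_space_distr[OF pm(1)] by (simp_all add: P_def)
  qed
  have "AE \<omega> in M. \<exists>Z. simple_config EE tm (N0 \<omega>) Z"
    using AE_simple_config unfolding P_def by (rule AE_distrD[OF pm(1)])
  then have good: "AE \<omega> in M. N0 \<omega> \<in> space lf \<and> N0 \<omega> = N \<omega> \<and> (\<exists>Z. simple_config EE tm (N0 \<omega>) Z)"
    using pm(2) AE_space by eventually_elim (use measurable_space[OF pm(1)] in metis)
  have L: "AE \<omega> in M. L \<omega> = lik_measure (N0 \<omega>)"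
    using good unfolding L_def assms(7) by eventually_elim (metis likelihood_config)
  have W1: "AE \<omega> in M. \<Lambda> \<omega> = crm (N0 \<omega>)"
    using good unfolding assms(7) by eventually_elim simp
  have W2: "AE \<omega> in M. ntr (\<Lambda> \<omega>) = ntrN (N0 \<omega>)"
    using good unfolding assms(7) by eventually_elim (metis ntr_config)
  have W3: "AE \<omega> in M. levy_measure_of (\<Lambda> \<omega>) = levyN (N0 \<omega>)"
    using good unfolding assms(7) by eventually_elim (metis levy_measure_of_crm levyN_def)
  note post = posterior[OF \<open>prob_space M\<close> pm(1) P_def L]
  note ae = AE_data[OF pm(1) P_def L]
  show ?thesis
    unfolding \<M>_def \<rho>'_def data_space_def
  proof (intro conjI)
    show "\<exists>K. posterior_kernel M (DD n) L (measure_algebra base) \<Lambda> K \<and>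
       (AE d in data_marginal M (DD n) L.
          \<exists>(M' :: ((real \<times> real \<times> 'x) measure \<times> (real \<times> 'x \<Rightarrow> real)) measure) N' J.
            poisson_and_jumps M' EE (intensity (tilted (Ydm d) \<rho>) \<eta>) n d (tilted (Ydm d) \<rho>) N' J \<and>
            posterior_hazard n d N' J \<in> M' \<rightarrow>\<^sub>M measure_algebra base \<and>
            K d = distr M' (measure_algebra base) (posterior_hazard n d N' J))"
      using post[OF crm_measurable W1] ae
      by (intro exI[of _ "Kern (measure_algebra base) crm"] conjI)
        (auto elim!: eventually_mono intro: crm_posterior_ae.posterior_hazard_model)
    show "\<exists>K. posterior_kernel M (DD n) L (measure_algebra base) (\<lambda>\<omega>. ntr (\<Lambda> \<omega>)) K \<and>
       (AE d in data_marginal M (DD n) L.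
          extended_ntr_law (K d) \<and>
          (\<exists>(M' :: ((real \<times> real \<times> 'x) measure \<times> (real \<times> 'x \<Rightarrow> real)) measure) N' J.
            poisson_and_jumps M' EE (intensity (tilted (Ydm d) \<rho>) \<eta>) n d (tilted (Ydm d) \<rho>) N' J \<and>
            (\<lambda>\<omega>. ntr (posterior_hazard n d N' J \<omega>)) \<in> completion M' \<rightarrow>\<^sub>M measure_algebra base \<and>
            K d = distr (completion M') (measure_algebra base) (\<lambda>\<omega>. ntr (posterior_hazard n d N' J \<omega>))))"
      using post[OF ntrN_measurable W2] ae
      by (intro exI[of _ "Kern (measure_algebra base) ntrN"] conjI)
        (auto elim!: eventually_mono intro: crm_posterior_ae.extended_ntr crm_posterior_ae.posterior_ntr_model)
    show "\<exists>K. posterior_kernel M (DD n) L (measure_algebra base) (\<lambda>\<omega>. levy_measure_of (\<Lambda> \<omega>)) K \<and>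
       (AE d in data_marginal M (DD n) L.
          \<exists>(M' :: ((ennreal \<times> real \<times> 'x) measure \<times> (real \<times> 'x \<Rightarrow> real)) measure) N' J.
            poisson_and_jumps M' (levy_jumps \<Otimes>\<^sub>M base) (levy_intensity (tilted (Ydm d) \<rho>) \<eta>) n d (tilted (Ydm d) \<rho>) N' J \<and>
            posterior_levy n d N' J \<in> M' \<rightarrow>\<^sub>M measure_algebra base \<and>
            K d = distr M' (measure_algebra base) (posterior_levy n d N' J))"
      using post[OF levyN_measurable W3] ae
      by (intro exI[of _ "Kern (measure_algebra base) levyN"] conjI)
        (auto elim!: eventually_mono intro: crm_posterior_ae.posterior_levy_model)
  qed
qed

end
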